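(* Let $A$ be a $C^*$-algebra and let $X$ be a right-Hilbert $A$--$A$ bimodule. Let $(i_A,i_X)$ be the universal representation of $X$ on Katsura's algebra $\mathcal{O}_X$, and let $j_{X^\otimes}$ be the universal CNP-covariant representation of the product system $X^\otimes$ over $\mathbb{N}$ on $\mathcal{NO}_{X^\otimes}$. (1) There is an isomorphism $\theta:\mathcal{O}_X\to\mathcal{NO}_{X^\otimes}$ satisfying $\theta(i_A(a))=j_{X^\otimes}(a)$ and $\theta(i_X(x))=j_{X^\otimes}(x)$ for all $a\in A=X^\otimes_0$ and $x\in X=X^\otimes_1$. (2) Let $(\pi,\psi)$ be a representation of $X$ and let $\psi^\otimes$ be the corresponding Nica covariant representation of $X^\otimes$. Then $(\pi,\psi)$ is covariant in the sense of Katsura if and only if $\psi^\otimes$ satisfies (CP).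
   Context: BIMODULES. A right-Hilbert $A$--$A$ bimodule over a $C^*$-algebra $A$ is a right Hilbert $A$-module $X$ (with $A$-valued inner product $\langle\cdot,\cdot\rangle_A$, linear in the second variable) together with a $*$-homomorphism $\phi:A\to\mathcal{L}(X)$ into the adjointable operators (not assumed injective or nondegenerate); write $a\cdot x=\phi(a)x$. $\mathcal{K}(X)=\overline{\mathrm{span}}\{x\otimes y^* : x,y\in X\}$, where $(x\otimes y^* )(z)=x\cdot\langle y,z\rangle_A$. ${}_AA_A$ denotes $A$ with $\langle a,b\rangle_A=a^*b$ and actions by multiplication; $\mathcal{K}({}_AA_A)\cong A$, with $a$ corresponding to left multiplication by $a$. $\otimes_A$ is the balanced (internal) tensor product, with left action $a\mapsto\phi(a)\otimes 1$. REPRESENTATIONS OF $X$ AND KATSURA'S ALGEBRA. A representation $(\pi,\psi)$ of $X$ in a $C^*$-algebra $B$ is a $*$-homomorphism $\pi:A\to B$ and a linear map $\psi:X\to B$ with $\psi(a\cdot x\cdot b)=\pi(a)\psi(x)\pi(b)$ and $\psi(x)^*\psi(y)=\pi(\langle x,y\rangle_A)$. Then $\psi^{(1)}:\mathcal{K}(X)\to B$ is the homomorphism with $\psi^{(1)}(x\otimes y^* )=\psi(x)\psi(y)^*$. For an ideal $I$ of $A$, $I^\perp=\{a\in A:ab=0\text{ for all }b\in I\}$. $(\pi,\psi)$ is covariant in the sense of Katsura if $\psi^{(1)}(\phi(a))=\pi(a)$ for all $a\in\ker(\phi)^\perp$ with $\phi(a)\in\mathcal{K}(X)$. Katsura's $\mathcal{O}_X$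 is the universal $C^*$-algebra generated by a representation $(i_A,i_X)$ of $X$ that is covariant in this sense. THE PRODUCT SYSTEM $X^\otimes$. In general, a product system over a semigroup $P$ (identity $e$) of right-Hilbert $A$--$A$ bimodules is a semigroup $Y=\bigsqcup_{p\in P}Y_p$ with each $Y_p$ a right-Hilbert $A$--$A$ bimodule (left action $\phi_p$, inner product $\langle\cdot,\cdot\rangle_A^p$), $Y_e={}_AA_A$, with isomorphisms $Y_p\otimes_AY_q\to Y_{pq}$, $x\otimes_Ay\mapsto xy$ for $p,q\ne e$, and with multiplication by elements of $Y_e=A$ implementing the actions of $A$. $X^\otimes$ is the product system over $P=\mathbb{N}$ (additive, $0\in\mathbb{N}$, usual order, $e=0$, $G=\mathbb{Z}$) with $X^\otimes_0=A$, $X^\otimes_n=X^{\otimes n}$ ($n$-fold balanced tensor power) for $n\ge1$, and multiplication given for nonzero $m,n$ by the natural isomorphisms $X^{\otimes m}\otimes_AX^{\otimes n}\cong X^{\otimes(m+n)}$. A representation of a product system $Y$ in $B$ is a map $\psi:Y\to B$ with each $\psi_p=\psi|_{Y_p}$ linear, $\psi_e$ a $*$-homomorphism, $\psi_p(x)\psi_q(y)=\psi_{pq}(xy)$, and $\psi_e(\langle x,y\rangle_A^p)=\psi_p(x)^*\psi_p(y)$; $\psi^{(p)}:\mathcal{K}(Y_p)\to B$ is the homomorphism with $\psi^{(p)}(x\otimes y^* )=\psi_p(x)\psi_p(y)^*$. Given a representation $(\pi,\psi)$ of $X$, $\psi^\otimes$ is the representation of $X^\otimes$ with $\psi^\otimes_0=\pi$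 and $\psi^\otimes_n(x_1\otimes\cdots\otimes x_n)=\psi(x_1)\cdots\psi(x_n)$ for $n\ge1$. THE ALGEBRA $\mathcal{NO}_{X^\otimes}$. For $m\ge 1$ and $n\ge m$, $\iota_m^n:\mathcal{L}(X^\otimes_m)\to\mathcal{L}(X^\otimes_n)$ is characterised by $\iota_m^n(S)(xy)=(Sx)y$ for $x\in X^\otimes_m,y\in X^\otimes_{n-m}$; $\iota_0^n:\mathcal{K}(X^\otimes_0)\cong A\to\mathcal{L}(X^\otimes_n)$ is $\phi_n$; $\iota_m^n=0$ if $m>n$. A representation $\psi$ of $X^\otimes$ is Nica covariant if $\psi^{(m)}(S)\psi^{(n)}(T)=\psi^{(m\vee n)}(\iota_m^{m\vee n}(S)\iota_n^{m\vee n}(T))$ for all $m,n$, $S\in\mathcal{K}(X^\otimes_m)$, $T\in\mathcal{K}(X^\otimes_n)$, where $m\vee n=\max\{m,n\}$ (over $\mathbb{N}$ every representation is Nica covariant). Put $I_0=A$ and $I_n=\bigcap_{0<r\le n}\ker(\phi_r)$ for $n\ge1$. For a bimodule $Y$ and ideal $I$, $Y\cdot I=\{y\cdot a:y\in Y,a\in I\}$. Put $\widetilde{X}_n=\bigoplus_{m\le n}X^\otimes_m\cdot I_{n-m}$, with left action $(\widetilde{\phi}_n(a)x)(m)=\phi_m(a)x(m)$ (each $\widetilde\phi_n$ is injective). For $m\ge1$ define $\widetilde{\iota}_m^{\,n}:\mathcal{L}(X^\otimes_m)\to\mathcal{L}(\widetilde{X}_n)$ by $(\widetilde{\iota}_m^{\,n}(S)x)(r)=\iota_m^r(S)x(r)$,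 and let $\widetilde{\iota}_0^{\,n}:\mathcal{K}(X^\otimes_0)\cong A\to\mathcal{L}(\widetilde{X}_n)$ be $\widetilde{\phi}_n$. $\psi$ satisfies (CP) if $\sum_{m\in F}\psi^{(m)}(T_m)=0$ for every finite $F\subset\mathbb{N}$ and all $T_m\in\mathcal{K}(X^\otimes_m)$ ($m\in F$) such that $\sum_{m\in F}\widetilde{\iota}_m^{\,s}(T_m)=0$ for large $s$, i.e. such that for every $q\in\mathbb{N}$ there is $r\ge q$ with the identity holding for all $s\ge r$. $\psi$ is CNP-covariant if it is Nica covariant and satisfies (CP). $(\mathcal{NO}_{X^\otimes},j_{X^\otimes})$ is the universal $C^*$-algebra generated by a CNP-covariant representation of $X^\otimes$. *)

theory Defs
  imports Complex_Main "HOL-Algebra.Module"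
begin

section \<open>Complex vector spaces with a norm\<close>

text \<open>
  A complex vector space is a module, in the sense of HOL-Algebra, over the following ring. As
  always for \<^locale>\<open>module\<close>, the record fields \<^const>\<open>mult\<close> and \<^const>\<open>one\<close> of the module carry no
  axioms. Algebras below use \<^const>\<open>mult\<close> for their product; no unit is assumed, and
  \<^const>\<open>one\<close> is never used.
\<close>

definition complex_ring :: "complex ring" where
  "complex_ring = \<lparr>carrier = UNIV, mult = (*), one = 1, zero = 0, add = (+)\<rparr>"

definition linear_on ::
  "(complex, 'v, 'm) module_scheme \<Rightarrow> (complex, 'w, 'n) module_scheme \<Rightarrow> ('v \<Rightarrow> 'w) \<Rightarrow> bool" where
  "linear_on V W f \<longleftrightarrow>
     f \<in> carrier V \<rightarrow> carrier W \<and>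
     (\<forall>x\<in>carrier V. \<forall>y\<in>carrier V. f (x \<oplus>\<^bsub>V\<^esub> y) = f x \<oplus>\<^bsub>W\<^esub> f y) \<and>
     (\<forall>c. \<forall>x\<in>carrier V. f (c \<odot>\<^bsub>V\<^esub> x) = c \<odot>\<^bsub>W\<^esub> f x)"

definition cspan :: "(complex, 'v, 'm) module_scheme \<Rightarrow> 'v set \<Rightarrow> 'v set" where
  "cspan V S = \<Inter>{W. submodule W complex_ring V \<and> S \<subseteq> W}"

definition norm_closure ::
  "(complex, 'v, 'm) module_scheme \<Rightarrow> ('v \<Rightarrow> real) \<Rightarrow> 'v set \<Rightarrow> 'v set" where
  "norm_closure V N S = {x \<in> carrier V. \<forall>e>0. \<exists>y\<in>S. N (x \<ominus>\<^bsub>V\<^esub> y) < e}"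

definition norm_complete :: "(complex, 'v, 'm) module_scheme \<Rightarrow> ('v \<Rightarrow> real) \<Rightarrow> bool" where
  "norm_complete V N \<longleftrightarrow>
     (\<forall>f :: nat \<Rightarrow> 'v. (\<forall>n. f n \<in> carrier V) \<longrightarrow>
        (\<forall>e>0. \<exists>M. \<forall>m\<ge>M. \<forall>n\<ge>M. N (f m \<ominus>\<^bsub>V\<^esub> f n) < e) \<longrightarrow>
        (\<exists>l\<in>carrier V. (\<lambda>n. N (f n \<ominus>\<^bsub>V\<^esub> l)) \<longlonglongrightarrow> 0))"


section \<open>C*-algebras\<close>

record 'a cstar = "(complex, 'a) module" +
  star :: "'a \<Rightarrow> 'a"
  nrm :: "'a \<Rightarrow> real"

locale cstar_algebra = module complex_ring A
  for A :: "('a, 'm) cstar_scheme" (structure) +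
  assumes mult_closed: "\<lbrakk>a \<in> carrier A; b \<in> carrier A\<rbrakk> \<Longrightarrow> a \<otimes> b \<in> carrier A"
    and mult_assoc: "\<lbrakk>a \<in> carrier A; b \<in> carrier A; c \<in> carrier A\<rbrakk>
          \<Longrightarrow> (a \<otimes> b) \<otimes> c = a \<otimes> (b \<otimes> c)"
    and mult_add_left: "\<lbrakk>a \<in> carrier A; b \<in> carrier A; c \<in> carrier A\<rbrakk>
          \<Longrightarrow> (a \<oplus> b) \<otimes> c = a \<otimes> c \<oplus> b \<otimes> c"
    and mult_add_right: "\<lbrakk>a \<in> carrier A; b \<in> carrier A; c \<in> carrier A\<rbrakk>
          \<Longrightarrow> a \<otimes> (b \<oplus> c) = a \<otimes> b \<oplus> a \<otimes> c"
    and mult_scale_left: "\<lbrakk>a \<in> carrier A; b \<in> carrier A\<rbrakk> \<Longrightarrow> (t \<odot> a) \<otimes> b = t \<odot> (a \<otimes> b)"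
    and mult_scale_right: "\<lbrakk>a \<in> carrier A; b \<in> carrier A\<rbrakk> \<Longrightarrow> a \<otimes> (t \<odot> b) = t \<odot> (a \<otimes> b)"
    and star_closed: "a \<in> carrier A \<Longrightarrow> star A a \<in> carrier A"
    and star_star: "a \<in> carrier A \<Longrightarrow> star A (star A a) = a"
    and star_add: "\<lbrakk>a \<in> carrier A; b \<in> carrier A\<rbrakk> \<Longrightarrow> star A (a \<oplus> b) = star A a \<oplus> star A b"
    and star_scale: "a \<in> carrier A \<Longrightarrow> star A (t \<odot> a) = cnj t \<odot> star A a"
    and star_mult: "\<lbrakk>a \<in> carrier A; b \<in> carrier A\<rbrakk> \<Longrightarrow> star A (a \<otimes> b) = star A b \<otimes> star A a"
    and nrm_nonneg: "a \<in> carrier A \<Longrightarrow> 0 \<le> nrm A a"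
    and nrm_eq_0: "a \<in> carrier A \<Longrightarrow> nrm A a = 0 \<longleftrightarrow> a = \<zero>"
    and nrm_scale: "a \<in> carrier A \<Longrightarrow> nrm A (t \<odot> a) = cmod t * nrm A a"
    and nrm_triangle: "\<lbrakk>a \<in> carrier A; b \<in> carrier A\<rbrakk> \<Longrightarrow> nrm A (a \<oplus> b) \<le> nrm A a + nrm A b"
    and nrm_mult: "\<lbrakk>a \<in> carrier A; b \<in> carrier A\<rbrakk> \<Longrightarrow> nrm A (a \<otimes> b) \<le> nrm A a * nrm A b"
    and nrm_star_mult: "a \<in> carrier A \<Longrightarrow> nrm A (star A a \<otimes> a) = (nrm A a)\<^sup>2"
    and complete: "norm_complete A (nrm A)"

definition cstar_hom :: "('a, 'm) cstar_scheme \<Rightarrow> ('b, 'n) cstar_scheme \<Rightarrow> ('a \<Rightarrow> 'b) set" where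
  "cstar_hom A B =
     {h. linear_on A B h \<and>
         (\<forall>a\<in>carrier A. \<forall>b\<in>carrier A. h (a \<otimes>\<^bsub>A\<^esub> b) = h a \<otimes>\<^bsub>B\<^esub> h b) \<and>
         (\<forall>a\<in>carrier A. h (star A a) = star B (h a))}"

definition cstar_iso :: "('a, 'm) cstar_scheme \<Rightarrow> ('b, 'n) cstar_scheme \<Rightarrow> ('a \<Rightarrow> 'b) set" where
  "cstar_iso A B = {h \<in> cstar_hom A B. bij_betw h (carrier A) (carrier B)}"

definition cstar_subalgebra :: "'a set \<Rightarrow> ('a, 'm) cstar_scheme \<Rightarrow> bool" where
  "cstar_subalgebra D A \<longleftrightarrow>
     submodule D complex_ring A \<and>
     (\<forall>a\<in>D. \<forall>b\<in>D. a \<otimes>\<^bsub>A\<^esub> b \<in> D) \<and> (\<forall>a\<in>D. star A a \<in> D) \<and>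
     norm_closure A (nrm A) D \<subseteq> D"

definition cstar_generated :: "('a, 'm) cstar_scheme \<Rightarrow> 'a set \<Rightarrow> 'a set" where
  "cstar_generated A S = \<Inter>{D. cstar_subalgebra D A \<and> S \<subseteq> D}"

definition positive :: "('a, 'm) cstar_scheme \<Rightarrow> 'a \<Rightarrow> bool" where
  "positive A a \<longleftrightarrow> (\<exists>b\<in>carrier A. a = star A b \<otimes>\<^bsub>A\<^esub> b)"

text \<open>The annihilator; it is used for two-sided ideals only.\<close>

definition perp :: "('a, 'm) cstar_scheme \<Rightarrow> 'a set \<Rightarrow> 'a set" where
  "perp A I = {a \<in> carrier A. \<forall>b\<in>I. a \<otimes>\<^bsub>A\<^esub> b = \<zero>\<^bsub>A\<^esub>}"


section \<open>Right-Hilbert bimodules\<close>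

text \<open>
  \<open>lact X a\<close> is the operator \<open>\<phi>(a)\<close>, so that \<open>a \<cdot> x = lact X a x\<close>; \<open>inn X\<close> is the algebra-valued
  inner product, linear in the second variable.
\<close>

record ('a, 'x) bimod = "(complex, 'x) module" +
  ract :: "'x \<Rightarrow> 'a \<Rightarrow> 'x"
  lact :: "'a \<Rightarrow> 'x \<Rightarrow> 'x"
  inn :: "'x \<Rightarrow> 'x \<Rightarrow> 'a"

definition hnorm :: "('a, 'm) cstar_scheme \<Rightarrow> ('a, 'x, 'n) bimod_scheme \<Rightarrow> 'x \<Rightarrow> real" where
  "hnorm A X x = sqrt (nrm A (inn X x x))"

locale hilbert_module = A: cstar_algebra A + X: module complex_ring X
  for A :: "('a, 'm) cstar_scheme" and X :: "('a, 'x, 'n) bimod_scheme" +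
  assumes ract_closed: "\<lbrakk>x \<in> carrier X; a \<in> carrier A\<rbrakk> \<Longrightarrow> ract X x a \<in> carrier X"
    and ract_add_left: "\<lbrakk>x \<in> carrier X; y \<in> carrier X; a \<in> carrier A\<rbrakk>
          \<Longrightarrow> ract X (x \<oplus>\<^bsub>X\<^esub> y) a = ract X x a \<oplus>\<^bsub>X\<^esub> ract X y a"
    and ract_add_right: "\<lbrakk>x \<in> carrier X; a \<in> carrier A; b \<in> carrier A\<rbrakk>
          \<Longrightarrow> ract X x (a \<oplus>\<^bsub>A\<^esub> b) = ract X x a \<oplus>\<^bsub>X\<^esub> ract X x b"
    and ract_mult: "\<lbrakk>x \<in> carrier X; a \<in> carrier A; b \<in> carrier A\<rbrakk>
          \<Longrightarrow> ract X x (a \<otimes>\<^bsub>A\<^esub> b) = ract X (ract X x a) b"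
    and ract_scale_left: "\<lbrakk>x \<in> carrier X; a \<in> carrier A\<rbrakk>
          \<Longrightarrow> ract X (t \<odot>\<^bsub>X\<^esub> x) a = t \<odot>\<^bsub>X\<^esub> ract X x a"
    and ract_scale_right: "\<lbrakk>x \<in> carrier X; a \<in> carrier A\<rbrakk>
          \<Longrightarrow> ract X x (t \<odot>\<^bsub>A\<^esub> a) = t \<odot>\<^bsub>X\<^esub> ract X x a"
    and inn_closed: "\<lbrakk>x \<in> carrier X; y \<in> carrier X\<rbrakk> \<Longrightarrow> inn X x y \<in> carrier A"
    and inn_add: "\<lbrakk>x \<in> carrier X; y \<in> carrier X; z \<in> carrier X\<rbrakk>
          \<Longrightarrow> inn X x (y \<oplus>\<^bsub>X\<^esub> z) = inn X x y \<oplus>\<^bsub>A\<^esub> inn X x z"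
    and inn_scale: "\<lbrakk>x \<in> carrier X; y \<in> carrier X\<rbrakk>
          \<Longrightarrow> inn X x (t \<odot>\<^bsub>X\<^esub> y) = t \<odot>\<^bsub>A\<^esub> inn X x y"
    and inn_ract: "\<lbrakk>x \<in> carrier X; y \<in> carrier X; a \<in> carrier A\<rbrakk>
          \<Longrightarrow> inn X x (ract X y a) = inn X x y \<otimes>\<^bsub>A\<^esub> a"
    and inn_star: "\<lbrakk>x \<in> carrier X; y \<in> carrier X\<rbrakk> \<Longrightarrow> star A (inn X x y) = inn X y x"
    and inn_positive: "x \<in> carrier X \<Longrightarrow> positive A (inn X x x)"
    and inn_definite: "\<lbrakk>x \<in> carrier X; inn X x x = \<zero>\<^bsub>A\<^esub>\<rbrakk> \<Longrightarrow> x = \<zero>\<^bsub>X\<^esub>"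
    and hcomplete: "norm_complete X (hnorm A X)"

text \<open>
  Operators on \<open>X\<close> are functions that are \<^const>\<open>undefined\<close> off the carrier, so that equality
  of operators is equality of functions. For a Hilbert module \<open>X\<close>, adjointable operators are
  automatically linear and bounded, and the adjoint is unique.
\<close>

definition adjointable :: "('a, 'x, 'n) bimod_scheme \<Rightarrow> ('x \<Rightarrow> 'x) set" where
  "adjointable X =
     {T \<in> carrier X \<rightarrow>\<^sub>E carrier X. \<exists>S \<in> carrier X \<rightarrow>\<^sub>E carrier X.
        \<forall>x\<in>carrier X. \<forall>y\<in>carrier X. inn X (T x) y = inn X x (S y)}"

definition adjoint :: "('a, 'x, 'n) bimod_scheme \<Rightarrow> ('x \<Rightarrow> 'x) \<Rightarrow> ('x \<Rightarrow> 'x)" where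
  "adjoint X T = (THE S. S \<in> carrier X \<rightarrow>\<^sub>E carrier X \<and>
     (\<forall>x\<in>carrier X. \<forall>y\<in>carrier X. inn X (T x) y = inn X x (S y)))"

definition op_norm ::
  "('a, 'm) cstar_scheme \<Rightarrow> ('a, 'x, 'n) bimod_scheme \<Rightarrow> ('x \<Rightarrow> 'x) \<Rightarrow> real" where
  "op_norm A X T = Sup {hnorm A X (T x) | x. x \<in> carrier X \<and> hnorm A X x \<le> 1}"

definition LL :: "('a, 'm) cstar_scheme \<Rightarrow> ('a, 'x, 'n) bimod_scheme \<Rightarrow> ('x \<Rightarrow> 'x) cstar" where
  "LL A X = \<lparr>carrier = adjointable X,
     mult = compose (carrier X), one = (\<lambda>x\<in>carrier X. x),
     zero = (\<lambda>x\<in>carrier X. \<zero>\<^bsub>X\<^esub>), add = (\<lambda>S T. \<lambda>x\<in>carrier X. S x \<oplus>\<^bsub>X\<^esub> T x),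
     smult = (\<lambda>t T. \<lambda>x\<in>carrier X. t \<odot>\<^bsub>X\<^esub> T x),
     star = adjoint X, nrm = op_norm A X\<rparr>"

definition rank_one :: "('a, 'x, 'n) bimod_scheme \<Rightarrow> 'x \<Rightarrow> 'x \<Rightarrow> ('x \<Rightarrow> 'x)" where
  "rank_one X x y = (\<lambda>z\<in>carrier X. ract X x (inn X y z))"

definition KK :: "('a, 'm) cstar_scheme \<Rightarrow> ('a, 'x, 'n) bimod_scheme \<Rightarrow> ('x \<Rightarrow> 'x) cstar" where
  "KK A X = (LL A X)\<lparr>carrier := norm_closure (LL A X) (op_norm A X)
     (cspan (LL A X) {rank_one X x y | x y. x \<in> carrier X \<and> y \<in> carrier X})\<rparr>"

locale hilbert_bimodule = hilbert_module A X
  for A :: "('a, 'm) cstar_scheme" and X :: "('a, 'x, 'n) bimod_scheme" +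
  assumes lact_hom: "lact X \<in> cstar_hom A (LL A X)"

definition lact_kernel :: "('a, 'm) cstar_scheme \<Rightarrow> ('a, 'x, 'n) bimod_scheme \<Rightarrow> 'a set" where
  "lact_kernel A X = {a \<in> carrier A. lact X a = \<zero>\<^bsub>LL A X\<^esub>}"

definition self_bimod :: "('a, 'm) cstar_scheme \<Rightarrow> ('a, 'a) bimod" where
  "self_bimod A = \<lparr>carrier = carrier A, mult = mult A, one = one A, zero = zero A, add = add A,
     smult = smult A, ract = mult A, lact = (\<lambda>a. \<lambda>b\<in>carrier A. a \<otimes>\<^bsub>A\<^esub> b),
     inn = (\<lambda>a b. star A a \<otimes>\<^bsub>A\<^esub> b)\<rparr>"

definition bimod_iso ::
  "('a, 'm) cstar_scheme \<Rightarrow> ('a, 'x, 'n) bimod_scheme \<Rightarrow> ('a, 'y, 'k) bimod_scheme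
     \<Rightarrow> ('x \<Rightarrow> 'y) set" where
  "bimod_iso A X Y = {u. linear_on X Y u \<and> bij_betw u (carrier X) (carrier Y) \<and>
     (\<forall>x\<in>carrier X. \<forall>y\<in>carrier X. inn Y (u x) (u y) = inn X x y) \<and>
     (\<forall>x\<in>carrier X. \<forall>a\<in>carrier A. u (ract X x a) = ract Y (u x) a) \<and>
     (\<forall>x\<in>carrier X. \<forall>a\<in>carrier A. u (lact X a x) = lact Y a (u x))}"

text \<open>
  The balanced tensor product of \<open>X\<close> and \<open>Y\<close> is the completion of the algebraic balanced tensor
  product in the inner product \<open>\<langle>x \<otimes> y, x' \<otimes> y'\<rangle> = \<langle>y, \<langle>x, x'\<rangle> \<cdot> y'\<rangle>\<close>, with left action
  \<open>\<phi>(a) \<otimes> 1\<close>. The predicate says that \<open>x \<otimes> y \<mapsto> t x y\<close> is a well-defined isomorphism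
  of bimodules from it onto the (complete) bimodule \<open>Z\<close>.
\<close>

definition is_balanced_tensor ::
  "('a, 'm) cstar_scheme \<Rightarrow> ('a, 'x, 'n) bimod_scheme \<Rightarrow> ('a, 'y, 'k) bimod_scheme
     \<Rightarrow> ('a, 'z, 'l) bimod_scheme \<Rightarrow> ('x \<Rightarrow> 'y \<Rightarrow> 'z) \<Rightarrow> bool" where
  "is_balanced_tensor A X Y Z t \<longleftrightarrow>
     (\<forall>x\<in>carrier X. linear_on Y Z (t x)) \<and>
     (\<forall>y\<in>carrier Y. linear_on X Z (\<lambda>x. t x y)) \<and>
     (\<forall>x\<in>carrier X. \<forall>y\<in>carrier Y. \<forall>a\<in>carrier A.
        t (ract X x a) y = t x (lact Y a y) \<and>
        t x (ract Y y a) = ract Z (t x y) a \<and>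
        t (lact X a x) y = lact Z a (t x y)) \<and>
     (\<forall>x\<in>carrier X. \<forall>y\<in>carrier Y. \<forall>x'\<in>carrier X. \<forall>y'\<in>carrier Y.
        inn Z (t x y) (t x' y') = inn Y y (lact Y (inn X x x') y')) \<and>
     norm_closure Z (hnorm A Z) (cspan Z {t x y | x y. x \<in> carrier X \<and> y \<in> carrier Y})
       = carrier Z"


section \<open>Representations of a bimodule and Katsura's algebra\<close>

definition is_rep ::
  "('a, 'm) cstar_scheme \<Rightarrow> ('a, 'x, 'n) bimod_scheme \<Rightarrow> ('b, 'k) cstar_scheme
     \<Rightarrow> ('a \<Rightarrow> 'b) \<Rightarrow> ('x \<Rightarrow> 'b) \<Rightarrow> bool" where
  "is_rep A X B \<pi> \<psi> \<longleftrightarrow>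
     \<pi> \<in> cstar_hom A B \<and> linear_on X B \<psi> \<and>
     (\<forall>a\<in>carrier A. \<forall>x\<in>carrier X. \<forall>b\<in>carrier A.
        \<psi> (ract X (lact X a x) b) = (\<pi> a \<otimes>\<^bsub>B\<^esub> \<psi> x) \<otimes>\<^bsub>B\<^esub> \<pi> b) \<and>
     (\<forall>x\<in>carrier X. \<forall>y\<in>carrier X. star B (\<psi> x) \<otimes>\<^bsub>B\<^esub> \<psi> y = \<pi> (inn X x y))"

text \<open>
  The homomorphism \<open>\<psi>\<^sup>(\<^sup>1\<^sup>)\<close>. It exists for representations and is then unique on the
  carrier of \<open>KK A X\<close>; off that carrier its values are arbitrary and never used.
\<close>

definition cpt_ext ::
  "('a, 'm) cstar_scheme \<Rightarrow> ('a, 'x, 'n) bimod_scheme \<Rightarrow> ('b, 'k) cstar_scheme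
     \<Rightarrow> ('x \<Rightarrow> 'b) \<Rightarrow> ('x \<Rightarrow> 'x) \<Rightarrow> 'b" where
  "cpt_ext A X B \<psi> = (SOME \<rho>. \<rho> \<in> cstar_hom (KK A X) B \<and>
     (\<forall>x\<in>carrier X. \<forall>y\<in>carrier X. \<rho> (rank_one X x y) = \<psi> x \<otimes>\<^bsub>B\<^esub> star B (\<psi> y)))"

definition katsura_covariant ::
  "('a, 'm) cstar_scheme \<Rightarrow> ('a, 'x, 'n) bimod_scheme \<Rightarrow> ('b, 'k) cstar_scheme
     \<Rightarrow> ('a \<Rightarrow> 'b) \<Rightarrow> ('x \<Rightarrow> 'b) \<Rightarrow> bool" where
  "katsura_covariant A X B \<pi> \<psi> \<longleftrightarrow>
     (\<forall>a \<in> perp A (lact_kernel A X). lact X a \<in> carrier (KK A X) \<longrightarrow>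
        cpt_ext A X B \<psi> (lact X a) = \<pi> a)"

text \<open>
  The type \<open>'u\<close> plays the role of a universe: universality is tested against all C*-algebras
  whose elements are taken from \<open>'u\<close>. The C*-algebra generated by the image of a representation has
  at most as many elements as there are sequences of *-polynomials in \<open>A\<close> and \<open>X\<close>, so for
  all sufficiently large \<open>'u\<close> this is universality among all C*-algebras.
\<close>

definition is_katsura_algebra ::
  "('a, 'm) cstar_scheme \<Rightarrow> ('a, 'x, 'n) bimod_scheme \<Rightarrow> 'u cstar
     \<Rightarrow> ('a \<Rightarrow> 'u) \<Rightarrow> ('x \<Rightarrow> 'u) \<Rightarrow> bool" where
  "is_katsura_algebra A X OX i\<^sub>A i\<^sub>X \<longleftrightarrow>
     cstar_algebra OX \<and> is_rep A X OX i\<^sub>A i\<^sub>X \<and> katsura_covariant A X OX i\<^sub>A i\<^sub>X \<and>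
     cstar_generated OX (i\<^sub>A ` carrier A \<union> i\<^sub>X ` carrier X) = carrier OX \<and>
     (\<forall>(B :: 'u cstar) \<pi> \<psi>.
        cstar_algebra B \<and> is_rep A X B \<pi> \<psi> \<and> katsura_covariant A X B \<pi> \<psi> \<longrightarrow>
        (\<exists>\<rho>\<in>cstar_hom OX B.
           (\<forall>a\<in>carrier A. \<rho> (i\<^sub>A a) = \<pi> a) \<and> (\<forall>x\<in>carrier X. \<rho> (i\<^sub>X x) = \<psi> x)))"


section \<open>Product systems over the natural numbers\<close>

text \<open>
  \<open>fib Y n\<close> is the fibre \<open>Y\<^sub>n\<close>, \<open>prd Y m n\<close> is the multiplication \<open>Y\<^sub>m \<times> Y\<^sub>n \<rightarrow> Y\<^sub>m\<^sub>+\<^sub>n\<close>, and \<open>base Y\<close>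
  is the identification of \<open>A\<close> with \<open>Y\<^sub>0\<close> (the elements of all fibres have the
  same HOL type, which may differ from that of the elements of \<open>A\<close>).
\<close>

record ('a, 'y) prod_system =
  fib :: "nat \<Rightarrow> ('a, 'y) bimod"
  prd :: "nat \<Rightarrow> nat \<Rightarrow> 'y \<Rightarrow> 'y \<Rightarrow> 'y"
  base :: "'a \<Rightarrow> 'y"

locale product_system = cstar_algebra A
  for A :: "('a, 'm) cstar_scheme" and Y :: "('a, 'y) prod_system" +
  assumes fib: "hilbert_bimodule A (fib Y n)"
    and base: "base Y \<in> bimod_iso A (self_bimod A) (fib Y 0)"
    and prd_assoc: "\<lbrakk>x \<in> carrier (fib Y l); y \<in> carrier (fib Y m); z \<in> carrier (fib Y n)\<rbrakk>
          \<Longrightarrow> prd Y (l + m) n (prd Y l m x y) z = prd Y l (m + n) x (prd Y m n y z)"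
    and prd_tensor: "\<lbrakk>m \<noteq> 0; n \<noteq> 0\<rbrakk>
          \<Longrightarrow> is_balanced_tensor A (fib Y m) (fib Y n) (fib Y (m + n)) (prd Y m n)"
    and prd_base_left: "\<lbrakk>a \<in> carrier A; y \<in> carrier (fib Y n)\<rbrakk>
          \<Longrightarrow> prd Y 0 n (base Y a) y = lact (fib Y n) a y"
    and prd_base_right: "\<lbrakk>y \<in> carrier (fib Y n); a \<in> carrier A\<rbrakk>
          \<Longrightarrow> prd Y n 0 y (base Y a) = ract (fib Y n) y a"

text \<open>
  \<open>Y\<close> is the product system \<open>X\<^sup>\<otimes>\<close> of tensor powers of \<open>X\<close>, with \<open>\<kappa>\<close> the identification of \<open>X\<close>
  with the fibre \<open>Y\<^sub>1\<close>; by \<open>prd_tensor\<close>, \<open>Y\<^sub>n\<close> is the \<open>n\<close>-fold balanced tensor power of \<open>Y\<^sub>1\<close>,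
  and the multiplication consists of the canonical isomorphisms.
\<close>

locale tensor_powers =
  X: hilbert_bimodule A X + product_system A Y
  for A :: "('a, 'm) cstar_scheme" and X :: "('a, 'x, 'n) bimod_scheme"
    and Y :: "('a, 'y) prod_system" and \<kappa> :: "'x \<Rightarrow> 'y" +
  assumes kappa: "\<kappa> \<in> bimod_iso A X (fib Y 1)"

definition is_prod_rep ::
  "('a, 'm) cstar_scheme \<Rightarrow> ('a, 'y) prod_system \<Rightarrow> ('b, 'k) cstar_scheme
     \<Rightarrow> (nat \<Rightarrow> 'y \<Rightarrow> 'b) \<Rightarrow> bool" where
  "is_prod_rep A Y B \<psi> \<longleftrightarrow>
     (\<forall>n. linear_on (fib Y n) B (\<psi> n)) \<and>
     (\<lambda>a. \<psi> 0 (base Y a)) \<in> cstar_hom A B \<and>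
     (\<forall>m n. \<forall>x\<in>carrier (fib Y m). \<forall>y\<in>carrier (fib Y n).
        \<psi> m x \<otimes>\<^bsub>B\<^esub> \<psi> n y = \<psi> (m + n) (prd Y m n x y)) \<and>
     (\<forall>n. \<forall>x\<in>carrier (fib Y n). \<forall>y\<in>carrier (fib Y n).
        \<psi> 0 (base Y (inn (fib Y n) x y)) = star B (\<psi> n x) \<otimes>\<^bsub>B\<^esub> \<psi> n y)"

text \<open>\<open>x\<^sub>1 \<otimes> \<dots> \<otimes> x\<^sub>n\<close> in \<open>Y\<^sub>n\<close>, and \<open>\<psi>(x\<^sub>1) \<dots> \<psi>(x\<^sub>n)\<close> in \<open>B\<close>, for \<open>n \<ge> 1\<close>.\<close>

fun tensor_word :: "('a, 'y) prod_system \<Rightarrow> ('x \<Rightarrow> 'y) \<Rightarrow> 'x list \<Rightarrow> 'y" where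
  "tensor_word Y \<kappa> [] = undefined"
| "tensor_word Y \<kappa> [x] = \<kappa> x"
| "tensor_word Y \<kappa> (x # x' # xs) =
     prd Y 1 (length (x' # xs)) (\<kappa> x) (tensor_word Y \<kappa> (x' # xs))"

fun mult_word :: "('b, 'k) cstar_scheme \<Rightarrow> ('x \<Rightarrow> 'b) \<Rightarrow> 'x list \<Rightarrow> 'b" where
  "mult_word B \<psi> [] = undefined"
| "mult_word B \<psi> [x] = \<psi> x"
| "mult_word B \<psi> (x # x' # xs) = \<psi> x \<otimes>\<^bsub>B\<^esub> mult_word B \<psi> (x' # xs)"

text \<open>
  The representation \<open>\<psi>\<^sup>\<otimes>\<close>, which exists for every representation \<open>(\<pi>, \<psi>)\<close> of \<open>X\<close> and
  is then unique on the fibres.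
\<close>

definition tensor_rep ::
  "('a, 'm) cstar_scheme \<Rightarrow> ('a, 'x, 'n) bimod_scheme \<Rightarrow> ('a, 'y) prod_system \<Rightarrow> ('x \<Rightarrow> 'y)
     \<Rightarrow> ('b, 'k) cstar_scheme \<Rightarrow> ('a \<Rightarrow> 'b) \<Rightarrow> ('x \<Rightarrow> 'b) \<Rightarrow> nat \<Rightarrow> 'y \<Rightarrow> 'b" where
  "tensor_rep A X Y \<kappa> B \<pi> \<psi> = (SOME \<Psi>. is_prod_rep A Y B \<Psi> \<and>
     (\<forall>a\<in>carrier A. \<Psi> 0 (base Y a) = \<pi> a) \<and>
     (\<forall>xs. xs \<noteq> [] \<and> set xs \<subseteq> carrier X \<longrightarrow>
        \<Psi> (length xs) (tensor_word Y \<kappa> xs) = mult_word B \<psi> xs))"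


section \<open>Covariance for product systems\<close>

text \<open>
  The inverse of the isomorphism from \<open>A\<close> onto the compact operators on \<open>Y\<^sub>0\<close> that sends \<open>a\<close>
  to left multiplication by \<open>a\<close>.
\<close>

definition symbol0 ::
  "('a, 'm) cstar_scheme \<Rightarrow> ('a, 'y) prod_system \<Rightarrow> ('y \<Rightarrow> 'y) \<Rightarrow> 'a" where
  "symbol0 A Y S = (THE a. a \<in> carrier A \<and> lact (fib Y 0) a = S)"

text \<open>\<open>iota A Y m n\<close> is \<open>\<iota>\<close> from degree \<open>m\<close> to degree \<open>n\<close>.\<close>

definition iota ::
  "('a, 'm) cstar_scheme \<Rightarrow> ('a, 'y) prod_system \<Rightarrow> nat \<Rightarrow> nat \<Rightarrow> ('y \<Rightarrow> 'y) \<Rightarrow> ('y \<Rightarrow> 'y)" where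
  "iota A Y m n S =
     (if n < m then \<zero>\<^bsub>LL A (fib Y n)\<^esub>
      else if m = 0 then lact (fib Y n) (symbol0 A Y S)
      else (THE T. T \<in> carrier (LL A (fib Y n)) \<and>
              (\<forall>x\<in>carrier (fib Y m). \<forall>y\<in>carrier (fib Y (n - m)).
                 T (prd Y m (n - m) x y) = prd Y m (n - m) (S x) y)))"

abbreviation prod_cpt_ext ::
  "('a, 'm) cstar_scheme \<Rightarrow> ('a, 'y) prod_system \<Rightarrow> ('b, 'k) cstar_scheme
     \<Rightarrow> (nat \<Rightarrow> 'y \<Rightarrow> 'b) \<Rightarrow> nat \<Rightarrow> ('y \<Rightarrow> 'y) \<Rightarrow> 'b" where
  "prod_cpt_ext A Y B \<psi> n \<equiv> cpt_ext A (fib Y n) B (\<psi> n)"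

definition nica_covariant ::
  "('a, 'm) cstar_scheme \<Rightarrow> ('a, 'y) prod_system \<Rightarrow> ('b, 'k) cstar_scheme
     \<Rightarrow> (nat \<Rightarrow> 'y \<Rightarrow> 'b) \<Rightarrow> bool" where
  "nica_covariant A Y B \<psi> \<longleftrightarrow>
     (\<forall>m n. \<forall>S\<in>carrier (KK A (fib Y m)). \<forall>T\<in>carrier (KK A (fib Y n)).
        prod_cpt_ext A Y B \<psi> m S \<otimes>\<^bsub>B\<^esub> prod_cpt_ext A Y B \<psi> n T =
        prod_cpt_ext A Y B \<psi> (max m n)
          (iota A Y m (max m n) S \<otimes>\<^bsub>LL A (fib Y (max m n))\<^esub> iota A Y n (max m n) T))"

definition kernel_ideal :: "('a, 'm) cstar_scheme \<Rightarrow> ('a, 'y) prod_system \<Rightarrow> nat \<Rightarrow> 'a set" where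
  "kernel_ideal A Y n =
     (if n = 0 then carrier A else (\<Inter>r\<in>{0<..n}. lact_kernel A (fib Y r)))"

definition mod_ideal :: "('a, 'x, 'n) bimod_scheme \<Rightarrow> 'a set \<Rightarrow> 'x set" where
  "mod_ideal X I = {ract X x a | x a. x \<in> carrier X \<and> a \<in> I}"

text \<open>
  The Hilbert module direct sum \<open>\<Oplus>\<^sub>m\<^sub>\<le>\<^sub>n Y\<^sub>m \<cdot> I\<^sub>n\<^sub>-\<^sub>m\<close>; its elements are functions on \<open>{..n}\<close>. The fields
  \<^const>\<open>mult\<close> and \<^const>\<open>one\<close> have no meaning for modules.
\<close>

definition Xtilde :: "('a, 'm) cstar_scheme \<Rightarrow> ('a, 'y) prod_system \<Rightarrow> nat
    \<Rightarrow> ('a, nat \<Rightarrow> 'y) bimod" where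
  "Xtilde A Y n =
     (let C = (\<Pi>\<^sub>E m\<in>{..n}. mod_ideal (fib Y m) (kernel_ideal A Y (n - m))) in
      \<lparr>carrier = C, mult = undefined, one = undefined,
       zero = (\<lambda>m\<in>{..n}. \<zero>\<^bsub>fib Y m\<^esub>),
       add = (\<lambda>x y. \<lambda>m\<in>{..n}. x m \<oplus>\<^bsub>fib Y m\<^esub> y m),
       smult = (\<lambda>t x. \<lambda>m\<in>{..n}. t \<odot>\<^bsub>fib Y m\<^esub> x m),
       ract = (\<lambda>x a. \<lambda>m\<in>{..n}. ract (fib Y m) (x m) a),
       lact = (\<lambda>a. \<lambda>x\<in>C. \<lambda>m\<in>{..n}. lact (fib Y m) a (x m)),
       inn = (\<lambda>x y. \<Oplus>\<^bsub>A\<^esub>m\<in>{..n}. inn (fib Y m) (x m) (y m))\<rparr>)"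

definition iota_tilde ::
  "('a, 'm) cstar_scheme \<Rightarrow> ('a, 'y) prod_system \<Rightarrow> nat \<Rightarrow> nat \<Rightarrow> ('y \<Rightarrow> 'y)
     \<Rightarrow> ((nat \<Rightarrow> 'y) \<Rightarrow> (nat \<Rightarrow> 'y))" where
  "iota_tilde A Y m n S =
     (if m = 0 then lact (Xtilde A Y n) (symbol0 A Y S)
      else (\<lambda>x\<in>carrier (Xtilde A Y n). \<lambda>r\<in>{..n}. iota A Y m r S (x r)))"

definition satisfies_CP ::
  "('a, 'm) cstar_scheme \<Rightarrow> ('a, 'y) prod_system \<Rightarrow> ('b, 'k) cstar_scheme
     \<Rightarrow> (nat \<Rightarrow> 'y \<Rightarrow> 'b) \<Rightarrow> bool" where
  "satisfies_CP A Y B \<psi> \<longleftrightarrow>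
     (\<forall>F T. finite F \<and> (\<forall>m\<in>F. T m \<in> carrier (KK A (fib Y m))) \<and>
        (\<forall>q. \<exists>r\<ge>q. \<forall>s\<ge>r.
           (\<Oplus>\<^bsub>LL A (Xtilde A Y s)\<^esub>m\<in>F. iota_tilde A Y m s (T m)) = \<zero>\<^bsub>LL A (Xtilde A Y s)\<^esub>) \<longrightarrow>
        (\<Oplus>\<^bsub>B\<^esub>m\<in>F. prod_cpt_ext A Y B \<psi> m (T m)) = \<zero>\<^bsub>B\<^esub>)"

definition CNP_covariant ::
  "('a, 'm) cstar_scheme \<Rightarrow> ('a, 'y) prod_system \<Rightarrow> ('b, 'k) cstar_scheme
     \<Rightarrow> (nat \<Rightarrow> 'y \<Rightarrow> 'b) \<Rightarrow> bool" where
  "CNP_covariant A Y B \<psi> \<longleftrightarrow> nica_covariant A Y B \<psi> \<and> satisfies_CP A Y B \<psi>"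

text \<open>As for \<^const>\<open>is_katsura_algebra\<close>, \<open>'u\<close> is a universe.\<close>

definition is_NO_algebra ::
  "('a, 'm) cstar_scheme \<Rightarrow> ('a, 'y) prod_system \<Rightarrow> 'u cstar \<Rightarrow> (nat \<Rightarrow> 'y \<Rightarrow> 'u) \<Rightarrow> bool" where
  "is_NO_algebra A Y NO j \<longleftrightarrow>
     cstar_algebra NO \<and> is_prod_rep A Y NO j \<and> CNP_covariant A Y NO j \<and>
     cstar_generated NO (\<Union>n. j n ` carrier (fib Y n)) = carrier NO \<and>
     (\<forall>(B :: 'u cstar) \<psi>.
        cstar_algebra B \<and> is_prod_rep A Y B \<psi> \<and> CNP_covariant A Y B \<psi> \<longrightarrow>
        (\<exists>\<rho>\<in>cstar_hom NO B. \<forall>n. \<forall>y\<in>carrier (fib Y n). \<rho> (j n y) = \<psi> n y))"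

end

theory Submission
  imports "HOL-Analysis.Weierstrass_Theorems" "HOL-Computational_Algebra.Polynomial" Defs
begin

text \<open>
  Write \<open>J = ker \<phi>\<^sub>1\<close>, so that \<open>I\<^sub>n = J\<close> for \<open>n \<ge> 1\<close>, and \<open>Q\<^sub>r = \<Sum> \<iota>\<^sub>m\<^sup>r(T\<^sub>m)\<close> for a family as in (CP). Read
  fibrewise, the hypothesis of (CP) says that \<open>Q\<^sub>s = 0\<close> for large \<open>s\<close> and that \<open>Q\<^sub>r\<close> kills \<open>Y\<^sub>r \<sqdot> J\<close> for all \<open>r\<close>,
  so that the matrix coefficients of \<open>Q\<^sub>r\<close> lie in \<open>J\<^sup>\<bottom>\<close>. As \<open>J\<^sup>\<bottom>\<close> acts isometrically on \<open>Y\<^sub>1\<close>, compactness of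
  \<open>Q\<^sub>r \<otimes> 1 = Q\<^sub>r\<^sub>+\<^sub>1 - T\<^sub>r\<^sub>+\<^sub>1\<close> descends to \<open>Q\<^sub>r\<close>, and Katsura covariance then gives \<open>\<psi>\<^sup>(\<^sup>r\<^sup>+\<^sup>1\<^sup>)(Q\<^sub>r \<otimes> 1) = \<psi>\<^sup>(\<^sup>r\<^sup>)(Q\<^sub>r)\<close>;
  the sum in (CP) telescopes. Conversely, for \<open>a \<in> J\<^sup>\<bottom>\<close> with \<open>\<phi>\<^sub>1(a)\<close> compact, (CP) is applied to \<open>T\<^sub>0 = a\<close>,
  \<open>T\<^sub>1 = - \<phi>\<^sub>1(a)\<close>. The isomorphism follows by comparing universal properties, Nica covariance being
  automatic over \<open>\<nat>\<close>.
\<close>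

text \<open>The obstacle: if \<phi>_1 has a kernel, S \<mapsto> S \<otimes> 1 may fail to be
  injective and to reflect compactness. Both properties hold for operators S whose matrix
  coefficients <x, S x'> lie in J^\<bottom>, and this is the information that the summands Y_r
  \<sqdot> I_(s-r) with s > r encode. Compactness has to be pushed down from some N with Q_N = 0
  before the sum can be telescoped upwards. The zeroth fibre is treated apart throughout: \<phi>_1
  may be degenerate, so A \<otimes> X need not be X, and \<iota> out of degree 0 is the action of A
  instead of an amplification.

  The C*-theory underneath rests on one estimate, ||p(a)|| \<le> sup |p| over [-||a||, ||a||] for
  self-adjoint a; the interval stands in for the spectrum. Sharp constants are extracted from crude
  ones by applying these to powers with exponent 2^k and letting k grow. This replaces the spectral
  radius formula and, for T \<otimes> 1, the positivity of matrices over A.\<close>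

abbreviation elem (infix "<:" 50) where
  "x <: S \<equiv> x \<in> carrier S"

syntax "_sub_index" :: "logic => index" ("\<^sub>_" [1000])
translations "_sub_index x" => "_index x"

section \<open>Complex vector spaces, spans and linear maps\<close>

lemma complex_ring_simps [simp]:
 "carrier complex_ring = UNIV" "zero complex_ring = 0" "one complex_ring = 1"
 "add complex_ring = (+)" "mult complex_ring = (*)"
 by (simp_all add: complex_ring_def)

lemma cring_complex_ring: "cring complex_ring"
proof (intro cringI abelian_groupI comm_monoidI)
 fix x assume "x <: complex_ring"
 thus "\<exists>y\<in>carrier complex_ring. y \<oplus>\<^sub>complex_ring x = \<zero>\<^sub>complex_ring"
  by (auto intro: exI[of _ "- x"])
qed (auto simp: algebra_simps)

lemma a_inv_complex_ring [simp]: "\<ominus>\<^sub>complex_ring x = - x"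
proof -
 interpret cring complex_ring by (rule cring_complex_ring)
 show ?thesis using minus_equality[of "-x" x] by simp
qed

text \<open>Every complex number is a scalar, so the module laws are restated free of membership
  conditions on scalars.\<close>

locale cvec = Module.module complex_ring V for V :: "(complex, 'v, 'm) module_scheme" (structure)
begin

lemma smult_in [simp, intro]: "x <: V ==> c \<odot> x <: V"
 by (rule smult_closed) auto

lemma smult_add_l: "x <: V ==> (s + t) \<odot> x = s \<odot> x \<oplus> t \<odot> x"
 using smult_l_distr[of s t x] by simp

lemma smult_add_r: "x <: V ==> y <: V ==> c \<odot> (x \<oplus> y) = c \<odot> x \<oplus> c \<odot> y"
 using smult_r_distr[of c x y] by simp

lemma smult_smult [simp]: "x <: V ==> s \<odot> (t \<odot> x) = (s * t) \<odot> x"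
 using smult_assoc1[of s t x] by simp

lemma smult_1 [simp]: "x <: V ==> 1 \<odot> x = x"
 using smult_one[of x] by simp

lemma smult_0 [simp]: "x <: V ==> 0 \<odot> x = \<zero>"
 using smult_l_null[of x] by simp

lemma smult_zero [simp]: "c \<odot> \<zero> = \<zero>"
 using smult_r_null[of c] by simp

lemma smult_neg: "x <: V ==> c \<odot> (\<ominus> x) = \<ominus> (c \<odot> x)"
 using smult_r_minus[of c x] by simp

lemma neg_smult: "x <: V ==> (- c) \<odot> x = \<ominus> (c \<odot> x)"
 using smult_l_minus[of c x] by simp

lemma neg_eq_smult: "x <: V ==> \<ominus> x = (- 1) \<odot> x"
 by (simp add: neg_smult)

lemma smult_minus: "x <: V ==> y <: V ==> c \<odot> (x \<ominus> y) = c \<odot> x \<ominus> c \<odot> y"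
 by (simp add: minus_eq smult_add_r smult_neg)

lemma minus_in [simp, intro]: "x <: V ==> y <: V ==> x \<ominus> y <: V"
 by (rule minus_closed)

lemma neg_zero [simp]: "\<ominus> \<zero> = \<zero>"
 by (simp add: neg_eq_smult)

lemmas group_simprules
 [algebra cvec "zero V" "add V" "a_inv V" "a_minus V"] =
 M.a_closed M.zero_closed M.a_inv_closed M.minus_closed smult_in
 M.a_assoc M.l_zero M.l_neg M.a_comm M.minus_eq
 M.r_zero M.r_neg M.r_neg2 M.r_neg1 M.minus_add M.minus_minus neg_zero
 M.a_lcomm smult_add_r smult_neg smult_zero

lemma minus_eq_zero_iff: "x <: V ==> y <: V ==> x \<ominus> y = \<zero> \<longleftrightarrow> x = y"
 by (metis M.minus_equality a_minus_def a_inv_closed r_neg minus_minus)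

lemma minus_self [simp]: "x <: V ==> x \<ominus> x = \<zero>"
 by (simp add: minus_eq_zero_iff)

lemma minus_zero_r [simp]: "x <: V ==> x \<ominus> \<zero> = x"
 by algebra

lemma half_half: "x <: V ==> (1/2) \<odot> (x \<oplus> x) = x"
 using smult_add_l[of x "1/2" "1/2"] by (simp add: smult_add_r)

lemma cspan_subset: "S \<subseteq> carrier V ==> cspan V S \<subseteq> carrier V"
proof -
 assume "S \<subseteq> carrier V"
 moreover have "submodule (carrier V) complex_ring V"
  by (rule submoduleI) auto
 ultimately show ?thesis unfolding cspan_def by blast
qed

lemma cspan_submodule: "S \<subseteq> carrier V ==> submodule (cspan V S) complex_ring V"
proof (rule submoduleI)
 assume S: "S \<subseteq> carrier V"
 show "cspan V S \<subseteq> carrier V" using S by (rule cspan_subset)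
 show "\<zero> \<in> cspan V S"
  unfolding cspan_def using submodule.axioms(1) subgroup.one_closed by fastforce
 show "\<ominus> a \<in> cspan V S" if "a \<in> cspan V S" for a
  using that unfolding cspan_def by (blast dest: submoduleE(3))
 show "a \<oplus> b \<in> cspan V S" if "a \<in> cspan V S" "b \<in> cspan V S" for a b
  using that unfolding cspan_def by (blast dest: submoduleE(5))
 show "a \<odot> b \<in> cspan V S" if "a <: complex_ring" "b \<in> cspan V S" for a b
  using that unfolding cspan_def by (blast dest: submoduleE(4))
qed

lemma cspan_gen: "x \<in> S ==> x \<in> cspan V S"
 unfolding cspan_def by blast

lemma cspan_zero: "\<zero> \<in> cspan V S"
 unfolding cspan_def using submodule.axioms(1) subgroup.one_closed by fastforce

lemma cspan_add: "a \<in> cspan V S ==> b \<in> cspan V S ==> a \<oplus> b \<in> cspan V S"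
 unfolding cspan_def by (blast dest: submoduleE(5))

lemma cspan_smult: "b \<in> cspan V S ==> c \<odot> b \<in> cspan V S"
 unfolding cspan_def using submoduleE(4)[of _ c] by fastforce

lemma cspan_induct [consumes 2, case_names zero gen add smult]:
 assumes "x \<in> cspan V S" and S: "S \<subseteq> carrier V"
  and z: "P \<zero>" and g: "!!x. x \<in> S ==> P x"
  and a: "!!x y. x <: V ==> y <: V ==> P x ==> P y ==> P (x \<oplus> y)"
  and s: "!!c x. x <: V ==> P x ==> P (c \<odot> x)"
 shows "P x"
proof -
 have "submodule {x \<in> carrier V. P x} complex_ring V"
  using z a s by (intro submoduleI) (auto simp: neg_eq_smult)
 moreover have "S \<subseteq> {x \<in> carrier V. P x}" using S g by blast
 ultimately have "cspan V S \<subseteq> {x \<in> carrier V. P x}"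
  unfolding cspan_def by blast
 thus ?thesis using assms(1) by blast
qed

end

lemma cvecI: "module complex_ring V ==> cvec V"
 by (simp add: cvec_def)

lemma cvec_intro:
 fixes V (structure)
 assumes "abelian_group V"
  and "!!c x. x <: V ==> c \<odot> x <: V"
  and "!!a b x. x <: V ==> (a + b) \<odot> x = a \<odot> x \<oplus> b \<odot> x"
  and "!!c x y. x <: V ==> y <: V ==> c \<odot> (x \<oplus> y) = c \<odot> x \<oplus> c \<odot> y"
  and "!!a b x. x <: V ==> (a * b) \<odot> x = a \<odot> (b \<odot> x)"
  and "!!x. x <: V ==> 1 \<odot> x = x"
 shows "cvec V"
 unfolding cvec_def using assms by (intro moduleI cring_complex_ring) auto

context
 fixes V :: "(complex, 'v, 'm) module_scheme" and W :: "(complex, 'w, 'n) module_scheme"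
 assumes V: "cvec V" and W: "cvec W"
begin

interpretation V: cvec V by (rule V)
interpretation W: cvec W by (rule W)

lemma linear_on_closed: "linear_on V W f ==> x <: V ==> f x <: W"
 unfolding linear_on_def by blast

lemma linear_on_add:
 "linear_on V W f ==> x <: V ==> y <: V ==> f (x \<oplus>\<^sub>V y) = f x \<oplus>\<^sub>W f y"
 unfolding linear_on_def by blast

lemma linear_on_smult: "linear_on V W f ==> x <: V ==> f (c \<odot>\<^sub>V x) = c \<odot>\<^sub>W f x"
 unfolding linear_on_def by blast

lemma linear_on_zero: "linear_on V W f ==> f \<zero>\<^sub>V = \<zero>\<^sub>W"
 using linear_on_smult[of f "\<zero>\<^sub>V" 0] by (simp add: linear_on_closed)

lemma linear_on_neg: "linear_on V W f ==> x <: V ==> f (\<ominus>\<^sub>V x) = \<ominus>\<^sub>W f x"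
 by (simp add: V.neg_eq_smult W.neg_eq_smult linear_on_smult linear_on_closed)

lemma linear_on_minus:
 "linear_on V W f ==> x <: V ==> y <: V ==> f (x \<ominus>\<^sub>V y) = f x \<ominus>\<^sub>W f y"
 by (simp add: V.minus_eq W.minus_eq linear_on_add linear_on_neg)

end

section \<open>Normed spaces on carriers\<close>

text \<open>The norm is a parameter apart from the structure: it will be \<open>nrm A\<close>,
  \<open>hnorm A X\<close> or \<open>op_norm A X\<close>, of which the last two are computed rather
  than stored in a record.\<close>

locale normed_vec = cvec V for V :: "(complex, 'v, 'm) module_scheme" (structure) +
 fixes N :: "'v => real"
 assumes N_nonneg [simp]: "x <: V ==> 0 \<le> N x"
  and N_eq_0: "x <: V ==> N x = 0 \<longleftrightarrow> x = \<zero>"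
  and N_smult: "x <: V ==> N (c \<odot> x) = cmod c * N x"
  and N_add: "x <: V ==> y <: V ==> N (x \<oplus> y) \<le> N x + N y"
begin

definition vlim :: "(nat => 'v) => 'v => bool" where
 "vlim f l \<longleftrightarrow> (\<forall>n. f n <: V) \<and> l <: V \<and> (%n. N (f n \<ominus> l)) \<longlonglongrightarrow> 0"

lemma N_zero [simp]: "N \<zero> = 0"
 by (simp add: N_eq_0)

lemma N_neg [simp]: "x <: V ==> N (\<ominus> x) = N x"
 by (simp add: neg_eq_smult N_smult)

lemma N_minus_commute: "x <: V ==> y <: V ==> N (x \<ominus> y) = N (y \<ominus> x)"
proof -
 assume "x <: V" "y <: V"
 hence "N (\<ominus> (x \<ominus> y)) = N (x \<ominus> y)" "\<ominus> (x \<ominus> y) = y \<ominus> x" by (simp, algebra)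
 thus ?thesis by simp
qed

lemma N_minus: "x <: V ==> y <: V ==> N (x \<ominus> y) \<le> N x + N y"
 using N_add[of x "\<ominus> y"] by (simp add: minus_eq)

lemma N_triangle:
 assumes "x <: V" "y <: V" "z <: V"
 shows "N (x \<ominus> z) \<le> N (x \<ominus> y) + N (y \<ominus> z)"
proof -
 have "x \<ominus> z = (x \<ominus> y) \<oplus> (y \<ominus> z)" using assms by algebra
 thus ?thesis using N_add[of "x \<ominus> y" "y \<ominus> z"] assms by simp
qed

lemma N_diff_le: "x <: V ==> y <: V ==> N x \<le> N y + N (x \<ominus> y)"
proof -
 assume a: "x <: V" "y <: V"
 have "x = y \<oplus> (x \<ominus> y)" using a by algebra
 thus ?thesis using N_add[of y "x \<ominus> y"] a by simp
qed

lemma N_abs_diff_le: "x <: V ==> y <: V ==> \<bar>N x - N y\<bar> \<le> N (x \<ominus> y)"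
 using N_diff_le[of x y] N_diff_le[of y x] N_minus_commute[of x y] by simp

lemma N_add_minus_add:
 assumes "x <: V" "y <: V" "z <: V" "w <: V"
 shows "N ((x \<oplus> y) \<ominus> (z \<oplus> w)) \<le> N (x \<ominus> z) + N (y \<ominus> w)"
proof -
 have "(x \<oplus> y) \<ominus> (z \<oplus> w) = (x \<ominus> z) \<oplus> (y \<ominus> w)" using assms by algebra
 thus ?thesis using N_add[of "x \<ominus> z" "y \<ominus> w"] assms by simp
qed

lemma vlimD: "vlim f l ==> f n <: V" "vlim f l ==> l <: V"
 "vlim f l ==> (%n. N (f n \<ominus> l)) \<longlonglongrightarrow> 0"
 by (auto simp: vlim_def)

lemma vlimI_bound:
 assumes "!!n. f n <: V" "l <: V" "!!n. N (f n \<ominus> l) \<le> g n" "g \<longlonglongrightarrow> 0"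
 shows "vlim f l"
 unfolding vlim_def
proof (intro conjI allI)
 show "(%n. N (f n \<ominus> l)) \<longlonglongrightarrow> 0"
  by (rule tendsto_sandwich[OF _ _ tendsto_const assms(4)]) (auto simp: assms)
qed (use assms in auto)

lemma vlim_const: "x <: V ==> vlim (%_. x) x"
 by (simp add: vlim_def)

lemma vlim_add: "vlim f l ==> vlim g m ==> vlim (%n. f n \<oplus> g n) (l \<oplus> m)"
 by (rule vlimI_bound[where g = "%n. N (f n \<ominus> l) + N (g n \<ominus> m)"])
  (auto simp: vlimD intro!: N_add_minus_add tendsto_eq_intros dest: vlimD)

lemma vlim_smult: "vlim f l ==> vlim (%n. c \<odot> f n) (c \<odot> l)"
 by (rule vlimI_bound[where g = "%n. cmod c * N (f n \<ominus> l)"])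
  (auto simp: vlimD smult_minus[symmetric] N_smult intro!: tendsto_eq_intros dest: vlimD)

lemma vlim_neg: "vlim f l ==> vlim (%n. \<ominus> f n) (\<ominus> l)"
 using vlim_smult[of f l "-1"] by (simp add: neg_eq_smult vlimD)

lemma vlim_minus: "vlim f l ==> vlim g m ==> vlim (%n. f n \<ominus> g n) (l \<ominus> m)"
 using vlim_add[OF _ vlim_neg, of f l g m] by (simp add: minus_eq)

lemma vlim_N: "vlim f l ==> (%n. N (f n)) \<longlonglongrightarrow> N l"
proof -
 assume f: "vlim f l"
 have "(%n. N (f n) - N l) \<longlonglongrightarrow> 0"
  by (rule Lim_null_comparison[OF _ vlimD(3)[OF f]]) (auto simp: vlimD[OF f] N_abs_diff_le)
 thus ?thesis by (simp add: LIM_zero_iff)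
qed

lemma vlim_unique: "vlim f l ==> vlim f m ==> l = m"
proof -
 assume f: "vlim f l" "vlim f m"
 have "(%n. N (f n \<ominus> f n)) \<longlonglongrightarrow> N (l \<ominus> m)" by (intro vlim_N vlim_minus f)
 hence "N (l \<ominus> m) = 0" using f by (simp add: vlimD LIMSEQ_const_iff)
 thus ?thesis using f by (simp add: N_eq_0 vlimD minus_eq_zero_iff)
qed

lemma vlim_Suc: "vlim f l ==> vlim (%n. f (Suc n)) l"
 unfolding vlim_def using LIMSEQ_Suc[of "%n. N (f n \<ominus> l)"] by blast

lemma vlim_N_le: "vlim f l ==> (!!n. N (f n) \<le> C n) ==> C \<longlonglongrightarrow> D ==> N l \<le> D"
 by (rule LIMSEQ_le[OF vlim_N]) auto

lemma cauchy_vlim: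
 assumes "norm_complete V N" "!!n. f n <: V"
  "!!e. e > 0 ==> \<exists>M. \<forall>m\<ge>M. \<forall>n\<ge>M. N (f m \<ominus> f n) < e"
 obtains l where "vlim f l"
proof -
 have "\<exists>l\<in>carrier V. (%n. N (f n \<ominus> l)) \<longlonglongrightarrow> 0"
  using assms(1)[unfolded norm_complete_def, rule_format, of f] assms(2,3) by blast
 thus ?thesis using that assms(2) unfolding vlim_def by blast
qed

text \<open>The shape in which most Cauchy sequences occur below: each term carries its own error
  \<open>g n\<close>.\<close>

lemma cauchy_vlim_bound:
 assumes "norm_complete V N" "!!n. f n <: V"
  "!!m n. N (f m \<ominus> f n) \<le> g m + g n" "g \<longlonglongrightarrow> 0"
 obtains l where "vlim f l"
proof -
 have "\<exists>M. \<forall>m\<ge>M. \<forall>n\<ge>M. N (f m \<ominus> f n) < e" if e: "e > 0" for e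
 proof -
  from assms(4) e have "\<exists>M. \<forall>n\<ge>M. norm (g n - 0) < e/2"
   by (intro LIMSEQ_D) auto
  then obtain M where M: "!!n. n \<ge> M ==> g n < e / 2" by fastforce
  have "N (f m \<ominus> f n) < e" if "m \<ge> M" "n \<ge> M" for m n
   using M[of m] M[of n] assms(3)[of m n] that by linarith
  thus ?thesis by blast
 qed
 thus ?thesis using cauchy_vlim assms(1,2) that by metis
qed

lemma norm_closure_in: "x \<in> norm_closure V N S ==> x <: V"
 by (simp add: norm_closure_def)

lemma norm_closure_vlim:
 assumes "x \<in> norm_closure V N S" "S \<subseteq> carrier V"
 obtains f where "vlim f x" "!!n. f n \<in> S" "!!n. N (x \<ominus> f n) < inverse (Suc n)"
proof -
 have "\<forall>n. \<exists>y\<in>S. N (x \<ominus> y) < inverse (real (Suc n))"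
  using assms(1) by (simp add: norm_closure_def)
 then obtain f where f: "!!n. f n \<in> S" "!!n. N (x \<ominus> f n) < inverse (real (Suc n))" by metis
 have x: "x <: V" using assms(1) by (rule norm_closure_in)
 have "vlim f x"
  by (rule vlimI_bound[OF _ _ _ LIMSEQ_inverse_real_of_nat])
   (use f assms x in \<open>auto intro!: less_imp_le simp: N_minus_commute[of _ x] subset_eq\<close>)
 thus ?thesis using f that by blast
qed

lemma vlim_norm_closure: "vlim f x ==> (!!n. f n \<in> S) ==> x \<in> norm_closure V N S"
proof -
 assume f: "vlim f x" and S: "!!n. f n \<in> S"
 have "\<exists>y\<in>S. N (x \<ominus> y) < e" if "e > 0" for e
 proof -
  obtain n where "norm (N (f n \<ominus> x) - 0) < e"
   using LIMSEQ_D[OF vlimD(3)[OF f] \<open>e > 0\<close>] by blast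
  hence "N (x \<ominus> f n) < e" using f by (simp add: vlimD N_minus_commute)
  thus ?thesis using S by blast
 qed
 thus ?thesis using f by (simp add: norm_closure_def vlimD)
qed

lemma norm_closure_subset: "S \<subseteq> carrier V ==> S \<subseteq> norm_closure V N S"
 unfolding norm_closure_def
proof (intro subsetI CollectI conjI allI impI)
 fix x e assume "S \<subseteq> carrier V" "x \<in> S" "(e::real) > 0"
 thus "\<exists>y\<in>S. N (x \<ominus> y) < e" by (intro bexI[of _ x]) (auto simp: subset_eq)
qed auto

lemma norm_closure_closed:
 assumes "S \<subseteq> carrier V" shows "norm_closure V N (norm_closure V N S) = norm_closure V N S"
proof
 show "norm_closure V N (norm_closure V N S) \<subseteq> norm_closure V N S"
 proof
  fix x assume x: "x \<in> norm_closure V N (norm_closure V N S)"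
  have "\<exists>y\<in>S. N (x \<ominus> y) < e" if e: "e > 0" for e
  proof -
   obtain z where z: "z \<in> norm_closure V N S" "N (x \<ominus> z) < e/2"
    using x e unfolding norm_closure_def by (auto dest: spec[of _ "e/2"])
   obtain y where y: "y \<in> S" "N (z \<ominus> y) < e/2"
    using z e unfolding norm_closure_def by (auto dest: spec[of _ "e/2"])
   have "N (x \<ominus> y) \<le> N (x \<ominus> z) + N (z \<ominus> y)"
    using x y z assms by (intro N_triangle) (auto dest: norm_closure_in)
   thus ?thesis using y z by (intro bexI[of _ y]) auto
  qed
  thus "x \<in> norm_closure V N S" using x by (simp add: norm_closure_def)
 qed
 show "norm_closure V N S \<subseteq> norm_closure V N (norm_closure V N S)"
  by (rule norm_closure_subset) (auto dest: norm_closure_in)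
qed

text \<open>Density arguments as an induction rule. Its instances for compact operators and for
  tensor products carry most identities on completions.\<close>

lemma closure_induct [consumes 2, case_names zero gen add smult lim]:
 assumes "x \<in> norm_closure V N (cspan V S)" and S: "S \<subseteq> carrier V"
  and z: "P \<zero>" and g: "!!x. x \<in> S ==> P x"
  and a: "!!x y. x <: V ==> y <: V ==> P x ==> P y ==> P (x \<oplus> y)"
  and s: "!!c x. x <: V ==> P x ==> P (c \<odot> x)"
  and l: "!!f x. vlim f x ==> (!!n. P (f n)) ==> P x"
 shows "P x"
proof -
 obtain f where f: "vlim f x" "!!n. f n \<in> cspan V S"
  using norm_closure_vlim[OF assms(1) cspan_subset[OF S]] by metis
 have "P (f n)" for n
  using f(2)[of n] S by (rule cspan_induct) (use z g a s in auto)
 thus ?thesis using l f by blast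
qed

lemma norm_closure_submodule:
 assumes "submodule S complex_ring V"
 shows "submodule (norm_closure V N S) complex_ring V"
proof (rule submoduleI)
 have S: "S \<subseteq> carrier V" using submoduleE(1)[OF assms] .
 show "norm_closure V N S \<subseteq> carrier V" by (auto dest: norm_closure_in)
 show "\<zero> \<in> norm_closure V N S"
  using norm_closure_subset[OF S] submodule.axioms(1)[OF assms] subgroup.one_closed by fastforce
 show *: "a \<odot> b \<in> norm_closure V N S" if ab: "a <: complex_ring" "b \<in> norm_closure V N S" for a b
 proof -
  obtain f where f: "vlim f b" "!!n. f n \<in> S" using norm_closure_vlim[OF ab(2) S] by metis
  thus ?thesis using submoduleE(4)[OF assms]
   by (intro vlim_norm_closure[OF vlim_smult]) auto
 qed
 thus "\<ominus> a \<in> norm_closure V N S" if "a \<in> norm_closure V N S" for a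
  using that *[of "-1" a] by (simp add: neg_eq_smult norm_closure_in)
 show "a \<oplus> b \<in> norm_closure V N S" if ab: "a \<in> norm_closure V N S" "b \<in> norm_closure V N S" for a b
 proof -
  obtain f where f: "vlim f a" "!!n. f n \<in> S" using norm_closure_vlim[OF ab(1) S] by metis
  obtain g where g: "vlim g b" "!!n. g n \<in> S" using norm_closure_vlim[OF ab(2) S] by metis
  show ?thesis using f g submoduleE(5)[OF assms]
   by (intro vlim_norm_closure[OF vlim_add]) auto
 qed
qed

end

text \<open>The linear span of \<open>G\<close> in the direct sum of V and W: a linear relation that
  is not yet known to be the graph of a map.\<close>

inductive_set pair_span ::
 "(complex, 'v, 'm) module_scheme => (complex, 'w, 'n) module_scheme => ('v \<times> 'w) set => ('v \<times> 'w) set"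
 for V W G where
 pair_span_zero: "(\<zero>\<^sub>V, \<zero>\<^sub>W) \<in> pair_span V W G"
| pair_span_gen: "p \<in> G ==> p \<in> pair_span V W G"
| pair_span_add: "(a, b) \<in> pair_span V W G ==> (c, d) \<in> pair_span V W G
  ==> (a \<oplus>\<^sub>V c, b \<oplus>\<^sub>W d) \<in> pair_span V W G"
| pair_span_smult: "(a, b) \<in> pair_span V W G ==> (t \<odot>\<^sub>V a, t \<odot>\<^sub>W b) \<in> pair_span V W G"

context
 fixes V :: "(complex, 'v, 'm) module_scheme" and N and W :: "(complex, 'w, 'n) module_scheme" and M
 assumes VN: "normed_vec V N" and WM: "normed_vec W M"
begin

interpretation V: normed_vec V N by (rule VN)
interpretation W: normed_vec W M by (rule WM)

lemma vlim_map:
 assumes "linear_on V W f" "!!x. x <: V ==> M (f x) \<le> C * N x" "V.vlim x l"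
 shows "W.vlim (%n. f (x n)) (f l)"
proof (rule W.vlimI_bound)
 note V.vlimD[OF assms(3), simp]
 note lin = V.cvec_axioms W.cvec_axioms
 show "f (x n) <: W" "f l <: W" for n
  using linear_on_closed[OF lin assms(1)] by auto
 show "M (f (x n) \<ominus>\<^sub>W f l) \<le> C * N (x n \<ominus>\<^sub>V l)" for n
  using assms(2)[of "x n \<ominus>\<^sub>V l"] linear_on_minus[OF lin assms(1), of "x n" l] by simp
 show "(%n. C * N (x n \<ominus>\<^sub>V l)) \<longlonglongrightarrow> 0"
  using tendsto_mult_left[OF V.vlimD(3)[OF assms(3)], of C] by simp
qed

lemma eq_on_dense:
 assumes f: "linear_on V W f" "!!x. x <: V ==> M (f x) \<le> C * N x"
  and g: "linear_on V W g" "!!x. x <: V ==> M (g x) \<le> D * N x"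
  and "S \<subseteq> carrier V" and x: "x \<in> norm_closure V N (cspan V S)"
  and eq: "!!x. x \<in> S ==> f x = g x"
 shows "f x = g x"
 using x assms(5)
proof (induction rule: V.closure_induct)
 case (lim y x)
 thus ?case
  using W.vlim_unique[OF vlim_map[OF f lim(1)]] vlim_map[OF g lim(1)] by simp
qed (use f(1) g(1) in \<open>simp_all add: eq linear_on_zero[OF V.cvec_axioms W.cvec_axioms]
  linear_on_add[OF V.cvec_axioms W.cvec_axioms] linear_on_smult[OF V.cvec_axioms W.cvec_axioms]\<close>)

lemma pair_span_closed:
 assumes "p \<in> pair_span V W G" "G \<subseteq> carrier V \<times> carrier W"
 shows "fst p <: V" "snd p <: W"
 using assms(1) by (induction rule: pair_span.induct) (use assms(2) in auto)

lemma pair_span_minus: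
 assumes "(a, b) \<in> pair_span V W G" "(c, d) \<in> pair_span V W G" "G \<subseteq> carrier V \<times> carrier W"
 shows "(a \<ominus>\<^sub>V c, b \<ominus>\<^sub>W d) \<in> pair_span V W G"
 using pair_span_add[OF assms(1) pair_span_smult[OF assms(2), of "-1"]]
  pair_span_closed[OF assms(2,3)] by (simp add: V.minus_eq W.minus_eq V.neg_eq_smult W.neg_eq_smult)

lemma cspan_pair_span:
 assumes "x \<in> cspan V (fst ` G)" "G \<subseteq> carrier V \<times> carrier W"
 shows "\<exists>w. (x, w) \<in> pair_span V W G"
 using assms(1)
proof (rule V.cspan_induct)
 show "fst ` G \<subseteq> carrier V" using assms(2) by auto
 show "\<exists>w. (x, w) \<in> pair_span V W G" if "x \<in> fst ` G" for x using that pair_span_gen by force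
qed (auto intro: pair_span_zero pair_span_add pair_span_smult)

text \<open>The bound makes the relation single-valued, since two images of one point differ by
  something of norm at most C times 0, and Lipschitz, so it extends to the closure by completeness.
  Maps on balanced tensor products and on compact operators are obtained this way: well-definedness
  comes from a norm estimate instead of a quotient construction.\<close>

theorem bounded_extension:
 assumes complete: "norm_complete W M" and G: "G \<subseteq> carrier V \<times> carrier W" and C: "0 \<le> C"
  and bound: "!!a b. (a, b) \<in> pair_span V W G ==> M b \<le> C * N a"
  and dense: "carrier V \<subseteq> norm_closure V N (cspan V (fst ` G))"
 obtains f where "linear_on V W f" "!!x. x <: V ==> M (f x) \<le> C * N x"
  "!!a b. (a, b) \<in> pair_span V W G ==> f a = b"
proof -
 \<comment> \<open>The closure of the relation in V \<oplus> W.\<close>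
 define Lim where "Lim x w \<longleftrightarrow> (\<exists>v b. (\<forall>n. (v n, b n) \<in> pair_span V W G) \<and> V.vlim v x \<and> W.vlim b w)" for x w
 note cl = pair_span_closed[OF _ G, of "(a, b)" for a b, simplified]
 have ex: "\<exists>w. Lim x w" if x: "x <: V" for x
 proof -
  have sub: "cspan V (fst ` G) \<subseteq> carrier V" using G by (intro V.cspan_subset) auto
  have "x \<in> norm_closure V N (cspan V (fst ` G))" using x dense by blast
  from V.norm_closure_vlim[OF this sub] obtain v where
   v: "V.vlim v x" "!!n. v n \<in> cspan V (fst ` G)" "!!n. N (x \<ominus>\<^sub>V v n) < inverse (real (Suc n))" by metis
  from cspan_pair_span[OF v(2) G] obtain b where b: "!!n. (v n, b n) \<in> pair_span V W G" by metis
  have "M (b m \<ominus>\<^sub>W b n) \<le> C * inverse (real (Suc m)) + C * inverse (real (Suc n))" for m n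
  proof -
   have "M (b m \<ominus>\<^sub>W b n) \<le> C * N (v m \<ominus>\<^sub>V v n)"
    by (rule bound[OF pair_span_minus[OF b b G]])
   also have "\<dots> \<le> C * (inverse (real (Suc m)) + inverse (real (Suc n)))"
    using V.N_triangle[of "v m" x "v n"] v(3)[of m] v(3)[of n] x V.vlimD(1)[OF v(1)] C
    by (intro mult_left_mono) (simp_all add: V.N_minus_commute[of "v m" x])
   finally show ?thesis by (simp only: distrib_left)
  qed
  moreover have "(%n. C * inverse (real (Suc n))) \<longlonglongrightarrow> 0"
   using tendsto_mult_left[OF LIMSEQ_inverse_real_of_nat, of C] by simp
  ultimately obtain l where "W.vlim b l"
   using W.cauchy_vlim_bound[OF complete, of b "%n. C * inverse (real (Suc n))"] b cl(2) by metis
  thus ?thesis unfolding Lim_def using v(1) b by blast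
 qed
 have bd: "M w \<le> C * N x" if "Lim x w" for x w
 proof -
  from that obtain v b where vb: "!!n. (v n, b n) \<in> pair_span V W G" "V.vlim v x" "W.vlim b w"
   unfolding Lim_def by blast
  show ?thesis
   by (rule LIMSEQ_le[OF W.vlim_N[OF vb(3)] tendsto_mult_left[OF V.vlim_N[OF vb(2)]]])
    (use bound vb(1) in blast)
 qed
 have add: "Lim (x \<oplus>\<^sub>V y) (w \<oplus>\<^sub>W z)" if "Lim x w" "Lim y z" for x y w z
 proof -
  from that obtain v b v' b' where "!!n. (v n, b n) \<in> pair_span V W G" "V.vlim v x" "W.vlim b w"
   "!!n. (v' n, b' n) \<in> pair_span V W G" "V.vlim v' y" "W.vlim b' z"
   unfolding Lim_def by blast
  thus ?thesis unfolding Lim_def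
   by (intro exI[of _ "%n. v n \<oplus>\<^sub>V v' n"] exI[of _ "%n. b n \<oplus>\<^sub>W b' n"] conjI allI
     V.vlim_add W.vlim_add pair_span_add)
 qed
 have smult: "Lim (c \<odot>\<^sub>V x) (c \<odot>\<^sub>W w)" if "Lim x w" for c x w
 proof -
  from that obtain v b where "!!n. (v n, b n) \<in> pair_span V W G" "V.vlim v x" "W.vlim b w"
   unfolding Lim_def by blast
  thus ?thesis unfolding Lim_def
   by (intro exI[of _ "%n. c \<odot>\<^sub>V v n"] exI[of _ "%n. c \<odot>\<^sub>W b n"] conjI allI
     V.vlim_smult W.vlim_smult pair_span_smult)
 qed
 have car: "x <: V" "w <: W" if "Lim x w" for x w
  using that V.vlimD(2) W.vlimD(2) unfolding Lim_def by blast+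
 have uniq: "w = z" if "Lim x w" "Lim x z" for x w z
 proof -
  have "Lim (x \<ominus>\<^sub>V x) (w \<ominus>\<^sub>W z)"
   using add[OF that(1) smult[OF that(2), of "-1"]] car[OF that(1)] car[OF that(2)]
   by (simp add: V.minus_eq W.minus_eq V.neg_eq_smult W.neg_eq_smult)
  from bd[OF this] have "M (w \<ominus>\<^sub>W z) \<le> 0" using car(1)[OF that(1)] by simp
  moreover have wz: "w <: W" "z <: W" using car(2) that by blast+
  ultimately have "M (w \<ominus>\<^sub>W z) = 0" by (intro order_antisym W.N_nonneg W.minus_in)
  thus ?thesis using wz by (simp add: W.N_eq_0 W.minus_eq_zero_iff)
 qed
 define f where "f x = (THE w. Lim x w)" for x
 have f: "Lim x (f x)" if "x <: V" for x
  unfolding f_def using ex[OF that] uniq by (metis theI)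
 have fI: "f x = w" if "Lim x w" for x w
  using uniq[OF f that] car[OF that] by simp
 have gen: "Lim a b" if "(a, b) \<in> pair_span V W G" for a b
  unfolding Lim_def using that V.vlim_const[of a] W.vlim_const[of b] cl[OF that]
  by (intro exI[of _ "%_. a"] exI[of _ "%_. b"]) simp
 show thesis
 proof
  show "linear_on V W f"
   unfolding linear_on_def
   by (intro conjI funcsetI ballI allI car(2)[OF f] fI[OF add[OF f f]] fI[OF smult[OF f]])
  show "M (f x) \<le> C * N x" if "x <: V" for x by (rule bd[OF f[OF that]])
  show "f a = b" if "(a, b) \<in> pair_span V W G" for a b by (rule fI[OF gen[OF that]])
 qed
qed

end

section \<open>Elementary theory of C*-algebras\<close>

lemma (in normed_vec) vlim_geometric:
 assumes "norm_complete V N" "!!n. f n <: V"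
  and step: "!!n. N (f (Suc n) \<ominus> f n) \<le> q ^ n" and q: "0 \<le> q" "q < 1"
 obtains l where "vlim f l" "!!n. N (l \<ominus> f n) \<le> q ^ n / (1 - q)"
proof -
 have *: "N (f (n + k) \<ominus> f n) \<le> q ^ n * (\<Sum>i<k. q ^ i)" for n k
 proof (induction k)
  case (Suc k)
  have "N (f (n + Suc k) \<ominus> f n) \<le> N (f (n + Suc k) \<ominus> f (n + k)) + N (f (n + k) \<ominus> f n)"
   using assms(2) by (intro N_triangle)
  also have "\<dots> \<le> q ^ (n + k) + q ^ n * (\<Sum>i<k. q ^ i)"
   using step[of "n + k"] Suc by simp
  finally show ?case by (simp add: algebra_simps power_add)
 qed (use assms(2) in simp)
 have b: "N (f (n + k) \<ominus> f n) \<le> q ^ n / (1 - q)" for n k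
 proof -
  have "(\<Sum>i<k. q ^ i) \<le> 1 / (1 - q)"
   using q by (simp add: sum_gp_strict divide_simps)
  hence "q ^ n * (\<Sum>i<k. q ^ i) \<le> q ^ n * (1 / (1 - q))"
   using q by (intro mult_left_mono) auto
  with *[of n k] show ?thesis by simp
 qed
 have pos: "0 \<le> q ^ n / (1 - q)" for n using q by simp
 have "N (f m \<ominus> f n) \<le> q ^ m / (1 - q) + q ^ n / (1 - q)" for m n
 proof (cases "m \<le> n")
  case True
  thus ?thesis using b[of m "n - m"] pos[of n] assms(2) N_minus_commute[of "f m" "f n"] by simp
 next
  case False
  thus ?thesis using b[of n "m - n"] pos[of m] by simp
 qed
 moreover have "(%n. q ^ n / (1 - q)) \<longlonglongrightarrow> 0"
  using tendsto_divide[OF LIMSEQ_power_zero[of q] tendsto_const, of "1 - q"] q by simp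
 ultimately obtain l where l: "vlim f l"
  using cauchy_vlim_bound[OF assms(1), of f "%n. q ^ n / (1 - q)"] assms(2) by metis
 have "N (l \<ominus> f n) \<le> q ^ n / (1 - q)" for n
 proof -
  have "vlim (%k. f (n + k)) l"
   using l LIMSEQ_ignore_initial_segment[of "%k. N (f k \<ominus> l)" 0 n] by (simp add: vlim_def add.commute)
  from vlim_minus[OF this vlim_const] show ?thesis
   by (rule vlim_N_le[OF _ b tendsto_const]) (rule assms)
 qed
 thus ?thesis using that l by blast
qed

sublocale cstar_algebra \<subseteq> normed_vec A "nrm A"
 by unfold_locales (auto simp: nrm_nonneg nrm_eq_0 nrm_scale nrm_triangle)

context cstar_algebra
begin

declare mult_closed [simp, intro] star_closed [simp, intro] star_star [simp]

lemma mult_zero_l [simp]: "a <: A ==> \<zero> \<otimes> a = \<zero>"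
 using mult_scale_left[of "\<zero>" a 0] by simp

lemma mult_zero_r [simp]: "a <: A ==> a \<otimes> \<zero> = \<zero>"
 using mult_scale_right[of a "\<zero>" 0] by simp

lemma mult_neg_l: "a <: A ==> b <: A ==> (\<ominus> a) \<otimes> b = \<ominus> (a \<otimes> b)"
 using mult_scale_left[of a b "-1"] by (simp add: neg_eq_smult)

lemma mult_neg_r: "a <: A ==> b <: A ==> a \<otimes> (\<ominus> b) = \<ominus> (a \<otimes> b)"
 using mult_scale_right[of a b "-1"] by (simp add: neg_eq_smult)

lemma mult_minus_l:
 "a <: A ==> b <: A ==> c <: A ==> (a \<ominus> b) \<otimes> c = a \<otimes> c \<ominus> b \<otimes> c"
 by (simp add: M.minus_eq mult_add_left mult_neg_l)

lemma mult_minus_r: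
 "a <: A ==> b <: A ==> c <: A ==> a \<otimes> (b \<ominus> c) = a \<otimes> b \<ominus> a \<otimes> c"
 by (simp add: M.minus_eq mult_add_right mult_neg_r)

lemma star_zero [simp]: "star A \<zero> = \<zero>"
 using star_scale[of "\<zero>" 0] by simp

lemma star_neg: "a <: A ==> star A (\<ominus> a) = \<ominus> star A a"
 using star_scale[of a "-1"] by (simp add: neg_eq_smult)

lemma star_minus: "a <: A ==> b <: A ==> star A (a \<ominus> b) = star A a \<ominus> star A b"
 by (simp add: M.minus_eq star_add star_neg)

lemmas cstar_simprules
 [algebra cstar "zero A" "add A" "a_inv A" "a_minus A" "one A" "mult A"] =
 M.a_closed M.zero_closed M.a_inv_closed M.minus_closed smult_in
 M.a_assoc M.l_zero M.l_neg M.a_comm M.minus_eq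
 M.r_zero M.r_neg M.r_neg2 M.r_neg1 M.minus_add M.minus_minus neg_zero
 M.a_lcomm smult_add_r smult_neg smult_zero
 mult_closed star_closed mult_assoc mult_add_left mult_add_right mult_zero_l mult_zero_r
 mult_neg_l mult_neg_r mult_scale_left mult_scale_right star_star star_zero star_add star_mult star_neg

lemma nrm_star [simp]:
 assumes "a <: A" shows "nrm A (star A a) = nrm A a"
proof -
 have le: "nrm A b \<le> nrm A (star A b)" if "b <: A" for b
 proof (cases "nrm A b = 0")
  case False
  have "nrm A b * nrm A b \<le> nrm A (star A b) * nrm A b"
   using nrm_star_mult[OF that] nrm_mult[of "star A b" b] that by (simp add: power2_eq_square)
  moreover have "0 < nrm A b" using False nrm_nonneg[OF that] by simp
  ultimately show ?thesis by simp
 qed (use that nrm_nonneg in auto)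
 show ?thesis using le[of a] le[of "star A a"] assms by simp
qed

lemma nrm_sa_square: "a <: A ==> star A a = a ==> nrm A (a \<otimes> a) = (nrm A a)\<^sup>2"
 using nrm_star_mult[of a] by simp

lemma star_mult_eq_0: "a <: A ==> star A a \<otimes> a = \<zero> \<longleftrightarrow> a = \<zero>"
 using nrm_star_mult[of a] N_eq_0[of a] N_eq_0[of "star A a \<otimes> a"] by auto

lemma vlim_mult:
 assumes "vlim f l" "vlim g m" shows "vlim (%n. f n \<otimes> g n) (l \<otimes> m)"
proof (rule vlimI_bound)
 note [simp] = vlimD[OF assms(1)] vlimD[OF assms(2)]
 show "f n \<otimes> g n <: A" "l \<otimes> m <: A" for n by auto
 show "nrm A (f n \<otimes> g n \<ominus> l \<otimes> m)
  \<le> nrm A (f n \<ominus> l) * nrm A (g n) + nrm A l * nrm A (g n \<ominus> m)" for n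
 proof -
  have "f n \<otimes> g n \<ominus> l \<otimes> m = (f n \<ominus> l) \<otimes> g n \<oplus> l \<otimes> (g n \<ominus> m)"
   using vlimD(1,2)[OF assms(1)] vlimD(1,2)[OF assms(2)] by algebra
  also have "nrm A \<dots> \<le> nrm A ((f n \<ominus> l) \<otimes> g n) + nrm A (l \<otimes> (g n \<ominus> m))"
   by (rule nrm_triangle) auto
  finally show ?thesis using nrm_mult[of "f n \<ominus> l" "g n"] nrm_mult[of l "g n \<ominus> m"] by simp
 qed
 have "(%n. nrm A (f n \<ominus> l) * nrm A (g n) + nrm A l * nrm A (g n \<ominus> m))
  \<longlonglongrightarrow> 0 * nrm A m + nrm A l * 0"
  by (intro tendsto_intros vlim_N assms) auto
 thus "(%n. nrm A (f n \<ominus> l) * nrm A (g n) + nrm A l * nrm A (g n \<ominus> m)) \<longlonglongrightarrow> 0"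
  by simp
qed

lemma vlim_star: "vlim f l ==> vlim (%n. star A (f n)) (star A l)"
proof (rule vlimI_bound)
 assume f: "vlim f l"
 note [simp] = vlimD[OF f]
 show "nrm A (star A (f n) \<ominus> star A l) \<le> nrm A (f n \<ominus> l)" for n
  using nrm_star[of "f n \<ominus> l"] by (simp add: star_minus del: nrm_star)
qed (simp_all add: vlimD)

text \<open>Picard iteration of c \<mapsto> (x + c^2) / 2. For ||x|| < 1 it stays in the ball of
  radius ||x|| and contracts there by the factor ||x||. No unit enters, so it runs in every
  C*-algebra.\<close>

primrec sqrt_iter :: "'a => nat => 'a" where
 "sqrt_iter x 0 = \<zero>"
| "sqrt_iter x (Suc n) = (1/2) \<odot> (x \<oplus> sqrt_iter x n \<otimes> sqrt_iter x n)"

text \<open>The fixed point \<open>c = (x + c\<^sup>2) / 2\<close> satisfies \<open>(1 - c)\<^sup>2 = 1 - x\<close>.\<close>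

lemma sqrt_one_minus:
 assumes x: "x <: A" "star A x = x" and q: "nrm A x < 1"
 obtains c where "c <: A" "star A c = c" "x = (c \<oplus> c) \<ominus> c \<otimes> c"
  "!!z. z <: A ==> z \<otimes> x = x \<otimes> z ==> z \<otimes> c = c \<otimes> z"
proof -
 let ?y = "sqrt_iter x" and ?q = "nrm A x"
 have q0: "0 \<le> ?q" using x by simp
 have cl [simp]: "?y n <: A" for n using x by (induction n) auto
 have sa: "star A (?y n) = ?y n" for n
  using x by (induction n) (auto simp: star_scale star_add star_mult)
 have com: "z \<otimes> ?y n = ?y n \<otimes> z" if z: "z <: A" "z \<otimes> x = x \<otimes> z" for z n
 proof (induction n)
  case (Suc n)
  have "z \<otimes> (?y n \<otimes> ?y n) = (?y n \<otimes> ?y n) \<otimes> z"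
   using Suc z by (metis cl mult_assoc)
  thus ?case using z x
   by (simp add: mult_scale_left mult_scale_right mult_add_left mult_add_right)
 qed (use z in simp)
 have bd: "nrm A (?y n) \<le> ?q" for n
 proof (induction n)
  case (Suc n)
  have "nrm A (?y (Suc n)) \<le> (1/2) * (?q + nrm A (?y n \<otimes> ?y n))"
   using x nrm_triangle[of x "?y n \<otimes> ?y n"] by (simp add: nrm_scale)
  also have "nrm A (?y n \<otimes> ?y n) \<le> nrm A (?y n) * nrm A (?y n)" by (simp add: nrm_mult)
  also have "nrm A (?y n) * nrm A (?y n) \<le> ?q * 1" using Suc q q0 cl[of n] by (intro mult_mono) (auto intro: N_nonneg)
  finally show ?case by simp
 qed (use q0 in simp)
 have step: "nrm A (?y (Suc n) \<ominus> ?y n) \<le> ?q ^ n" for n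
 proof (induction n)
  case 0
  show ?case using x q by (simp add: nrm_scale)
 next
  case (Suc n)
  let ?d = "?y (Suc n) \<ominus> ?y n"
  have "?y (Suc (Suc n)) \<ominus> ?y (Suc n) =
   (1/2) \<odot> ((x \<oplus> ?y (Suc n) \<otimes> ?y (Suc n)) \<ominus> (x \<oplus> ?y n \<otimes> ?y n))"
   unfolding sqrt_iter.simps(2)[of x "Suc n"] sqrt_iter.simps(2)[of x n]
   using x by (simp add: smult_minus)
  also have "(x \<oplus> ?y (Suc n) \<otimes> ?y (Suc n)) \<ominus> (x \<oplus> ?y n \<otimes> ?y n)
   = ?y (Suc n) \<otimes> ?d \<oplus> ?d \<otimes> ?y n"
   using x cl[of n] cl[of "Suc n"] by algebra
  finally have eq: "?y (Suc (Suc n)) \<ominus> ?y (Suc n) = (1/2) \<odot> (?y (Suc n) \<otimes> ?d \<oplus> ?d \<otimes> ?y n)" .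
  have "nrm A ((1/2) \<odot> (?y (Suc n) \<otimes> ?d \<oplus> ?d \<otimes> ?y n))
   = (1/2) * nrm A (?y (Suc n) \<otimes> ?d \<oplus> ?d \<otimes> ?y n)"
   using cl[of "Suc n"] cl[of n] by (subst nrm_scale) auto
  also have "\<dots> \<le> (1/2) * (nrm A (?y (Suc n)) * nrm A ?d + nrm A ?d * nrm A (?y n))"
   using nrm_triangle[of "?y (Suc n) \<otimes> ?d" "?d \<otimes> ?y n"] nrm_mult[of "?y (Suc n)" ?d]
    nrm_mult[of ?d "?y n"] cl[of "Suc n"] cl[of n] by (simp del: sqrt_iter.simps)
  also have "\<dots> \<le> (1/2) * (?q * ?q ^ n + ?q ^ n * ?q)"
   using Suc bd[of n] bd[of "Suc n"] q0 cl[of "Suc n"] cl[of n]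
   by (intro mult_left_mono add_mono mult_mono) (auto simp del: sqrt_iter.simps)
  finally show ?case unfolding eq by simp
 qed
 obtain c where c: "vlim ?y c"
  using vlim_geometric[OF complete cl step q0 q] by blast
 note [simp] = vlimD(2)[OF c]
 have "vlim (%n. (1/2) \<odot> (x \<oplus> ?y n \<otimes> ?y n)) ((1/2) \<odot> (x \<oplus> c \<otimes> c))"
  by (intro vlim_smult vlim_add vlim_mult vlim_const c x)
 hence "vlim (%n. ?y (Suc n)) ((1/2) \<odot> (x \<oplus> c \<otimes> c))" by simp
 hence eq: "c = (1/2) \<odot> (x \<oplus> c \<otimes> c)"
  by (rule vlim_unique[OF vlim_Suc[OF c]])
 have "c \<oplus> c = x \<oplus> c \<otimes> c"
 proof -
  have "c \<oplus> c = (1/2) \<odot> (x \<oplus> c \<otimes> c) \<oplus> (1/2) \<odot> (x \<oplus> c \<otimes> c)"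
   by (rule arg_cong2[OF eq eq])
  also have "\<dots> = (1/2) \<odot> ((x \<oplus> c \<otimes> c) \<oplus> (x \<oplus> c \<otimes> c))" using x by (simp only: smult_add_r M.a_closed mult_closed \<open>c <: A\<close>)
  also have "\<dots> = x \<oplus> c \<otimes> c" using x by (intro half_half) auto
  finally show ?thesis .
 qed
 hence "x = (c \<oplus> c) \<ominus> c \<otimes> c" using x by (simp add: M.minus_eq M.a_assoc M.r_neg)
 moreover have "star A c = c"
  using vlim_star[OF c] unfolding sa by (rule vlim_unique[OF _ c])
 moreover have "z \<otimes> c = c \<otimes> z" if "z <: A" "z \<otimes> x = x \<otimes> z" for z
  using vlim_mult[OF vlim_const[OF that(1)] c] vlim_mult[OF c vlim_const[OF that(1)]]
  unfolding com[OF that] by (rule vlim_unique)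
 ultimately show ?thesis using that \<open>c <: A\<close> by blast
qed

end

section \<open>Functional calculus in unital C*-algebras\<close>

locale unital_cstar = cstar_algebra A for A :: "('a, 'm) cstar_scheme" (structure) +
 assumes one_closed: "\<one> <: A"
  and l_one: "a <: A ==> \<one> \<otimes> a = a"
  and r_one: "a <: A ==> a \<otimes> \<one> = a"

sublocale unital_cstar \<subseteq> UR: ring A
 by unfold_locales (auto simp: one_closed l_one r_one mult_assoc mult_add_left mult_add_right)

context unital_cstar
begin

declare one_closed [simp, intro] l_one [simp] r_one [simp]

lemmas unital_simprules
 [algebra ucstar "zero A" "add A" "a_inv A" "a_minus A" "one A" "mult A"] =
 cstar_simprules one_closed l_one r_one

lemma star_one [simp]: "star A \<one> = \<one>"
proof -
 have "star A (star A \<one> \<otimes> \<one>) = star A \<one> \<otimes> \<one>" by (subst star_mult) auto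
 thus ?thesis by simp
qed

text \<open>An inequality rather than an equality because \<open>\<one>\<close> has norm 0 in the
  zero algebra.\<close>

lemma unitary_nrm: "u <: A ==> star A u \<otimes> u = \<one> ==> nrm A u \<le> 1"
proof -
 assume u: "u <: A" "star A u \<otimes> u = \<one>"
 have "(nrm A \<one>)\<^sup>2 = nrm A \<one>" using nrm_sa_square[of \<one>] by simp
 hence "nrm A \<one> \<le> 1" by (auto simp: power2_eq_square)
 hence "(nrm A u)\<^sup>2 \<le> 1\<^sup>2" using nrm_star_mult[OF u(1)] u(2) by simp
 thus ?thesis by (rule power2_le_imp_le) simp
qed

lemma nrm_one: "nrm A \<one> \<le> 1"
 by (rule unitary_nrm) auto

lemma nrm_pow_le_1: "u <: A ==> nrm A u \<le> 1 ==> nrm A (u [^] (n::nat)) \<le> 1"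
proof (induction n)
 case (Suc n)
 have "nrm A (u [^] n \<otimes> u) \<le> nrm A (u [^] n) * nrm A u" using Suc.prems by (intro nrm_mult) auto
 also have "\<dots> \<le> 1 * 1" using Suc by (intro mult_mono) auto
 finally show ?case by simp
qed (simp add: nrm_one)

lemma star_pow: "a <: A ==> star A (a [^] (n::nat)) = star A a [^] n"
 by (induction n) (auto simp: star_mult UR.nat_pow_Suc2[symmetric] simp del: UR.nat_pow_Suc simp flip: UR.nat_pow_Suc2)

text \<open>The C*-identity only squares, hence the exponents 2^k. Together with
  \<open>subexponential_le_1\<close> this does the work of the spectral radius formula.\<close>

lemma nrm_sa_pow:
 assumes "b <: A" "star A b = b" shows "nrm A (b [^] ((2::nat) ^ k)) = nrm A b ^ (2 ^ k)"
proof (induction k)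
 case (Suc k)
 let ?c = "b [^] ((2::nat) ^ k)"
 have "b [^] ((2::nat) ^ Suc k) = ?c \<otimes> ?c"
  using assms by (simp add: UR.nat_pow_mult mult_2)
 hence "nrm A (b [^] ((2::nat) ^ Suc k)) = (nrm A ?c)\<^sup>2"
  using assms by (simp add: nrm_sa_square star_pow)
 thus ?case using Suc by (simp add: power_mult[symmetric] mult.commute)
qed (use assms in simp)

text \<open>p(a) by Horner's rule. The coefficients are real, so that p(a) is self-adjoint whenever
  a is.\<close>

definition pev :: "'a => real poly => 'a" where
 "pev a p = fold_coeffs (%c x. complex_of_real c \<odot> \<one> \<oplus> a \<otimes> x) p \<zero>"

lemma pev_0 [simp]: "pev a 0 = \<zero>"
 by (simp add: pev_def)

lemma pev_pCons [simp]:
 "a <: A ==> pev a (pCons c p) = complex_of_real c \<odot> \<one> \<oplus> a \<otimes> pev a p"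
 by (cases "p = 0"; cases "c = 0") (simp_all add: pev_def)

lemma pev_closed [simp, intro]: "a <: A ==> pev a p <: A"
 by (induction p) auto

lemma pev_add: "a <: A ==> pev a (p + q) = pev a p \<oplus> pev a q"
proof (induction p q rule: poly_induct2)
 case (pCons c p d q)
 have "complex_of_real (c + d) \<odot> \<one> = complex_of_real c \<odot> \<one> \<oplus> complex_of_real d \<odot> \<one>"
  by (simp add: smult_add_l)
 thus ?case using pCons by (simp add: mult_add_right M.a_ac)
qed simp

lemma pev_smult: "a <: A ==> pev a (Polynomial.smult t p) = complex_of_real t \<odot> pev a p"
 by (induction p) (simp_all add: smult_add_r mult_scale_right)

lemma pev_mult: "a <: A ==> pev a (p * q) = pev a p \<otimes> pev a q"
 by (induction p) (simp_all add: pev_add pev_smult mult_add_left mult_scale_left mult_assoc)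

lemma pev_1 [simp]: "a <: A ==> pev a 1 = \<one>"
 using pev_pCons[of a 1 0] by (simp add: one_pCons)

lemma pev_diff: "a <: A ==> pev a (p - q) = pev a p \<ominus> pev a q"
 using pev_add[of a p "- q"] pev_smult[of a "-1" q] by (simp add: M.minus_eq neg_eq_smult)

lemma pev_power: "a <: A ==> pev a (p ^ n) = pev a p [^] n"
 by (induction n) (simp_all add: pev_mult UR.nat_pow_Suc2[symmetric] del: UR.nat_pow_Suc
   flip: UR.nat_pow_Suc2)

lemma pev_commute:
 "a <: A ==> z <: A ==> z \<otimes> a = a \<otimes> z ==> z \<otimes> pev a p = pev a p \<otimes> z"
proof (induction p)
 case (pCons c p)
 have "z \<otimes> (a \<otimes> pev a p) = a \<otimes> pev a p \<otimes> z"
  using pCons by (metis mult_assoc pev_closed)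
 thus ?case using pCons.prems
  by (simp add: mult_add_left mult_add_right mult_scale_left mult_scale_right)
qed simp

lemma pev_star: "a <: A ==> star A a = a ==> star A (pev a p) = pev a p"
 by (induction p) (simp_all add: star_add star_scale star_mult pev_commute)

lemma pev_coeff_bound:
 assumes u: "u <: A" "nrm A u \<le> 1" and K: "!!i. \<bar>coeff L i\<bar> \<le> K" and "degree L \<le> d"
 shows "nrm A (pev u L) \<le> (real d + 1) * K"
 using assms(3,4)
proof (induction d arbitrary: L)
 case 0
 then obtain c where c: "L = [:c:]" by (metis degree_eq_zeroE le_zero_eq)
 have "nrm A (pev u L) = \<bar>c\<bar> * nrm A \<one>" using u by (simp add: c nrm_scale)
 also have "\<dots> \<le> \<bar>c\<bar> * 1" using nrm_one by (intro mult_left_mono) auto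
 finally show ?case using 0(1)[of 0] c by simp
next
 case (Suc d)
 obtain c p where L: "L = pCons c p" by (cases L)
 have "degree p \<le> d" using Suc.prems(2) L by (cases "p = 0") auto
 moreover have "\<bar>coeff p i\<bar> \<le> K" for i using Suc.prems(1)[of "Suc i"] L by simp
 ultimately have IH: "nrm A (pev u p) \<le> (real d + 1) * K" using Suc.IH by blast
 have "nrm A (pev u L) \<le> nrm A (complex_of_real c \<odot> \<one>) + nrm A (u \<otimes> pev u p)"
  using u by (simp add: L nrm_triangle)
 also have "nrm A (complex_of_real c \<odot> \<one>) \<le> \<bar>c\<bar> * 1"
  using nrm_one by (simp add: nrm_scale mult_left_le)
 also have "\<bar>c\<bar> * 1 \<le> K" using Suc.prems(1)[of 0] L by simp
 also have "nrm A (u \<otimes> pev u p) \<le> nrm A u * nrm A (pev u p)" using u by (simp add: nrm_mult)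
 also have "\<dots> \<le> 1 * ((real d + 1) * K)" using u IH by (intro mult_mono) auto
 finally show ?case by (simp add: algebra_simps)
qed

end

text \<open>For degree p \<le> n this is z^n p((z + 1/z) / 2), a polynomial in z. The factor
  \<open>[:1/2, 0, 1/2:]\<close> is z times (z + 1/z) / 2.\<close>

primrec laurent :: "nat => real poly => real poly" where
 "laurent 0 p = p"
| "laurent (Suc n) p = monom (coeff p 0) (Suc n) + [:1/2, 0, 1/2:] * laurent n (poly_shift 1 p)"

lemma pCons_poly_shift: "pCons (coeff p 0) (poly_shift 1 p) = p"
 by (rule poly_eqI) (auto simp: coeff_pCons coeff_poly_shift split: nat.splits)

lemma degree_poly_shift_le: "degree p \<le> Suc n ==> degree (poly_shift 1 p) \<le> n"
 by (intro degree_le) (auto simp: coeff_poly_shift coeff_eq_0)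

lemma degree_laurent: "degree p \<le> n ==> degree (laurent n p) \<le> 2 * n"
proof (induction n arbitrary: p)
 case (Suc n)
 have "degree (laurent n (poly_shift 1 p)) \<le> 2 * n"
  using Suc degree_poly_shift_le by blast
 hence "degree ([:1/2, 0, 1/2:] * laurent n (poly_shift 1 p)) \<le> 2 * Suc n"
  by (intro order_trans[OF degree_mult_le]) simp
 moreover have "degree (monom (coeff p 0) (Suc n)) \<le> 2 * Suc n"
  by (rule order_trans[OF degree_monom_le]) simp
 ultimately show ?case by (simp del: mult_pCons_left add: degree_add_le)
qed simp

text \<open>The third assumption says a = (u + 1/u) / 2 without mentioning an inverse. The recursion
  of \<open>laurent\<close> is the splitting p = p(0) + t q, multiplied by u^(n+1).\<close>

lemma (in unital_cstar) pev_laurent: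
 assumes u: "u <: A" "a <: A" "u \<otimes> a = pev u [:1/2, 0, 1/2:]"
  and "degree p \<le> n"
 shows "u [^] n \<otimes> pev a p = pev u (laurent n p)"
 using assms(4)
proof (induction n arbitrary: p)
 case 0
 then obtain c where "p = [:c:]" by (metis degree_eq_zeroE le_zero_eq)
 thus ?case using u by simp
next
 case (Suc n)
 let ?q = "poly_shift 1 p" and ?c = "complex_of_real (coeff p 0)"
 have IH: "u [^] n \<otimes> pev a ?q = pev u (laurent n ?q)"
  by (rule Suc.IH[OF degree_poly_shift_le[OF Suc.prems]])
 have mon: "pev u (monom c k) = complex_of_real c \<odot> u [^] k" for c and k :: nat
  using u by (induction k) (simp_all add: monom_0 monom_Suc mult_scale_right UR.nat_pow_Suc2[symmetric] del: UR.nat_pow_Suc flip: UR.nat_pow_Suc2)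
 have "u [^] Suc n \<otimes> pev a p = u [^] Suc n \<otimes> (?c \<odot> \<one> \<oplus> a \<otimes> pev a ?q)"
  using pev_pCons[OF u(2), of "coeff p 0" ?q] unfolding pCons_poly_shift by simp
 also have "\<dots> = ?c \<odot> u [^] Suc n \<oplus> (u [^] Suc n \<otimes> a) \<otimes> pev a ?q"
  using u(1,2) by (simp add: mult_add_right mult_scale_right mult_assoc del: UR.nat_pow_Suc)
 also have "u [^] Suc n \<otimes> a = u [^] n \<otimes> pev u [:1/2, 0, 1/2:]"
  using u(1,2) by (simp add: mult_assoc u(3) del: pev_pCons)
 also have "\<dots> = pev u [:1/2, 0, 1/2:] \<otimes> u [^] n"
 proof (rule pev_commute)
  show "u [^] n \<otimes> u = u \<otimes> u [^] n" using u UR.nat_pow_Suc2[of u n] by simp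
 qed (use u in auto)
 also have "?c \<odot> u [^] Suc n \<oplus> pev u [:1/2, 0, 1/2:] \<otimes> u [^] n \<otimes> pev a ?q
  = pev u (laurent (Suc n) p)"
  using u(1,2) by (simp add: pev_add pev_mult mon IH[unfolded One_nat_def] mult_assoc del: pev_pCons mult_pCons_left UR.nat_pow_Suc)
 finally show ?case .
qed

subsection \<open>The complex numbers as a C*-algebra\<close>

text \<open>The scalars as a C*-algebra: \<open>pev_laurent\<close> then applies verbatim to points
  of the unit circle, where the coefficients of \<open>laurent n p\<close> are estimated.\<close>

definition complex_cstar :: "complex cstar" where
 "complex_cstar = \<lparr>carrier = UNIV, mult = (*), one = 1, zero = 0, add = (+), smult = (*), star = cnj, nrm = cmod\<rparr>"

lemma complex_cstar_simps [simp]: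
 "carrier complex_cstar = UNIV" "mult complex_cstar = (*)" "one complex_cstar = 1"
 "zero complex_cstar = 0" "add complex_cstar = (+)" "smult complex_cstar = (*)"
 "star complex_cstar = cnj" "nrm complex_cstar = cmod"
 by (simp_all add: complex_cstar_def)

lemma cvec_complex_cstar: "cvec complex_cstar"
proof (rule cvec_intro)
 show "abelian_group complex_cstar"
 proof (rule abelian_groupI)
  fix x assume "x <: complex_cstar"
  thus "\<exists>y\<in>carrier complex_cstar. y \<oplus>\<^sub>complex_cstar x = \<zero>\<^sub>complex_cstar"
   by (auto intro: exI[of _ "- x"])
 qed auto
qed (auto simp: algebra_simps)

lemma a_minus_complex_cstar [simp]: "x \<ominus>\<^sub>complex_cstar y = x - y"
proof -
 interpret cvec complex_cstar by (rule cvec_complex_cstar)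
 show ?thesis using M.minus_eq[of x y] neg_eq_smult[of y] by simp
qed

interpretation CC: unital_cstar complex_cstar
proof -
 interpret cvec complex_cstar by (rule cvec_complex_cstar)
 show "unital_cstar complex_cstar"
 proof unfold_locales
  show "norm_complete complex_cstar (nrm complex_cstar)"
   unfolding norm_complete_def
  proof (intro allI impI)
   fix f :: "nat => complex"
   assume "\<forall>e>0. \<exists>M. \<forall>m\<ge>M. \<forall>n\<ge>M. nrm complex_cstar (f m \<ominus>\<^sub>complex_cstar f n) < e"
   hence "Cauchy f" by (intro CauchyI) simp
   then obtain l where "f \<longlonglongrightarrow> l" using Cauchy_convergent convergent_def by blast
   hence "(%n. cmod (f n - l)) \<longlonglongrightarrow> 0" using tendsto_norm_zero Lim_null by blast
   thus "\<exists>l\<in>carrier complex_cstar. (%n. nrm complex_cstar (f n \<ominus>\<^sub>complex_cstar l)) \<longlonglongrightarrow> 0"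
    by auto
  qed
  show "nrm complex_cstar (star complex_cstar a \<otimes>\<^sub>complex_cstar a) = (nrm complex_cstar a)\<^sup>2" for a
   by (simp add: norm_mult power2_eq_square)
 qed (auto simp: algebra_simps norm_mult norm_triangle_ineq)
qed

lemma CC_pev_real: "CC.pev (complex_of_real x) p = complex_of_real (poly p x)"
 by (induction p) simp_all

lemma CC_pow: "z [^]\<^sub>complex_cstar (n::nat) = z ^ n"
 by (induction n) simp_all

lemma CC_pev_sum: "degree p \<le> d ==> CC.pev z p = (\<Sum>i\<le>d. complex_of_real (coeff p i) * z ^ i)"
proof (induction d arbitrary: p)
 case 0
 then obtain c where "p = [:c:]" by (metis degree_eq_zeroE le_zero_eq)
 thus ?case by simp
next
 case (Suc d)
 obtain c q where p: "p = pCons c q" by (cases p)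
 have "degree q \<le> d" using Suc.prems p by (cases "q = 0") auto
 thus ?case using Suc.IH[of q] p
  by (simp add: sum.atMost_Suc_shift sum_distrib_left algebra_simps del: sum.atMost_Suc)
qed

text \<open>Discrete Fourier inversion: the j-th coefficient is the mean of w^(-k j) p(w^k) over the
  n-th roots of unity w^k.\<close>

lemma coeff_le_circle:
 fixes p :: "real poly"
 assumes M: "!!z. cmod z = 1 ==> cmod (CC.pev z p) \<le> M"
 shows "\<bar>coeff p j\<bar> \<le> M"
proof (cases "j \<le> degree p")
 case False
 hence "coeff p j = 0" by (simp add: coeff_eq_0)
 moreover have "0 \<le> M" using M[of 1] norm_ge_zero order_trans by (metis norm_one)
 ultimately show ?thesis by simp
next
 case j: True
 \<comment> \<open>More roots of unity than degrees, so that n divides i - j only if i = j.\<close>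
 define n where "n = Suc (degree p)"
 define w where "w = cis (2 * pi / n)"
 have n: "n > 0" by (simp add: n_def)
 have geo: "(\<Sum>k<n. (w ^ i * cnj w ^ j) ^ k) = (if i = j then of_nat n else 0)" if i: "i \<le> degree p" for i
 proof (cases "i = j")
  case True
  have "w * cnj w = 1" by (simp add: w_def cis_cnj cis_mult)
  thus ?thesis using True by (simp flip: power_mult_distrib)
 next
  case False
  let ?v = "w ^ i * cnj w ^ j"
  have v: "?v = cis (2 * pi * (real i - real j) / n)"
   by (simp add: w_def cis_cnj DeMoivre cis_mult algebra_simps diff_divide_distrib)
  have "?v ^ n = cis (2 * pi * of_int (int i - int j))"
   unfolding v DeMoivre using n by simp
  also have "\<dots> = 1" by (rule cis_multiple_2pi) auto
  finally have v1: "?v ^ n = 1" .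
  have "?v \<noteq> 1"
  proof
   assume "?v = 1"
   hence "cos (2 * pi * (real i - real j) / n) = 1" unfolding v by (metis cis.sel(1) one_complex.sel(1))
   then obtain x :: int where "2 * pi * (real i - real j) / n = of_int x * 2 * pi"
    using cos_one_2pi_int by blast
   hence "(2 * pi) * (real i - real j) = (2 * pi) * (of_int x * real n)" using n by (simp add: field_simps)
   hence "real i - real j = of_int x * real n" by (rule mult_left_cancel[THEN iffD1, rotated]) simp
   hence "real_of_int (int i - int j) = real_of_int (x * int n)" by simp
   hence "int i - int j = x * int n" by (simp only: of_int_eq_iff)
   moreover have "\<bar>int i - int j\<bar> < int n" using i j by (simp add: n_def)
   ultimately have "x = 0" using False
    by (metis abs_mult abs_of_nat dvd_triv_right mult_zero_left zdvd_imp_le zero_less_abs_iff not_less mult_eq_0_iff abs_dvd_iff dvd_abs_iff)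
   thus False using False \<open>int i - int j = x * int n\<close> by simp
  qed
  thus ?thesis using False v1 by (simp add: geometric_sum)
 qed
 have "(\<Sum>k<n. cnj (w ^ k) ^ j * CC.pev (w ^ k) p)
   = (\<Sum>k<n. \<Sum>i\<le>degree p. complex_of_real (coeff p i) * (w ^ i * cnj w ^ j) ^ k)"
  by (simp add: CC_pev_sum[OF order_refl] sum_distrib_left power_mult_distrib mult_ac flip: power_mult)
 also have "\<dots> = (\<Sum>i\<le>degree p. complex_of_real (coeff p i) * (\<Sum>k<n. (w ^ i * cnj w ^ j) ^ k))"
  by (subst sum.swap) (simp add: sum_distrib_left)
 also have "\<dots> = (\<Sum>i\<le>degree p. if i = j then complex_of_real (coeff p i) * of_nat n else 0)"
  by (intro sum.cong refl) (simp add: geo)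
 also have "\<dots> = complex_of_real (coeff p j) * of_nat n" using j by simp
 finally have "real n * \<bar>coeff p j\<bar> = cmod (\<Sum>k<n. cnj (w ^ k) ^ j * CC.pev (w ^ k) p)"
  by (simp add: norm_mult)
 also have "\<dots> \<le> (\<Sum>k<n. M)"
 proof (rule order_trans[OF norm_sum], rule sum_mono)
  fix k
  have "cmod (w ^ k) = 1" by (simp add: w_def norm_power)
  thus "cmod (cnj (w ^ k) ^ j * CC.pev (w ^ k) p) \<le> M"
   using M[of "w ^ k"] by (simp add: norm_mult norm_power)
 qed
 finally show ?thesis using n by simp
qed

text \<open>On the unit circle (z + 1/z) / 2 is the real part of z, so \<open>laurent n p\<close>
  has the modulus of p(Re z) there.\<close>

lemma laurent_coeff_le:
 assumes "degree p \<le> n" and M: "!!t. \<bar>t\<bar> \<le> 1 ==> \<bar>poly p t\<bar> \<le> M"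
 shows "\<bar>coeff (laurent n p) j\<bar> \<le> M"
proof (rule coeff_le_circle)
 fix z :: complex assume z: "cmod z = 1"
 have zz: "z * cnj z = 1" using z by (simp add: complex_norm_square[symmetric])
 have "2 * complex_of_real (Re z) = z + cnj z" by (simp add: complex_add_cnj)
 hence "2 * (z * complex_of_real (Re z)) = z * z + 1" using zz by (metis distrib_left mult.left_commute)
 hence "z * complex_of_real (Re z) = CC.pev z [:1/2, 0, 1/2:]" by (simp add: field_simps)
 hence "z ^ n * CC.pev (complex_of_real (Re z)) p = CC.pev z (laurent n p)"
  using CC.pev_laurent[of z "complex_of_real (Re z)" p n] assms(1) by (simp add: CC_pow)
 moreover have "\<bar>Re z\<bar> \<le> 1" using abs_Re_le_cmod[of z] z by simp
 ultimately show "cmod (CC.pev z (laurent n p)) \<le> M"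
  using M[of "Re z"] z by (metis CC_pev_real mult_1 norm_mult norm_of_real norm_power power_one)
qed

lemma subexponential_le_1:
 assumes "!!k. x ^ (2 ^ k) \<le> c * 2 ^ k + (1::real)" shows "x \<le> 1"
proof (rule ccontr)
 assume "\<not> x \<le> 1"
 define h where "h = x - 1"
 have h: "h > 0" "x = 1 + h" using \<open>\<not> x \<le> 1\<close> by (auto simp: h_def)
 obtain k where k: "2 * \<bar>c\<bar> / h\<^sup>2 < 2 ^ k" using real_arch_pow[of 2 "2 * \<bar>c\<bar> / h\<^sup>2"] by auto
 let ?m = "(2::nat) ^ k"
 have "1 + real ?m * h \<le> x ^ ?m" unfolding h(2) using h(1) by (intro Bernoulli_inequality) simp
 hence "(1 + real ?m * h)\<^sup>2 \<le> (x ^ ?m)\<^sup>2" using h(1) by (intro power_mono) auto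
 also have "(x ^ ?m)\<^sup>2 = x ^ (2 ^ Suc k)" by (simp add: power_mult[symmetric] mult.commute)
 also have "\<dots> \<le> c * 2 ^ Suc k + 1" by (rule assms)
 finally have "(real ?m * h)\<^sup>2 + 2 * (real ?m * h) \<le> c * 2 * real ?m" by (simp add: power2_sum algebra_simps)
 moreover have "0 \<le> 2 * (real ?m * h)" using h by simp
 ultimately have "(real ?m * h)\<^sup>2 \<le> c * 2 * real ?m" by linarith
 hence "real ?m * (real ?m * h\<^sup>2) \<le> real ?m * (2 * c)" by (simp add: power2_eq_square algebra_simps)
 hence "real ?m * h\<^sup>2 \<le> 2 * c" by (rule mult_left_le_imp_le) simp
 hence "real ?m \<le> 2 * \<bar>c\<bar> / h\<^sup>2" using h by (simp add: pos_le_divide_eq) 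
 thus False using k by simp
qed

section \<open>The norm bound for polynomials in a self-adjoint element\<close>

context unital_cstar
begin

text \<open>With s = sqrt(1 - a^2), the element u = a + i s is unitary and a is its real part, so
  p(a) = u^(-d) L(u) for L = \<open>laurent d p\<close>. The coefficients of L are at most M in
  modulus by \<open>laurent_coeff_le\<close>; adding up 2 d + 1 of them costs the factor that
  \<open>pev_bound_strict\<close> removes.\<close>

lemma pev_bound_degree:
 assumes a: "a <: A" "star A a = a" "nrm A a < 1" and p: "degree p \<le> d"
  and M: "!!t. \<bar>t\<bar> \<le> 1 ==> \<bar>poly p t\<bar> \<le> M"
 shows "nrm A (pev a p) \<le> (2 * real d + 1) * M"
proof -
 have "nrm A (a \<otimes> a) < 1"
  using a power_strict_mono[of "nrm A a" 1 2] by (simp add: nrm_sa_square)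
 moreover have "star A (a \<otimes> a) = a \<otimes> a" using a by (simp add: star_mult)
 moreover have "a \<otimes> a <: A" using a by simp
 ultimately obtain c where c: "c <: A" "star A c = c" "a \<otimes> a = (c \<oplus> c) \<ominus> c \<otimes> c"
  and com: "!!z. z <: A ==> z \<otimes> (a \<otimes> a) = a \<otimes> a \<otimes> z ==> z \<otimes> c = c \<otimes> z"
  using sqrt_one_minus by metis
 have ac: "a \<otimes> c = c \<otimes> a" using com[of a] a by (simp add: mult_assoc)
 define s where "s = \<one> \<ominus> c"
 have s: "s <: A" "star A s = s" using c by (auto simp: s_def star_minus)
 have ss: "s \<otimes> s = \<one> \<ominus> a \<otimes> a"
  unfolding c(3) s_def using c(1) by algebra
 have as: "a \<otimes> s = s \<otimes> a" unfolding s_def using a(1) c(1) ac by (simp add: mult_minus_l mult_minus_r)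
 define u where "u = a \<oplus> \<i> \<odot> s"
 define v where "v = a \<oplus> (- \<i>) \<odot> s"
 have uv: "u <: A" "v <: A" using a s by (auto simp: u_def v_def)
 have su: "star A u = v" unfolding u_def v_def using a s by (simp add: star_add star_scale)
 have one: "a \<otimes> a \<oplus> s \<otimes> s = \<one>" unfolding ss using a(1) by algebra
 have uv1: "u \<otimes> v = \<one>"
 proof -
  have "u \<otimes> v = a \<otimes> a \<oplus> s \<otimes> s \<oplus> (\<i> \<odot> (s \<otimes> a) \<oplus> (- \<i>) \<odot> (a \<otimes> s))"
   unfolding u_def v_def using a(1) s(1)
   by (simp add: mult_add_left mult_add_right mult_scale_left mult_scale_right smult_add_r M.a_ac)
  thus ?thesis using one as a(1) s(1) by (simp add: neg_smult M.r_neg)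
 qed
 have vu1: "v \<otimes> u = \<one>"
 proof -
  have "v \<otimes> u = a \<otimes> a \<oplus> s \<otimes> s \<oplus> (\<i> \<odot> (a \<otimes> s) \<oplus> (- \<i>) \<odot> (s \<otimes> a))"
   unfolding u_def v_def using a(1) s(1)
   by (simp add: mult_add_left mult_add_right mult_scale_left mult_scale_right smult_add_r M.a_ac)
  thus ?thesis using one as a(1) s(1) by (simp add: neg_smult M.r_neg)
 qed
 have upv: "u \<oplus> v = a \<oplus> a"
 proof -
  have "u \<oplus> v = (a \<oplus> a) \<oplus> (\<i> \<odot> s \<oplus> (- \<i>) \<odot> s)" unfolding u_def v_def using a s by (simp add: M.a_ac)
  thus ?thesis using a s by (simp add: neg_smult M.r_neg)
 qed
 have ua: "u \<otimes> a = pev u [:1/2, 0, 1/2:]"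
 proof -
  have "u \<otimes> a = (1/2) \<odot> (u \<otimes> (a \<oplus> a))" using uv a by (simp add: mult_add_right half_half)
  also have "\<dots> = (1/2) \<odot> (u \<otimes> u \<oplus> \<one>)" using uv by (simp add: upv[symmetric] mult_add_right uv1)
  also have "\<dots> = pev u [:1/2, 0, 1/2:]" using uv by (simp add: smult_add_r mult_scale_right M.a_ac)
  finally show ?thesis .
 qed
 have nu: "nrm A u \<le> 1" using unitary_nrm[of u] uv vu1 su by simp
 hence nv: "nrm A v \<le> 1" using uv(1) nrm_star[of u] su by simp
 have vun: "v [^] (n::nat) \<otimes> u [^] n = \<one>" for n
 proof (induction n)
  case (Suc n)
  have "v [^] Suc n \<otimes> u [^] Suc n = v [^] n \<otimes> (v \<otimes> u) \<otimes> u [^] n"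
   using uv UR.nat_pow_Suc2[of u n] by (simp add: mult_assoc)
  thus ?case using Suc uv vu1 by simp
 qed simp
 let ?L = "laurent d p"
 have "pev a p = v [^] d \<otimes> (u [^] d \<otimes> pev a p)"
  using uv a vun[of d] by (simp flip: mult_assoc)
 also have "u [^] d \<otimes> pev a p = pev u ?L" by (rule pev_laurent[OF uv(1) a(1) ua p])
 finally have "nrm A (pev a p) \<le> nrm A (v [^] d) * nrm A (pev u ?L)"
  using nrm_mult[of "v [^] d" "pev u ?L"] uv by simp
 also have "\<dots> \<le> 1 * nrm A (pev u ?L)" using nrm_pow_le_1[OF uv(2) nv] uv by (intro mult_right_mono) auto
 also have "nrm A (pev u ?L) \<le> (real (2 * d) + 1) * M"
  by (rule pev_coeff_bound[OF uv(1) nu laurent_coeff_le[OF p M] degree_laurent[OF p]])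
 finally show ?thesis by simp
qed

text \<open>Apply the crude bound to p^(2^k): the left side becomes ||p(a)||^(2^k), while the factor
  grows only linearly in 2^k. \<open>K\<close> = M + e keeps the divisor positive.\<close>

lemma pev_bound_strict:
 assumes a: "a <: A" "star A a = a" "nrm A a < 1"
  and M: "!!t. \<bar>t\<bar> \<le> 1 ==> \<bar>poly p t\<bar> \<le> M"
 shows "nrm A (pev a p) \<le> M"
proof (rule field_le_epsilon)
 fix e :: real assume e: "e > 0"
 define K where "K = M + e"
 have "0 \<le> M" using M[of 0] by simp
 hence K: "K > 0" using e by (simp add: K_def)
 have "nrm A (pev a p) / K \<le> 1"
 proof (rule subexponential_le_1)
  fix k
  let ?n = "(2::nat) ^ k"
  have "nrm A (pev a (p ^ ?n)) \<le> (2 * real (degree p * ?n) + 1) * K ^ ?n"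
  proof (rule pev_bound_degree[OF a])
   show "degree (p ^ ?n) \<le> degree p * ?n" by (rule degree_power_le)
   show "\<bar>poly (p ^ ?n) t\<bar> \<le> K ^ ?n" if "\<bar>t\<bar> \<le> 1" for t
    using M[OF that] e by (auto simp: poly_power power_abs K_def intro!: power_mono)
  qed
  also have "nrm A (pev a (p ^ ?n)) = nrm A (pev a p) ^ ?n"
   using a by (simp add: pev_power nrm_sa_pow pev_star)
  finally show "(nrm A (pev a p) / K) ^ ?n \<le> (2 * real (degree p)) * 2 ^ k + 1"
   using K by (simp add: power_divide divide_le_eq mult.assoc add.commute)
 qed
 thus "nrm A (pev a p) \<le> M + e" using K by (simp add: K_def divide_le_eq)
qed

lemma pev_pcompose_scale:
 "a <: A ==> pev a (pcompose p [:0, r:]) = pev (complex_of_real r \<odot> a) p"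
 by (induction p) (simp_all add: pcompose_pCons pev_add pev_mult mult_scale_left mult_scale_right del: mult_pCons_left)

text \<open>For r slightly above ||a||, the element a / r has norm below 1, and uniform continuity
  of p controls its values on the margin between ||a|| and r.\<close>

theorem pev_bound:
 assumes a: "a <: A" "star A a = a"
  and M: "!!t. \<bar>t\<bar> \<le> nrm A a ==> \<bar>poly p t\<bar> \<le> M"
 shows "nrm A (pev a p) \<le> M"
proof (rule field_le_epsilon)
 fix e :: real assume e: "e > 0"
 let ?R = "nrm A a + 1"
 have "uniformly_continuous_on {-?R..?R} (poly p)"
  by (intro compact_uniformly_continuous continuous_intros) auto
 then obtain d where d: "d > 0" "!!x y. x \<in> {-?R..?R} ==> y \<in> {-?R..?R} ==> dist x y < d ==> dist (poly p x) (poly p y) < e"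
  unfolding uniformly_continuous_on_def using e by metis
 define r where "r = nrm A a + min 1 d / 2"
 have n0: "0 \<le> nrm A a" using a by simp
 have r: "nrm A a < r" "r < nrm A a + d" "r \<le> ?R" "r > 0" using d(1) n0 by (auto simp: r_def min_def)
 have ba: "complex_of_real r \<odot> (complex_of_real (1 / r) \<odot> a) = a"
  using a r by (simp flip: of_real_mult)
 have "nrm A (pev (complex_of_real (1 / r) \<odot> a) (pcompose p [:0, r:])) \<le> M + e"
 proof (rule pev_bound_strict)
  show "nrm A (complex_of_real (1 / r) \<odot> a) < 1" using a r by (simp add: nrm_scale norm_divide)
  fix t :: real assume t: "\<bar>t\<bar> \<le> 1"
  have tr: "\<bar>r * t\<bar> \<le> r" using t r(4) by (simp add: abs_mult mult_left_le)
  \<comment> \<open>The point r t clamped to [-||a||, ||a||], where the hypothesis on p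
    applies.\<close>
  define x where "x = max (- nrm A a) (min (r * t) (nrm A a))"
  have "\<bar>x\<bar> \<le> nrm A a" using n0 by (auto simp: x_def)
  moreover have "\<bar>x - r * t\<bar> \<le> r - nrm A a" using tr r n0 unfolding x_def by linarith
  ultimately have "x \<in> {-?R..?R}" "r * t \<in> {-?R..?R}" "dist x (r * t) < d" "\<bar>poly p x\<bar> \<le> M"
   using r tr M[of x] by (auto simp: dist_real_def simp del: abs_mult)
  moreover from d(2)[OF this(1-3)] have "dist (poly p x) (poly p (r * t)) < e" .
  ultimately show "\<bar>poly (pcompose p [:0, r:]) t\<bar> \<le> M + e"
   by (simp add: poly_pcompose dist_real_def mult.commute)
 qed (use a in \<open>auto simp: star_scale\<close>)
 thus "nrm A (pev a p) \<le> M + e" using a ba by (simp add: pev_pcompose_scale)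
qed

subsection \<open>Continuous functions of a self-adjoint element\<close>

text \<open>An interval that contains the spectrum, not the spectrum itself.\<close>

abbreviation spec :: "'a => real set" where "spec a \<equiv> {- nrm A a..nrm A a}"

text \<open>\<open>cfun a f c\<close> says that \<open>c = f(a)\<close>, where \<open>f\<close> need only be defined on \<open>[-\<parallel>a\<parallel>, \<parallel>a\<parallel>]\<close>.\<close>

definition cfun :: "'a => (real => real) => 'a => bool" where
 "cfun a f c \<longleftrightarrow> (\<exists>P. uniform_limit (spec a) (%n. poly (P n)) f sequentially \<and> vlim (%n. pev a (P n)) c)"

lemma cfun_closed: "cfun a f c ==> c <: A"
 using vlimD(2) unfolding cfun_def by blast

lemma cfun_pev: "a <: A ==> cfun a (poly p) (pev a p)"
 unfolding cfun_def by (rule exI[of _ "%_. p"]) (auto intro: vlim_const uniform_limit_const)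

lemma cfun_add: "cfun a f c ==> cfun a g d ==> a <: A ==> cfun a (%t. f t + g t) (c \<oplus> d)"
proof -
 assume "cfun a f c" "cfun a g d" and a: "a <: A"
 then obtain P Q where "uniform_limit (spec a) (%n. poly (P n)) f sequentially" "vlim (%n. pev a (P n)) c"
  "uniform_limit (spec a) (%n. poly (Q n)) g sequentially" "vlim (%n. pev a (Q n)) d"
  unfolding cfun_def by blast
 moreover have "(%n. poly (P n + Q n)) = (%n t. poly (P n) t + poly (Q n) t)" by (intro ext) simp
 ultimately show ?thesis unfolding cfun_def using a
  by (intro exI[of _ "%n. P n + Q n"]) (simp add: pev_add uniform_limit_add vlim_add)
qed

lemma cfun_continuous: "cfun a f c ==> continuous_on (spec a) f"
 unfolding cfun_def by (auto intro!: uniform_limit_theorem[of _ "%n. poly (P n)" for P] continuous_intros always_eventually)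

lemma cfun_mult: "cfun a f c ==> cfun a g d ==> a <: A ==> cfun a (%t. f t * g t) (c \<otimes> d)"
proof -
 assume fg: "cfun a f c" "cfun a g d" and a: "a <: A"
 then obtain P Q where "uniform_limit (spec a) (%n. poly (P n)) f sequentially" "vlim (%n. pev a (P n)) c"
  "uniform_limit (spec a) (%n. poly (Q n)) g sequentially" "vlim (%n. pev a (Q n)) d"
  unfolding cfun_def by blast
 moreover have "bounded (f ` spec a)" "bounded (g ` spec a)"
  using cfun_continuous fg by (auto intro!: compact_imp_bounded compact_continuous_image)
 moreover have "(%n. poly (P n * Q n)) = (%n t. poly (P n) t * poly (Q n) t)" by (intro ext) simp
 ultimately show ?thesis unfolding cfun_def using a
  by (intro exI[of _ "%n. P n * Q n"]) (simp add: pev_mult uniform_lim_mult vlim_mult)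
qed

lemma cfun_nrm:
 assumes a: "a <: A" "star A a = a" and f: "cfun a f c" and M: "!!t. t \<in> spec a ==> \<bar>f t\<bar> \<le> M"
 shows "nrm A c \<le> M"
proof (rule field_le_epsilon)
 fix e :: real assume e: "e > 0"
 obtain P where P: "uniform_limit (spec a) (%n. poly (P n)) f sequentially" "vlim (%n. pev a (P n)) c"
  using f unfolding cfun_def by blast
 have "eventually (%n. \<forall>t\<in>spec a. dist (poly (P n) t) (f t) < e / 2) sequentially"
  using P(1) e unfolding uniform_limit_iff by (meson half_gt_zero)
 moreover have "eventually (%n. nrm A (pev a (P n) \<ominus> c) < e / 2) sequentially"
  by (rule order_tendstoD[OF vlimD(3)[OF P(2)]]) (use e in simp)
 ultimately have "eventually (%n. (\<forall>t\<in>spec a. dist (poly (P n) t) (f t) < e / 2) \<and> nrm A (pev a (P n) \<ominus> c) < e / 2) sequentially"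
  by (rule eventually_conj)
 from eventually_happens'[OF sequentially_bot this]
 obtain n where n: "!!t. t \<in> spec a ==> dist (poly (P n) t) (f t) < e / 2" "nrm A (pev a (P n) \<ominus> c) < e / 2"
  by blast
 have "nrm A (pev a (P n)) \<le> M + e / 2"
 proof (rule pev_bound[OF a])
  fix t assume "\<bar>t\<bar> \<le> nrm A a"
  hence "t \<in> spec a" by auto
  from M[OF this] n(1)[OF this] show "\<bar>poly (P n) t\<bar> \<le> M + e / 2" unfolding dist_real_def by linarith
 qed
 moreover have "nrm A c \<le> nrm A (pev a (P n)) + nrm A (c \<ominus> pev a (P n))"
  using a cfun_closed[OF f] by (intro N_diff_le) auto
 moreover have "nrm A (c \<ominus> pev a (P n)) = nrm A (pev a (P n) \<ominus> c)"
  using a cfun_closed[OF f] by (intro N_minus_commute) auto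
 ultimately show "nrm A c \<le> M + e" using n(2) by simp
qed

lemma cfun_unique:
 assumes a: "a <: A" "star A a = a" and f: "cfun a f c" and g: "cfun a g d"
  and fg: "!!t. t \<in> spec a ==> f t = g t"
 shows "c = d"
proof -
 \<comment> \<open>The function f - g, assembled from the rules for sums, products and
   polynomials.\<close>
 have "cfun a (%t. f t + poly [:-1:] t * g t) (c \<oplus> pev a [:-1:] \<otimes> d)"
  by (intro cfun_add cfun_mult cfun_pev f g a)
 hence "nrm A (c \<oplus> pev a [:-1:] \<otimes> d) \<le> 0"
  by (rule cfun_nrm[OF a]) (simp add: fg)
 moreover have cd: "c <: A" "d <: A" using f g by (auto dest: cfun_closed)
 moreover have "c \<oplus> pev a [:-1:] \<otimes> d = c \<ominus> d"
  using a cd by (simp add: M.minus_eq neg_eq_smult mult_scale_left)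
 ultimately have "nrm A (c \<ominus> d) = 0" by (intro order_antisym N_nonneg) auto
 thus ?thesis using cd by (simp add: N_eq_0 minus_eq_zero_iff)
qed

lemma cfun_star: "cfun a f c ==> a <: A ==> star A a = a ==> star A c = c"
proof -
 assume "cfun a f c" and a: "a <: A" "star A a = a"
 then obtain P where P: "vlim (%n. pev a (P n)) c" unfolding cfun_def by blast
 from vlim_star[OF this] show ?thesis unfolding pev_star[OF a] by (rule vlim_unique[OF _ P])
qed

lemma cfun_commute:
 assumes "cfun a f c" "a <: A" "z <: A" "z \<otimes> a = a \<otimes> z" shows "z \<otimes> c = c \<otimes> z"
proof -
 obtain P where P: "vlim (%n. pev a (P n)) c" using assms(1) unfolding cfun_def by blast
 show ?thesis
  using vlim_mult[OF vlim_const[OF assms(3)] P] vlim_mult[OF P vlim_const[OF assms(3)]]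
  by (simp add: pev_commute assms(2-) vlim_unique)
qed

lemma weierstrass_poly:
 fixes f :: "real => real"
 assumes "continuous_on S f" "compact S"
 obtains P where "!!n x. x \<in> S ==> \<bar>poly (P n) x - f x\<bar> \<le> inverse (real (Suc n))"
proof -
 have "\<exists>p. \<forall>x\<in>S. \<bar>poly p x - f x\<bar> \<le> inverse (real (Suc n))" for n
 proof -
  obtain g where g: "real_polynomial_function g" "!!x. x \<in> S ==> \<bar>f x - g x\<bar> < inverse (real (Suc n))"
   using Stone_Weierstrass_real_polynomial_function[OF assms(2,1), of "inverse (real (Suc n))"] by auto
  obtain a k where ak: "g = (%x. \<Sum>i\<le>k. a i * x ^ i)" using g(1) real_polynomial_function_iff_sum by blast
  have "poly (\<Sum>i\<le>k. monom (a i) i) x = g x" for x by (simp add: ak poly_sum poly_monom)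
  thus ?thesis using g(2) by (intro exI[of _ "\<Sum>i\<le>k. monom (a i) i"]) (simp add: abs_minus_commute less_imp_le)
 qed
 thus ?thesis using that by metis
qed

text \<open>By \<open>pev_bound\<close>, uniformly convergent polynomials give a Cauchy sequence in
  the algebra.\<close>

lemma cfun_ex:
 assumes a: "a <: A" "star A a = a" and f: "continuous_on (spec a) f"
 obtains c where "cfun a f c"
proof -
 obtain P where P: "!!n x. x \<in> spec a ==> \<bar>poly (P n) x - f x\<bar> \<le> inverse (real (Suc n))"
  using weierstrass_poly[OF f] by auto
 have "nrm A (pev a (P m) \<ominus> pev a (P n)) \<le> inverse (real (Suc m)) + inverse (real (Suc n))" for m n
  unfolding pev_diff[OF a(1), symmetric]
 proof (rule pev_bound[OF a])
  fix t assume "\<bar>t\<bar> \<le> nrm A a"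
  hence "t \<in> spec a" by auto
  from P[OF this, of m] P[OF this, of n]
  show "\<bar>poly (P m - P n) t\<bar> \<le> inverse (real (Suc m)) + inverse (real (Suc n))" by simp
 qed
 then obtain c where c: "vlim (%n. pev a (P n)) c"
  using cauchy_vlim_bound[OF complete _ _ LIMSEQ_inverse_real_of_nat, of "%n. pev a (P n)"] a by auto
 have "uniform_limit (spec a) (%n. poly (P n)) f sequentially"
 proof (rule uniform_limitI)
  fix e :: real assume "e > 0"
  hence "eventually (%n. inverse (real (Suc n)) < e) sequentially"
   by (rule order_tendstoD(2)[OF LIMSEQ_inverse_real_of_nat])
  thus "eventually (%n. \<forall>x\<in>spec a. dist (poly (P n) x) (f x) < e) sequentially"
  proof (rule eventually_mono)
   fix n assume n: "inverse (real (Suc n)) < e"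
   show "\<forall>x\<in>spec a. dist (poly (P n) x) (f x) < e"
    unfolding dist_real_def by (intro ballI le_less_trans[OF P n])
  qed
 qed
 thus ?thesis using that c unfolding cfun_def by blast
qed

subsection \<open>Positive elements\<close>

text \<open>Squares of self-adjoint elements; that each b^* b is of this form is
  \<open>Pos_star_mult\<close>.\<close>

definition Pos :: "'a => bool" where
 "Pos c \<longleftrightarrow> (\<exists>b\<in>carrier A. star A b = b \<and> c = b \<otimes> b)"

lemma Pos_closed: "Pos c ==> c <: A" and Pos_star: "Pos c ==> star A c = c"
 by (auto simp: Pos_def star_mult)

lemma cfun_root:
 assumes a: "a <: A" "star A a = a" and f: "cfun a f c" and pos: "!!t. t \<in> spec a ==> 0 \<le> f t"
 obtains b where "b <: A" "star A b = b" "c = b \<otimes> b"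
  "!!z. z <: A ==> z \<otimes> a = a \<otimes> z ==> z \<otimes> b = b \<otimes> z"
proof -
 obtain b where b: "cfun a (%t. sqrt (f t)) b"
  using cfun_ex[OF a, of "%t. sqrt (f t)"] cfun_continuous[OF f] by (auto intro: continuous_intros)
 have "c = b \<otimes> b"
  by (rule cfun_unique[OF a f cfun_mult[OF b b a(1)]]) (simp add: pos)
 thus ?thesis
  using that[OF cfun_closed[OF b] cfun_star[OF b a]] cfun_commute[OF b a(1)] by blast
qed

lemma Pos_cfun:
 assumes "a <: A" "star A a = a" "cfun a f c" "!!t. t \<in> spec a ==> 0 \<le> f t" shows "Pos c"
 using cfun_root[OF assms] unfolding Pos_def by metis

text \<open>Write c = 1 - d. The function t \<mapsto> 1 - t is nonnegative on [-1, 1], so it has a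
  square root there and functional calculus of d applies. In contrast to
  \<open>sqrt_one_minus\<close> this reaches ||d|| = 1.\<close>

lemma root_one_minus:
 assumes c: "c <: A" "star A c = c" and n: "nrm A (\<one> \<ominus> c) \<le> 1"
 obtains b where "b <: A" "star A b = b" "c = b \<otimes> b"
  "!!z. z <: A ==> z \<otimes> c = c \<otimes> z ==> z \<otimes> b = b \<otimes> z"
proof -
 let ?d = "\<one> \<ominus> c"
 have d: "?d <: A" "star A ?d = ?d" using c by (auto simp: star_minus)
 have "pev ?d [:1, -1:] = \<one> \<ominus> ?d" using d by (simp add: M.minus_eq[of \<one> ?d] neg_eq_smult[of ?d] mult_scale_right)
 also have "\<one> \<ominus> ?d = c" using c(1) by algebra
 finally have cf: "cfun ?d (poly [:1, -1:]) c" using cfun_pev[OF d(1), of "[:1, -1:]"] by simp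
 show ?thesis
 proof (rule cfun_root[OF d cf])
  show "0 \<le> poly [:1, -1:] t" if "t \<in> spec ?d" for t using that n by simp
  fix b assume b: "b <: A" "star A b = b" "c = b \<otimes> b"
   and com: "!!z. z <: A ==> z \<otimes> ?d = ?d \<otimes> z ==> z \<otimes> b = b \<otimes> z"
  show thesis
  proof (rule that[OF b])
   fix z assume "z <: A" "z \<otimes> c = c \<otimes> z"
   thus "z \<otimes> b = b \<otimes> z" using c by (intro com) (auto simp: mult_minus_l mult_minus_r)
  qed
 qed
qed

text \<open>With \<open>Pos_nrm\<close> this characterises positivity of a self-adjoint c in the
  unit ball by ||1 - c|| \<le> 1. The condition is convex, which is why sums of positive elements
  are positive.\<close>

lemma Pos_I: "c <: A ==> star A c = c ==> nrm A (\<one> \<ominus> c) \<le> 1 ==> Pos c"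
 using root_one_minus unfolding Pos_def by metis

lemma Pos_nrm: assumes "Pos c" "nrm A c \<le> 1" shows "nrm A (\<one> \<ominus> c) \<le> 1"
proof -
 obtain b where b: "b <: A" "star A b = b" "c = b \<otimes> b" using assms(1) unfolding Pos_def by blast
 have "(nrm A b)\<^sup>2 \<le> 1" using assms(2) b by (simp add: nrm_sa_square)
 hence nb: "nrm A b \<le> 1" using power2_le_imp_le[of "nrm A b" 1] by simp
 have "pev b [:1, 0, -1:] = \<one> \<ominus> c" using b by (simp add: M.minus_eq neg_eq_smult mult_scale_right)
 moreover have "nrm A (pev b [:1, 0, -1:]) \<le> 1"
 proof (rule pev_bound[OF b(1,2)])
  fix t assume "\<bar>t\<bar> \<le> nrm A b"
  hence "\<bar>t\<bar> \<le> 1" using nb by linarith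
  hence "t * t \<le> 1" using abs_square_le_1[of t] by (simp add: power2_eq_square)
  thus "\<bar>poly [:1, 0, -1:] t\<bar> \<le> 1" by simp
 qed
 ultimately show ?thesis by simp
qed

lemma Pos_scale: "Pos c ==> 0 \<le> t ==> Pos (complex_of_real t \<odot> c)"
proof -
 assume "Pos c" and t: "0 \<le> t"
 then obtain b where b: "b <: A" "star A b = b" "c = b \<otimes> b" unfolding Pos_def by blast
 thus ?thesis unfolding Pos_def using t
  by (intro bexI[of _ "complex_of_real (sqrt t) \<odot> b"])
   (auto simp: star_scale mult_scale_left mult_scale_right simp flip: of_real_mult)
qed

lemma Pos_add: assumes "Pos c" "Pos d" shows "Pos (c \<oplus> d)"
proof -
 have cd [simp]: "c <: A" "d <: A" "star A c = c" "star A d = d"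
  using assms by (auto simp: Pos_closed Pos_star)
 \<comment> \<open>Common factor that brings both elements into the unit ball.\<close>
 define T where "T = nrm A c + nrm A d + 1"
 have n: "0 \<le> nrm A c" "0 \<le> nrm A d" by auto
 hence T: "T > 0" "nrm A c \<le> T" "nrm A d \<le> T" unfolding T_def by linarith+
 let ?c = "complex_of_real (1 / T) \<odot> c" and ?d = "complex_of_real (1 / T) \<odot> d"
 have "nrm A (\<one> \<ominus> ?c) \<le> 1" "nrm A (\<one> \<ominus> ?d) \<le> 1"
  using T assms by (auto intro!: Pos_nrm Pos_scale simp: nrm_scale norm_divide simp del: of_real_divide)
 moreover have "\<one> \<ominus> (1/2) \<odot> (?c \<oplus> ?d) = (1/2) \<odot> ((\<one> \<ominus> ?c) \<oplus> (\<one> \<ominus> ?d))"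
 proof -
  have "(1/2) \<odot> ((\<one> \<ominus> ?c) \<oplus> (\<one> \<ominus> ?d)) = (1/2) \<odot> ((\<one> \<oplus> \<one>) \<ominus> (?c \<oplus> ?d))"
   by (rule arg_cong[where f = "%x. (1/2) \<odot> x"]) (use cd(1,2) in algebra)
  also have "\<dots> = \<one> \<ominus> (1/2) \<odot> (?c \<oplus> ?d)" by (subst smult_minus) (auto simp: half_half)
  finally show ?thesis by simp
 qed
 moreover have "nrm A ((1/2) \<odot> ((\<one> \<ominus> ?c) \<oplus> (\<one> \<ominus> ?d))) \<le> (1/2) * (nrm A (\<one> \<ominus> ?c) + nrm A (\<one> \<ominus> ?d))"
  using nrm_triangle[of "\<one> \<ominus> ?c" "\<one> \<ominus> ?d"] by (simp add: nrm_scale)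
 ultimately have "nrm A (\<one> \<ominus> (1/2) \<odot> (?c \<oplus> ?d)) \<le> 1" by simp
 hence "Pos ((1/2) \<odot> (?c \<oplus> ?d))" by (intro Pos_I) (auto simp: star_scale star_add)
 from Pos_scale[OF this, of "2 * T"] have "Pos (complex_of_real (2 * T) \<odot> ((1/2) \<odot> (?c \<oplus> ?d)))" using T by simp
 moreover have "complex_of_real (2 * T) \<odot> ((1/2) \<odot> (?c \<oplus> ?d)) = c \<oplus> d"
  using T(1) by (simp add: smult_add_r)
 ultimately show ?thesis by simp
qed

lemma Pos_root:
 assumes "Pos c"
 obtains b where "b <: A" "star A b = b" "c = b \<otimes> b"
  "!!z. z <: A ==> z \<otimes> c = c \<otimes> z ==> z \<otimes> b = b \<otimes> z"
proof -
 have cd [simp]: "c <: A" "star A c = c" using assms by (auto simp: Pos_closed Pos_star)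
 define T where "T = nrm A c + 1"
 have T: "T > 0" "nrm A c \<le> T" using N_nonneg[of c] unfolding T_def by (simp_all del: N_nonneg)
 let ?c = "complex_of_real (1 / T) \<odot> c"
 have "nrm A (\<one> \<ominus> ?c) \<le> 1" using T assms by (auto intro!: Pos_nrm Pos_scale simp: nrm_scale norm_divide simp del: of_real_divide)
 moreover have "?c <: A" "star A ?c = ?c" by (auto simp: star_scale)
 ultimately obtain b where b: "b <: A" "star A b = b" "?c = b \<otimes> b"
  "!!z. z <: A ==> z \<otimes> ?c = ?c \<otimes> z ==> z \<otimes> b = b \<otimes> z" using root_one_minus by metis
 show ?thesis
 proof (rule that[of "complex_of_real (sqrt T) \<odot> b"])
  have "c = complex_of_real T \<odot> ?c" using T by simp
  also have "\<dots> = (complex_of_real (sqrt T) \<odot> b) \<otimes> (complex_of_real (sqrt T) \<odot> b)"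
   unfolding b(3) using T b(1) by (simp add: mult_scale_left mult_scale_right flip: of_real_mult)
  finally show "c = (complex_of_real (sqrt T) \<odot> b) \<otimes> (complex_of_real (sqrt T) \<odot> b)" .
  fix z assume "z <: A" "z \<otimes> c = c \<otimes> z"
  thus "z \<otimes> (complex_of_real (sqrt T) \<odot> b) = (complex_of_real (sqrt T) \<odot> b) \<otimes> z"
   using b(1) b(4)[of z] by (simp add: mult_scale_left mult_scale_right)
 qed (use b(1,2) in \<open>simp_all add: star_scale\<close>)
qed

text \<open>Commuting square roots \<open>b\<close>, \<open>c\<close> of \<open>x\<close> and \<open>1 - x\<close> give a unitary \<open>b + ic\<close>.\<close>

lemma Pos_le_one:
 assumes "Pos x" "Pos (\<one> \<ominus> x)" shows "nrm A x \<le> 1"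
proof -
 have x: "x <: A" using assms(1) by (rule Pos_closed)
 obtain b where b: "b <: A" "star A b = b" "x = b \<otimes> b"
  "!!z. z <: A ==> z \<otimes> x = x \<otimes> z ==> z \<otimes> b = b \<otimes> z" using Pos_root[OF assms(1)] by metis
 obtain c where c: "c <: A" "star A c = c" "\<one> \<ominus> x = c \<otimes> c"
  "!!z. z <: A ==> z \<otimes> (\<one> \<ominus> x) = (\<one> \<ominus> x) \<otimes> z ==> z \<otimes> c = c \<otimes> z" using Pos_root[OF assms(2)] by metis
 have "b \<otimes> x = x \<otimes> b" using b(1) by (simp add: b(3) mult_assoc)
 hence bc: "b \<otimes> c = c \<otimes> b" using b(1) x by (intro c(4)) (auto simp: mult_minus_l mult_minus_r)
 define u where "u = b \<oplus> \<i> \<odot> c"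
 have u: "u <: A" using b(1) c(1) by (auto simp: u_def)
 have su: "star A u = b \<oplus> (- \<i>) \<odot> c" unfolding u_def using b(1,2) c(1,2) by (simp add: star_add star_scale)
 have "star A u \<otimes> u = b \<otimes> b \<oplus> c \<otimes> c \<oplus> (\<i> \<odot> (b \<otimes> c) \<oplus> (- \<i>) \<odot> (c \<otimes> b))"
  unfolding su unfolding u_def using b(1) c(1)
  by (simp add: mult_add_left mult_add_right mult_scale_left mult_scale_right smult_add_r M.a_ac)
 also have "\<dots> = x \<oplus> (\<one> \<ominus> x)" using b(1) c(1) x bc by (simp add: neg_smult M.r_neg b(3)[symmetric] c(3)[symmetric])
 also have "\<dots> = \<one>" using x by algebra
 finally have nu: "nrm A u \<le> 1" using unitary_nrm u by blast
 have "b \<oplus> b = u \<oplus> star A u"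
 proof -
  have "u \<oplus> star A u = (b \<oplus> b) \<oplus> (\<i> \<odot> c \<oplus> (- \<i>) \<odot> c)" unfolding su unfolding u_def using b(1) c(1) by (simp add: M.a_ac)
  thus ?thesis using b(1) c(1) by (simp add: neg_smult M.r_neg)
 qed
 hence "b = (1/2) \<odot> (u \<oplus> star A u)" using half_half[OF b(1)] by simp
 hence "nrm A b \<le> (1/2) * (nrm A u + nrm A (star A u))"
  using nrm_triangle[of u "star A u"] u by (simp add: nrm_scale)
 hence "nrm A b \<le> 1" using nu u by simp
 hence "(nrm A b)\<^sup>2 \<le> 1\<^sup>2" using b(1) by (intro power_mono) auto
 thus ?thesis using b(1,2,3) by (simp add: nrm_sa_square)
qed

text \<open>For T slightly above ||x + z||, 1 - x/T is the sum of the positive elements 1 - (x +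
  z)/T and z/T, so \<open>Pos_le_one\<close> bounds x/T.\<close>

lemma Pos_mono:
 assumes x: "Pos x" and z: "Pos z" shows "nrm A x \<le> nrm A (x \<oplus> z)"
proof (rule field_le_epsilon)
 fix e :: real assume e: "e > 0"
 let ?y = "x \<oplus> z"
 have c [simp]: "x <: A" "z <: A" "star A x = x" "star A z = z"
  using x z by (auto simp: Pos_closed Pos_star)
 define T where "T = nrm A ?y + e"
 have T: "T > 0" "nrm A ?y \<le> T" using e unfolding T_def by (auto intro: add_nonneg_pos)
 let ?t = "complex_of_real (1 / T)"
 have "Pos (\<one> \<ominus> ?t \<odot> ?y)"
 proof (rule Pos_I)
  have "\<one> \<ominus> (\<one> \<ominus> ?t \<odot> ?y) = ?t \<odot> ?y" using c(1,2) by algebra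
  thus "nrm A (\<one> \<ominus> (\<one> \<ominus> ?t \<odot> ?y)) \<le> 1" using T by (simp add: nrm_scale norm_divide)
 qed (auto simp: star_minus star_scale star_add)
 moreover have "Pos (?t \<odot> z)" using T z by (intro Pos_scale) auto
 ultimately have "Pos ((\<one> \<ominus> ?t \<odot> ?y) \<oplus> ?t \<odot> z)" by (rule Pos_add)
 also have "(\<one> \<ominus> ?t \<odot> ?y) \<oplus> ?t \<odot> z = \<one> \<ominus> ?t \<odot> x" using c(1,2) by algebra
 finally have "nrm A (?t \<odot> x) \<le> 1" using T x by (intro Pos_le_one Pos_scale) auto
 moreover have "nrm A (?t \<odot> x) = nrm A x / T" using T by (simp add: nrm_scale norm_divide)
 ultimately have "nrm A x \<le> T" using T by simp
 thus "nrm A x \<le> nrm A ?y + e" by (simp add: T_def)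
qed

end

context unital_cstar
begin

lemma unital_pow_intertwine:
 assumes "r <: A" "s <: A" "y <: A" "r \<otimes> y = y \<otimes> s"
 shows "r [^] (n::nat) \<otimes> y = y \<otimes> s [^] n"
proof (induction n)
 case (Suc n)
 have "r [^] Suc n \<otimes> y = r [^] n \<otimes> (r \<otimes> y)" using assms by (simp add: mult_assoc)
 also have "\<dots> = (r [^] n \<otimes> y) \<otimes> s" using assms by (simp add: mult_assoc)
 also have "\<dots> = y \<otimes> s [^] Suc n" unfolding Suc using assms by (simp add: mult_assoc)
 finally show ?case .
qed (use assms in simp)

text \<open>If \<open>y\<^sup>* y = - p\<close> with \<open>p = b\<^sup>2\<close> and \<open>y y\<^sup>*\<close> is positive, then \<open>p (1 + e p)\<^sup>n\<close> stays bounded, while it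
 dominates \<open>n e p\<^sup>2\<close>.\<close>

lemma neg_square_zero:
 assumes y: "y <: A" and b: "b <: A" "star A b = b" and yb: "star A y \<otimes> y = \<ominus> (b \<otimes> b)"
  and P: "Pos (y \<otimes> star A y)"
 shows "b = \<zero>"
proof -
 define T where "T = nrm A (y \<otimes> star A y) + 1"
 define e where "e = 1 / T"
 have T: "T > 0" "nrm A (y \<otimes> star A y) \<le> T" using N_nonneg[of "y \<otimes> star A y"] y unfolding T_def by (simp_all del: N_nonneg)
 have e: "e > 0" using T by (simp add: e_def)
 \<comment> \<open>r = 1 - e y y^* is a contraction because e ||y y^*|| \<le> 1, and s = 1 + e b^2 =
   1 - e y^* y. The relation r y = y s carries the contraction over to the powers of s.\<close>
 let ?r = "\<one> \<ominus> complex_of_real e \<odot> (y \<otimes> star A y)"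
 let ?s = "pev b [:1, 0, e:]"
 have "nrm A ?r \<le> 1"
  by (intro Pos_nrm Pos_scale P) (use e y T in \<open>auto simp: nrm_scale e_def norm_divide\<close>)
 hence rn: "nrm A (?r [^] n) \<le> 1" for n :: nat
  using y by (intro nrm_pow_le_1) auto
 have s1: "?s = \<one> \<ominus> complex_of_real e \<odot> (star A y \<otimes> y)"
  unfolding yb using b by (simp add: mult_scale_right smult_neg M.minus_eq)
 have "?r \<otimes> y = y \<otimes> ?s"
  unfolding s1 using y by (simp add: mult_minus_l mult_minus_r mult_scale_left mult_scale_right mult_assoc)
 hence inter: "?r [^] n \<otimes> y = y \<otimes> ?s [^] n" for n :: nat
  using y b by (intro unital_pow_intertwine) auto
 let ?Q = "\<lambda>n::nat. [:0, 0, 1:] * [:1, 0, e:] ^ n"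
 let ?c = "(nrm A y)\<^sup>2"
 have bd: "nrm A (pev b (?Q n)) \<le> ?c" for n
 proof -
  have p2: "pev b [:0, 0, 1:] = b \<otimes> b" using b by (simp add: mult_scale_right)
  have "star A y \<otimes> (?r [^] n \<otimes> y) = \<ominus> (pev b (?Q n))"
   unfolding inter using y b p2 by (simp add: pev_mult pev_power yb mult_neg_l flip: mult_assoc del: pev_pCons mult_pCons_left)
  hence "nrm A (pev b (?Q n)) = nrm A (star A y \<otimes> (?r [^] n \<otimes> y))" using b by simp
  also have "\<dots> \<le> nrm A y * (nrm A (?r [^] n) * nrm A y)"
   using nrm_mult[of "star A y" "?r [^] n \<otimes> y"] nrm_mult[of "?r [^] n" y] y
   by (smt (verit) M.minus_closed UR.nat_pow_closed mult_closed mult_left_mono N_nonneg nrm_star one_closed smult_in star_closed)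
  also have "\<dots> \<le> nrm A y * (1 * nrm A y)" using rn y by (intro mult_left_mono mult_right_mono) auto
  finally show ?thesis by (simp add: power2_eq_square)
 qed
 have "nrm A (pev b [:0, 0, 0, 0, real n * e:]) \<le> ?c" for n
 proof -
  let ?R = "[:0, 0, 0, 0, real n * e:]"
  have "Pos (pev b ?R)" by (rule Pos_cfun[OF b cfun_pev[OF b(1)]]) (use e in \<open>simp flip: mult.assoc power2_eq_square add: mult.left_commute[of _ "real n * e"]\<close>)
  moreover have "Pos (pev b (?Q n - ?R))"
  proof (rule Pos_cfun[OF b cfun_pev[OF b(1)]])
   fix t :: real
   have "1 + real n * (e * t\<^sup>2) \<le> (1 + e * t\<^sup>2) ^ n" using e by (intro Bernoulli_inequality) (simp add: order_trans[of _ 0])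
   hence "t\<^sup>2 * (real n * (e * t\<^sup>2)) \<le> t\<^sup>2 * (1 + e * t\<^sup>2) ^ n" by (intro mult_left_mono) auto
   thus "0 \<le> poly (?Q n - ?R) t" by (simp add: power2_eq_square algebra_simps)
  qed
  ultimately have "nrm A (pev b ?R) \<le> nrm A (pev b ?R \<oplus> pev b (?Q n - ?R))" by (rule Pos_mono)
  also have "pev b ?R \<oplus> pev b (?Q n - ?R) = pev b (?Q n)" using b by (simp flip: pev_add del: pev_pCons)
  finally show ?thesis using bd by (rule order_trans)
 qed
 moreover have "nrm A (pev b [:0, 0, 0, 0, real n * e:]) = real n * e * nrm A (b \<otimes> b \<otimes> (b \<otimes> b))" for n
  using b e by (simp add: mult_scale_right nrm_scale norm_mult mult_assoc)
 ultimately have le: "real n * (e * nrm A (b \<otimes> b \<otimes> (b \<otimes> b))) \<le> ?c" for n by (metis mult.assoc)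
 have "nrm A (b \<otimes> b \<otimes> (b \<otimes> b)) = 0"
 proof (rule ccontr)
  assume ne: "nrm A (b \<otimes> b \<otimes> (b \<otimes> b)) \<noteq> 0"
  have "0 \<le> nrm A (b \<otimes> b \<otimes> (b \<otimes> b))" using b by (intro N_nonneg) auto
  hence "e * nrm A (b \<otimes> b \<otimes> (b \<otimes> b)) > 0" using e ne by simp
  then obtain n where "?c < real n * (e * nrm A (b \<otimes> b \<otimes> (b \<otimes> b)))" using reals_Archimedean3 by blast
  thus False using le[of n] by simp
 qed
 hence "nrm A b = 0" using b by (simp add: nrm_sa_square[of "b \<otimes> b"] star_mult nrm_sa_square[of b])
 thus ?thesis using b by (simp add: N_eq_0)
qed

text \<open>The negative part v of a = x^* x satisfies a v = - v^2, so y = x v has y^* y = - v^3 = -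
  b^2 for b = v sqrt(v). Since y y^* + y^* y is half of a sum of two squares of self-adjoint
  elements, y y^* is positive. Then \<open>neg_square_zero\<close> forces b = 0, hence v = 0 and a =
  a + v is positive.\<close>

theorem Pos_star_mult: assumes x: "x <: A" shows "Pos (star A x \<otimes> x)"
proof -
 define a where "a = star A x \<otimes> x"
 have a: "a <: A" "star A a = a" using x by (auto simp: a_def star_mult)
 let ?f = "\<lambda>t::real. max (- t) 0"
 obtain v where v: "cfun a ?f v"
  by (rule cfun_ex[OF a, of ?f]) (auto intro!: continuous_intros)
 have vc: "v <: A" "star A v = v" using cfun_closed[OF v] cfun_star[OF v a] by auto
 have ida: "cfun a (poly [:0, 1:]) a" using cfun_pev[OF a(1), of "[:0, 1:]"] a by simp
 have av: "a \<otimes> v = \<ominus> (v \<otimes> v)"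
 proof -
  have 1: "cfun a (%t. poly [:0, 1:] t * ?f t) (a \<otimes> v)" by (rule cfun_mult[OF ida v a(1)])
  have 2: "cfun a (%t. poly [:-1:] t * (?f t * ?f t)) (pev a [:-1:] \<otimes> (v \<otimes> v))"
   by (intro cfun_mult v a cfun_pev)
  have "a \<otimes> v = pev a [:-1:] \<otimes> (v \<otimes> v)"
   by (rule cfun_unique[OF a 1 2]) (simp add: max_def)
  also have "\<dots> = \<ominus> (v \<otimes> v)" using a vc by (simp add: mult_scale_left mult_neg_l neg_smult)
  finally show ?thesis .
 qed
 have "Pos v" by (rule Pos_cfun[OF a v]) simp
 then obtain w where w: "w <: A" "star A w = w" "v = w \<otimes> w" unfolding Pos_def by blast
 define b where "b = v \<otimes> w"
 have vw: "v \<otimes> w = w \<otimes> v" using w(1) by (simp add: w(3) mult_assoc)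
 have b: "b <: A" "star A b = b" using vc w(1,2) vw by (auto simp: b_def star_mult)
 have bb: "b \<otimes> b = v \<otimes> (v \<otimes> v)"
 proof -
  have "b \<otimes> b = v \<otimes> (w \<otimes> (v \<otimes> w))" unfolding b_def using vc w(1) by (simp add: mult_assoc)
  also have "w \<otimes> (v \<otimes> w) = (w \<otimes> w) \<otimes> v" unfolding vw using vc w(1) by (simp add: mult_assoc)
  finally show ?thesis using w(3) by simp
 qed
 define y where "y = x \<otimes> v"
 have y: "y <: A" using x vc by (simp add: y_def)
 have yy: "star A y \<otimes> y = \<ominus> (b \<otimes> b)"
 proof -
  have "star A y \<otimes> y = v \<otimes> (a \<otimes> v)" unfolding y_def a_def using x vc by (simp add: star_mult mult_assoc)
  thus ?thesis unfolding av bb using vc by (simp add: mult_neg_r)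
 qed
 let ?H = "y \<oplus> star A y" and ?K = "\<i> \<odot> (y \<ominus> star A y)"
 have "star A ?H = ?H" using y by algebra
 hence PH: "Pos (?H \<otimes> ?H)" unfolding Pos_def using y by (intro bexI[of _ ?H]) auto
 have "star A (y \<ominus> star A y) = \<ominus> (y \<ominus> star A y)" using y by algebra
 hence "star A ?K = ?K" using y by (simp add: star_scale smult_neg neg_smult)
 hence "Pos (?K \<otimes> ?K)" unfolding Pos_def using y by (intro bexI[of _ ?K]) auto
 with PH have "Pos (?H \<otimes> ?H \<oplus> ?K \<otimes> ?K)" by (rule Pos_add)
 moreover have "?H \<otimes> ?H \<oplus> ?K \<otimes> ?K = (y \<otimes> star A y \<oplus> star A y \<otimes> y) \<oplus> (y \<otimes> star A y \<oplus> star A y \<otimes> y)"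
 proof -
  have "?K \<otimes> ?K = \<ominus> ((y \<ominus> star A y) \<otimes> (y \<ominus> star A y))"
   using y neg_smult[of "(y \<ominus> star A y) \<otimes> (y \<ominus> star A y)" 1] by (simp add: mult_scale_left mult_scale_right)
  thus ?thesis using y by algebra
 qed
 ultimately have "Pos (complex_of_real (1/2) \<odot> ((y \<otimes> star A y \<oplus> star A y \<otimes> y) \<oplus> (y \<otimes> star A y \<oplus> star A y \<otimes> y)))"
  by (intro Pos_scale) auto
 hence "Pos (y \<otimes> star A y \<oplus> star A y \<otimes> y)" using y by (simp add: half_half)
 moreover have "Pos (b \<otimes> b)" using b unfolding Pos_def by blast
 ultimately have "Pos ((y \<otimes> star A y \<oplus> star A y \<otimes> y) \<oplus> b \<otimes> b)" by (rule Pos_add)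
 also have "(y \<otimes> star A y \<oplus> star A y \<otimes> y) \<oplus> b \<otimes> b = y \<otimes> star A y"
  unfolding yy using y b(1) by algebra
 finally have "b = \<zero>" by (intro neg_square_zero[OF y b yy])
 hence v3: "v \<otimes> (v \<otimes> v) = \<zero>" using bb by (metis b(1) mult_zero_l)
 have "v \<otimes> v \<otimes> (v \<otimes> v) = v \<otimes> (v \<otimes> (v \<otimes> v))" using vc(1) by (rule mult_assoc) (use vc in auto)
 hence "v \<otimes> v \<otimes> (v \<otimes> v) = \<zero>" unfolding v3 using vc by simp
 hence "nrm A v = 0"
  using vc nrm_sa_square[of "v \<otimes> v"] nrm_sa_square[of v] by (simp add: star_mult)
 hence v0: "v = \<zero>" using vc by (simp add: N_eq_0)
 have "cfun a (%t. poly [:0, 1:] t + ?f t) (a \<oplus> v)" by (rule cfun_add[OF ida v a(1)])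
 hence "Pos (a \<oplus> v)" by (rule Pos_cfun[OF a]) (simp add: max_def)
 thus ?thesis using v0 a by (simp add: a_def)
qed

end

section \<open>Hilbert modules\<close>

sublocale hilbert_module \<subseteq> X: cvec X
 by (rule cvecI) unfold_locales

context hilbert_module
begin

declare ract_closed [simp, intro] inn_closed [simp, intro]

lemma inn_add_left:
 assumes "x <: X" "y <: X" "z <: X"
 shows "inn X (x \<oplus>\<^sub>X y) z = inn X x z \<oplus>\<^sub>A inn X y z"
proof -
 have "inn X (x \<oplus>\<^sub>X y) z = star A (inn X z (x \<oplus>\<^sub>X y))" using assms by (simp add: inn_star)
 also have "\<dots> = inn X x z \<oplus>\<^sub>A inn X y z"
  using assms by (simp add: inn_add A.star_add inn_star)
 finally show ?thesis .
qed

lemma inn_scale_left: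
 assumes "x <: X" "y <: X" shows "inn X (t \<odot>\<^sub>X x) y = cnj t \<odot>\<^sub>A inn X x y"
proof -
 have "inn X (t \<odot>\<^sub>X x) y = star A (inn X y (t \<odot>\<^sub>X x))" using assms by (simp add: inn_star)
 thus ?thesis using assms by (simp add: inn_scale A.star_scale inn_star)
qed

lemma inn_ract_left:
 assumes "x <: X" "y <: X" "a <: A"
 shows "inn X (ract X x a) y = star A a \<otimes>\<^sub>A inn X x y"
proof -
 have "inn X (ract X x a) y = star A (inn X y (ract X x a))" using assms by (simp add: inn_star)
 thus ?thesis using assms by (simp add: inn_ract A.star_mult inn_star)
qed

lemma inn_linear: "x <: X ==> linear_on X A (inn X x)"
 by (auto simp: linear_on_def inn_add inn_scale)

lemma inn_zero [simp]: "x <: X ==> inn X x \<zero>\<^sub>X = \<zero>\<^sub>A" "x <: X ==> inn X \<zero>\<^sub>X x = \<zero>\<^sub>A"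
 using inn_scale[of x "\<zero>\<^sub>X" 0] inn_scale_left[of "\<zero>\<^sub>X" x 0] by auto

lemma inn_minus: "x <: X ==> y <: X ==> z <: X ==>
  inn X x (y \<ominus>\<^sub>X z) = inn X x y \<ominus>\<^sub>A inn X x z"
 by (simp add: X.M.minus_eq A.M.minus_eq X.neg_eq_smult A.neg_eq_smult inn_add inn_scale)

lemma inn_minus_left: "x <: X ==> y <: X ==> z <: X ==>
  inn X (y \<ominus>\<^sub>X z) x = inn X y x \<ominus>\<^sub>A inn X z x"
 by (simp add: X.M.minus_eq A.M.minus_eq X.neg_eq_smult A.neg_eq_smult inn_add_left inn_scale_left)

lemma inn_eqI:
 assumes "x <: X" "y <: X" "!!z. z <: X ==> inn X z x = inn X z y"
 shows "x = y"
proof -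
 have "inn X (x \<ominus>\<^sub>X y) (x \<ominus>\<^sub>X y) = \<zero>\<^sub>A" using assms by (simp add: inn_minus)
 thus ?thesis using inn_definite[of "x \<ominus>\<^sub>X y"] assms by (simp add: X.minus_eq_zero_iff)
qed

lemma ract_minus: "x <: X ==> y <: X ==> a <: A ==>
  ract X (x \<ominus>\<^sub>X y) a = ract X x a \<ominus>\<^sub>X ract X y a"
 by (simp add: X.M.minus_eq X.neg_eq_smult ract_add_left ract_scale_left)

lemma ract_zero [simp]: "a <: A ==> ract X \<zero>\<^sub>X a = \<zero>\<^sub>X" "x <: X ==> ract X x \<zero>\<^sub>A = \<zero>\<^sub>X"
 using ract_scale_left[of "\<zero>\<^sub>X" a 0] ract_scale_right[of x "\<zero>\<^sub>A" 0] by auto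

lemma hnorm_square: "x <: X ==> (hnorm A X x)\<^sup>2 = nrm A (inn X x x)"
 by (simp add: hnorm_def)

lemma hnorm_nonneg [simp]: "x <: X ==> 0 \<le> hnorm A X x"
 by (simp add: hnorm_def)

lemma hnorm_smult: "x <: X ==> hnorm A X (t \<odot>\<^sub>X x) = cmod t * hnorm A X x"
proof (rule power2_eq_imp_eq)
 assume x: "x <: X"
 show "(hnorm A X (t \<odot>\<^sub>X x))\<^sup>2 = (cmod t * hnorm A X x)\<^sup>2"
  using x by (simp add: hnorm_square inn_scale inn_scale_left A.nrm_scale power_mult_distrib)
   (simp add: power2_eq_square norm_mult)
qed auto

lemma hnorm_eq_0: "x <: X ==> hnorm A X x = 0 \<longleftrightarrow> x = \<zero>\<^sub>X"
 using inn_definite[of x] by (auto simp: hnorm_def A.N_eq_0)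

lemma hnorm_le: "x <: X ==> nrm A (inn X x x) \<le> C\<^sup>2 ==> 0 \<le> C ==> hnorm A X x \<le> C"
 using real_le_lsqrt[of C] unfolding hnorm_def by simp

lemma hnorm_ract: "x <: X ==> a <: A ==> hnorm A X (ract X x a) \<le> hnorm A X x * nrm A a"
proof (rule hnorm_le)
 assume x: "x <: X" "a <: A"
 have "nrm A (inn X (ract X x a) (ract X x a)) = nrm A (star A a \<otimes>\<^sub>A (inn X x x \<otimes>\<^sub>A a))"
  using x by (simp add: inn_ract inn_ract_left A.mult_assoc)
 also have "\<dots> \<le> nrm A (star A a) * nrm A (inn X x x \<otimes>\<^sub>A a)" using x by (intro A.nrm_mult) auto
 also have "\<dots> \<le> nrm A (star A a) * (nrm A (inn X x x) * nrm A a)"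
  using x by (intro mult_left_mono A.nrm_mult) auto
 finally show "nrm A (inn X (ract X x a) (ract X x a)) \<le> (hnorm A X x * nrm A a)\<^sup>2"
  using x by (simp add: power_mult_distrib hnorm_square) (simp add: power2_eq_square mult_ac)
qed auto

end

subsection \<open>Adjointable operators\<close>

text \<open>The Cauchy--Schwarz inequality holds in every Hilbert module; as a temporary assumption it
 makes adjointable operators on \<open>A\<close> itself available before it is proved.\<close>

locale hilbert_module_cs = hilbert_module A X
 for A :: "('a, 'm) cstar_scheme" and X :: "('a, 'x, 'n) bimod_scheme" +
 assumes inn_bound: "x <: X ==> y <: X ==> nrm A (inn X x y) \<le> hnorm A X x * hnorm A X y"

sublocale hilbert_module_cs \<subseteq> X: normed_vec X "hnorm A X"
proof unfold_locales
 fix x y assume xy: "x <: X" "y <: X"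
 show "hnorm A X (x \<oplus>\<^sub>X y) \<le> hnorm A X x + hnorm A X y"
 proof (rule hnorm_le)
  have "inn X (x \<oplus>\<^sub>X y) (x \<oplus>\<^sub>X y) = (inn X x x \<oplus>\<^sub>A inn X y x) \<oplus>\<^sub>A (inn X x y \<oplus>\<^sub>A inn X y y)"
   using xy by (simp add: inn_add inn_add_left)
  also have "nrm A \<dots> \<le> nrm A (inn X x x \<oplus>\<^sub>A inn X y x) + nrm A (inn X x y \<oplus>\<^sub>A inn X y y)"
   using xy by (intro A.nrm_triangle) auto
  also have "\<dots> \<le> (nrm A (inn X x x) + nrm A (inn X y x)) + (nrm A (inn X x y) + nrm A (inn X y y))"
   using xy by (intro add_mono A.nrm_triangle) auto
  also have "\<dots> \<le> (hnorm A X x + hnorm A X y)\<^sup>2"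
   using inn_bound[OF xy] inn_bound[OF xy(2,1)] xy
   by (simp add: power2_sum hnorm_square mult.commute[of "hnorm A X y"])
  finally show "nrm A (inn X (x \<oplus>\<^sub>X y) (x \<oplus>\<^sub>X y)) \<le> (hnorm A X x + hnorm A X y)\<^sup>2" .
 qed (use xy in auto)
qed (auto simp: hnorm_eq_0 hnorm_smult)

context hilbert_module_cs
begin

abbreviation hn :: "'x => real" where "hn \<equiv> hnorm A X"

lemma vlim_inn: "x <: X ==> X.vlim f l ==> A.vlim (%n. inn X x (f n)) (inn X x l)"
 by (rule vlim_map[OF X.normed_vec_axioms A.normed_vec_axioms inn_linear, where C = "hn x"])
  (auto simp: inn_bound)

lemma vlim_inn_left: "x <: X ==> X.vlim f l ==> A.vlim (%n. inn X (f n) x) (inn X l x)"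
proof -
 assume x: "x <: X" and f: "X.vlim f l"
 have "A.vlim (%n. star A (inn X x (f n))) (star A (inn X x l))" by (intro A.vlim_star vlim_inn x f)
 thus ?thesis using x f by (simp add: inn_star X.vlimD)
qed

text \<open>Naming the adjoint makes the relation symmetric, so each fact about T is available for
  its adjoint.\<close>

definition adjoint_pair :: "('x => 'x) => ('x => 'x) => bool" where
 "adjoint_pair T S \<longleftrightarrow> T \<in> carrier X \<rightarrow>\<^sub>E carrier X \<and> S \<in> carrier X \<rightarrow>\<^sub>E carrier X \<and>
   (\<forall>x\<in>carrier X. \<forall>y\<in>carrier X. inn X (T x) y = inn X x (S y))"

lemma adjointable_iff: "T \<in> adjointable X \<longleftrightarrow> (\<exists>S. adjoint_pair T S)"
 by (auto simp: adjointable_def adjoint_pair_def)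

lemma adjoint_pair_sym: "adjoint_pair T S ==> adjoint_pair S T"
 unfolding adjoint_pair_def by (metis PiE_mem inn_star)

lemma adjoint_pair_closed [simp]:
 "adjoint_pair T S ==> x <: X ==> T x <: X"
 "adjoint_pair T S ==> x <: X ==> S x <: X"
 by (auto simp: adjoint_pair_def)

lemma adjoint_pair_inn:
 "adjoint_pair T S ==> x <: X ==> y <: X ==> inn X (T x) y = inn X x (S y)"
 by (simp add: adjoint_pair_def)

lemma adjoint_pair_inn':
 "adjoint_pair T S ==> x <: X ==> y <: X ==> inn X (S x) y = inn X x (T y)"
 using adjoint_pair_inn[OF adjoint_pair_sym] .

lemma adjoint_pairI:
 assumes "!!x. x <: X ==> f x <: X" "!!x. x <: X ==> g x <: X"
  "!!x y. x <: X ==> y <: X ==> inn X (f x) y = inn X x (g y)"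
 shows "adjoint_pair (\<lambda>x\<in>carrier X. f x) (\<lambda>x\<in>carrier X. g x)"
 using assms by (auto simp: adjoint_pair_def)

lemma adjoint_pair_ext:
 assumes "adjoint_pair T S" "adjoint_pair T' S'" "!!x. x <: X ==> T x = T' x"
 shows "T = T'"
 using assms unfolding adjoint_pair_def by (intro PiE_ext[of T "carrier X" "%_. carrier X" T']) auto

lemma adjoint_pair_unique: assumes "adjoint_pair T S" "adjoint_pair T S'" shows "S = S'"
proof (rule adjoint_pair_ext[OF assms[THEN adjoint_pair_sym]])
 fix x assume x: "x <: X"
 show "S x = S' x"
 proof (rule inn_eqI)
  fix z assume "z <: X"
  thus "inn X z (S x) = inn X z (S' x)"
   using adjoint_pair_inn[OF assms(1) _ x] adjoint_pair_inn[OF assms(2) _ x] by metis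
 qed (use assms x in auto)
qed

lemma adjoint_eq: "adjoint_pair T S ==> adjoint X T = S"
 unfolding adjoint_def
proof (rule the_equality)
 assume T: "adjoint_pair T S"
 thus "S \<in> carrier X \<rightarrow>\<^sub>E carrier X \<and> (\<forall>x\<in>carrier X. \<forall>y\<in>carrier X. inn X (T x) y = inn X x (S y))"
  by (simp add: adjoint_pair_def)
 fix S' assume "S' \<in> carrier X \<rightarrow>\<^sub>E carrier X \<and> (\<forall>x\<in>carrier X. \<forall>y\<in>carrier X. inn X (T x) y = inn X x (S' y))"
 hence "adjoint_pair T S'" using T by (simp add: adjoint_pair_def)
 thus "S' = S" using adjoint_pair_unique T by blast
qed

lemma adjoint_pair_adjoint: "T \<in> adjointable X ==> adjoint_pair T (adjoint X T)"
 using adjointable_iff adjoint_eq by metis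

lemma adjoint_pair_linear: assumes "adjoint_pair T S" shows "linear_on X X T"
 unfolding linear_on_def
proof (intro conjI funcsetI ballI allI)
 note [simp] = adjoint_pair_closed[OF assms] adjoint_pair_inn'[OF assms, symmetric]
 show "T (x \<oplus>\<^sub>X y) = T x \<oplus>\<^sub>X T y" if "x <: X" "y <: X" for x y
  using that by (intro inn_eqI) (auto simp: inn_add)
 show "T (c \<odot>\<^sub>X x) = c \<odot>\<^sub>X T x" if "x <: X" for c x
  using that by (intro inn_eqI) (auto simp: inn_scale)
qed (use assms in auto)

lemma adjoint_pair_ract: assumes "adjoint_pair T S" "x <: X" "a <: A"
 shows "T (ract X x a) = ract X (T x) a"
proof -
 note [simp] = adjoint_pair_closed[OF assms(1)] adjoint_pair_inn'[OF assms(1), symmetric]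
 show ?thesis using assms(2,3) by (intro inn_eqI) (auto simp: inn_ract)
qed

lemmas XX = X.cvec_axioms X.cvec_axioms

text \<open>A gliding hump argument: if \<open>T\<close> were unbounded, the functionals \<open>\<langle>T z, \<cdot>\<rangle> = \<langle>z, S \<cdot>\<rangle>\<close>, for \<open>\<parallel>z\<parallel> \<le> 1\<close>,
 would be pointwise bounded but not uniformly bounded.\<close>

lemma adjoint_pair_bounded:
 assumes TS: "adjoint_pair T S"
 obtains C where "0 \<le> C" "!!x. x <: X ==> hn (T x) \<le> C * hn x"
proof (rule ccontr)
 note lin = adjoint_pair_linear[OF TS]
 note [simp] = adjoint_pair_closed[OF TS]
 note goal = that
 assume nt: "\<not> thesis"
 have unb: "\<exists>x\<in>carrier X. C * hn x < hn (T x)" if C: "0 \<le> C" for C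
  using goal[OF C] nt by (meson not_le)
 \<comment> \<open>The factor is what the last estimate uses up: of \<open>h n\<close> there remains
   (1/2 - 1/3) 4^(-n) = 4^(-n) / 6, and this has to reach n + 1.\<close>
 have "\<exists>z. z <: X \<and> hn z \<le> 1 \<and> 6 * 4 ^ n * (real n + 1) < hn (T z)" for n :: nat
 proof -
  obtain x where x: "x <: X" "6 * 4 ^ n * (real n + 1) * hn x < hn (T x)"
   using unb[of "6 * 4 ^ n * (real n + 1)"] by auto
  have "hn x \<noteq> 0"
   using x linear_on_zero[OF XX lin] by (auto simp: hnorm_eq_0)
  hence hx: "hn x > 0" using x by (simp add: order_less_le)
  let ?z = "complex_of_real (1 / hn x) \<odot>\<^sub>X x"
  have "hn ?z \<le> 1" using x hx by (simp add: hnorm_smult norm_divide)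
  moreover have "hn (T ?z) = hn (T x) / hn x"
   using x hx by (simp add: linear_on_smult[OF XX lin] hnorm_smult norm_divide)
  ultimately show ?thesis using x hx by (intro exI[of _ ?z]) (simp add: pos_less_divide_eq)
 qed
 then obtain z where z: "!!n. z n <: X" "!!n. hn (z n) \<le> 1" "!!n::nat. 6 * 4 ^ n * (real n + 1) < hn (T (z n))"
  by metis
 define h where "h n = hn (T (z n))" for n
 have h: "h n > 0" for n using z(3)[of n] unfolding h_def
  by (rule le_less_trans[rotated]) simp
 define e where "e n = complex_of_real (1 / h n) \<odot>\<^sub>X T (z n)" for n
 have e: "e n <: X" "hn (e n) = 1" for n
  using z h[of n] by (auto simp: e_def hnorm_smult norm_divide h_def)
 define f where "f n x = inn X (T (z n)) x" for n x
 have f: "f n x <: A" if "x <: X" for n x using that z by (simp add: f_def)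
 have fb: "nrm A (f n x) \<le> h n * hn x" if "x <: X" for n x
  using that z inn_bound[of "T (z n)" x] by (simp add: f_def h_def)
 have fS: "nrm A (f n x) \<le> hn (S x)" if "x <: X" for n x
 proof -
  have "nrm A (f n x) \<le> hn (z n) * hn (S x)"
   using that z inn_bound[of "z n" "S x"] by (simp add: f_def adjoint_pair_inn[OF TS])
  also have "\<dots> \<le> 1 * hn (S x)" using z that by (intro mult_right_mono) auto
  finally show ?thesis by simp
 qed
 have fe: "nrm A (f n (e n)) = h n" for n
  using z h[of n] by (simp add: f_def e_def inn_scale A.nrm_scale norm_divide hnorm_square[symmetric] power2_eq_square flip: h_def)
 \<comment> \<open>A hump of size 4^(-n) is added only if \<open>f n\<close> is still small at the
   current point, so \<open>f n\<close> is large after this step in either case. All later humps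
   together have norm at most 4^(-n) / 3.\<close>
 define y where "y = rec_nat \<zero>\<^sub>X (%n u. if 1/2 * (1/4) ^ n * h n \<le> nrm A (f n u) then u
   else u \<oplus>\<^sub>X complex_of_real ((1/4) ^ n) \<odot>\<^sub>X e n)"
 have y0: "y 0 = \<zero>\<^sub>X" by (simp add: y_def)
 have ySuc: "y (Suc n) = (if 1/2 * (1/4) ^ n * h n \<le> nrm A (f n (y n)) then y n
   else y n \<oplus>\<^sub>X complex_of_real ((1/4) ^ n) \<odot>\<^sub>X e n)" for n by (simp add: y_def)
 have y: "y n <: X" for n by (induction n) (auto simp: y0 ySuc e)
 have step: "hn (y (Suc n) \<ominus>\<^sub>X y n) \<le> (1/4) ^ n" for n
 proof (cases "1/2 * (1/4) ^ n * h n \<le> nrm A (f n (y n))")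
  case True
  thus ?thesis using y[of n] by (simp add: ySuc)
 next
  case False
  have "(y n \<oplus>\<^sub>X w) \<ominus>\<^sub>X y n = w" if "w <: X" for w using y[of n] that by algebra
  thus ?thesis using False y[of n] e by (simp add: ySuc hnorm_smult norm_power norm_divide)
 qed
 have big: "1/2 * (1/4) ^ n * h n \<le> nrm A (f n (y (Suc n)))" for n
 proof (cases "1/2 * (1/4) ^ n * h n \<le> nrm A (f n (y n))")
  case True
  thus ?thesis by (simp add: ySuc)
 next
  case False
  let ?w = "complex_of_real ((1/4) ^ n) \<odot>\<^sub>X e n"
  have w: "?w <: X" using e by simp
  have "nrm A (f n ?w) = (1/4) ^ n * h n"
   using e[of n] z fe[of n] by (simp add: f_def inn_scale A.nrm_scale norm_power norm_divide)
  moreover have "f n ?w = f n (y n \<oplus>\<^sub>X ?w) \<ominus>\<^sub>A f n (y n)"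
  proof -
   have "f n (y n \<oplus>\<^sub>X ?w) = f n (y n) \<oplus>\<^sub>A f n ?w" unfolding f_def using y[of n] w z by (intro inn_add) auto
   thus ?thesis using f[OF y, of n n] f[OF w, of n] by (simp, algebra)
  qed
  moreover have "nrm A (f n (y n \<oplus>\<^sub>X ?w) \<ominus>\<^sub>A f n (y n)) \<le> nrm A (f n (y n \<oplus>\<^sub>X ?w)) + nrm A (f n (y n))"
   using f y w by (intro A.N_minus) auto
  ultimately have "(1/4) ^ n * h n \<le> nrm A (f n (y (Suc n))) + nrm A (f n (y n))"
   using False by (simp add: ySuc)
  thus ?thesis using False by simp
 qed
 obtain l where l: "X.vlim y l" "!!n. hn (l \<ominus>\<^sub>X y n) \<le> (1/4) ^ n / (1 - 1/4)"
  using X.vlim_geometric[OF hcomplete y step] by auto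
 have lc: "l <: X" using l(1) by (rule X.vlimD)
 have "real n + 1 \<le> hn (S l)" for n
 proof -
  have "f n (y (Suc n)) = f n l \<ominus>\<^sub>A f n (l \<ominus>\<^sub>X y (Suc n))"
  proof -
   have "f n (l \<ominus>\<^sub>X y (Suc n)) = f n l \<ominus>\<^sub>A f n (y (Suc n))"
    unfolding f_def using lc y[of "Suc n"] z by (intro inn_minus) auto
   thus ?thesis using f[OF lc, of n] f[OF y, of n "Suc n"] by (simp, algebra)
  qed
  hence "nrm A (f n (y (Suc n))) \<le> nrm A (f n l) + nrm A (f n (l \<ominus>\<^sub>X y (Suc n)))"
   using f lc y A.N_minus[of "f n l" "f n (l \<ominus>\<^sub>X y (Suc n))"] by auto
  also have "nrm A (f n (l \<ominus>\<^sub>X y (Suc n))) \<le> h n * hn (l \<ominus>\<^sub>X y (Suc n))"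
   using lc y by (intro fb) auto
  also have "\<dots> \<le> h n * ((1/4) ^ Suc n / (1 - 1/4))" using h[of n] l(2)[of "Suc n"] by (intro mult_left_mono) auto
  finally have "1/2 * (1/4) ^ n * h n \<le> nrm A (f n l) + h n * ((1/4) ^ n / 3)" using big[of n] by simp
  hence "(1/4) ^ n / 6 * h n \<le> nrm A (f n l)" by (simp add: field_simps)
  moreover have "(1/4) ^ n / 6 * (6 * 4 ^ n * (real n + 1)) \<le> (1/4) ^ n / 6 * h n"
   using z(3)[of n] by (intro mult_left_mono) (auto simp: h_def)
  moreover have "(1/4) ^ n / 6 * (6 * 4 ^ n * (real n + 1)) = real n + 1"
   by (simp add: power_one_over field_simps)
  ultimately show ?thesis using fS[OF lc, of n] by linarith
 qed
 moreover obtain n where "hn (S l) < real n" using reals_Archimedean2 by blast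
 ultimately show False by (metis add_increasing2 not_less zero_le_one less_le_trans less_irrefl le_less_trans order_less_imp_le)
qed

lemma op_norm_bdd:
 assumes "0 \<le> C" "!!x. x <: X ==> hn (T x) \<le> C * hn x"
 shows "bdd_above {hn (T x) |x. x <: X \<and> hn x \<le> 1}"
proof (rule bdd_aboveI[of _ C])
 fix v assume "v \<in> {hn (T x) |x. x <: X \<and> hn x \<le> 1}"
 then obtain x where "x <: X" "hn x \<le> 1" "v = hn (T x)" by auto
 thus "v \<le> C" using assms(2)[of x] mult_left_mono[of "hn x" 1 C] assms(1) by simp
qed

lemma op_norm_le:
 assumes "0 \<le> C" "!!x. x <: X ==> hn (T x) \<le> C * hn x" shows "op_norm A X T \<le> C"
 unfolding op_norm_def
proof (rule cSup_least)
 show "{hn (T x) |x. x <: X \<and> hn x \<le> 1} \<noteq> {}" by (auto intro!: exI[of _ "\<zero>\<^sub>X"])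
 fix v assume "v \<in> {hn (T x) |x. x <: X \<and> hn x \<le> 1}"
 then obtain x where "x <: X" "hn x \<le> 1" "v = hn (T x)" by auto
 thus "v \<le> C" using assms(2)[of x] mult_left_mono[of "hn x" 1 C] assms(1) by simp
qed

text \<open>The operator norm is a supremum of reals and dominates its members only because the set
  is bounded, which is \<open>adjoint_pair_bounded\<close>.\<close>

lemma op_norm_ge:
 assumes T: "T \<in> adjointable X" and x: "x <: X" shows "hn (T x) \<le> op_norm A X T * hn x"
proof -
 note TS = adjoint_pair_adjoint[OF T]
 note lin = adjoint_pair_linear[OF TS]
 obtain C where C: "0 \<le> C" "!!x. x <: X ==> hn (T x) \<le> C * hn x" using adjoint_pair_bounded[OF TS] by metis
 show ?thesis
 proof (cases "hn x = 0")
  case True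
  thus ?thesis using C(2)[OF x] by simp
 next
  case False
  hence hx: "hn x > 0" using x by (simp add: order_less_le)
  let ?z = "complex_of_real (1 / hn x) \<odot>\<^sub>X x"
  have "hn ?z \<le> 1" using x hx by (simp add: hnorm_smult norm_divide)
  hence "hn (T ?z) \<le> op_norm A X T" unfolding op_norm_def
   using x by (intro cSup_upper op_norm_bdd[OF C]) auto
  moreover have "hn (T ?z) = hn (T x) / hn x"
   using x hx TS by (simp add: linear_on_smult[OF XX lin] hnorm_smult norm_divide)
  ultimately show ?thesis using hx by (simp add: divide_le_eq)
 qed
qed

lemma op_norm_nonneg: "T \<in> adjointable X ==> 0 \<le> op_norm A X T"
proof -
 assume T: "T \<in> adjointable X"
 obtain C where C: "0 \<le> C" "!!x. x <: X ==> hn (T x) \<le> C * hn x"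
  using adjoint_pair_bounded[OF adjoint_pair_adjoint[OF T]] by metis
 have "hn (T \<zero>\<^sub>X) \<le> op_norm A X T" unfolding op_norm_def
  by (intro cSup_upper op_norm_bdd[OF C]) auto
 moreover have "0 \<le> hn (T \<zero>\<^sub>X)" using adjoint_pair_adjoint[OF T] by simp
 ultimately show ?thesis by simp
qed

end

section \<open>The adjointable operators as a unital C*-algebra\<close>

lemma LL_simps [simp]:
 "carrier (LL A X) = adjointable X" "mult (LL A X) = compose (carrier X)"
 "one (LL A X) = (\<lambda>x\<in>carrier X. x)" "zero (LL A X) = (\<lambda>x\<in>carrier X. \<zero>\<^sub>X)"
 "add (LL A X) = (%S T. \<lambda>x\<in>carrier X. S x \<oplus>\<^sub>X T x)"
 "smult (LL A X) = (%t T. \<lambda>x\<in>carrier X. t \<odot>\<^sub>X T x)"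
 "star (LL A X) = adjoint X" "nrm (LL A X) = op_norm A X"
 by (simp_all add: LL_def)

context hilbert_module_cs
begin

lemma adjointable_closed [simp, intro]: "T \<in> adjointable X ==> x <: X ==> T x <: X"
 by (auto simp: adjointable_def)

lemma adjointable_ext:
 assumes "T \<in> adjointable X" "S \<in> adjointable X" "!!x. x <: X ==> T x = S x" shows "T = S"
 using adjoint_pair_ext[OF adjoint_pair_adjoint[OF assms(1)] adjoint_pair_adjoint[OF assms(2)] assms(3)] .

lemma adjointableI:
 assumes "!!x. x <: X ==> f x <: X" "!!x. x <: X ==> g x <: X"
  "!!x y. x <: X ==> y <: X ==> inn X (f x) y = inn X x (g y)"
 shows "(\<lambda>x\<in>carrier X. f x) \<in> adjointable X"
 using adjoint_pairI[OF assms] adjointable_iff by blast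

lemma adjoint_inn: "T \<in> adjointable X ==> x <: X ==> y <: X ==>
  inn X (T x) y = inn X x (adjoint X T y)"
 by (rule adjoint_pair_inn[OF adjoint_pair_adjoint])

lemma adjoint_inn': "T \<in> adjointable X ==> x <: X ==> y <: X ==>
  inn X (adjoint X T x) y = inn X x (T y)"
 by (rule adjoint_pair_inn'[OF adjoint_pair_adjoint])

lemma adjoint_adjointable [simp, intro]: "T \<in> adjointable X ==> adjoint X T \<in> adjointable X"
 using adjoint_pair_sym[OF adjoint_pair_adjoint] adjointable_iff by blast

lemma adjoint_adjoint [simp]: "T \<in> adjointable X ==> adjoint X (adjoint X T) = T"
 by (rule adjoint_eq[OF adjoint_pair_sym[OF adjoint_pair_adjoint]])

lemma adjoint_unique:
 assumes T: "T \<in> adjointable X" and S: "S \<in> adjointable X"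
  and eq: "!!x y. x <: X ==> y <: X ==> inn X (T x) y = inn X x (S y)"
 shows "adjoint X T = S"
proof (rule adjointable_ext)
 fix y assume y: "y <: X"
 show "adjoint X T y = S y"
  using T S y by (intro inn_eqI) (auto simp: adjoint_inn[symmetric] eq)
qed (use T S in auto)

lemma LL_add_closed: "T \<in> adjointable X ==> S \<in> adjointable X ==> (\<lambda>x\<in>carrier X. T x \<oplus>\<^sub>X S x) \<in> adjointable X"
 by (rule adjointableI[where g = "%x. adjoint X T x \<oplus>\<^sub>X adjoint X S x"])
  (auto simp: inn_add inn_add_left adjoint_inn)

lemma LL_smult_closed: "T \<in> adjointable X ==> (\<lambda>x\<in>carrier X. t \<odot>\<^sub>X T x) \<in> adjointable X"
 by (rule adjointableI[where g = "%x. cnj t \<odot>\<^sub>X adjoint X T x"])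
  (auto simp: inn_scale inn_scale_left adjoint_inn)

lemma LL_compose_closed: "T \<in> adjointable X ==> S \<in> adjointable X ==> compose (carrier X) T S \<in> adjointable X"
 unfolding compose_def
 by (rule adjointableI[where g = "%x. adjoint X S (adjoint X T x)"]) (auto simp: adjoint_inn)

lemma LL_zero_closed: "(\<lambda>x\<in>carrier X. \<zero>\<^sub>X) \<in> adjointable X"
 by (rule adjointableI[where g = "%x. \<zero>\<^sub>X"]) auto

lemma LL_one_closed: "(\<lambda>x\<in>carrier X. x) \<in> adjointable X"
 by (rule adjointableI[where g = "%x. x"]) auto

lemmas LL_closed = LL_add_closed LL_smult_closed LL_compose_closed LL_zero_closed LL_one_closed

lemma adjointable_linear: "T \<in> adjointable X ==> linear_on X X T"
 by (rule adjoint_pair_linear[OF adjoint_pair_adjoint])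

lemma adjointable_add: "T \<in> adjointable X ==> x <: X ==> y <: X ==> T (x \<oplus>\<^sub>X y) = T x \<oplus>\<^sub>X T y"
 using linear_on_add[OF XX adjointable_linear] .

lemma adjointable_smult: "T \<in> adjointable X ==> x <: X ==> T (c \<odot>\<^sub>X x) = c \<odot>\<^sub>X T x"
 using linear_on_smult[OF XX adjointable_linear] .

lemma adjointable_zero [simp]: "T \<in> adjointable X ==> T \<zero>\<^sub>X = \<zero>\<^sub>X"
 using linear_on_zero[OF XX adjointable_linear] .

lemma adjointable_minus: "T \<in> adjointable X ==> x <: X ==> y <: X ==> T (x \<ominus>\<^sub>X y) = T x \<ominus>\<^sub>X T y"
 using linear_on_minus[OF XX adjointable_linear] .

lemma adjointable_ract: "T \<in> adjointable X ==> x <: X ==> a <: A ==> T (ract X x a) = ract X (T x) a"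
 by (rule adjoint_pair_ract[OF adjoint_pair_adjoint])

lemma cvec_LL: "cvec (LL A X)"
proof (rule cvec_intro)
 show "abelian_group (LL A X)"
 proof (rule abelian_groupI)
  fix T assume T: "T <: LL A X"
  show "\<exists>S\<in>carrier (LL A X). S \<oplus>\<^sub>(LL A X) T = \<zero>\<^sub>(LL A X)"
  proof
   show "(\<lambda>x\<in>carrier X. (-1) \<odot>\<^sub>X T x) <: LL A X" using T LL_smult_closed by simp
   show "(\<lambda>x\<in>carrier X. (-1) \<odot>\<^sub>X T x) \<oplus>\<^sub>(LL A X) T = \<zero>\<^sub>(LL A X)"
    using T by (auto simp: X.neg_eq_smult[symmetric] X.M.l_neg intro!: restrict_ext)
  qed
 next
  fix T assume "T <: LL A X"
  hence T: "T \<in> adjointable X" by simp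
  show "\<zero>\<^sub>(LL A X) \<oplus>\<^sub>(LL A X) T = T"
   using adjointable_ext[OF LL_add_closed[OF LL_zero_closed T] T] T by simp
 qed (auto simp: LL_closed X.M.a_ac intro!: restrict_ext)
next
 fix T assume "T <: LL A X"
 hence T: "T \<in> adjointable X" by simp
 show "1 \<odot>\<^sub>(LL A X) T = T"
  using adjointable_ext[OF LL_smult_closed[OF T, of 1] T] T by simp
qed (auto simp: LL_closed X.smult_add_l X.smult_add_r intro!: restrict_ext)

lemma LL_minus_apply:
 assumes "T \<in> adjointable X" "S \<in> adjointable X" "x <: X"
 shows "(T \<ominus>\<^sub>(LL A X) S) x = T x \<ominus>\<^sub>X S x"
proof -
 interpret cvec "LL A X" by (rule cvec_LL)
 show ?thesis using assms M.minus_eq[of T S] neg_eq_smult[of S] by (simp add: X.M.minus_eq X.neg_eq_smult)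
qed

lemma op_norm_eq_0: assumes "T \<in> adjointable X" shows "op_norm A X T = 0 \<longleftrightarrow> T = (\<lambda>x\<in>carrier X. \<zero>\<^sub>X)"
proof
 assume 0: "op_norm A X T = 0"
 show "T = (\<lambda>x\<in>carrier X. \<zero>\<^sub>X)"
 proof (rule adjointable_ext[OF assms LL_zero_closed])
  fix x assume x: "x <: X"
  have "hn (T x) \<le> 0" using op_norm_ge[OF assms x] 0 by simp
  hence "hn (T x) = 0" using assms x by (intro order_antisym X.N_nonneg) auto
  thus "T x = (\<lambda>x\<in>carrier X. \<zero>\<^sub>X) x" using assms x by (simp add: hnorm_eq_0)
 qed
next
 assume T: "T = (\<lambda>x\<in>carrier X. \<zero>\<^sub>X)"
 have "op_norm A X T \<le> 0" by (rule op_norm_le) (auto simp: T)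
 thus "op_norm A X T = 0" using op_norm_nonneg[OF assms] by simp
qed

lemma op_norm_smult_le: assumes "T \<in> adjointable X"
 shows "op_norm A X (\<lambda>x\<in>carrier X. t \<odot>\<^sub>X T x) \<le> cmod t * op_norm A X T"
 using assms op_norm_ge[OF assms] by (intro op_norm_le)
  (auto simp: op_norm_nonneg hnorm_smult mult.assoc intro!: mult_left_mono)

lemma op_norm_smult: assumes "T \<in> adjointable X"
 shows "op_norm A X (\<lambda>x\<in>carrier X. t \<odot>\<^sub>X T x) = cmod t * op_norm A X T"
proof (cases "t = 0")
 case True
 hence "(\<lambda>x\<in>carrier X. t \<odot>\<^sub>X T x) = (\<lambda>x\<in>carrier X. \<zero>\<^sub>X)" using assms by (auto intro!: restrict_ext)
 thus ?thesis using op_norm_eq_0[OF LL_zero_closed] True by simp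
next
 case False
 let ?S = "\<lambda>x\<in>carrier X. t \<odot>\<^sub>X T x"
 have "(\<lambda>x\<in>carrier X. (1/t) \<odot>\<^sub>X ?S x) = T"
  by (rule adjointable_ext[OF LL_smult_closed[OF LL_smult_closed[OF assms]] assms]) (use assms False in simp)
 hence "op_norm A X T \<le> cmod (1/t) * op_norm A X ?S"
  using op_norm_smult_le[OF LL_smult_closed[OF assms, of t], of "1/t"] by simp
 hence "cmod t * op_norm A X T \<le> op_norm A X ?S" using False by (simp add: norm_divide field_simps)
 thus ?thesis using op_norm_smult_le[OF assms, of t] by simp
qed

lemma op_norm_add: assumes "T \<in> adjointable X" "S \<in> adjointable X"
 shows "op_norm A X (\<lambda>x\<in>carrier X. T x \<oplus>\<^sub>X S x) \<le> op_norm A X T + op_norm A X S"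
proof (rule op_norm_le)
 show "0 \<le> op_norm A X T + op_norm A X S" using assms by (simp add: op_norm_nonneg)
 fix x assume x: "x <: X"
 have "hn (T x \<oplus>\<^sub>X S x) \<le> hn (T x) + hn (S x)" using assms x by (intro X.N_add) auto
 also have "\<dots> \<le> op_norm A X T * hn x + op_norm A X S * hn x" using assms x by (intro add_mono op_norm_ge) auto
 finally show "hn ((\<lambda>x\<in>carrier X. T x \<oplus>\<^sub>X S x) x) \<le> (op_norm A X T + op_norm A X S) * hn x"
  using x by (simp add: distrib_right)
qed

lemma op_norm_compose: assumes "T \<in> adjointable X" "S \<in> adjointable X"
 shows "op_norm A X (compose (carrier X) T S) \<le> op_norm A X T * op_norm A X S"
proof (rule op_norm_le)
 show "0 \<le> op_norm A X T * op_norm A X S" using assms by (simp add: op_norm_nonneg)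
 fix x assume x: "x <: X"
 have "hn (T (S x)) \<le> op_norm A X T * hn (S x)" using assms x by (intro op_norm_ge) auto
 also have "\<dots> \<le> op_norm A X T * (op_norm A X S * hn x)"
  using assms x by (intro mult_left_mono op_norm_ge) (auto simp: op_norm_nonneg)
 finally show "hn (compose (carrier X) T S x) \<le> op_norm A X T * op_norm A X S * hn x"
  using x by (simp add: compose_def mult.assoc)
qed

lemma op_norm_adjoint_le: assumes "T \<in> adjointable X" shows "op_norm A X (adjoint X T) \<le> op_norm A X T"
proof (rule op_norm_le)
 show "0 \<le> op_norm A X T" using assms by (rule op_norm_nonneg)
 fix x assume x: "x <: X"
 let ?y = "adjoint X T x"
 have y: "?y <: X" using assms x by auto
 have "hn ?y * hn ?y = nrm A (inn X (T ?y) x)"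
  using assms x y hnorm_square[OF y] by (simp add: adjoint_inn power2_eq_square)
 also have "\<dots> \<le> hn (T ?y) * hn x" using assms x y by (intro inn_bound) auto
 also have "\<dots> \<le> (op_norm A X T * hn ?y) * hn x" using assms x y by (intro mult_right_mono op_norm_ge) auto
 finally have *: "hn ?y * hn ?y \<le> hn ?y * (op_norm A X T * hn x)" by (simp add: mult_ac)
 show "hn ?y \<le> op_norm A X T * hn x"
 proof (cases "hn ?y = 0")
  case True
  thus ?thesis using assms x by (simp add: op_norm_nonneg)
 next
  case False
  hence "0 < hn ?y" using y by (simp add: order_less_le)
  thus ?thesis using * by simp
 qed
qed

lemma op_norm_cstar: assumes "T \<in> adjointable X"
 shows "op_norm A X (compose (carrier X) (adjoint X T) T) = (op_norm A X T)\<^sup>2"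
proof (rule order_antisym)
 have "op_norm A X (compose (carrier X) (adjoint X T) T) \<le> op_norm A X (adjoint X T) * op_norm A X T"
  using assms by (intro op_norm_compose) auto
 also have "\<dots> \<le> op_norm A X T * op_norm A X T"
  using assms by (intro mult_right_mono op_norm_adjoint_le op_norm_nonneg)
 finally show "op_norm A X (compose (carrier X) (adjoint X T) T) \<le> (op_norm A X T)\<^sup>2" by (simp add: power2_eq_square)
 let ?N = "op_norm A X (compose (carrier X) (adjoint X T) T)"
 have H: "compose (carrier X) (adjoint X T) T \<in> adjointable X" using assms by (intro LL_closed) auto
 have N: "0 \<le> ?N" by (rule op_norm_nonneg[OF H])
 have "op_norm A X T \<le> sqrt ?N"
 proof (rule op_norm_le)
  fix x assume x: "x <: X"
  have "(hn (T x))\<^sup>2 = nrm A (inn X x (compose (carrier X) (adjoint X T) T x))"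
   using assms x by (simp add: hnorm_square compose_def adjoint_inn)
  also have "\<dots> \<le> hn x * hn (compose (carrier X) (adjoint X T) T x)" using assms x by (intro inn_bound) (auto simp: compose_def)
  also have "\<dots> \<le> hn x * (?N * hn x)" using x by (intro mult_left_mono op_norm_ge H) auto
  also have "\<dots> = (sqrt ?N * hn x)\<^sup>2" using N by (simp add: power_mult_distrib) (simp add: power2_eq_square)
  finally show "hn (T x) \<le> sqrt ?N * hn x" by (rule power2_le_imp_le) (use N x in simp)
 qed (use N in simp)
 hence "(op_norm A X T)\<^sup>2 \<le> (sqrt ?N)\<^sup>2" using op_norm_nonneg[OF assms] by (intro power_mono)
 thus "(op_norm A X T)\<^sup>2 \<le> ?N" using N by simp
qed

lemma normed_vec_LL: "normed_vec (LL A X) (op_norm A X)"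
proof -
 interpret cvec "LL A X" by (rule cvec_LL)
 show ?thesis
  by unfold_locales (auto simp: op_norm_nonneg op_norm_eq_0 op_norm_smult op_norm_add)
qed

text \<open>The adjoints form a Cauchy sequence as well, and the pointwise limits F of the operators
  and G of the adjoints are adjoint to each other. The Cauchy estimate, passed to the limit
  pointwise, gives convergence in norm.\<close>

lemma norm_complete_LL: "norm_complete (LL A X) (op_norm A X)"
 unfolding norm_complete_def
proof (intro allI impI)
 interpret L: normed_vec "LL A X" "op_norm A X" by (rule normed_vec_LL)
 fix T :: "nat => 'x => 'x"
 assume "\<forall>n. T n <: LL A X" and cauchy: "\<forall>e>0. \<exists>M. \<forall>m\<ge>M. \<forall>n\<ge>M. op_norm A X (T m \<ominus>\<^sub>(LL A X) T n) < e"
 hence T: "T n \<in> adjointable X" for n by simp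
 have Tdiff: "T m \<ominus>\<^sub>(LL A X) T n \<in> adjointable X" for m n using L.minus_in[of "T m" "T n"] T by simp
 have ptw: "\<exists>y. X.vlim (%n. T n x) y" if x: "x <: X" for x
 proof (rule X.cauchy_vlim[OF hcomplete])
  fix e :: real assume e: "e > 0"
  have hx: "hn x + 1 > 0" using x by (simp add: add_nonneg_pos)
  then obtain M where M: "!!m n. m \<ge> M ==> n \<ge> M ==> op_norm A X (T m \<ominus>\<^sub>(LL A X) T n) < e / (hn x + 1)"
   using cauchy e by (meson divide_pos_pos)
  show "\<exists>M. \<forall>m\<ge>M. \<forall>n\<ge>M. hn (T m x \<ominus>\<^sub>X T n x) < e"
  proof (intro exI allI impI)
   fix m n assume mn: "m \<ge> M" "n \<ge> M"
   have "hn (T m x \<ominus>\<^sub>X T n x) \<le> op_norm A X (T m \<ominus>\<^sub>(LL A X) T n) * hn x"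
    using op_norm_ge[OF Tdiff x, of m n] T x by (simp add: LL_minus_apply)
   also have "\<dots> \<le> e / (hn x + 1) * hn x" using M[OF mn] x by (intro mult_right_mono) auto
   also have "\<dots> < e" using hx e x by (simp add: divide_less_eq algebra_simps)
   finally show "hn (T m x \<ominus>\<^sub>X T n x) < e" .
  qed
 qed (use T x in auto)
 then obtain F where F: "!!x. x <: X ==> X.vlim (%n. T n x) (F x)" by metis
 have adj: "op_norm A X (adjoint X (T m) \<ominus>\<^sub>(LL A X) adjoint X (T n)) \<le> op_norm A X (T m \<ominus>\<^sub>(LL A X) T n)" for m n
 proof -
  have "adjoint X (T m \<ominus>\<^sub>(LL A X) T n) = adjoint X (T m) \<ominus>\<^sub>(LL A X) adjoint X (T n)"
   using T Tdiff L.minus_in[of "adjoint X (T m)" "adjoint X (T n)"]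
   by (intro adjoint_unique) (auto simp: LL_minus_apply inn_minus inn_minus_left adjoint_inn)
  thus ?thesis using op_norm_adjoint_le[OF Tdiff, of m n] by simp
 qed
 have ptw': "\<exists>y. X.vlim (%n. adjoint X (T n) x) y" if x: "x <: X" for x
 proof (rule X.cauchy_vlim[OF hcomplete])
  fix e :: real assume e: "e > 0"
  have hx: "hn x + 1 > 0" using x by (simp add: add_nonneg_pos)
  then obtain M where M: "!!m n. m \<ge> M ==> n \<ge> M ==> op_norm A X (T m \<ominus>\<^sub>(LL A X) T n) < e / (hn x + 1)"
   using cauchy e by (meson divide_pos_pos)
  show "\<exists>M. \<forall>m\<ge>M. \<forall>n\<ge>M. hn (adjoint X (T m) x \<ominus>\<^sub>X adjoint X (T n) x) < e"
  proof (intro exI allI impI)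
   fix m n assume mn: "m \<ge> M" "n \<ge> M"
   have "hn (adjoint X (T m) x \<ominus>\<^sub>X adjoint X (T n) x) \<le> op_norm A X (adjoint X (T m) \<ominus>\<^sub>(LL A X) adjoint X (T n)) * hn x"
    using op_norm_ge[of "adjoint X (T m) \<ominus>\<^sub>(LL A X) adjoint X (T n)" x] T x
     L.minus_in[of "adjoint X (T m)" "adjoint X (T n)"] by (simp add: LL_minus_apply)
   also have "\<dots> \<le> e / (hn x + 1) * hn x" using M[OF mn] adj[of m n] x by (intro mult_right_mono) auto
   also have "\<dots> < e" using hx e x by (simp add: divide_less_eq algebra_simps)
   finally show "hn (adjoint X (T m) x \<ominus>\<^sub>X adjoint X (T n) x) < e" .
  qed
 qed (use T x in auto)
 then obtain G where G: "!!x. x <: X ==> X.vlim (%n. adjoint X (T n) x) (G x)" by metis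
 let ?F = "\<lambda>x\<in>carrier X. F x"
 have Fa: "?F \<in> adjointable X"
 proof (rule adjointableI[where g = G])
  show "F x <: X" "G x <: X" if "x <: X" for x
   using X.vlimD(2)[OF F[OF that]] X.vlimD(2)[OF G[OF that]] .
  fix x y assume xy: "x <: X" "y <: X"
  have "A.vlim (%n. inn X (T n x) y) (inn X (F x) y)" by (intro vlim_inn_left F xy)
  moreover have "A.vlim (%n. inn X x (adjoint X (T n) y)) (inn X x (G y))" by (intro vlim_inn G xy)
  ultimately show "inn X (F x) y = inn X x (G y)"
   using T xy by (simp add: adjoint_inn A.vlim_unique)
 qed
 have "(%n. op_norm A X (T n \<ominus>\<^sub>(LL A X) ?F)) \<longlonglongrightarrow> 0"
 proof (rule LIMSEQ_I)
  fix e :: real assume e: "e > 0"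
  obtain M where M: "!!m n. m \<ge> M ==> n \<ge> M ==> op_norm A X (T m \<ominus>\<^sub>(LL A X) T n) < e / 2"
   using cauchy e by (meson half_gt_zero)
  have "op_norm A X (T n \<ominus>\<^sub>(LL A X) ?F) \<le> e / 2" if n: "n \<ge> M" for n
  proof (rule op_norm_le)
   fix x assume x: "x <: X"
   have "X.vlim (%m. T n x \<ominus>\<^sub>X T (m + M) x) (T n x \<ominus>\<^sub>X F x)"
    using F[OF x] T x LIMSEQ_ignore_initial_segment[of "%k. hn (T k x \<ominus>\<^sub>X F x)" 0 M]
    by (intro X.vlim_minus X.vlim_const) (auto simp: X.vlim_def)
   hence "hn (T n x \<ominus>\<^sub>X F x) \<le> e / 2 * hn x"
   proof (rule X.vlim_N_le[OF _ _ tendsto_const])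
    fix m
    have "hn (T n x \<ominus>\<^sub>X T (m + M) x) \<le> op_norm A X (T n \<ominus>\<^sub>(LL A X) T (m + M)) * hn x"
     using op_norm_ge[OF Tdiff x, of n "m + M"] T x by (simp add: LL_minus_apply)
    also have "\<dots> \<le> e / 2 * hn x" using M[OF n, of "m + M"] x by (intro mult_right_mono) auto
    finally show "hn (T n x \<ominus>\<^sub>X T (m + M) x) \<le> e / 2 * hn x" .
   qed
   thus "hn ((T n \<ominus>\<^sub>(LL A X) ?F) x) \<le> e / 2 * hn x" using T Fa x by (simp add: LL_minus_apply)
  qed (use e in simp)
  moreover have "0 \<le> op_norm A X (T n \<ominus>\<^sub>(LL A X) ?F)" for n
   using T Fa by (intro L.N_nonneg L.minus_in) auto
  ultimately show "\<exists>no. \<forall>n\<ge>no. norm (op_norm A X (T n \<ominus>\<^sub>(LL A X) ?F) - 0) < e"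
   using e by (intro exI[of _ M]) force
 qed
 thus "\<exists>l\<in>carrier (LL A X). (%n. op_norm A X (T n \<ominus>\<^sub>(LL A X) l)) \<longlonglongrightarrow> 0" using Fa by auto
qed

lemma unital_cstar_LL: "unital_cstar (LL A X)"
proof -
 interpret cvec "LL A X" by (rule cvec_LL)
 show ?thesis
 proof unfold_locales
  show "star (LL A X) (S \<otimes>\<^sub>(LL A X) T) = star (LL A X) T \<otimes>\<^sub>(LL A X) star (LL A X) S"
   if "S <: LL A X" "T <: LL A X" for S T
   using that by (simp, intro adjoint_unique) (auto simp: compose_def adjoint_inn LL_closed[unfolded compose_def])
  show "star (LL A X) (S \<oplus>\<^sub>(LL A X) T) = star (LL A X) S \<oplus>\<^sub>(LL A X) star (LL A X) T"
   if "S <: LL A X" "T <: LL A X" for S T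
   using that by (simp, intro adjoint_unique) (auto simp: adjoint_inn inn_add inn_add_left LL_closed)
  show "star (LL A X) (c \<odot>\<^sub>(LL A X) T) = cnj c \<odot>\<^sub>(LL A X) star (LL A X) T" if "T <: LL A X" for c T
   using that by (simp, intro adjoint_unique) (auto simp: adjoint_inn inn_scale inn_scale_left LL_closed)
  show "nrm (LL A X) (S \<otimes>\<^sub>(LL A X) T) \<le> nrm (LL A X) S * nrm (LL A X) T"
   if "S <: LL A X" "T <: LL A X" for S T using that by (simp add: op_norm_compose)
  show "nrm (LL A X) (star (LL A X) T \<otimes>\<^sub>(LL A X) T) = (nrm (LL A X) T)\<^sup>2" if "T <: LL A X" for T
   using that by (simp add: op_norm_cstar)
  show "norm_complete (LL A X) (nrm (LL A X))" using norm_complete_LL by simp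
  show "\<one>\<^sub>(LL A X) \<otimes>\<^sub>(LL A X) T = T" "T \<otimes>\<^sub>(LL A X) \<one>\<^sub>(LL A X) = T" if "T <: LL A X" for T
  proof -
   have T: "T \<in> adjointable X" using that by simp
   show "\<one>\<^sub>(LL A X) \<otimes>\<^sub>(LL A X) T = T" "T \<otimes>\<^sub>(LL A X) \<one>\<^sub>(LL A X) = T"
    using adjointable_ext[OF LL_compose_closed[OF LL_one_closed T] T]
     adjointable_ext[OF LL_compose_closed[OF T LL_one_closed] T] T by (simp_all add: compose_def)
  qed
  show "S \<otimes>\<^sub>(LL A X) T <: LL A X" if "S <: LL A X" "T <: LL A X" for S T
   using that by (simp add: LL_compose_closed)
 qed (auto simp: LL_one_closed op_norm_nonneg op_norm_eq_0 op_norm_smult op_norm_add compose_def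
   adjointable_add adjointable_smult intro!: restrict_ext)
qed

end

sublocale hilbert_module_cs \<subseteq> LL: unital_cstar "LL A X"
 by (rule unital_cstar_LL)

section \<open>Consequences for general C*-algebras\<close>

lemma self_bimod_simps [simp]:
 "carrier (self_bimod A) = carrier A" "zero (self_bimod A) = zero A" "add (self_bimod A) = add A"
 "smult (self_bimod A) = smult A" "ract (self_bimod A) = mult A" "inn (self_bimod A) a b = star A a \<otimes>\<^sub>A b"
 "lact (self_bimod A) a = (\<lambda>b\<in>carrier A. a \<otimes>\<^sub>A b)"
 by (simp_all add: self_bimod_def)

context cstar_algebra
begin

lemma cvec_self: "cvec (self_bimod A)"
 by (rule cvec_intro) (auto simp: smult_add_l smult_add_r M.a_ac intro!: abelian_groupI bexI[of _ "\<ominus> x" for x] M.l_neg)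

lemma hnorm_self [simp]: "a <: A ==> hnorm A (self_bimod A) a = nrm A a"
 by (simp add: hnorm_def nrm_star_mult)

lemma minus_self_bimod: "a <: A ==> b <: A ==> a \<ominus>\<^sub>(self_bimod A) b = a \<ominus> b"
proof -
 assume "a <: A" "b <: A"
 interpret S: cvec "self_bimod A" by (rule cvec_self)
 show ?thesis using S.M.minus_eq[of a b] S.neg_eq_smult[of b] \<open>a <: A\<close> \<open>b <: A\<close>
  by (simp add: M.minus_eq neg_eq_smult)
qed

lemma norm_complete_self: "norm_complete (self_bimod A) (hnorm A (self_bimod A))"
 unfolding norm_complete_def
proof (intro allI impI)
 fix f :: "nat => 'a"
 assume "\<forall>n. f n <: self_bimod A"
  and c: "\<forall>e>0. \<exists>M. \<forall>m\<ge>M. \<forall>n\<ge>M. hnorm A (self_bimod A) (f m \<ominus>\<^sub>(self_bimod A) f n) < e"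
 hence f [simp]: "f n <: A" for n by auto
 obtain l where "vlim f l"
 proof (rule cauchy_vlim[OF complete f])
  show "\<exists>M. \<forall>m\<ge>M. \<forall>n\<ge>M. nrm A (f m \<ominus> f n) < e" if "e > 0" for e
   using c[rule_format, OF that] by (simp add: minus_self_bimod)
 qed
 thus "\<exists>l\<in>carrier (self_bimod A). (%n. hnorm A (self_bimod A) (f n \<ominus>\<^sub>(self_bimod A) l)) \<longlonglongrightarrow> 0"
  by (intro bexI[of _ l]) (auto simp: vlimD minus_self_bimod)
qed

text \<open>For A over itself the Cauchy--Schwarz inequality is submultiplicativity of the norm, so
  the operators on A form a unital C*-algebra before the inequality is known in general.\<close>

lemma hilbert_module_cs_self: "hilbert_module_cs A (self_bimod A)"
proof -
 interpret S: cvec "self_bimod A" by (rule cvec_self)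
 show ?thesis
  by unfold_locales
   (auto simp: mult_add_left mult_add_right mult_assoc mult_scale_left mult_scale_right star_mult star_mult_eq_0
    norm_complete_self positive_def intro: order_trans[OF nrm_mult])
qed

end

section \<open>The left regular representation and positivity without unit\<close>

context cstar_algebra
begin

interpretation self: hilbert_module_cs A "self_bimod A"
 by (rule hilbert_module_cs_self)

text \<open>An isometric embedding of A into a unital C*-algebra (\<open>op_norm_lmult\<close>); it
  serves in place of a unitization.\<close>

abbreviation lmult :: "'a => 'a => 'a" where "lmult a \<equiv> lact (self_bimod A) a"

lemma lmult_adjointable [simp]: "a <: A ==> (\<lambda>b\<in>carrier A. a \<otimes> b) \<in> adjointable (self_bimod A)"
 using self.adjointableI[of "%b. a \<otimes> b" "%b. star A a \<otimes> b"] by (simp add: star_mult mult_assoc)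

lemma lmult_star: "a <: A ==> star (LL A (self_bimod A)) (lmult a) = lmult (star A a)"
 by (simp, intro self.adjoint_unique) (auto simp: star_mult mult_assoc)

lemma lmult_mult: "a <: A ==> b <: A ==> lmult (a \<otimes> b) = lmult a \<otimes>\<^sub>(LL A (self_bimod A)) lmult b"
 by (auto simp: compose_def mult_assoc intro!: restrict_ext)

lemma lmult_add: "a <: A ==> b <: A ==> lmult (a \<oplus> b) = lmult a \<oplus>\<^sub>(LL A (self_bimod A)) lmult b"
 by (auto simp: mult_add_left intro!: restrict_ext)

lemma lmult_smult: "a <: A ==> lmult (t \<odot> a) = t \<odot>\<^sub>(LL A (self_bimod A)) lmult a"
 by (auto simp: mult_scale_left intro!: restrict_ext)

lemma op_norm_lmult: assumes "a <: A" shows "op_norm A (self_bimod A) (lmult a) = nrm A a"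
proof (rule order_antisym)
 show "op_norm A (self_bimod A) (lmult a) \<le> nrm A a"
  by (rule self.op_norm_le) (use assms in \<open>auto simp: nrm_mult\<close>)
 have "nrm A (a \<otimes> star A a) \<le> op_norm A (self_bimod A) (lmult a) * nrm A a"
  using self.op_norm_ge[of "lmult a" "star A a"] assms by simp
 hence *: "nrm A a * nrm A a \<le> op_norm A (self_bimod A) (lmult a) * nrm A a"
  using nrm_star_mult[of "star A a"] assms by (simp add: power2_eq_square)
 show "nrm A a \<le> op_norm A (self_bimod A) (lmult a)"
 proof (cases "nrm A a = 0")
  case True
  thus ?thesis using self.op_norm_nonneg[of "lmult a"] assms by simp
 next
  case False
  hence "nrm A a > 0" using assms by (simp add: order_less_le)
  thus ?thesis using * by simp
 qed
qed

text \<open>The square root is only asked for among the operators on A. That suffices for the norm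
  comparison \<open>pos_mono\<close>.\<close>

definition pos :: "'a => bool" where
 "pos a \<longleftrightarrow> a <: A \<and> unital_cstar.Pos (LL A (self_bimod A)) (lmult a)"

lemma pos_closed: "pos a ==> a <: A"
 by (simp add: pos_def)

lemma pos_star_mult: "x <: A ==> pos (star A x \<otimes> x)"
 using self.LL.Pos_star_mult[of "lmult x"]
 by (simp add: pos_def lmult_mult lmult_star[symmetric] lmult_adjointable[folded self_bimod_simps(7)] del: self_bimod_simps(7))

lemma positive_pos: "positive A a ==> pos a"
 using pos_star_mult by (auto simp: positive_def)

lemma pos_add: "pos a ==> pos b ==> pos (a \<oplus> b)"
 using self.LL.Pos_add[of "lmult a" "lmult b"] by (simp add: pos_def lmult_add del: self_bimod_simps(7))

lemma pos_mono: assumes "pos a" "pos b" shows "nrm A a \<le> nrm A (a \<oplus> b)"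
proof -
 have "op_norm A (self_bimod A) (lmult a) \<le> op_norm A (self_bimod A) (lmult (a \<oplus> b))"
  using self.LL.Pos_mono[of "lmult a" "lmult b"] assms
  by (simp add: pos_def lmult_add del: self_bimod_simps(7) LL_simps(1-7)) 
 thus ?thesis using assms by (simp add: op_norm_lmult pos_closed del: self_bimod_simps(7))
qed

end

text \<open>With \<open>a = \<langle>y, y\<rangle>\<close>, \<open>b = \<langle>y, x\<rangle>\<close> and \<open>(1 - c)\<^sup>2 = 1 - a\<close>:
 \<open>\<langle>x, x\<rangle> = b\<^sup>*b + \<langle>x - y b, x - y b\<rangle> + ((1 - c) b)\<^sup>*((1 - c) b)\<close>.\<close>

lemma (in hilbert_module) inn_bound_unit:
 assumes x: "x <: X" and y: "y <: X" "hnorm A X y < 1"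
 shows "nrm A (inn X y x) \<le> hnorm A X x"
proof -
 let ?a = "inn X y y" and ?b = "inn X y x" and ?xx = "inn X x x"
 have ab: "?a <: A" "?b <: A" "?xx <: A" "star A ?a = ?a" using x y by (auto simp: inn_star)
 have "nrm A ?a < 1" using y(2) by (simp add: hnorm_def)
 then obtain c where c: "c <: A" "star A c = c" and a: "?a = (c \<oplus>\<^sub>A c) \<ominus>\<^sub>A c \<otimes>\<^sub>A c"
  using A.sqrt_one_minus[of ?a] ab by metis
 define b where "b = ?b"
 define xx where "xx = ?xx"
 have b: "b <: A" and xx: "xx <: A" using ab by (auto simp: b_def xx_def)
 have yx: "inn X x y = star A b" using x y by (simp add: b_def inn_star)
 define d where "d = b \<ominus>\<^sub>A c \<otimes>\<^sub>A b"
 define w where "w = x \<ominus>\<^sub>X ract X y b"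
 have d: "d <: A" and w: "w <: X" using b c x y by (auto simp: d_def w_def)
 have ww: "inn X w w = xx \<ominus>\<^sub>A star A b \<otimes>\<^sub>A b \<ominus>\<^sub>A (star A b \<otimes>\<^sub>A b \<ominus>\<^sub>A star A b \<otimes>\<^sub>A (?a \<otimes>\<^sub>A b))"
  unfolding w_def using x y b
  by (simp add: inn_minus inn_minus_left inn_ract inn_ract_left yx A.mult_assoc A.mult_minus_l flip: b_def xx_def)
 have sd: "star A d = star A b \<ominus>\<^sub>A star A b \<otimes>\<^sub>A c" unfolding d_def using b c by (simp add: A.star_minus A.star_mult)
 have dd: "star A d \<otimes>\<^sub>A d = star A b \<otimes>\<^sub>A b \<ominus>\<^sub>A star A b \<otimes>\<^sub>A (?a \<otimes>\<^sub>A b)"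
  unfolding sd unfolding a d_def using b c(1) by algebra
 have "xx = star A b \<otimes>\<^sub>A b \<oplus>\<^sub>A (inn X w w \<oplus>\<^sub>A star A d \<otimes>\<^sub>A d)"
  unfolding ww dd using b xx ab(1) by algebra
 moreover have "A.pos (star A b \<otimes>\<^sub>A b)" "A.pos (inn X w w \<oplus>\<^sub>A star A d \<otimes>\<^sub>A d)"
  using b d w by (auto intro!: A.pos_add A.pos_star_mult A.positive_pos[OF inn_positive])
 ultimately have "nrm A (star A b \<otimes>\<^sub>A b) \<le> nrm A xx" using A.pos_mono by metis
 hence "(nrm A b)\<^sup>2 \<le> (hnorm A X x)\<^sup>2" using b x by (simp add: A.nrm_star_mult hnorm_square xx_def)
 thus ?thesis unfolding b_def by (rule power2_le_imp_le) (use x in simp)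
qed

text \<open>Scaling y to norm below 1 reduces the inequality to \<open>inn_bound_unit\<close>. From
  here on the operator theory above is available on every Hilbert module.\<close>

sublocale hilbert_module \<subseteq> hilbert_module_cs A X
proof unfold_locales
 fix y x assume yx: "y <: X" "x <: X"
 show "nrm A (inn X y x) \<le> hnorm A X y * hnorm A X x"
 proof (rule field_le_epsilon)
  fix e :: real assume e: "e > 0"
  have hx: "hnorm A X x + 1 > 0" using yx by (simp add: add_nonneg_pos)
  \<comment> \<open>Above ||y|| by an amount that costs at most e after multiplication by
    ||x||.\<close>
  define t where "t = hnorm A X y + e / (hnorm A X x + 1)"
  have t: "t > hnorm A X y" "t > 0" using e hx yx by (auto simp: t_def add_nonneg_pos)
  let ?y = "complex_of_real (1 / t) \<odot>\<^sub>X y"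
  have "nrm A (inn X ?y x) \<le> hnorm A X x"
   using t yx by (intro inn_bound_unit) (auto simp: hnorm_smult norm_divide)
  hence "nrm A (inn X y x) \<le> t * hnorm A X x"
   using t yx by (simp add: inn_scale_left A.nrm_scale norm_divide divide_le_eq mult.commute)
  also have "\<dots> = hnorm A X y * hnorm A X x + e * (hnorm A X x / (hnorm A X x + 1))"
   by (simp add: t_def algebra_simps)
  also have "\<dots> \<le> hnorm A X y * hnorm A X x + e * 1"
   using e hx yx by (intro add_left_mono mult_left_mono) (auto simp: divide_le_eq)
  finally show "nrm A (inn X y x) \<le> hnorm A X y * hnorm A X x + e" by simp
 qed
qed

subsection \<open>Homomorphisms are contractive\<close>

context
 fixes A :: "('a, 'm) cstar_scheme" and B :: "('b, 'n) cstar_scheme" and h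
 assumes A: "cstar_algebra A" and B: "cstar_algebra B" and h: "h \<in> cstar_hom A B"
begin

interpretation A: cstar_algebra A by (rule A)
interpretation B: cstar_algebra B by (rule B)

lemma hom_linear: "linear_on A B h"
 using h by (simp add: cstar_hom_def)

lemma hom_closed: "a <: A ==> h a <: B"
 using hom_linear linear_on_closed[OF A.cvec_axioms B.cvec_axioms] by blast

lemma hom_mult: "a <: A ==> b <: A ==> h (a \<otimes>\<^sub>A b) = h a \<otimes>\<^sub>B h b"
 using h by (simp add: cstar_hom_def)

lemma hom_star: "a <: A ==> h (star A a) = star B (h a)"
 using h by (simp add: cstar_hom_def)

lemmas hom_add = linear_on_add[OF A.cvec_axioms B.cvec_axioms hom_linear]
 and hom_smult = linear_on_smult[OF A.cvec_axioms B.cvec_axioms hom_linear]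
 and hom_minus = linear_on_minus[OF A.cvec_axioms B.cvec_axioms hom_linear]
 and hom_zero = linear_on_zero[OF A.cvec_axioms B.cvec_axioms hom_linear]

text \<open>If \<open>a\<^sup>*a = 1 - (1 - c)\<^sup>2\<close>, then \<open>(h(a) b)\<^sup>*(h(a) b) + ((1 - h(c)) b)\<^sup>*((1 - h(c)) b) = b\<^sup>*b\<close>; take \<open>b = h(a)\<^sup>*\<close>.\<close>

lemma hom_contractive_unit:
 assumes a: "a <: A" "nrm A a < 1" shows "nrm B (h a) \<le> 1"
proof -
 have "nrm A (star A a \<otimes>\<^sub>A a) < 1" using a power_strict_mono[of "nrm A a" 1 2] by (simp add: A.nrm_star_mult)
 then obtain c where c: "c <: A" "star A c = c" and ac: "star A a \<otimes>\<^sub>A a = (c \<oplus>\<^sub>A c) \<ominus>\<^sub>A c \<otimes>\<^sub>A c"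
  using A.sqrt_one_minus[of "star A a \<otimes>\<^sub>A a"] a by (metis A.mult_closed A.star_closed A.star_mult A.star_star)
 define x k b where "x = h a" and "k = h c" and "b = star B (h a)"
 have [simp]: "x <: B" "k <: B" "b <: B" "star B k = k"
  using a c hom_star[of c] by (auto simp: x_def k_def b_def hom_closed)
 have xx: "star B x \<otimes>\<^sub>B x = (k \<oplus>\<^sub>B k) \<ominus>\<^sub>B k \<otimes>\<^sub>B k"
  using arg_cong[OF ac, of h] a c by (simp add: x_def k_def hom_mult hom_star hom_add hom_minus)
 define d where "d = b \<ominus>\<^sub>B k \<otimes>\<^sub>B b"
 have [simp]: "d <: B" by (simp add: d_def)
 have sd: "star B d = star B b \<ominus>\<^sub>B star B b \<otimes>\<^sub>B k" unfolding d_def by (simp add: B.star_minus B.star_mult)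
 have 1: "star B (x \<otimes>\<^sub>B b) \<otimes>\<^sub>B (x \<otimes>\<^sub>B b) = star B b \<otimes>\<^sub>B (((k \<oplus>\<^sub>B k) \<ominus>\<^sub>B k \<otimes>\<^sub>B k) \<otimes>\<^sub>B b)"
  unfolding xx[symmetric] by (simp add: B.star_mult B.mult_assoc)
 have kb: "k <: B" "b <: B" by simp_all
 have "star B (x \<otimes>\<^sub>B b) \<otimes>\<^sub>B (x \<otimes>\<^sub>B b) \<oplus>\<^sub>B star B d \<otimes>\<^sub>B d = star B b \<otimes>\<^sub>B b"
  unfolding 1 sd unfolding d_def using kb by algebra
 hence "nrm B (star B (x \<otimes>\<^sub>B b) \<otimes>\<^sub>B (x \<otimes>\<^sub>B b)) \<le> nrm B (star B b \<otimes>\<^sub>B b)"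
  using B.pos_mono[of "star B (x \<otimes>\<^sub>B b) \<otimes>\<^sub>B (x \<otimes>\<^sub>B b)" "star B d \<otimes>\<^sub>B d"] by (simp add: B.pos_star_mult)
 hence "(nrm B (x \<otimes>\<^sub>B b))\<^sup>2 \<le> (nrm B b)\<^sup>2" by (simp add: B.nrm_star_mult)
 hence "nrm B (x \<otimes>\<^sub>B b) \<le> nrm B b" by (rule power2_le_imp_le) simp
 moreover have "nrm B (x \<otimes>\<^sub>B b) = (nrm B x)\<^sup>2" using B.nrm_star_mult[of b] by (simp add: b_def flip: x_def)
 moreover have "nrm B b = nrm B x" by (simp add: b_def flip: x_def)
 ultimately have le: "nrm B x * nrm B x \<le> 1 * nrm B x" by (simp add: power2_eq_square)
 show ?thesis unfolding x_def[symmetric]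
 proof (rule ccontr)
  assume "\<not> nrm B x \<le> 1"
  hence "1 * nrm B x < nrm B x * nrm B x" by (intro mult_strict_right_mono) auto
  thus False using le by simp
 qed
qed

theorem hom_contractive: assumes a: "a <: A" shows "nrm B (h a) \<le> nrm A a"
proof (rule field_le_epsilon)
 fix e :: real assume e: "e > 0"
 define t where "t = nrm A a + e"
 have t: "t > 0" "nrm A a < t" using a e by (auto simp: t_def add_nonneg_pos)
 let ?a = "complex_of_real (1 / t) \<odot>\<^sub>A a"
 have "nrm B (h ?a) \<le> 1" using t a by (intro hom_contractive_unit) (auto simp: A.nrm_scale norm_divide)
 thus "nrm B (h a) \<le> nrm A a + e"
  using t a by (simp add: hom_smult hom_closed B.nrm_scale norm_divide divide_le_eq t_def[symmetric] del: of_real_add)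
qed

lemma hom_vlim: "A.vlim f l ==> B.vlim (%n. h (f n)) (h l)"
 by (rule vlim_map[OF A.normed_vec_axioms B.normed_vec_axioms hom_linear, of 1]) (simp add: hom_contractive)

end

subsection \<open>Functional calculus without unit\<close>

context cstar_algebra
begin

interpretation self: hilbert_module_cs A "self_bimod A"
 by (rule hilbert_module_cs_self)

text \<open>\<open>nev a q\<close> is \<open>a q(a)\<close>.\<close>

definition nev :: "'a => real poly => 'a" where
 "nev a p = fold_coeffs (%c x. complex_of_real c \<odot> a \<oplus> a \<otimes> x) p \<zero>"

lemma nev_0 [simp]: "nev a 0 = \<zero>"
 by (simp add: nev_def)

lemma nev_pCons [simp]: "a <: A ==> nev a (pCons c p) = complex_of_real c \<odot> a \<oplus> a \<otimes> nev a p"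
 by (cases "p = 0"; cases "c = 0") (simp_all add: nev_def)

lemma nev_closed [simp, intro]: "a <: A ==> nev a p <: A"
 by (induction p) auto

lemma nev_add: "a <: A ==> nev a (p + q) = nev a p \<oplus> nev a q"
proof (induction p q rule: poly_induct2)
 case (pCons c p d q)
 have "complex_of_real (c + d) \<odot> a = complex_of_real c \<odot> a \<oplus> complex_of_real d \<odot> a"
  using pCons.prems by (simp add: smult_add_l)
 thus ?case using pCons by (simp add: mult_add_right M.a_ac)
qed simp

lemma nev_smult: "a <: A ==> nev a (Polynomial.smult t p) = complex_of_real t \<odot> nev a p"
 by (induction p) (simp_all add: smult_add_r mult_scale_right)

lemma nev_diff: "a <: A ==> nev a (p - q) = nev a p \<ominus> nev a q"
 using nev_add[of a p "- q"] nev_smult[of a "-1" q] by (simp add: M.minus_eq neg_eq_smult)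

lemma nev_star: "a <: A ==> star A a = a ==> star A (nev a p) = nev a p"
proof (induction p)
 case (pCons c p)
 have "nev a p \<otimes> a = a \<otimes> nev a p"
  using pCons.prems by (induction p) (simp_all add: mult_add_left mult_add_right mult_scale_left mult_scale_right mult_assoc)
 thus ?case using pCons by (simp add: star_add star_scale star_mult)
qed simp

lemma lmult_nev: "a <: A ==> lmult (nev a p) = lmult a \<otimes>\<^sub>(LL A (self_bimod A)) self.LL.pev (lmult a) p"
proof (induction p)
 case 0
 show ?case using 0 by (auto simp: compose_def intro!: restrict_ext)
next
 case (pCons c p)
 let ?L = "LL A (self_bimod A)" and ?l = "lmult a"
 have l: "?l <: ?L" using pCons by simp
 have "lmult (nev a (pCons c p)) = complex_of_real c \<odot>\<^sub>?L ?l \<oplus>\<^sub>?L ?l \<otimes>\<^sub>?L (?l \<otimes>\<^sub>?L self.LL.pev ?l p)"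
  using pCons by (simp add: lmult_add lmult_smult lmult_mult del: self_bimod_simps(7) LL_simps)
 also have "\<dots> = ?l \<otimes>\<^sub>?L self.LL.pev ?l (pCons c p)"
  using l by (simp add: self.LL.mult_add_right self.LL.mult_scale_right del: LL_simps self_bimod_simps(7))
 finally show ?case .
qed

text \<open>\<open>pev_bound\<close> carried back along the isometric left regular representation,
  under which a q(a) becomes the value of the polynomial t q(t).\<close>

theorem nev_bound:
 assumes a: "a <: A" "star A a = a" and M: "!!t. \<bar>t\<bar> \<le> nrm A a ==> \<bar>t * poly p t\<bar> \<le> M"
 shows "nrm A (nev a p) \<le> M"
proof -
 let ?L = "LL A (self_bimod A)" and ?l = "lmult a"
 have l: "?l <: ?L" "star ?L ?l = ?l" "nrm ?L ?l = nrm A a"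
  using a lmult_star[OF a(1)] op_norm_lmult[OF a(1)] by auto
 have "nrm A (nev a p) = nrm ?L (lmult (nev a p))" using a by (simp add: op_norm_lmult del: self_bimod_simps(7))
 also have "lmult (nev a p) = self.LL.pev ?l (pCons 0 p)"
  using a l(1) by (simp add: lmult_nev del: self_bimod_simps(7) LL_simps)
 also have "nrm ?L (self.LL.pev ?l (pCons 0 p)) \<le> M"
  by (rule self.LL.pev_bound[OF l(1,2)]) (use M l(3) in simp)
 finally show ?thesis .
qed

text \<open>\<open>nfun a f q c\<close> says that \<open>c = f(a)\<close>, where \<open>f(t)\<close> is the uniform limit of \<open>t q\<^sub>n(t)\<close>.\<close>

definition nfun :: "'a => (real => real) => (nat => real poly) => 'a => bool" where
 "nfun a f q c \<longleftrightarrow> (\<forall>n t. \<bar>t\<bar> \<le> nrm A a \<longrightarrow> \<bar>t * poly (q n) t - f t\<bar> \<le> inverse (real (Suc n))) \<and> vlim (%n. nev a (q n)) c"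

lemma nfun_ex:
 assumes a: "a <: A" "star A a = a" and f: "continuous_on {- nrm A a..nrm A a} f" "f 0 = 0"
 obtains q c where "nfun a f q c"
proof -
 obtain P where P: "!!n t. t \<in> {- nrm A a..nrm A a} ==> \<bar>poly (P n) t - f t\<bar> \<le> inverse (real (Suc n))"
  using unital_cstar.weierstrass_poly[OF CC.unital_cstar_axioms f(1)] by auto
 \<comment> \<open>Dropping the constant coefficient costs the error at 0 once more, because f(0) =
   0. Starting from index 2 n + 1 the doubled error is 2 / (2 n + 2) = 1 / (n + 1).\<close>
 define q where "q n = poly_shift 1 (P (2 * n + 1))" for n
 have q: "\<bar>t * poly (q n) t - f t\<bar> \<le> inverse (real (Suc n))" if t: "\<bar>t\<bar> \<le> nrm A a" for n t
 proof -
  let ?p = "P (2 * n + 1)"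
  have "poly ?p t = poly ?p 0 + t * poly (q n) t"
   using arg_cong[OF pCons_poly_shift[of ?p], of "%p. poly p t"] by (simp add: q_def poly_0_coeff_0)
  moreover have "\<bar>poly ?p t - f t\<bar> \<le> inverse (real (Suc (2 * n + 1)))" using P[of t "2 * n + 1"] t by (simp add: abs_le_iff)
  moreover have "\<bar>poly ?p 0 - f 0\<bar> \<le> inverse (real (Suc (2 * n + 1)))" using P[of 0 "2 * n + 1"] a by auto
  ultimately have "\<bar>t * poly (q n) t - f t\<bar> \<le> 2 * inverse (real (Suc (2 * n + 1)))" using f(2) by linarith
  also have "\<dots> = inverse (real (Suc n))" by (simp add: field_simps)
  finally show ?thesis .
 qed
 have "nrm A (nev a (q m) \<ominus> nev a (q n)) \<le> inverse (real (Suc m)) + inverse (real (Suc n))" for m n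
  unfolding nev_diff[OF a(1), symmetric]
 proof (rule nev_bound[OF a])
  fix t assume t: "\<bar>t\<bar> \<le> nrm A a"
  show "\<bar>t * poly (q m - q n) t\<bar> \<le> inverse (real (Suc m)) + inverse (real (Suc n))"
   using q[OF t, of m] q[OF t, of n] unfolding poly_diff right_diff_distrib by linarith
 qed
 then obtain c where "vlim (%n. nev a (q n)) c"
  using cauchy_vlim_bound[OF complete _ _ LIMSEQ_inverse_real_of_nat, of "%n. nev a (q n)"] a by auto
 thus ?thesis using that q unfolding nfun_def by blast
qed

end

text \<open>For \<open>t = \<parallel>h(a)\<parallel> < \<parallel>a\<parallel>\<close> and \<open>f(s) = s - max(-t, min(s, t))\<close>, the element \<open>f(a)\<close> is nonzero but \<open>h(f(a)) = 0\<close>.\<close>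

lemma hom_isometric_sa:
 fixes A :: "('a, 'm) cstar_scheme" and B :: "('b, 'n) cstar_scheme"
 assumes A: "cstar_algebra A" and B: "cstar_algebra B" and h: "h \<in> cstar_hom A B"
  and a: "a <: A" "star A a = a"
  and inj: "!!c. c <: A ==> h c = \<zero>\<^sub>B ==> c \<in> norm_closure A (nrm A) (range (cstar_algebra.nev A a)) ==> star A c = c ==> c = \<zero>\<^sub>A"
 shows "nrm A a \<le> nrm B (h a)"
proof -
 interpret A: cstar_algebra A by (rule A)
 interpret B: cstar_algebra B by (rule B)
 note [simp] = hom_closed[OF A B h]
 define t where "t = nrm B (h a)"
 have t0: "0 \<le> t" using a by (simp add: t_def)
 let ?g = "%s. max (- t) (min s t)"
 obtain q c where qc: "A.nfun a (%s. s - ?g s) q c"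
  by (rule A.nfun_ex[OF a, of "%s. s - ?g s"]) (use t0 in \<open>auto intro!: continuous_intros\<close>)
 hence q: "!!n s. \<bar>s\<bar> \<le> nrm A a ==> \<bar>s * poly (q n) s - (s - ?g s)\<bar> \<le> inverse (real (Suc n))"
  and c: "A.vlim (%n. A.nev a (q n)) c" unfolding A.nfun_def by blast+
 have cc: "c <: A" using A.vlimD(2)[OF c] .
 have ha: "h a <: B" "star B (h a) = h a" using a hom_star[OF A B h, of a] by auto
 have hnev: "h (A.nev a p) = B.nev (h a) p" for p
  using a by (induction p) (simp_all add: hom_zero[OF A B h] hom_add[OF A B h] hom_smult[OF A B h] hom_mult[OF A B h])
 have tle: "t \<le> nrm A a" unfolding t_def by (rule hom_contractive[OF A B h a(1)])
 have "h c = \<zero>\<^sub>B"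
 proof -
  have "nrm B (h c) \<le> 0"
  proof (rule B.vlim_N_le[OF hom_vlim[OF A B h c] _ LIMSEQ_inverse_real_of_nat])
   fix n
   show "nrm B (h (A.nev a (q n))) \<le> inverse (real (Suc n))" unfolding hnev
   proof (rule B.nev_bound[OF ha])
    fix s assume s: "\<bar>s\<bar> \<le> nrm B (h a)"
    hence "?g s = s" by (auto simp: t_def)
    thus "\<bar>s * poly (q n) s\<bar> \<le> inverse (real (Suc n))" using q[of s n] s tle by (simp add: t_def)
   qed
  qed
  hence "nrm B (h c) = 0" using cc by (intro order_antisym B.N_nonneg) auto
  thus ?thesis using cc by (simp add: B.N_eq_0)
 qed
 moreover have "c \<in> norm_closure A (nrm A) (range (A.nev a))" using A.vlim_norm_closure[OF c] by blast
 moreover have "star A c = c"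
  using A.vlim_star[OF c] unfolding A.nev_star[OF a] by (rule A.vlim_unique[OF _ c])
 ultimately have c0: "c = \<zero>\<^sub>A" using inj[OF cc] by blast
 \<comment> \<open>Here \<open>A.nev a 1\<close> = a, so these elements approximate a - f(a), whose
   function is the clamping to [-t, t].\<close>
 have "nrm A (A.nev a (1 - q n)) \<le> t + inverse (real (Suc n))" for n
 proof (rule A.nev_bound[OF a])
  fix s assume s: "\<bar>s\<bar> \<le> nrm A a"
  have "\<bar>?g s\<bar> \<le> t" using t0 by auto
  thus "\<bar>s * poly (1 - q n) s\<bar> \<le> t + inverse (real (Suc n))"
   using q[OF s, of n] by (simp add: right_diff_distrib del: of_nat_Suc) 
 qed
 note bound = this
 have "A.nev a 1 = a" using a A.nev_pCons[of a 1 0] by (simp add: one_pCons)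
 hence lim: "A.vlim (%n. A.nev a (1 - q n)) (a \<ominus>\<^sub>A c)"
  using A.vlim_minus[OF A.vlim_const[OF a(1)] c] a by (simp add: A.nev_diff)
 have "nrm A (a \<ominus>\<^sub>A c) \<le> t + 0"
  by (rule A.vlim_N_le[OF lim bound tendsto_add[OF tendsto_const LIMSEQ_inverse_real_of_nat]])
 thus ?thesis using c0 a by (simp add: t_def)
qed

section \<open>Subalgebras and closed ideals\<close>

context
 fixes A :: "('a, 'm) cstar_scheme" and D
 assumes A: "cstar_algebra A" and D: "cstar_subalgebra D A"
begin

interpretation A: cstar_algebra A by (rule A)

lemma subalgebra_subset: "D \<subseteq> carrier A"
 using D A.submoduleE(1) by (auto simp: cstar_subalgebra_def)

lemma subalgebra_ops:
 "x \<in> D ==> y \<in> D ==> x \<oplus>\<^sub>A y \<in> D" "x \<in> D ==> t \<odot>\<^sub>A x \<in> D" "\<zero>\<^sub>A \<in> D"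
 "x \<in> D ==> y \<in> D ==> x \<otimes>\<^sub>A y \<in> D" "x \<in> D ==> star A x \<in> D"
proof -
 have s: "submodule D complex_ring A" using D by (simp add: cstar_subalgebra_def)
 show "x \<in> D ==> y \<in> D ==> x \<oplus>\<^sub>A y \<in> D" "x \<in> D ==> t \<odot>\<^sub>A x \<in> D"
  using A.submoduleE(4,5)[OF s] by auto
 show "\<zero>\<^sub>A \<in> D" using submodule.axioms(1)[OF s] subgroup.one_closed by fastforce
qed (use D in \<open>auto simp: cstar_subalgebra_def\<close>)

lemma cvec_subalgebra: "cvec (A\<lparr>carrier := D\<rparr>)"
proof (rule cvec_intro)
 note [simp] = subalgebra_ops and [simp] = subalgebra_subset[THEN subsetD]
 show "abelian_group (A\<lparr>carrier := D\<rparr>)"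
 proof (rule abelian_groupI)
  fix x assume "x <: (A\<lparr>carrier := D\<rparr>)"
  hence x: "x \<in> D" by simp
  thus "\<exists>y\<in>carrier (A\<lparr>carrier := D\<rparr>). y \<oplus>\<^sub>(A\<lparr>carrier := D\<rparr>) x = \<zero>\<^sub>(A\<lparr>carrier := D\<rparr>)"
   using A.M.l_neg[of x] by (intro bexI[of _ "(-1) \<odot>\<^sub>A x"]) (simp_all add: A.neg_eq_smult)
 qed (auto simp: A.M.a_ac)
qed (auto simp: subalgebra_ops subalgebra_subset[THEN subsetD] A.smult_add_l A.smult_add_r)

text \<open>Subtraction is defined through additive inverses in the carrier, so it has to be
  compared when the carrier shrinks.\<close>

lemma minus_subalgebra: "x \<in> D ==> y \<in> D ==> x \<ominus>\<^sub>(A\<lparr>carrier := D\<rparr>) y = x \<ominus>\<^sub>A y"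
proof -
 assume "x \<in> D" "y \<in> D"
 interpret D: cvec "A\<lparr>carrier := D\<rparr>" by (rule cvec_subalgebra)
 show ?thesis using D.M.minus_eq[of x y] D.neg_eq_smult[of y] \<open>x \<in> D\<close> \<open>y \<in> D\<close> subalgebra_subset
  by (simp add: A.M.minus_eq A.neg_eq_smult subset_eq)
qed

lemma cstar_algebra_subalgebra: "cstar_algebra (A\<lparr>carrier := D\<rparr>)"
proof -
 note [simp] = subalgebra_ops and sub = subalgebra_subset[THEN subsetD]
 interpret D: cvec "A\<lparr>carrier := D\<rparr>" by (rule cvec_subalgebra)
 show ?thesis
 proof unfold_locales
  show "norm_complete (A\<lparr>carrier := D\<rparr>) (nrm (A\<lparr>carrier := D\<rparr>))"
   unfolding norm_complete_def
  proof (intro allI impI)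
   fix f :: "nat => 'a"
   assume "\<forall>n. f n <: (A\<lparr>carrier := D\<rparr>)"
    and c: "\<forall>e>0. \<exists>M. \<forall>m\<ge>M. \<forall>n\<ge>M. nrm (A\<lparr>carrier := D\<rparr>) (f m \<ominus>\<^sub>(A\<lparr>carrier := D\<rparr>) f n) < e"
   hence f: "f n \<in> D" for n by simp
   obtain l where l: "A.vlim f l"
   proof (rule A.cauchy_vlim[OF A.complete])
    show "f n <: A" for n using f sub by blast
    show "\<exists>M. \<forall>m\<ge>M. \<forall>n\<ge>M. nrm A (f m \<ominus>\<^sub>A f n) < e" if "e > 0" for e
     using c[rule_format, OF that] f by (simp add: minus_subalgebra)
   qed
   have "l \<in> norm_closure A (nrm A) D" by (rule A.vlim_norm_closure[OF l f])
   hence "l \<in> D" using D by (auto simp: cstar_subalgebra_def)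
   thus "\<exists>l\<in>carrier (A\<lparr>carrier := D\<rparr>). (%n. nrm (A\<lparr>carrier := D\<rparr>) (f n \<ominus>\<^sub>(A\<lparr>carrier := D\<rparr>) l)) \<longlonglongrightarrow> 0"
    using A.vlimD(3)[OF l] f by (intro bexI[of _ l]) (auto simp: minus_subalgebra)
  qed
 qed (auto simp: sub A.mult_assoc A.mult_add_left A.mult_add_right A.mult_scale_left A.mult_scale_right
   A.star_add A.star_scale A.star_mult A.nrm_scale A.nrm_triangle A.nrm_mult A.nrm_star_mult A.N_eq_0)
qed

lemma vlim_subalgebra:
 assumes "A.vlim f l" "!!n. f n \<in> D"
 shows "l \<in> D" "normed_vec.vlim (A\<lparr>carrier := D\<rparr>) (nrm A) f l"
proof -
 have "l \<in> norm_closure A (nrm A) D" by (rule A.vlim_norm_closure[OF assms])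
 thus l: "l \<in> D" using D by (auto simp: cstar_subalgebra_def)
 interpret D: cstar_algebra "A\<lparr>carrier := D\<rparr>" by (rule cstar_algebra_subalgebra)
 show "normed_vec.vlim (A\<lparr>carrier := D\<rparr>) (nrm A) f l"
  using D.vlim_def[of f l] A.vlimD(3)[OF assms(1)] assms(2) l by (simp add: minus_subalgebra)
qed

end

definition closed_ideal :: "('a, 'm) cstar_scheme => 'a set => bool" where
 "closed_ideal A I \<longleftrightarrow> submodule I complex_ring A \<and>
   (\<forall>a\<in>carrier A. \<forall>b\<in>I. a \<otimes>\<^sub>A b \<in> I \<and> b \<otimes>\<^sub>A a \<in> I) \<and> norm_closure A (nrm A) I \<subseteq> I"

context cstar_algebra
begin

lemma closed_idealD:
 assumes "closed_ideal A I"
 shows "I \<subseteq> carrier A" "\<zero> \<in> I" "!!x y. x \<in> I ==> y \<in> I ==> x \<oplus> y \<in> I" "!!t x. x \<in> I ==> t \<odot> x \<in> I"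
  "!!a b. a <: A ==> b \<in> I ==> a \<otimes> b \<in> I" "!!a b. a <: A ==> b \<in> I ==> b \<otimes> a \<in> I"
proof -
 have s: "submodule I complex_ring A" using assms by (simp add: closed_ideal_def)
 show "I \<subseteq> carrier A" by (rule submoduleE(1)[OF s])
 show "\<zero> \<in> I" using submodule.axioms(1)[OF s] subgroup.one_closed by fastforce
 show "!!x y. x \<in> I ==> y \<in> I ==> x \<oplus> y \<in> I" "!!t x. x \<in> I ==> t \<odot> x \<in> I" using submoduleE(4,5)[OF s] by auto
qed (use assms in \<open>auto simp: closed_ideal_def\<close>)

text \<open>Each term of a q(a) has a factor a; this is the reason for evaluating t q(t) instead of
  q(t).\<close>

lemma closed_ideal_nev: assumes "closed_ideal A I" "a \<in> I" shows "nev a p \<in> I"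
 using assms closed_idealD[OF assms(1)] by (induction p) (auto simp: subset_eq)

lemma closed_ideal_nfun: assumes "closed_ideal A I" "a \<in> I" "nfun a f q c" shows "c \<in> I"
proof -
 have "c \<in> norm_closure A (nrm A) I"
  using assms(3) closed_ideal_nev[OF assms(1,2)] unfolding nfun_def by (blast intro: vlim_norm_closure)
 thus ?thesis using assms(1) by (auto simp: closed_ideal_def)
qed

lemma closed_ideal_carrier: "closed_ideal A (carrier A)"
 unfolding closed_ideal_def by (auto simp: norm_closure_in intro!: submoduleI)

end

section \<open>Factorization in Hilbert modules\<close>

context hilbert_module
begin

text \<open>The vector y p(<y, y>).\<close>

definition yev :: "'x => real poly => 'x" where
 "yev y p = fold_coeffs (%c x. complex_of_real c \<odot>\<^sub>X y \<oplus>\<^sub>X ract X x (inn X y y)) p \<zero>\<^sub>X"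

lemma yev_0 [simp]: "yev y 0 = \<zero>\<^sub>X"
 by (simp add: yev_def)

lemma yev_pCons [simp]:
 "y <: X ==> yev y (pCons c p) = complex_of_real c \<odot>\<^sub>X y \<oplus>\<^sub>X ract X (yev y p) (inn X y y)"
 by (cases "p = 0"; cases "c = 0") (simp_all add: yev_def)

lemma yev_closed [simp, intro]: "y <: X ==> yev y p <: X"
 by (induction p) auto

lemma yev_add: "y <: X ==> yev y (p + q) = yev y p \<oplus>\<^sub>X yev y q"
proof (induction p q rule: poly_induct2)
 case (pCons c p d q)
 have "complex_of_real (c + d) \<odot>\<^sub>X y = complex_of_real c \<odot>\<^sub>X y \<oplus>\<^sub>X complex_of_real d \<odot>\<^sub>X y"
  using pCons.prems by (simp add: X.smult_add_l)
 thus ?case using pCons by (simp add: ract_add_left X.M.a_ac)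
qed simp

lemma yev_smult: "y <: X ==> yev y (Polynomial.smult t p) = complex_of_real t \<odot>\<^sub>X yev y p"
 by (induction p) (simp_all add: X.smult_add_r ract_scale_left)

lemma yev_diff: "y <: X ==> yev y (p - q) = yev y p \<ominus>\<^sub>X yev y q"
 using yev_add[of y p "- q"] yev_smult[of y "-1" q] by (simp add: X.M.minus_eq X.neg_eq_smult)

lemma yev_1 [simp]: "y <: X ==> yev y 1 = y"
 using yev_pCons[of y 1 0] by (simp add: one_pCons)

lemma inn_self_sa: "y <: X ==> star A (inn X y y) = inn X y y"
 by (simp add: inn_star)

lemma nev_commute: "a <: A ==> A.nev a p \<otimes>\<^sub>A a = a \<otimes>\<^sub>A A.nev a p"
 by (induction p) (simp_all add: A.mult_add_left A.mult_add_right A.mult_scale_left A.mult_scale_right A.mult_assoc)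

lemma inn_y_yev: "y <: X ==> inn X y (yev y p) = A.nev (inn X y y) p"
 by (induction p) (simp_all add: inn_add inn_scale inn_ract nev_commute)

lemma inn_yev: "y <: X ==> inn X (yev y p) (yev y q) = A.nev (inn X y y) (p * q)"
proof (induction p)
 case (pCons c p)
 thus ?case
  by (simp add: inn_add_left inn_scale_left inn_ract_left inn_self_sa inn_y_yev A.nev_add A.nev_smult)
qed simp

lemma ract_yev_nev: "y <: X ==> ract X (yev y p) (A.nev (inn X y y) q) = yev y (p * pCons 0 q)"
proof -
 assume y: "y <: X"
 have 1: "ract X y (A.nev (inn X y y) q) = yev y (pCons 0 q)"
  using y by (induction q) (simp_all add: ract_add_right ract_scale_right ract_scale_left nev_commute[symmetric] ract_mult ract_add_left)
 show ?thesis
 proof (induction p)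
  case (pCons c p)
  have "ract X (yev y (pCons c p)) (A.nev (inn X y y) q)
   = complex_of_real c \<odot>\<^sub>X ract X y (A.nev (inn X y y) q)
    \<oplus>\<^sub>X ract X (yev y p) (inn X y y \<otimes>\<^sub>A A.nev (inn X y y) q)"
   using y by (simp add: ract_add_left ract_scale_left ract_mult)
  also have "\<dots> = complex_of_real c \<odot>\<^sub>X yev y (pCons 0 q) \<oplus>\<^sub>X ract X (yev y (p * pCons 0 q)) (inn X y y)"
   unfolding 1 using y pCons.IH by (simp add: nev_commute[symmetric] ract_mult del: yev_pCons mult_pCons_right)
  also have "\<dots> = yev y (pCons c p * pCons 0 q)"
   using y by (simp add: yev_add yev_smult del: mult_pCons_right smult_pCons)
  finally show ?case .
 qed (use y in simp)
qed

text \<open>With a = <y, y>, ||y p(a)||^2 = ||a p(a)^2||, whence the weight sqrt |t|: polynomials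
  may grow near 0 as long as this weight compensates.\<close>

lemma yev_bound:
 assumes y: "y <: X" and M: "!!t. \<bar>t\<bar> \<le> nrm A (inn X y y) ==> sqrt \<bar>t\<bar> * \<bar>poly p t\<bar> \<le> M"
 shows "hn (yev y p) \<le> M"
proof (rule hnorm_le)
 show "nrm A (inn X (yev y p) (yev y p)) \<le> M\<^sup>2"
  unfolding inn_yev[OF y]
 proof (rule A.nev_bound)
  fix t assume t: "\<bar>t\<bar> \<le> nrm A (inn X y y)"
  have "\<bar>t * poly (p * p) t\<bar> = (sqrt \<bar>t\<bar> * \<bar>poly p t\<bar>)\<^sup>2"
   by (simp add: power_mult_distrib abs_mult) (simp add: power2_eq_square)
  also have "\<dots> \<le> M\<^sup>2" using M[OF t] by (intro power_mono) auto
  finally show "\<bar>t * poly (p * p) t\<bar> \<le> M\<^sup>2" .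
 qed (use y in \<open>auto simp: inn_self_sa\<close>)
 show "0 \<le> M" using M[of 0] y by simp
qed (use y in auto)

lemma vlim_ract:
 assumes "X.vlim x l" "A.vlim a b" shows "X.vlim (%n. ract X (x n) (a n)) (ract X l b)"
proof (rule X.vlimI_bound)
 note [simp] = X.vlimD[OF assms(1)] A.vlimD[OF assms(2)]
 show "hn (ract X (x n) (a n) \<ominus>\<^sub>X ract X l b) \<le> hn (x n \<ominus>\<^sub>X l) * nrm A (a n) + hn l * nrm A (a n \<ominus>\<^sub>A b)" for n
 proof -
  have "ract X l (a n \<ominus>\<^sub>A b) = ract X l (a n) \<ominus>\<^sub>X ract X l b"
   by (simp add: A.M.minus_eq A.neg_eq_smult ract_add_right ract_scale_right X.M.minus_eq X.neg_eq_smult)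
  hence "ract X (x n) (a n) \<ominus>\<^sub>X ract X l b = ract X (x n \<ominus>\<^sub>X l) (a n) \<oplus>\<^sub>X ract X l (a n \<ominus>\<^sub>A b)"
  proof -
   have "ract X (x n) (a n) <: X" "ract X l (a n) <: X" "ract X l b <: X" by auto
   hence "ract X (x n) (a n) \<ominus>\<^sub>X ract X l b
    = (ract X (x n) (a n) \<ominus>\<^sub>X ract X l (a n)) \<oplus>\<^sub>X (ract X l (a n) \<ominus>\<^sub>X ract X l b)" by algebra
   thus ?thesis using \<open>ract X l (a n \<ominus>\<^sub>A b) = ract X l (a n) \<ominus>\<^sub>X ract X l b\<close> by (simp add: ract_minus)
  qed
  hence "hn (ract X (x n) (a n) \<ominus>\<^sub>X ract X l b) \<le> hn (ract X (x n \<ominus>\<^sub>X l) (a n)) + hn (ract X l (a n \<ominus>\<^sub>A b))"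
   using X.N_add[of "ract X (x n \<ominus>\<^sub>X l) (a n)" "ract X l (a n \<ominus>\<^sub>A b)"] by simp
  thus ?thesis using hnorm_ract[of "x n \<ominus>\<^sub>X l" "a n"] hnorm_ract[of l "a n \<ominus>\<^sub>A b"] by simp
 qed
 have "(%n. hn (x n \<ominus>\<^sub>X l) * nrm A (a n) + hn l * nrm A (a n \<ominus>\<^sub>A b)) \<longlonglongrightarrow> 0 * nrm A b + hn l * 0"
  by (intro tendsto_intros A.vlim_N assms) auto
 thus "(%n. hn (x n \<ominus>\<^sub>X l) * nrm A (a n) + hn l * nrm A (a n \<ominus>\<^sub>A b)) \<longlonglongrightarrow> 0" by simp
qed (use X.vlimD[OF assms(1)] A.vlimD[OF assms(2)] in blast)+

text \<open>With \<open>a = \<langle>y, y\<rangle>\<close> and \<open>g(t) = \<bar>t\<bar>\<^sup>1\<^sup>/\<^sup>4\<close>, take \<open>b = g(a)\<close> and \<open>z = lim y f\<^sub>n(a)\<close> where \<open>f\<^sub>n = 1 / (g + 1/n)\<close>.\<close>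

theorem factorization:
 assumes y: "y <: X" and I: "closed_ideal A I" "inn X y y \<in> I"
 obtains z b where "z <: X" "b \<in> I" "y = ract X z b"
proof -
 let ?a = "inn X y y" and ?R = "nrm A (inn X y y)"
 have a: "?a <: A" "star A ?a = ?a" using y by (auto simp: inn_self_sa)
 define g where "g t = sqrt (sqrt \<bar>t\<bar>)" for t :: real
 define i where "i n = inverse (real (Suc n))" for n
 have i: "i n > 0" "i n \<le> 1" for n by (auto simp: i_def inverse_le_1_iff)
 define f where "f n t = 1 / (g t + i n)" for n t
 have g0: "g t \<ge> 0" for t by (simp add: g_def)
 have g2: "(g t)\<^sup>2 = sqrt \<bar>t\<bar>" for t by (simp add: g_def)
 have gc: "continuous_on S g" for S unfolding g_def by (intro continuous_intros)
 have fc: "continuous_on S (f n)" for S n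
 proof -
  have "g t + i n \<noteq> 0" for t using g0[of t] i(1)[of n] by linarith
  thus ?thesis unfolding f_def by (intro continuous_intros gc) auto
 qed
 define G where "G = g ?R"
 have gG: "g t \<le> G" if "\<bar>t\<bar> \<le> ?R" for t using that a by (auto simp: g_def G_def)
 have "\<exists>p. \<forall>t\<in>{- ?R..?R}. \<bar>poly p t - f n t\<bar> \<le> i n" for n
  using unital_cstar.weierstrass_poly[OF CC.unital_cstar_axioms fc[of "{- ?R..?R}" n]]
  unfolding i_def by (metis compact_Icc)
 then obtain q where q: "!!n t. t \<in> {- ?R..?R} ==> \<bar>poly (q n) t - f n t\<bar> \<le> i n" by metis
 obtain r b where rb: "A.nfun ?a g r b"
  by (rule A.nfun_ex[OF a gc]) (simp add: g_def)
 have r: "\<bar>t * poly (r n) t - g t\<bar> \<le> i n" if "\<bar>t\<bar> \<le> ?R" for n t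
  using rb that unfolding A.nfun_def i_def by blast
 have b: "A.vlim (%n. A.nev ?a (r n)) b" using rb unfolding A.nfun_def by blast
 have bI: "b \<in> I" by (rule A.closed_ideal_nfun[OF I rb])
 \<comment> \<open>The difference of the fractions has the denominator (g + i m)(g + i n), which is
   at least g^2; this makes the approximating vectors a Cauchy sequence.\<close>
 have fdiff: "(g t)\<^sup>2 * \<bar>f m t - f n t\<bar> \<le> i m + i n" for m n t
 proof -
  let ?d = "(g t + i m) * (g t + i n)"
  have pos: "g t + i m > 0" "g t + i n > 0" using g0[of t] i(1)[of m] i(1)[of n] by linarith+
  have "f m t - f n t = (i n - i m) / ?d" unfolding f_def using pos by (simp add: divide_simps)
  hence "(g t)\<^sup>2 * \<bar>f m t - f n t\<bar> = (g t)\<^sup>2 / ?d * \<bar>i n - i m\<bar>" using pos by (simp add: abs_mult)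
  also have "(g t)\<^sup>2 \<le> ?d" unfolding power2_eq_square using g0[of t] i(1)[of m] i(1)[of n] by (intro mult_mono) auto
  hence "(g t)\<^sup>2 / ?d \<le> 1" using pos by (simp add: divide_le_eq)
  hence "(g t)\<^sup>2 / ?d * \<bar>i n - i m\<bar> \<le> 1 * \<bar>i n - i m\<bar>" by (rule mult_right_mono) simp
  also have "\<dots> \<le> i m + i n" using i(1)[of m] i(1)[of n] by simp
  finally show ?thesis .
 qed
 have G0: "0 \<le> G" by (simp add: G_def g0)
 have g2G: "(g t)\<^sup>2 \<le> G\<^sup>2" if "\<bar>t\<bar> \<le> ?R" for t using gG[OF that] g0 by (intro power_mono)
 have "hn (yev y (q m) \<ominus>\<^sub>X yev y (q n)) \<le> (G\<^sup>2 + 1) * i m + (G\<^sup>2 + 1) * i n" for m n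
  unfolding yev_diff[OF y, symmetric]
 proof (rule yev_bound[OF y])
  fix t assume t: "\<bar>t\<bar> \<le> ?R"
  hence t': "t \<in> {- ?R..?R}" by auto
  have "\<bar>poly (q m - q n) t\<bar> \<le> \<bar>f m t - f n t\<bar> + (i m + i n)"
   using q[OF t', of m] q[OF t', of n] by simp
  hence "sqrt \<bar>t\<bar> * \<bar>poly (q m - q n) t\<bar> \<le> (g t)\<^sup>2 * (\<bar>f m t - f n t\<bar> + (i m + i n))"
   unfolding g2 by (intro mult_left_mono) auto
  also have "\<dots> \<le> (i m + i n) + G\<^sup>2 * (i m + i n)"
   using fdiff[of t m n] mult_right_mono[OF g2G[OF t], of "i m + i n"] i(1)[of m] i(1)[of n]
   by (simp add: distrib_left)
  finally show "sqrt \<bar>t\<bar> * \<bar>poly (q m - q n) t\<bar> \<le> (G\<^sup>2 + 1) * i m + (G\<^sup>2 + 1) * i n"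
   by (simp add: algebra_simps)
 qed
 moreover have i0: "(%n. C * i n) \<longlonglongrightarrow> 0" for C
  unfolding i_def using tendsto_mult_left[OF LIMSEQ_inverse_real_of_nat, of C] by simp
 ultimately obtain z where z: "X.vlim (%n. yev y (q n)) z"
  using X.cauchy_vlim_bound[OF hcomplete, of "%n. yev y (q n)" "%n. (G\<^sup>2 + 1) * i n"] y by blast
 have "X.vlim (%n. ract X (yev y (q n)) (A.nev ?a (r n))) (ract X z b)" by (rule vlim_ract[OF z b])
 moreover have "X.vlim (%n. ract X (yev y (q n)) (A.nev ?a (r n))) y"
 proof (rule X.vlimI_bound[OF _ y _ i0])
  fix n
  show "ract X (yev y (q n)) (A.nev ?a (r n)) <: X" using y by auto
  let ?p = "q n * pCons 0 (r n)"
  have "ract X (yev y (q n)) (A.nev ?a (r n)) \<ominus>\<^sub>X y = yev y (?p - 1)"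
   using y by (simp only: ract_yev_nev yev_diff yev_1)
  also have "hn \<dots> \<le> (G\<^sup>2 * (G + 1) + G + G) * i n"
  proof (rule yev_bound[OF y])
   fix t assume t: "\<bar>t\<bar> \<le> ?R"
   hence t': "t \<in> {- ?R..?R}" by auto
   define s where "s = t * poly (r n) t"
   define u where "u = poly (q n) t"
   have su: "\<bar>s - g t\<bar> \<le> i n" "\<bar>u - f n t\<bar> \<le> i n" using r[OF t] q[OF t'] by (auto simp: s_def u_def)
   have gi: "g t + i n > 0" using g0[of t] i(1)[of n] by linarith
   \<comment> \<open>u approximates f n and s approximates g, so u s - 1 splits into two
     approximation errors and f g - 1. The weight sqrt |t| = g^2 absorbs f n because g f n \<le>
     1.\<close>
   have e: "poly (?p - 1) t = (u - f n t) * s + f n t * (s - g t) + (f n t * g t - 1)"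
    by (simp add: s_def u_def algebra_simps)
   have f0: "0 \<le> f n t" using gi by (simp add: f_def)
   have s1: "\<bar>s\<bar> \<le> G + 1" using su(1) gG[OF t] g0[of t] i(2)[of n] by linarith
   have gf: "g t * f n t \<le> 1" using gi i(1)[of n] by (simp add: f_def divide_le_eq)
   have fg1: "\<bar>f n t * g t - 1\<bar> = i n * f n t" using gi i(1)[of n] by (simp add: f_def divide_simps)
   have "\<bar>poly (?p - 1) t\<bar> \<le> i n * (G + 1) + f n t * i n + i n * f n t"
   proof -
    have "\<bar>(u - f n t) * s\<bar> \<le> i n * (G + 1)" unfolding abs_mult using su s1 i(1)[of n] by (intro mult_mono) auto
    moreover have "\<bar>f n t * (s - g t)\<bar> \<le> f n t * i n" unfolding abs_mult using su f0 by (simp add: mult_left_mono)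
    ultimately show ?thesis unfolding e using fg1 by linarith
   qed
   hence "sqrt \<bar>t\<bar> * \<bar>poly (?p - 1) t\<bar> \<le> (g t)\<^sup>2 * (i n * (G + 1) + f n t * i n + i n * f n t)"
    unfolding g2 by (intro mult_left_mono) auto
   also have "\<dots> = (g t)\<^sup>2 * (G + 1) * i n + (g t * (g t * f n t) + g t * (g t * f n t)) * i n"
    by (simp add: power2_eq_square algebra_simps)
   also have "\<dots> \<le> G\<^sup>2 * (G + 1) * i n + (G * 1 + G * 1) * i n"
    using g2G[OF t] gG[OF t] gf g0[of t] f0 G0 i(1)[of n]
    by (intro add_mono mult_right_mono mult_mono) auto
   finally show "sqrt \<bar>t\<bar> * \<bar>poly (?p - 1) t\<bar> \<le> (G\<^sup>2 * (G + 1) + G + G) * i n" by (simp add: algebra_simps)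
  qed
  finally show "hn (ract X (yev y (q n)) (A.nev ?a (r n)) \<ominus>\<^sub>X y) \<le> (G\<^sup>2 * (G + 1) + G + G) * i n" .
 qed
 ultimately have "y = ract X z b" using X.vlim_unique by blast
 thus ?thesis using that bI X.vlimD(2)[OF z] by blast
qed

text \<open>One inclusion is the factorization theorem. It is what makes a set of single products
  closed under addition.\<close>

corollary mod_ideal_iff:
 assumes I: "closed_ideal A I" shows "mod_ideal X I = {y \<in> carrier X. inn X y y \<in> I}"
proof (intro equalityI subsetI)
 note id = A.closed_idealD[OF I]
 fix y assume "y \<in> mod_ideal X I"
 then obtain x a where xa: "x <: X" "a \<in> I" "y = ract X x a" unfolding mod_ideal_def by blast
 have a: "a <: A" using xa id(1) by blast
 have "star A a \<otimes>\<^sub>A inn X x x \<otimes>\<^sub>A a \<in> I" using xa a by (intro id(5)) auto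
 thus "y \<in> {y \<in> carrier X. inn X y y \<in> I}" using xa a by (simp add: inn_ract inn_ract_left)
next
 fix y assume "y \<in> {y \<in> carrier X. inn X y y \<in> I}"
 thus "y \<in> mod_ideal X I" using factorization[OF _ I, of y] unfolding mod_ideal_def by blast
qed

lemma mod_ideal_add:
 assumes I: "closed_ideal A I" and xy: "x \<in> mod_ideal X I" "y \<in> mod_ideal X I"
 shows "x \<oplus>\<^sub>X y \<in> mod_ideal X I"
proof -
 note id = A.closed_idealD[OF I]
 obtain u a where u: "u <: X" "a \<in> I" "x = ract X u a" using xy unfolding mod_ideal_def by blast
 obtain v b where v: "v <: X" "b \<in> I" "y = ract X v b" using xy unfolding mod_ideal_def by blast
 have ab: "a <: A" "b <: A" using u v id(1) by auto
 have "inn X (x \<oplus>\<^sub>X y) (x \<oplus>\<^sub>X y) = inn X (x \<oplus>\<^sub>X y) u \<otimes>\<^sub>A a \<oplus>\<^sub>A inn X (x \<oplus>\<^sub>X y) v \<otimes>\<^sub>A b"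
  using u v ab by (simp add: inn_add inn_ract)
 also have "\<dots> \<in> I" using u v ab by (intro id(3,5)) auto
 finally show ?thesis unfolding mod_ideal_iff[OF I] using u v ab by simp
qed

end

section \<open>Compact operators and bimodules\<close>

lemma (in cstar_algebra) nev_annihilate:
 "a <: A ==> b <: A ==> a \<otimes> b = \<zero> ==> nev a p \<otimes> b = \<zero>"
 by (induction p) (simp_all add: mult_add_left mult_scale_left mult_assoc)

lemma KK_simps [simp]:
 "mult (KK A X) = mult (LL A X)" "one (KK A X) = one (LL A X)" "zero (KK A X) = zero (LL A X)"
 "add (KK A X) = add (LL A X)" "smult (KK A X) = smult (LL A X)"
 "star (KK A X) = star (LL A X)" "nrm (KK A X) = nrm (LL A X)"
 by (simp_all add: KK_def)

lemma LL_apply: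
 assumes "z <: X"
 shows "(S \<oplus>\<^sub>(LL A X) T) z = S z \<oplus>\<^sub>X T z" "(c \<odot>\<^sub>(LL A X) T) z = c \<odot>\<^sub>X T z" "\<zero>\<^sub>(LL A X) z = \<zero>\<^sub>X"
  "(S \<otimes>\<^sub>(LL A X) T) z = S (T z)" "\<one>\<^sub>(LL A X) z = z"
 using assms by (auto simp: compose_def)

context hilbert_module
begin

abbreviation KX :: "('x => 'x) set" where "KX \<equiv> carrier (KK A X)"

definition rank_ones :: "('x => 'x) set" where
 "rank_ones = {rank_one X x y | x y. x <: X \<and> y <: X}"

lemma KX_def: "KX = norm_closure (LL A X) (op_norm A X) (cspan (LL A X) rank_ones)"
 by (simp add: KK_def rank_ones_def)

lemma rank_one_apply [simp]: "z <: X ==> rank_one X x y z = ract X x (inn X y z)"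
 by (simp add: rank_one_def)

lemma rank_one_adjointable [simp, intro]:
 "x <: X ==> y <: X ==> rank_one X x y \<in> adjointable X"
 unfolding rank_one_def
 by (rule adjointableI[where g = "%z. ract X y (inn X x z)"]) (auto simp: inn_ract inn_ract_left inn_star)

lemma adjoint_rank_one: "x <: X ==> y <: X ==> adjoint X (rank_one X x y) = rank_one X y x"
 by (rule adjoint_unique) (auto simp: inn_ract inn_ract_left inn_star)

lemma compose_rank_one:
 assumes "T \<in> adjointable X" "x <: X" "y <: X"
 shows "T \<otimes>\<^sub>(LL A X) rank_one X x y = rank_one X (T x) y"
proof (rule adjointable_ext)
 show "T \<otimes>\<^sub>(LL A X) rank_one X x y \<in> adjointable X" using assms by (simp add: LL_compose_closed)
qed (use assms in \<open>auto simp: compose_def adjointable_ract\<close>)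

lemma op_norm_rank_one:
 assumes "x <: X" "y <: X" shows "op_norm A X (rank_one X x y) \<le> hn x * hn y"
proof (rule op_norm_le)
 fix z assume z: "z <: X"
 have "hn (ract X x (inn X y z)) \<le> hn x * nrm A (inn X y z)" using assms z by (intro hnorm_ract) auto
 also have "\<dots> \<le> hn x * (hn y * hn z)" using assms z by (intro mult_left_mono inn_bound) auto
 finally show "hn (rank_one X x y z) \<le> hn x * hn y * hn z" using z by (simp add: mult.assoc)
qed (use assms in simp)

lemma rank_ones_subset: "rank_ones \<subseteq> carrier (LL A X)"
 by (auto simp: rank_ones_def)

lemma KX_adjointable: "T \<in> KX ==> T \<in> adjointable X"
 unfolding KX_def using LL.norm_closure_in by simp

lemma KX_induct [consumes 1, case_names zero rank_one add smult lim]: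
 assumes "T \<in> KX" and "P \<zero>\<^sub>(LL A X)"
  and "!!x y. x <: X ==> y <: X ==> P (rank_one X x y)"
  and "!!S T. S \<in> adjointable X ==> T \<in> adjointable X ==> P S ==> P T ==> P (S \<oplus>\<^sub>(LL A X) T)"
  and "!!c T. T \<in> adjointable X ==> P T ==> P (c \<odot>\<^sub>(LL A X) T)"
  and "!!F T. LL.vlim F T ==> (!!n. P (F n)) ==> P T"
 shows "P T"
proof -
 have "T \<in> norm_closure (LL A X) (nrm (LL A X)) (cspan (LL A X) rank_ones)" using assms(1) by (simp add: KX_def)
 thus ?thesis using rank_ones_subset
  by (rule LL.closure_induct) (use assms(2-) in \<open>auto simp: rank_ones_def simp del: LL_simps(4-7)\<close>)
qed

lemma KX_submodule: "submodule KX complex_ring (LL A X)"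
 unfolding KX_def LL_simps(8)[symmetric]
 by (intro LL.norm_closure_submodule LL.cspan_submodule rank_ones_subset)

lemma KX_rank_one: "x <: X ==> y <: X ==> rank_one X x y \<in> KX"
proof -
 assume "x <: X" "y <: X"
 hence "rank_one X x y \<in> cspan (LL A X) rank_ones" by (intro LL.cspan_gen) (auto simp: rank_ones_def)
 thus ?thesis unfolding KX_def LL_simps(8)[symmetric]
  using LL.norm_closure_subset[OF LL.cspan_subset[OF rank_ones_subset]] by blast
qed

lemma KX_add: "S \<in> KX ==> T \<in> KX ==> S \<oplus>\<^sub>(LL A X) T \<in> KX"
 using LL.submoduleE(5)[OF KX_submodule] by blast

lemma KX_smult: "T \<in> KX ==> c \<odot>\<^sub>(LL A X) T \<in> KX"
 using LL.submoduleE(4)[OF KX_submodule, of c] by simp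

lemma KX_zero: "\<zero>\<^sub>(LL A X) \<in> KX"
 using submodule.axioms(1)[OF KX_submodule] subgroup.one_closed by fastforce

lemma KX_minus: "S \<in> KX ==> T \<in> KX ==> S \<ominus>\<^sub>(LL A X) T \<in> KX"
 using KX_add[of S "(-1) \<odot>\<^sub>(LL A X) T"] KX_smult[of T "-1"] KX_adjointable[of T]
 by (simp add: LL.M.minus_eq LL.neg_eq_smult del: LL_simps) (simp add: LL.neg_eq_smult)

lemma KX_vlim: "LL.vlim F T ==> (!!n. F n \<in> KX) ==> T \<in> KX"
proof -
 assume "LL.vlim F T" "!!n. F n \<in> KX"
 hence "T \<in> norm_closure (LL A X) (nrm (LL A X)) KX" by (rule LL.vlim_norm_closure)
 thus ?thesis
  using LL.norm_closure_closed[OF LL.cspan_subset[OF rank_ones_subset]] unfolding KX_def by simp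
qed

lemma KX_compose_left: assumes "T \<in> KX" and S: "S \<in> adjointable X" shows "S \<otimes>\<^sub>(LL A X) T \<in> KX"
proof -
 have S': "S <: LL A X" using S by simp
 show ?thesis using assms(1)
 proof (induction rule: KX_induct)
  case zero
  show ?case using S' KX_zero LL.mult_zero_r[OF S'] by metis
 next
  case (rank_one x y)
  thus ?case using S by (simp add: compose_rank_one KX_rank_one del: LL_simps)
 next
  case (add T U)
  thus ?case using LL.mult_add_right[OF S', of T U] KX_add by (simp del: LL_simps(2-8))
 next
  case (smult c T)
  thus ?case using LL.mult_scale_right[OF S', of T c] KX_smult by (simp del: LL_simps(2-8))
 next
  case (lim F T)
  show ?case by (rule KX_vlim[OF LL.vlim_mult[OF LL.vlim_const[OF S'] lim(1)] lim(2)])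
 qed
qed

lemma KX_star: "T \<in> KX ==> star (LL A X) T \<in> KX"
proof (induction rule: KX_induct)
 case zero
 show ?case using KX_zero LL.star_zero by metis
next
 case (rank_one x y)
 thus ?case by (simp add: adjoint_rank_one KX_rank_one)
next
 case (add T U)
 thus ?case using LL.star_add[of T U] KX_add by (simp del: LL_simps(2-8))
next
 case (smult c T)
 thus ?case using LL.star_scale[of T c] KX_smult by (simp del: LL_simps(2-8))
next
 case (lim F T)
 show ?case by (rule KX_vlim[OF LL.vlim_star[OF lim(1)] lim(2)])
qed

lemma KX_adjoint: "T \<in> KX ==> adjoint X T \<in> KX"
 using KX_star by simp

lemma KX_compose_right: assumes "T \<in> KX" and S: "S \<in> adjointable X" shows "T \<otimes>\<^sub>(LL A X) S \<in> KX"
proof -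
 have T: "T \<in> adjointable X" using assms(1) by (rule KX_adjointable)
 have "adjoint X (adjoint X S \<otimes>\<^sub>(LL A X) adjoint X T) \<in> KX"
  using S by (intro KX_adjoint KX_compose_left assms(1)) auto
 thus ?thesis using LL.star_mult[of "adjoint X S" "adjoint X T"] S T by simp
qed

lemma KX_subalgebra: "cstar_subalgebra KX (LL A X)"
 unfolding cstar_subalgebra_def
proof (intro conjI ballI)
 show "submodule KX complex_ring (LL A X)" by (rule KX_submodule)
 show "norm_closure (LL A X) (nrm (LL A X)) KX \<subseteq> KX"
  using LL.norm_closure_closed[OF LL.cspan_subset[OF rank_ones_subset]] unfolding KX_def by simp
qed (use KX_adjoint in \<open>auto simp: KX_compose_left[unfolded LL_simps] KX_adjointable\<close>)

lemma KK_eq: "KK A X = (LL A X)\<lparr>carrier := KX\<rparr>"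
 by (simp add: KK_def)

lemma cstar_algebra_KK: "cstar_algebra (KK A X)"
 using cstar_algebra_subalgebra[OF LL.cstar_algebra_axioms KX_subalgebra] KK_eq by simp

lemma KK_vlim: "LL.vlim F T ==> (!!n. F n \<in> KX) ==> normed_vec.vlim (KK A X) (nrm (KK A X)) F T"
 using vlim_subalgebra(2)[OF LL.cstar_algebra_axioms KX_subalgebra] KK_eq by simp

text \<open>Strengthens the cases of \<open>KX_induct\<close> by compactness of all operators
  involved, as needed for maps that are only controlled on compact operators.\<close>

lemma KX_induct' [consumes 1, case_names zero rank_one add smult lim]:
 assumes "T \<in> KX" and z: "P \<zero>\<^sub>(LL A X)"
  and r: "!!x y. x <: X ==> y <: X ==> P (rank_one X x y)"
  and a: "!!S T. S \<in> KX ==> T \<in> KX ==> P S ==> P T ==> P (S \<oplus>\<^sub>(LL A X) T)"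
  and s: "!!c T. T \<in> KX ==> P T ==> P (c \<odot>\<^sub>(LL A X) T)"
  and l: "!!F T. LL.vlim F T ==> (!!n. F n \<in> KX) ==> T \<in> KX ==> (!!n. P (F n)) ==> P T"
 shows "P T"
proof -
 have "T \<in> KX \<and> P T" using assms(1)
 proof (induction rule: KX_induct)
  case (lim F T)
  hence "F n \<in> KX" "P (F n)" for n by auto
  thus ?case using l[OF lim(1)] KX_vlim[OF lim(1)] by blast
 qed (use z r a s KX_zero KX_rank_one KX_add KX_smult in \<open>auto simp del: LL_simps\<close>)
 thus ?thesis by blast
qed

lemma op_vlim: "LL.vlim F T ==> z <: X ==> X.vlim (%n. F n z) (T z)"
proof (rule X.vlimI_bound)
 assume F: "LL.vlim F T" and z: "z <: X"
 have Fa: "F n \<in> adjointable X" "T \<in> adjointable X" for n using LL.vlimD[OF F] by auto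
 show "F n z <: X" "T z <: X" for n using Fa z by auto
 show "hn (F n z \<ominus>\<^sub>X T z) \<le> op_norm A X (F n \<ominus>\<^sub>(LL A X) T) * hn z" for n
 proof -
  have "F n \<ominus>\<^sub>(LL A X) T \<in> adjointable X" using LL.minus_in[of "F n" T] Fa by simp
  from op_norm_ge[OF this z] show ?thesis using Fa z by (simp add: LL_minus_apply)
 qed
 show "(%n. op_norm A X (F n \<ominus>\<^sub>(LL A X) T) * hn z) \<longlonglongrightarrow> 0"
  using tendsto_mult_right[OF LL.vlimD(3)[OF F], of "hn z"] by simp
qed

text \<open>With \<open>\<theta> = \<theta>\<^sub>y\<^sub>,\<^sub>y\<close> and \<open>\<parallel>y\<parallel> < 1\<close>, the contraction \<open>V = (1 - \<theta>\<^sup>2)\<^sup>n\<close> makes \<open>V y\<close> small, and \<open>1 - V\<close> is compact.\<close>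

definition near_one :: "('x => 'x) set" where
 "near_one = {V \<in> adjointable X. op_norm A X V \<le> 1 \<and> \<one>\<^sub>(LL A X) \<ominus>\<^sub>(LL A X) V \<in> KX}"

lemma pev_rank_one:
 assumes y: "y <: X" shows "LL.pev (rank_one X y y) p y = yev y p"
proof (induction p)
 case (pCons c p)
 have th: "rank_one X y y <: LL A X" using y by simp
 have pc: "LL.pev (rank_one X y y) p \<in> adjointable X" using LL.pev_closed[OF th, of p] by simp
 show ?case using y pCons pc by (simp add: LL.pev_pCons[OF th, unfolded LL_simps] compose_def inn_y_yev ract_yev_nev)
  (use ract_yev_nev[OF y, of 1 p] y in simp)
qed (use y in simp)

lemma pev_KX: assumes "T \<in> KX" shows "LL.pev T (pCons 0 p) \<in> KX"
proof -
 have T: "T <: LL A X" "T \<in> adjointable X" using KX_adjointable[OF assms] by auto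
 have p: "LL.pev T p <: LL A X" by (rule LL.pev_closed[OF T(1)])
 have "LL.pev T (pCons 0 p) = T \<otimes>\<^sub>(LL A X) LL.pev T p"
  using LL.pev_pCons[OF T(1), of 0 p] LL.smult_0[OF LL.one_closed] LL.M.l_zero[OF LL.mult_closed[OF T(1) p]]
  by (simp del: LL_simps)
 moreover have "T \<otimes>\<^sub>(LL A X) LL.pev T p \<in> KX" using KX_compose_right[OF assms, of "LL.pev T p"] p by simp
 ultimately show ?thesis by simp
qed

lemma near_one_unit:
 assumes y: "y <: X" "hn y < 1" and e: "e > 0"
 obtains V where "V \<in> near_one" "hn (V y) \<le> e"
proof -
 let ?th = "rank_one X y y" and ?a = "inn X y y"
 have th: "?th <: LL A X" "star (LL A X) ?th = ?th" using y by (auto simp: adjoint_rank_one)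
 \<comment> \<open>The fourth power of sqrt |t| (1 - t^2)^n is t^2 (1 - t^2)^(4 n), which will be
   bounded by 1/n; hence e^4.\<close>
 obtain n :: nat where n: "1 / e ^ 4 < real n" using reals_Archimedean2 by blast
 hence n0: "n > 0" using e by (metis divide_nonneg_nonneg less_irrefl less_le_trans of_nat_0 of_nat_0_less_iff not_less zero_le_one zero_le_power le_less_trans less_imp_le)
 define p :: "real poly" where "p = [:1, 0, -1:] ^ n"
 define V where "V = LL.pev ?th p"
 have pt: "poly p t = (1 - t\<^sup>2) ^ n" for t :: real by (simp add: p_def poly_power power2_eq_square)
 have Vc: "V <: LL A X" unfolding V_def by (rule LL.pev_closed[OF th(1)])
 have nth: "nrm (LL A X) ?th \<le> 1"
 proof -
  have "nrm (LL A X) ?th \<le> hn y * hn y" using op_norm_rank_one[OF y(1) y(1)] by simp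
  also have "\<dots> \<le> 1 * 1" using y by (intro mult_mono) auto
  finally show ?thesis by simp
 qed
 have small: "0 \<le> 1 - t\<^sup>2" "1 - t\<^sup>2 \<le> 1" if "\<bar>t\<bar> \<le> 1" for t :: real
  using that abs_square_le_1[of t] by auto
 have "nrm (LL A X) V \<le> 1" unfolding V_def
 proof (rule LL.pev_bound[OF th])
  fix t assume "\<bar>t\<bar> \<le> nrm (LL A X) ?th"
  hence "\<bar>t\<bar> \<le> 1" using nth by linarith
  thus "\<bar>poly p t\<bar> \<le> 1" unfolding pt using small[of t] by (simp add: power_le_one)
 qed
 moreover have "\<one>\<^sub>(LL A X) \<ominus>\<^sub>(LL A X) V \<in> KX"
 proof -
  have "coeff (1 - p) 0 = 0" using pt[of 0] by (simp flip: poly_0_coeff_0)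
  hence "1 - p = pCons 0 (poly_shift 1 (1 - p))" using pCons_poly_shift[of "1 - p"] by simp
  moreover have "LL.pev ?th (1 - p) = \<one>\<^sub>(LL A X) \<ominus>\<^sub>(LL A X) V"
   using LL.pev_diff[OF th(1), of 1 p] LL.pev_1[OF th(1)] V_def by (simp del: LL_simps)
  ultimately show ?thesis using pev_KX[OF KX_rank_one[OF y(1) y(1)]] by metis
 qed
 moreover have "hn (V y) \<le> e"
  unfolding V_def pev_rank_one[OF y(1)]
 proof (rule yev_bound[OF y(1)])
  fix t assume t: "\<bar>t\<bar> \<le> nrm A ?a"
  have "nrm A ?a \<le> 1" using y hnorm_square[OF y(1)] power_mono[of "hn y" 1 2] by simp
  hence t1: "\<bar>t\<bar> \<le> 1" using t by linarith
  let ?s = "t\<^sup>2"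
  have s: "0 \<le> ?s" "?s \<le> 1" using small[OF t1] by auto
  have "?s * (1 - ?s) ^ (4 * n) \<le> ?s * (1 - ?s) ^ n"
   using s by (intro mult_left_mono power_decreasing) auto
  also have "\<dots> \<le> 1 / real n"
  proof -
   have m1: "- 1 \<le> ?s" using zero_le_power2[of t] by linarith
   \<comment> \<open>Bernoulli's inequality: (1 - s)^n (1 + n s) \<le> (1 - s^2)^n \<le> 1, so n s
     (1 - s)^n \<le> 1.\<close>
   have "(1 - ?s) ^ n * (1 + real n * ?s) \<le> (1 - ?s) ^ n * (1 + ?s) ^ n"
    by (rule mult_left_mono[OF Bernoulli_inequality[OF m1]]) (use s in simp)
   also have "\<dots> = ((1 - ?s) * (1 + ?s)) ^ n" by (rule power_mult_distrib[symmetric])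
   also have "(1 - ?s) * (1 + ?s) = 1 - ?s * ?s" by (simp add: algebra_simps)
   also have "(1 - ?s * ?s) ^ n \<le> 1" using mult_le_one[OF s(2) s] zero_le_square[of ?s] by (intro power_le_one) linarith+
   finally have *: "(1 - ?s) ^ n + real n * (?s * (1 - ?s) ^ n) \<le> 1" by (simp add: algebra_simps)
   moreover have "0 \<le> (1 - ?s) ^ n" using s by simp
   ultimately have "real n * (?s * (1 - ?s) ^ n) \<le> 1" by linarith
   thus ?thesis using n0 by (simp add: field_simps)
  qed
  also have "\<dots> \<le> e ^ 4" using n n0 e by (simp add: field_simps)
  finally have le: "?s * (1 - ?s) ^ (4 * n) \<le> e ^ 4" .
  have "(sqrt \<bar>t\<bar> * \<bar>poly p t\<bar>) ^ 4 = ?s * (1 - ?s) ^ (4 * n)"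
  proof -
   have "(sqrt \<bar>t\<bar>) ^ 4 = ?s" using real_sqrt_pow2[of "\<bar>t\<bar>"] power_mult[of "sqrt \<bar>t\<bar>" 2 2] by simp
   thus ?thesis unfolding pt using s by (simp add: power_mult_distrib power_abs power_mult[symmetric] mult.commute)
  qed
  with le have "(sqrt \<bar>t\<bar> * \<bar>poly p t\<bar>) ^ 4 \<le> e ^ 4" by simp
  thus "sqrt \<bar>t\<bar> * \<bar>poly p t\<bar> \<le> e" using e by (simp add: power_mono_iff)
 qed
 ultimately show ?thesis using that[of V] Vc by (simp add: near_one_def)
qed

lemma near_one_small:
 assumes y: "y <: X" and e: "e > 0"
 obtains V where "V \<in> near_one" "hn (V y) \<le> e"
proof -
 define t where "t = hn y + 1"
 have t: "t > 0" "hn y < t" using y by (auto simp: t_def add_nonneg_pos)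
 let ?y = "complex_of_real (1 / t) \<odot>\<^sub>X y"
 have y': "?y <: X" "hn ?y < 1" using y t by (auto simp: hnorm_smult norm_divide)
 obtain V where V: "V \<in> near_one" "hn (V ?y) \<le> e / t" using near_one_unit[OF y', of "e / t"] e t by auto
 hence "hn (V y) \<le> e" using t y by (simp add: near_one_def adjointable_smult hnorm_smult norm_divide divide_le_eq)
 thus ?thesis using V that by blast
qed

text \<open>1 - V W = (1 - V) + V (1 - W). Composition lets several vectors be made small one after
  the other.\<close>

lemma near_one_compose: assumes "V \<in> near_one" "W \<in> near_one" shows "V \<otimes>\<^sub>(LL A X) W \<in> near_one"
proof -
 have V: "V <: LL A X" "nrm (LL A X) V \<le> 1" "\<one>\<^sub>(LL A X) \<ominus>\<^sub>(LL A X) V \<in> KX"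
  and W: "W <: LL A X" "nrm (LL A X) W \<le> 1" "\<one>\<^sub>(LL A X) \<ominus>\<^sub>(LL A X) W \<in> KX"
  using assms by (auto simp: near_one_def)
 have "nrm (LL A X) (V \<otimes>\<^sub>(LL A X) W) \<le> 1"
  using LL.nrm_mult[OF V(1) W(1)] mult_mono[OF V(2) W(2)] V W by (meson LL.N_nonneg order_trans zero_le_one mult_le_one)
 moreover have "V \<otimes>\<^sub>(LL A X) W <: LL A X" using V W by blast
 moreover have "\<one>\<^sub>(LL A X) \<ominus>\<^sub>(LL A X) V \<otimes>\<^sub>(LL A X) W \<in> KX"
 proof -
  have "\<one>\<^sub>(LL A X) \<ominus>\<^sub>(LL A X) V \<otimes>\<^sub>(LL A X) W
   = (\<one>\<^sub>(LL A X) \<ominus>\<^sub>(LL A X) V) \<oplus>\<^sub>(LL A X) V \<otimes>\<^sub>(LL A X) (\<one>\<^sub>(LL A X) \<ominus>\<^sub>(LL A X) W)"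
   using V(1) W(1) LL.one_closed by algebra
  moreover have "V \<otimes>\<^sub>(LL A X) (\<one>\<^sub>(LL A X) \<ominus>\<^sub>(LL A X) W) \<in> KX" using KX_compose_left[OF W(3), of V] V by simp
  ultimately show ?thesis using KX_add V(3) by simp
 qed
 ultimately show ?thesis by (simp add: near_one_def)
qed

lemma near_one_one: "\<one>\<^sub>(LL A X) \<in> near_one"
proof -
 have "\<one>\<^sub>(LL A X) \<ominus>\<^sub>(LL A X) \<one>\<^sub>(LL A X) \<in> KX" using KX_zero LL.minus_self[OF LL.one_closed] by metis
 thus ?thesis using LL.nrm_one LL.one_closed by (simp add: near_one_def)
qed

end

section \<open>The left action of a bimodule and the annihilator of its kernel\<close>

context hilbert_bimodule
begin

lemma lact_adjointable [simp, intro]: "a <: A ==> lact X a \<in> adjointable X"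
 using hom_closed[OF A.cstar_algebra_axioms LL.cstar_algebra_axioms lact_hom] by simp

lemma lact_closed [simp, intro]: "a <: A ==> x <: X ==> lact X a x <: X"
 by blast

lemma lact_star: "a <: A ==> lact X (star A a) = adjoint X (lact X a)"
 using hom_star[OF A.cstar_algebra_axioms LL.cstar_algebra_axioms lact_hom] by simp

lemma lact_mult: "a <: A ==> b <: A ==> x <: X ==> lact X (a \<otimes>\<^sub>A b) x = lact X a (lact X b x)"
 using hom_mult[OF A.cstar_algebra_axioms LL.cstar_algebra_axioms lact_hom, of a b] by (simp add: compose_def)

lemma lact_add: "a <: A ==> b <: A ==> x <: X ==> lact X (a \<oplus>\<^sub>A b) x = lact X a x \<oplus>\<^sub>X lact X b x"
 using hom_add[OF A.cstar_algebra_axioms LL.cstar_algebra_axioms lact_hom, of a b] by simp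

lemma lact_smult: "a <: A ==> x <: X ==> lact X (t \<odot>\<^sub>A a) x = t \<odot>\<^sub>X lact X a x"
 using hom_smult[OF A.cstar_algebra_axioms LL.cstar_algebra_axioms lact_hom, of a t] by simp

lemma lact_zero [simp]: "x <: X ==> lact X \<zero>\<^sub>A x = \<zero>\<^sub>X"
 using hom_zero[OF A.cstar_algebra_axioms LL.cstar_algebra_axioms lact_hom] by simp

lemma lact_bound: "a <: A ==> x <: X ==> hn (lact X a x) \<le> nrm A a * hn x"
proof -
 assume a: "a <: A" and x: "x <: X"
 have "hn (lact X a x) \<le> op_norm A X (lact X a) * hn x" using a x by (intro op_norm_ge) auto
 also have "\<dots> \<le> nrm A a * hn x"
  using hom_contractive[OF A.cstar_algebra_axioms LL.cstar_algebra_axioms lact_hom a] x by (intro mult_right_mono) auto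
 finally show ?thesis .
qed

lemma lact_linear: "x <: X ==> linear_on A X (%a. lact X a x)"
 by (auto simp: linear_on_def lact_add lact_smult)

lemma lact_kernel_iff: "a \<in> lact_kernel A X \<longleftrightarrow> a <: A \<and> (\<forall>x\<in>carrier X. lact X a x = \<zero>\<^sub>X)"
proof
 assume "a \<in> lact_kernel A X"
 thus "a <: A \<and> (\<forall>x\<in>carrier X. lact X a x = \<zero>\<^sub>X)" by (auto simp: lact_kernel_def)
next
 assume a: "a <: A \<and> (\<forall>x\<in>carrier X. lact X a x = \<zero>\<^sub>X)"
 hence "lact X a = (\<lambda>x\<in>carrier X. \<zero>\<^sub>X)" by (intro adjointable_ext LL_zero_closed) auto
 thus "a \<in> lact_kernel A X" using a by (simp add: lact_kernel_def)
qed

lemma closed_ideal_lact_kernel: "closed_ideal A (lact_kernel A X)"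
 unfolding closed_ideal_def
proof (intro conjI)
 show "submodule (lact_kernel A X) complex_ring A"
  by (rule A.submoduleI) (auto simp: lact_kernel_iff lact_add lact_smult A.neg_eq_smult)
 show "\<forall>a\<in>carrier A. \<forall>b\<in>lact_kernel A X. a \<otimes>\<^sub>A b \<in> lact_kernel A X \<and> b \<otimes>\<^sub>A a \<in> lact_kernel A X"
  by (auto simp: lact_kernel_iff lact_mult)
 show "norm_closure A (nrm A) (lact_kernel A X) \<subseteq> lact_kernel A X"
 proof
  fix a assume a: "a \<in> norm_closure A (nrm A) (lact_kernel A X)"
  have "lact_kernel A X \<subseteq> carrier A" by (auto simp: lact_kernel_iff)
  from A.norm_closure_vlim[OF a this] obtain f where f: "A.vlim f a" "!!n. f n \<in> lact_kernel A X" by metis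
  have "lact X a x = \<zero>\<^sub>X" if x: "x <: X" for x
  proof (rule X.vlim_unique)
   show "X.vlim (%n. lact X (f n) x) (lact X a x)"
    by (rule vlim_map[OF A.normed_vec_axioms X.normed_vec_axioms lact_linear[OF x] _ f(1), of "hn x"])
     (use x in \<open>simp add: lact_bound mult.commute[of "hn x"]\<close>)
   show "X.vlim (%n. lact X (f n) x) \<zero>\<^sub>X" using f(2) x X.vlim_const by (simp add: lact_kernel_iff)
  qed
  thus "a \<in> lact_kernel A X" using f(1) by (simp add: lact_kernel_iff A.vlimD)
 qed
qed

text \<open>For a = c^* c, all a q(a) annihilate ker \<phi>. A self-adjoint b in ker \<phi> that is
  a limit of such elements satisfies b b = 0, so b = 0; this is the injectivity that
  \<open>hom_isometric_sa\<close> asks for.\<close>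

lemma perp_isometric:
 assumes c: "c \<in> perp A (lact_kernel A X)" shows "nrm A c \<le> op_norm A X (lact X c)"
proof -
 let ?I = "lact_kernel A X" and ?a = "star A c \<otimes>\<^sub>A c"
 have cc: "c <: A" and cI: "!!b. b \<in> ?I ==> c \<otimes>\<^sub>A b = \<zero>\<^sub>A" using c by (auto simp: perp_def)
 have I: "?I \<subseteq> carrier A" by (auto simp: lact_kernel_iff)
 have a: "?a <: A" "star A ?a = ?a" using cc by (auto simp: A.star_mult)
 have aI: "A.nev ?a p \<otimes>\<^sub>A b = \<zero>\<^sub>A" if b: "b \<in> ?I" for p b
 proof -
  have bc: "b <: A" using b I by blast
  have ab: "?a \<otimes>\<^sub>A b = \<zero>\<^sub>A" using cc bc cI[OF b] by (simp add: A.mult_assoc)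
  show ?thesis by (rule A.nev_annihilate[OF a(1) bc ab])
 qed
 have "nrm A ?a \<le> nrm (LL A X) (lact X ?a)"
 proof (rule hom_isometric_sa[OF A.cstar_algebra_axioms LL.cstar_algebra_axioms lact_hom a])
  fix b assume b: "b <: A" "lact X b = \<zero>\<^sub>(LL A X)" "b \<in> norm_closure A (nrm A) (range (A.nev ?a))" "star A b = b"
  have bI: "b \<in> ?I" using b by (simp add: lact_kernel_def)
  have "range (A.nev ?a) \<subseteq> carrier A" using a by blast
  from A.norm_closure_vlim[OF b(3) this] obtain f where f: "A.vlim f b" "!!n. f n \<in> range (A.nev ?a)" by metis
  have "A.vlim (%n. f n \<otimes>\<^sub>A b) (b \<otimes>\<^sub>A b)" by (intro A.vlim_mult A.vlim_const f b)
  moreover have "f n \<otimes>\<^sub>A b = \<zero>\<^sub>A" for n using f(2)[of n] aI[OF bI] by auto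
  ultimately have "A.vlim (%n. \<zero>\<^sub>A) (b \<otimes>\<^sub>A b)" by simp
  hence "b \<otimes>\<^sub>A b = \<zero>\<^sub>A" by (rule A.vlim_unique[OF _ A.vlim_const[OF A.M.zero_closed]])
  thus "b = \<zero>\<^sub>A" using A.star_mult_eq_0[OF b(1)] b(4) by simp
 qed
 also have "lact X ?a = star (LL A X) (lact X c) \<otimes>\<^sub>(LL A X) lact X c"
  using hom_mult[OF A.cstar_algebra_axioms LL.cstar_algebra_axioms lact_hom, of "star A c" c] cc by (simp add: lact_star)
 also have "nrm (LL A X) \<dots> = (op_norm A X (lact X c))\<^sup>2" using LL.nrm_star_mult[of "lact X c"] cc by simp
 finally have "(nrm A c)\<^sup>2 \<le> (op_norm A X (lact X c))\<^sup>2" using cc by (simp add: A.nrm_star_mult)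
 thus ?thesis by (rule power2_le_imp_le) (use cc in \<open>simp add: op_norm_nonneg\<close>)
qed

end

section \<open>Representations of bimodules\<close>

locale bimod_rep = hilbert_bimodule A X + B: cstar_algebra B
 for A :: "('a, 'm) cstar_scheme" and X :: "('a, 'x, 'n) bimod_scheme" and B :: "('b, 'k) cstar_scheme" +
 fixes \<pi> :: "'a => 'b" and \<psi> :: "'x => 'b"
 assumes rep: "is_rep A X B \<pi> \<psi>"
begin

lemma pi_hom: "\<pi> \<in> cstar_hom A B" and psi_linear: "linear_on X B \<psi>"
 using rep by (auto simp: is_rep_def)

lemmas AB = A.cstar_algebra_axioms B.cstar_algebra_axioms
lemmas XB = X.cvec_axioms B.cvec_axioms

lemma pi_closed [simp, intro]: "a <: A ==> \<pi> a <: B"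
 by (rule hom_closed[OF AB pi_hom])

lemma psi_closed [simp, intro]: "x <: X ==> \<psi> x <: B"
 by (rule linear_on_closed[OF XB psi_linear])

lemmas pi_mult = hom_mult[OF AB pi_hom] and pi_star = hom_star[OF AB pi_hom]
 and pi_add = hom_add[OF AB pi_hom] and pi_contractive = hom_contractive[OF AB pi_hom]
 and pi_vlim = hom_vlim[OF AB pi_hom] and pi_zero = hom_zero[OF AB pi_hom]
 and psi_add = linear_on_add[OF XB psi_linear] and psi_smult = linear_on_smult[OF XB psi_linear]
 and psi_zero = linear_on_zero[OF XB psi_linear]

lemma psi_inn: "x <: X ==> y <: X ==> star B (\<psi> x) \<otimes>\<^sub>B \<psi> y = \<pi> (inn X x y)"
 using rep by (simp add: is_rep_def)

lemma psi_bound: "x <: X ==> nrm B (\<psi> x) \<le> hn x"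
proof -
 assume x: "x <: X"
 have "(nrm B (\<psi> x))\<^sup>2 = nrm B (\<pi> (inn X x x))" using x by (simp add: psi_inn flip: B.nrm_star_mult)
 also have "\<dots> \<le> (hn x)\<^sup>2" using x by (simp add: hnorm_square pi_contractive)
 finally show ?thesis by (rule power2_le_imp_le) (use x in simp)
qed

lemma psi_vlim: "X.vlim f l ==> B.vlim (%n. \<psi> (f n)) (\<psi> l)"
 by (rule vlim_map[OF X.normed_vec_axioms B.normed_vec_axioms psi_linear, of 1]) (simp add: psi_bound)

text \<open>The axioms speak only about two-sided products a x b, and the left action may be
  degenerate. The one-sided law follows from the inner product: (p - q b)^* (p - q b) = 0 for p =
  \<psi>(x a), q = \<psi>(x), b = \<pi>(a).\<close>

lemma psi_ract: assumes x: "x <: X" and a: "a <: A" shows "\<psi> (ract X x a) = \<psi> x \<otimes>\<^sub>B \<pi> a"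
proof -
 let ?p = "\<psi> (ract X x a)"
 define p q b where "p = \<psi> (ract X x a)" and "q = \<psi> x" and "b = \<pi> a"
 have c: "p <: B" "q <: B" "b <: B" using x a by (auto simp: p_def q_def b_def)
 have "star B p \<otimes>\<^sub>B p = star B b \<otimes>\<^sub>B (star B q \<otimes>\<^sub>B q \<otimes>\<^sub>B b)"
  unfolding p_def q_def b_def using x a by (simp add: psi_inn inn_ract inn_ract_left pi_mult pi_star B.mult_assoc)
 moreover have "star B p \<otimes>\<^sub>B q = star B b \<otimes>\<^sub>B (star B q \<otimes>\<^sub>B q)"
  unfolding p_def q_def b_def using x a by (simp add: psi_inn inn_ract_left pi_mult pi_star)
 moreover have "star B q \<otimes>\<^sub>B p = star B q \<otimes>\<^sub>B q \<otimes>\<^sub>B b"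
  unfolding p_def q_def b_def using x a by (simp add: psi_inn inn_ract pi_mult)
 moreover have "star B (p \<ominus>\<^sub>B q \<otimes>\<^sub>B b) \<otimes>\<^sub>B (p \<ominus>\<^sub>B q \<otimes>\<^sub>B b)
   = (star B p \<otimes>\<^sub>B p \<ominus>\<^sub>B (star B p \<otimes>\<^sub>B q) \<otimes>\<^sub>B b) \<ominus>\<^sub>B (star B b \<otimes>\<^sub>B (star B q \<otimes>\<^sub>B p) \<ominus>\<^sub>B star B b \<otimes>\<^sub>B ((star B q \<otimes>\<^sub>B q) \<otimes>\<^sub>B b))"
  using c by algebra
 ultimately have "star B (p \<ominus>\<^sub>B q \<otimes>\<^sub>B b) \<otimes>\<^sub>B (p \<ominus>\<^sub>B q \<otimes>\<^sub>B b) = \<zero>\<^sub>B" using c by (simp add: B.mult_assoc)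
 hence "p \<ominus>\<^sub>B q \<otimes>\<^sub>B b = \<zero>\<^sub>B" using c B.star_mult_eq_0[of "p \<ominus>\<^sub>B q \<otimes>\<^sub>B b"] by simp
 thus ?thesis using c B.minus_eq_zero_iff[of p "q \<otimes>\<^sub>B b"] by (simp add: p_def q_def b_def)
qed

text \<open>Factorization writes x as z b, which brings in the right factor that the axiom
  wants.\<close>

lemma psi_lact: assumes x: "x <: X" and a: "a <: A" shows "\<psi> (lact X a x) = \<pi> a \<otimes>\<^sub>B \<psi> x"
proof -
 obtain z b where zb: "z <: X" "b <: A" "x = ract X z b"
  using factorization[OF x A.closed_ideal_carrier] x by blast
 have "\<psi> (ract X (lact X a z) b) = (\<pi> a \<otimes>\<^sub>B \<psi> z) \<otimes>\<^sub>B \<pi> b"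
  using rep zb a by (simp add: is_rep_def)
 thus ?thesis using zb a by (simp add: adjointable_ract psi_ract B.mult_assoc)
qed

text \<open>If \<open>b = \<Sigma> \<psi>(x\<^sub>i) \<psi>(y\<^sub>i)\<^sup>*\<close> and \<open>T = \<Sigma> x\<^sub>i \<otimes> y\<^sub>i\<^sup>*\<close>, then
 \<open>\<parallel>b\<parallel>\<^sup>2\<^sup>m = \<parallel>(b\<^sup>*b)\<^sup>m\<parallel> \<le> C \<parallel>T\<parallel>\<^sup>2\<^sup>m\<^sup>-\<^sup>1\<close> for \<open>m = 2\<^sup>k\<close>, with \<open>C\<close> independent of \<open>k\<close>.\<close>

definition acts :: "'b => ('x => 'x) => bool" where
 "acts c S \<longleftrightarrow> c <: B \<and> S \<in> adjointable X \<and> (\<forall>z\<in>carrier X. c \<otimes>\<^sub>B \<psi> z = \<psi> (S z))"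

lemma acts_mult: "acts c S ==> acts d T ==> acts (c \<otimes>\<^sub>B d) (S \<otimes>\<^sub>(LL A X) T)"
 unfolding acts_def by (auto simp: B.mult_assoc LL_compose_closed) (simp add: compose_def)

abbreviation G1 :: "(('x => 'x) \<times> 'b) set" where
 "G1 \<equiv> {(rank_one X x y, \<psi> x \<otimes>\<^sub>B star B (\<psi> y)) | x y. x <: X \<and> y <: X}"

lemma acts_rank_one: "x <: X ==> y <: X ==> acts (\<psi> x \<otimes>\<^sub>B star B (\<psi> y)) (rank_one X x y)"
 unfolding acts_def by (auto simp: B.mult_assoc psi_inn psi_ract)

lemma acts_zero: "acts \<zero>\<^sub>B \<zero>\<^sub>(LL A X)"
 by (auto simp: acts_def LL_zero_closed psi_zero)

lemma acts_add: "acts c S ==> acts d T ==> acts (c \<oplus>\<^sub>B d) (S \<oplus>\<^sub>(LL A X) T)"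
 by (auto simp: acts_def LL_add_closed B.mult_add_left psi_add)

lemma acts_smult: "acts c S ==> acts (t \<odot>\<^sub>B c) (t \<odot>\<^sub>(LL A X) S)"
 by (auto simp: acts_def LL_smult_closed B.mult_scale_left psi_smult)

text \<open>If c acts as S and b is the sum of the \<psi>(x_i) \<psi>(y_i)^*, then c b is the sum of
  the \<psi>(S x_i) \<psi>(y_i)^*. So C is the sum of the ||x_i|| ||y_i|| and does not depend on
  c.\<close>

lemma pair_span_acts:
 assumes "(T, b) \<in> pair_span (KK A X) B G1"
 shows "acts b T \<and> acts (star B b) (star (LL A X) T) \<and>
  (\<exists>C\<ge>0. \<forall>c S. acts c S \<longrightarrow> nrm B (c \<otimes>\<^sub>B b) \<le> C * op_norm A X S)"
 using assms
proof (induction T b rule: pair_span.induct[split_format (complete)])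
 case pair_span_zero
 have "nrm B (c \<otimes>\<^sub>B \<zero>\<^sub>B) \<le> 0 * op_norm A X S" if "acts c S" for c S using that by (simp add: acts_def)
 thus ?case using acts_zero LL.star_zero by (metis B.star_zero KK_simps(3) order_refl)
next
 case (pair_span_gen T b)
 then obtain x y where xy: "x <: X" "y <: X" "T = rank_one X x y" "b = \<psi> x \<otimes>\<^sub>B star B (\<psi> y)" by auto
 have "nrm B (c \<otimes>\<^sub>B b) \<le> (hn x * hn y) * op_norm A X S" if cS: "acts c S" for c S
 proof -
  have "c \<otimes>\<^sub>B b = \<psi> (S x) \<otimes>\<^sub>B star B (\<psi> y)"
   using cS xy by (simp add: acts_def flip: B.mult_assoc)
  hence "nrm B (c \<otimes>\<^sub>B b) \<le> nrm B (\<psi> (S x)) * nrm B (\<psi> y)"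
   using cS xy B.nrm_mult[of "\<psi> (S x)" "star B (\<psi> y)"] by (simp add: acts_def)
  also have "\<dots> \<le> hn (S x) * hn y" using cS xy by (intro mult_mono psi_bound) (auto simp: acts_def)
  also have "\<dots> \<le> (op_norm A X S * hn x) * hn y" using cS xy by (intro mult_right_mono op_norm_ge) (auto simp: acts_def)
  finally show ?thesis by (simp add: mult_ac)
 qed
 moreover have "acts (star B b) (star (LL A X) T)"
  using acts_rank_one[of y x] xy by (simp add: adjoint_rank_one B.star_mult)
 ultimately show ?case using xy acts_rank_one[of x y] by (auto intro!: exI[of _ "hn x * hn y"])
next
 case (pair_span_add S b T d)
 then obtain C D where C: "C \<ge> 0" "!!c S. acts c S ==> nrm B (c \<otimes>\<^sub>B b) \<le> C * op_norm A X S"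
  and D: "D \<ge> 0" "!!c S. acts c S ==> nrm B (c \<otimes>\<^sub>B d) \<le> D * op_norm A X S" by blast
 have a: "acts b S" "acts d T" "acts (star B b) (star (LL A X) S)" "acts (star B d) (star (LL A X) T)"
  using pair_span_add by auto
 have bd: "b <: B" "d <: B" "S <: LL A X" "T <: LL A X" using a by (auto simp: acts_def)
 have "nrm B (c \<otimes>\<^sub>B (b \<oplus>\<^sub>B d)) \<le> (C + D) * op_norm A X S" if cS: "acts c S" for c S
  using C(2)[OF cS] D(2)[OF cS] cS bd B.nrm_triangle[of "c \<otimes>\<^sub>B b" "c \<otimes>\<^sub>B d"]
  by (simp add: acts_def B.mult_add_right distrib_right)
 moreover have "acts (star B (b \<oplus>\<^sub>B d)) (star (LL A X) (S \<oplus>\<^sub>(LL A X) T))"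
  using acts_add[OF a(3,4)] bd by (simp add: B.star_add LL.star_add del: LL_simps)
 ultimately show ?case using acts_add[OF a(1,2)] C(1) D(1)
  by (simp del: LL_simps) (intro exI[of _ "C + D"], simp)
next
 case (pair_span_smult T b t)
 then obtain C where C: "C \<ge> 0" "!!c S. acts c S ==> nrm B (c \<otimes>\<^sub>B b) \<le> C * op_norm A X S" by blast
 have a: "acts b T" "acts (star B b) (star (LL A X) T)" using pair_span_smult by auto
 have bd: "b <: B" "T <: LL A X" using a by (auto simp: acts_def)
 have "nrm B (c \<otimes>\<^sub>B (t \<odot>\<^sub>B b)) \<le> (cmod t * C) * op_norm A X S" if cS: "acts c S" for c S
  using C(2)[OF cS] cS bd by (simp add: acts_def B.mult_scale_right B.nrm_scale mult.assoc mult_left_mono)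
 moreover have "acts (star B (t \<odot>\<^sub>B b)) (star (LL A X) (t \<odot>\<^sub>(LL A X) T))"
  using acts_smult[OF a(2)] bd by (simp add: B.star_scale LL.star_scale del: LL_simps)
 ultimately show ?case using acts_smult[OF a(1)] C(1)
  by (simp del: LL_simps) (intro exI[of _ "cmod t * C"], simp)
qed

lemma pair_span_bound:
 assumes "(T, b) \<in> pair_span (KK A X) B G1" shows "nrm B b \<le> op_norm A X T"
proof -
 obtain C where bT: "acts b T" "acts (star B b) (star (LL A X) T)"
  and C: "C \<ge> 0" "!!c S. acts c S ==> nrm B (c \<otimes>\<^sub>B b) \<le> C * op_norm A X S"
  using pair_span_acts[OF assms] by blast
 have b: "b <: B" "T \<in> adjointable X" using bT by (auto simp: acts_def)
 define t where "t = op_norm A X T"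
 have t0: "0 \<le> t" using b by (simp add: t_def op_norm_nonneg)
 \<comment> \<open>c is (b^* b)^(2^k) with its last factor b left off, and S is the same word in T,
   which explains the odd exponent.\<close>
 have pow: "\<exists>c S. acts c S \<and> star B (c \<otimes>\<^sub>B b) = c \<otimes>\<^sub>B b \<and> nrm B (c \<otimes>\<^sub>B b) = nrm B b ^ (2 * 2 ^ k)
   \<and> op_norm A X S \<le> t ^ (2 * 2 ^ k - 1)" for k :: nat
 proof (induction k)
  case 0
  have "op_norm A X (star (LL A X) T) \<le> t" using op_norm_adjoint_le[OF b(2)] by (simp add: t_def)
  thus ?case using bT b by (intro exI[of _ "star B b"] exI[of _ "star (LL A X) T"]) (simp add: B.star_mult B.nrm_star_mult)
 next
  case (Suc k)
  then obtain c S where c: "acts c S" "star B (c \<otimes>\<^sub>B b) = c \<otimes>\<^sub>B b" "nrm B (c \<otimes>\<^sub>B b) = nrm B b ^ (2 * 2 ^ k)"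
   "op_norm A X S \<le> t ^ (2 * 2 ^ k - 1)" by blast
  have cc: "c <: B" "S \<in> adjointable X" using c(1) by (auto simp: acts_def)
  let ?c = "c \<otimes>\<^sub>B b \<otimes>\<^sub>B c" and ?S = "S \<otimes>\<^sub>(LL A X) T \<otimes>\<^sub>(LL A X) S"
  have e: "?c \<otimes>\<^sub>B b = (c \<otimes>\<^sub>B b) \<otimes>\<^sub>B (c \<otimes>\<^sub>B b)" using cc b by (simp add: B.mult_assoc)
  have "star B (?c \<otimes>\<^sub>B b) = ?c \<otimes>\<^sub>B b" unfolding e using cc b c(2) by (subst B.star_mult) auto
  moreover have "nrm B (?c \<otimes>\<^sub>B b) = nrm B b ^ (2 * 2 ^ Suc k)"
   unfolding e using cc b c(2,3) B.nrm_sa_square[of "c \<otimes>\<^sub>B b"]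
   by (simp add: power_mult[symmetric] mult.commute mult.left_commute)
  moreover have "op_norm A X ?S \<le> t ^ (2 * 2 ^ Suc k - 1)"
  proof -
   have "op_norm A X ?S \<le> op_norm A X (S \<otimes>\<^sub>(LL A X) T) * op_norm A X S"
    using op_norm_compose[OF LL_compose_closed[OF cc(2) b(2)] cc(2)] by simp
   also have "\<dots> \<le> (op_norm A X S * t) * op_norm A X S"
    using op_norm_compose[OF cc(2) b(2)] cc by (intro mult_right_mono) (auto simp: t_def op_norm_nonneg)
   also have "\<dots> \<le> (t ^ (2 * 2 ^ k - 1) * t) * t ^ (2 * 2 ^ k - 1)"
    using c(4) t0 cc by (intro mult_mono mult_right_mono) (auto simp: op_norm_nonneg)
   also have "\<dots> = t ^ ((2 * 2 ^ k - 1) + 1 + (2 * 2 ^ k - 1))" by (simp only: power_add power_one_right)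
   also have "(2 * 2 ^ k - 1) + 1 + (2 * 2 ^ k - 1) = 2 * 2 ^ Suc k - (1::nat)"
   proof -
    have "(1::nat) \<le> 2 ^ k" by simp
    thus ?thesis by simp
   qed
   finally show ?thesis .
  qed
  moreover have "acts ?c ?S" by (intro acts_mult c(1) bT(1))
  ultimately show ?case by blast
 qed
 have main: "nrm B b ^ (2 * 2 ^ k) \<le> C * t ^ (2 * 2 ^ k - 1)" for k :: nat
 proof -
  from pow[of k] obtain c S where c: "acts c S" "nrm B (c \<otimes>\<^sub>B b) = nrm B b ^ (2 * 2 ^ k)"
   "op_norm A X S \<le> t ^ (2 * 2 ^ k - 1)" by blast
  have "nrm B (c \<otimes>\<^sub>B b) \<le> C * op_norm A X S" by (rule C(2)[OF c(1)])
  also have "\<dots> \<le> C * t ^ (2 * 2 ^ k - 1)" using c(3) C(1) by (rule mult_left_mono)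
  finally show ?thesis using c(2) by simp
 qed
 show ?thesis
 proof (cases "t = 0")
  case True
  hence "nrm B b ^ 2 \<le> 0" using main[of 0] by simp
  thus ?thesis using True b by (simp add: t_def)
 next
  case False
  hence t: "t > 0" using t0 by simp
  have "(nrm B b / t)\<^sup>2 \<le> 1"
  proof (rule subexponential_le_1)
   fix k :: nat
   have "t ^ (2 * 2 ^ k) = t ^ (2 * 2 ^ k - 1) * t" using power_Suc2[of t "2 * 2 ^ k - 1"] by simp
   hence "((nrm B b / t)\<^sup>2) ^ (2 ^ k) = nrm B b ^ (2 * 2 ^ k) / (t ^ (2 * 2 ^ k - 1) * t)"
    by (simp add: power_divide flip: power_mult)
   also have "\<dots> \<le> (C * t ^ (2 * 2 ^ k - 1)) / (t ^ (2 * 2 ^ k - 1) * t)"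
    using main[of k] t by (intro divide_right_mono) auto
   also have "\<dots> = C / t" using t by simp
   also have "\<dots> \<le> C / t * 2 ^ k" using C(1) t mult_left_mono[of 1 "2 ^ k" "C / t"] by simp
   finally show "((nrm B b / t)\<^sup>2) ^ (2 ^ k) \<le> C / t * 2 ^ k + 1" by simp
  qed
  hence "nrm B b / t \<le> 1" using power2_le_imp_le[of "nrm B b / t" 1] by simp
  thus ?thesis using t by (simp add: t_def[symmetric] divide_le_eq)
 qed
qed

lemma KK_cstar: "cstar_algebra (KK A X)"
 by (rule cstar_algebra_KK)

text \<open>Existence is \<open>bounded_extension\<close> with the estimate
  \<open>pair_span_bound\<close>. Multiplicativity rests on \<rho>(T) \<psi>(z) = \<psi>(T z), since
  S composed with the rank-one operator of x, y is that of S x, y.\<close>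

lemma cpt_ex: "\<exists>\<rho>. \<rho> \<in> cstar_hom (KK A X) B \<and>
   (\<forall>x\<in>carrier X. \<forall>y\<in>carrier X. \<rho> (rank_one X x y) = \<psi> x \<otimes>\<^sub>B star B (\<psi> y))"
proof -
 interpret K: cstar_algebra "KK A X" by (rule KK_cstar)
 have GK: "G1 \<subseteq> carrier (KK A X) \<times> carrier B" using KX_rank_one by auto
 have fst_G: "fst ` G1 = rank_ones" unfolding rank_ones_def by force
 \<comment> \<open>\<open>KK\<close> was defined by a closure taken among all adjointable operators,
   whereas the extension needs a closure taken inside \<open>KK A X\<close>.\<close>
 have dense: "carrier (KK A X) \<subseteq> norm_closure (KK A X) (nrm (KK A X)) (cspan (KK A X) (fst ` G1))"
 proof
  fix T assume "T \<in> KX"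
  hence "T \<in> KX \<and> T \<in> norm_closure (KK A X) (nrm (KK A X)) (cspan (KK A X) rank_ones)"
  proof -
   have sub: "rank_ones \<subseteq> KX" using KX_rank_one by (auto simp: rank_ones_def)
   have span: "S \<in> cspan (KK A X) rank_ones" if "S \<in> cspan (LL A X) rank_ones" for S
    using that rank_ones_subset
   proof (induction rule: LL.cspan_induct)
    case zero
    show ?case using K.cspan_zero by (simp del: LL_simps)
   next
    case (gen T)
    thus ?case by (rule K.cspan_gen)
   next
    case (add S T)
    thus ?case using K.cspan_add[of S rank_ones T] by (simp del: LL_simps)
   next
    case (smult c T)
    thus ?case using K.cspan_smult[of T rank_ones c] by (simp del: LL_simps)
   qed
   have T: "T \<in> norm_closure (LL A X) (nrm (LL A X)) (cspan (LL A X) rank_ones)" using \<open>T \<in> KX\<close> by (simp add: KX_def)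
   from LL.norm_closure_vlim[OF T LL.cspan_subset[OF rank_ones_subset]] obtain F where
    F: "LL.vlim F T" "!!n. F n \<in> cspan (LL A X) rank_ones" by metis
   have FK: "F n \<in> KX" for n using K.cspan_subset[OF sub] span[OF F(2)] by blast
   have "T \<in> norm_closure (KK A X) (nrm (KK A X)) (cspan (KK A X) rank_ones)"
    by (rule K.vlim_norm_closure[OF KK_vlim[OF F(1) FK] span[OF F(2)]])
   thus ?thesis using \<open>T \<in> KX\<close> by simp
  qed
  thus "T \<in> norm_closure (KK A X) (nrm (KK A X)) (cspan (KK A X) (fst ` G1))" unfolding fst_G by simp
 qed
 have bound: "nrm B b \<le> 1 * nrm (KK A X) T" if "(T, b) \<in> pair_span (KK A X) B G1" for T b
  using pair_span_bound[OF that] by simp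
 obtain \<rho> where \<rho>: "linear_on (KK A X) B \<rho>" "!!T. T \<in> KX ==> nrm B (\<rho> T) \<le> 1 * nrm (KK A X) T"
  "!!T b. (T, b) \<in> pair_span (KK A X) B G1 ==> \<rho> T = b"
  using bounded_extension[OF K.normed_vec_axioms B.normed_vec_axioms B.complete GK zero_le_one bound dense] by blast
 note KB = K.cvec_axioms B.cvec_axioms
 note \<rho>c = linear_on_closed[OF KB \<rho>(1)]
 have \<rho>1: "\<rho> (rank_one X x y) = \<psi> x \<otimes>\<^sub>B star B (\<psi> y)" if "x <: X" "y <: X" for x y
  using that by (intro \<rho>(3) pair_span_gen) auto
 have \<rho>v: "B.vlim (%n. \<rho> (F n)) (\<rho> T)" if "LL.vlim F T" "!!n. F n \<in> KX" for F T
  by (rule vlim_map[OF K.normed_vec_axioms B.normed_vec_axioms \<rho>(1,2) KK_vlim[OF that]])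
 have \<rho>0: "\<rho> \<zero>\<^sub>(LL A X) = \<zero>\<^sub>B" using linear_on_zero[OF KB \<rho>(1)] by (simp del: LL_simps)
 have \<rho>add: "\<rho> (S \<oplus>\<^sub>(LL A X) T) = \<rho> S \<oplus>\<^sub>B \<rho> T" if "S \<in> KX" "T \<in> KX" for S T
  using linear_on_add[OF KB \<rho>(1), of S T] that by (simp del: LL_simps)
 have \<rho>sm: "\<rho> (c \<odot>\<^sub>(LL A X) T) = c \<odot>\<^sub>B \<rho> T" if "T \<in> KX" for c T
  using linear_on_smult[OF KB \<rho>(1), of T c] that by (simp del: LL_simps)
 have act: "T \<in> KX \<and> (\<forall>z\<in>carrier X. \<rho> T \<otimes>\<^sub>B \<psi> z = \<psi> (T z))" if "T \<in> KX" for T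
  using that
 proof (induction rule: KX_induct)
  case zero
  show ?case using KX_zero \<rho>0 psi_zero by (simp del: LL_simps) (simp add: psi_zero)
 next
  case (rank_one x y)
  thus ?case using acts_rank_one[of x y] \<rho>1 KX_rank_one by (simp add: acts_def)
 next
  case (add S T)
  thus ?case using \<rho>add[of S T] KX_add[of S T] \<rho>c
   by (simp add: LL_apply B.mult_add_left psi_add del: LL_simps(2-8))
 next
  case (smult c T)
  thus ?case using \<rho>sm[of T c] KX_smult[of T c] \<rho>c
   by (simp add: LL_apply B.mult_scale_left psi_smult del: LL_simps(2-8))
 next
  case (lim F T)
  have FK: "F n \<in> KX" for n using lim(2) by blast
  have T: "T \<in> KX" by (rule KX_vlim[OF lim(1) FK])
  have "\<rho> T \<otimes>\<^sub>B \<psi> z = \<psi> (T z)" if z: "z <: X" for z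
  proof (rule B.vlim_unique)
   show "B.vlim (%n. \<rho> (F n) \<otimes>\<^sub>B \<psi> z) (\<rho> T \<otimes>\<^sub>B \<psi> z)"
    by (intro B.vlim_mult B.vlim_const \<rho>v lim FK psi_closed z)
   have "X.vlim (%n. F n z) (T z)" by (rule op_vlim[OF lim(1) z])
   hence "B.vlim (%n. \<psi> (F n z)) (\<psi> (T z))" by (rule psi_vlim)
   thus "B.vlim (%n. \<rho> (F n) \<otimes>\<^sub>B \<psi> z) (\<psi> (T z))" using lim(2) z by simp
  qed
  thus ?case using T by blast
 qed
 have mult: "\<rho> (S \<otimes>\<^sub>(LL A X) T) = \<rho> S \<otimes>\<^sub>B \<rho> T" if S: "S \<in> KX" and "T \<in> KX" for S T
 proof -
  have Sa: "S <: LL A X" "S \<in> adjointable X" using S KX_adjointable by auto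
  have "T \<in> KX \<and> \<rho> (S \<otimes>\<^sub>(LL A X) T) = \<rho> S \<otimes>\<^sub>B \<rho> T" using \<open>T \<in> KX\<close>
  proof (induction rule: KX_induct)
   case zero
   show ?case using KX_zero \<rho>0 LL.mult_zero_r[OF Sa(1)] B.mult_zero_r[OF \<rho>c[OF S]] by (simp del: LL_simps)
  next
   case (rank_one x y)
   thus ?case using act[OF S] Sa \<rho>c[OF S]
    by (simp add: compose_rank_one \<rho>1 KX_rank_one del: LL_simps flip: B.mult_assoc)
  next
   case (add T U)
   hence "S \<otimes>\<^sub>(LL A X) T \<in> KX" "S \<otimes>\<^sub>(LL A X) U \<in> KX" using KX_compose_left Sa by blast+
   thus ?case using add LL.mult_add_right[OF Sa(1), of T U] \<rho>c S
    by (simp add: \<rho>add KX_add B.mult_add_right del: LL_simps(2-8))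
  next
   case (smult c T)
   hence "S \<otimes>\<^sub>(LL A X) T \<in> KX" using KX_compose_left Sa by blast
   thus ?case using smult LL.mult_scale_right[OF Sa(1), of T c] \<rho>c S
    by (simp add: \<rho>sm KX_smult B.mult_scale_right del: LL_simps(2-8))
  next
   case (lim F T)
   have FK: "F n \<in> KX" for n using lim(2) by blast
   have T: "T \<in> KX" by (rule KX_vlim[OF lim(1) FK])
   have "LL.vlim (%n. S \<otimes>\<^sub>(LL A X) F n) (S \<otimes>\<^sub>(LL A X) T)" by (intro LL.vlim_mult LL.vlim_const Sa lim)
   hence "B.vlim (%n. \<rho> (S \<otimes>\<^sub>(LL A X) F n)) (\<rho> (S \<otimes>\<^sub>(LL A X) T))"
    by (rule \<rho>v) (rule KX_compose_left[OF FK Sa(2)])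
   moreover have "B.vlim (%n. \<rho> S \<otimes>\<^sub>B \<rho> (F n)) (\<rho> S \<otimes>\<^sub>B \<rho> T)"
    by (intro B.vlim_mult B.vlim_const \<rho>c S \<rho>v lim FK)
   ultimately show ?case using T lim(2) by (simp add: B.vlim_unique del: LL_simps)
  qed
  thus ?thesis by blast
 qed
 have st: "\<rho> (star (LL A X) T) = star B (\<rho> T)" if "T \<in> KX" for T
 proof -
  have "T \<in> KX \<and> \<rho> (star (LL A X) T) = star B (\<rho> T)" using that
  proof (induction rule: KX_induct)
   case zero
   show ?case using KX_zero \<rho>0 LL.star_zero by (simp del: LL_simps)
  next
   case (rank_one x y)
   thus ?case by (simp add: adjoint_rank_one \<rho>1 KX_rank_one B.star_mult)
  next
   case (add T U)
   thus ?case using LL.star_add[of T U] \<rho>c KX_star[of T] KX_star[of U]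
    by (simp add: \<rho>add KX_add B.star_add del: LL_simps(2-8))
  next
   case (smult c T)
   thus ?case using LL.star_scale[of T c] \<rho>c KX_star[of T]
    by (simp add: \<rho>sm KX_smult B.star_scale del: LL_simps(2-8))
  next
   case (lim F T)
   have FK: "F n \<in> KX" for n using lim(2) by blast
   have T: "T \<in> KX" by (rule KX_vlim[OF lim(1) FK])
   have "B.vlim (%n. \<rho> (star (LL A X) (F n))) (\<rho> (star (LL A X) T))"
    by (rule \<rho>v[OF LL.vlim_star[OF lim(1)] KX_star[OF FK]])
   moreover have "B.vlim (%n. star B (\<rho> (F n))) (star B (\<rho> T))" by (intro B.vlim_star \<rho>v lim FK)
   ultimately show ?case using T lim(2) by (simp add: B.vlim_unique del: LL_simps)
  qed
  thus ?thesis by blast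
 qed
 have "\<rho> \<in> cstar_hom (KK A X) B"
  unfolding cstar_hom_def using \<rho>(1) mult st by (simp del: LL_simps)
 thus ?thesis using \<rho>1 by blast
qed

abbreviation cpt :: "('x => 'x) => 'b" where "cpt \<equiv> cpt_ext A X B \<psi>"

lemma cpt_hom: "cpt \<in> cstar_hom (KK A X) B"
 and cpt_rank_one: "x <: X ==> y <: X ==> cpt (rank_one X x y) = \<psi> x \<otimes>\<^sub>B star B (\<psi> y)"
 using someI_ex[OF cpt_ex] unfolding cpt_ext_def by auto

lemmas KB = cstar_algebra_KK B.cstar_algebra_axioms

lemma cpt_closed [simp]: "T \<in> KX ==> cpt T <: B"
 by (rule hom_closed[OF KB cpt_hom])

lemma cpt_zero: "cpt \<zero>\<^sub>(LL A X) = \<zero>\<^sub>B"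
 using hom_zero[OF KB cpt_hom] by (simp del: LL_simps)

lemma cpt_add: "S \<in> KX ==> T \<in> KX ==> cpt (S \<oplus>\<^sub>(LL A X) T) = cpt S \<oplus>\<^sub>B cpt T"
 using hom_add[OF KB cpt_hom, of S T] by (simp del: LL_simps)

lemma cpt_smult: "T \<in> KX ==> cpt (c \<odot>\<^sub>(LL A X) T) = c \<odot>\<^sub>B cpt T"
 using hom_smult[OF KB cpt_hom, of T c] by (simp del: LL_simps)

lemma cpt_star: "T \<in> KX ==> cpt (star (LL A X) T) = star B (cpt T)"
 using hom_star[OF KB cpt_hom, of T] by (simp del: LL_simps)

lemma cpt_vlim: "LL.vlim F T ==> (!!n. F n \<in> KX) ==> B.vlim (%n. cpt (F n)) (cpt T)"
 using hom_vlim[OF KB cpt_hom KK_vlim] .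

lemma cpt_psi: "T \<in> KX ==> z <: X ==> cpt T \<otimes>\<^sub>B \<psi> z = \<psi> (T z)"
proof (induction rule: KX_induct')
 case zero
 thus ?case using cpt_zero psi_zero by (simp del: LL_simps) (simp add: psi_zero)
next
 case (rank_one x y)
 thus ?case using acts_rank_one[of x y] by (simp add: acts_def cpt_rank_one)
next
 case (add S T)
 thus ?case using cpt_add[of S T] KX_adjointable[of S] KX_adjointable[of T]
  by (simp add: LL_apply B.mult_add_left psi_add del: LL_simps(2-8))
next
 case (smult c T)
 thus ?case using cpt_smult[of T c] KX_adjointable[of T]
  by (simp add: LL_apply B.mult_scale_left psi_smult del: LL_simps(2-8))
next
 case (lim F T)
 have "B.vlim (%n. cpt (F n) \<otimes>\<^sub>B \<psi> z) (cpt T \<otimes>\<^sub>B \<psi> z)"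
  using lim by (intro B.vlim_mult B.vlim_const cpt_vlim) auto
 moreover have "B.vlim (%n. \<psi> (F n z)) (\<psi> (T z))" using lim by (intro psi_vlim op_vlim)
 ultimately show ?case using lim by (simp add: B.vlim_unique)
qed

text \<open>Each generator of the image of \<open>cpt\<close> starts with some \<psi>(x). Used in
  \<open>cpt_amp_eq\<close> to pass from vanishing on vectors to vanishing on operators.\<close>

lemma annihilate_cpt:
 assumes c: "c <: B" "!!z. z <: X ==> c \<otimes>\<^sub>B \<psi> z = \<zero>\<^sub>B" and "K \<in> KX"
 shows "c \<otimes>\<^sub>B cpt K = \<zero>\<^sub>B"
 using assms(3)
proof (induction rule: KX_induct')
 case zero
 show ?case using cpt_zero c by (simp del: LL_simps)
next
 case (rank_one x y)
 thus ?case using c by (simp add: cpt_rank_one flip: B.mult_assoc)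
next
 case (add S T)
 thus ?case using cpt_add[of S T] c by (simp add: B.mult_add_right del: LL_simps)
next
 case (smult t T)
 thus ?case using cpt_smult[of T t] c by (simp add: B.mult_scale_right del: LL_simps)
next
 case (lim F T)
 have "B.vlim (%n. c \<otimes>\<^sub>B cpt (F n)) (c \<otimes>\<^sub>B cpt T)"
  by (intro B.vlim_mult B.vlim_const c cpt_vlim lim)
 hence "B.vlim (%n. \<zero>\<^sub>B) (c \<otimes>\<^sub>B cpt T)" using lim(4) by simp
 thus ?case by (rule B.vlim_unique[OF _ B.vlim_const[OF B.M.zero_closed]])
qed

end

section \<open>Balanced tensor products\<close>

locale balanced_tensor = X: hilbert_bimodule A X + Y: hilbert_bimodule A Y + Z: hilbert_bimodule A Z
 for A :: "('a, 'm) cstar_scheme" and X :: "('a, 'x, 'n) bimod_scheme"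
  and Y :: "('a, 'y, 'k) bimod_scheme" and Z :: "('a, 'z, 'l) bimod_scheme" +
 fixes t :: "'x => 'y => 'z"
 assumes tensor: "is_balanced_tensor A X Y Z t"
begin

lemmas YZ = Y.X.cvec_axioms Z.X.cvec_axioms
lemmas XZ = X.X.cvec_axioms Z.X.cvec_axioms

lemma t_linear_r: "x <: X ==> linear_on Y Z (t x)"
 and t_linear_l: "y <: Y ==> linear_on X Z (%x. t x y)"
 using tensor by (auto simp: is_balanced_tensor_def)

lemma t_closed [simp, intro]: "x <: X ==> y <: Y ==> t x y <: Z"
 using linear_on_closed[OF YZ t_linear_r] .

lemma t_add_l: "x <: X ==> x' <: X ==> y <: Y ==> t (x \<oplus>\<^sub>X x') y = t x y \<oplus>\<^sub>Z t x' y"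
 using linear_on_add[OF XZ t_linear_l] .

lemma t_smult_l: "x <: X ==> y <: Y ==> t (c \<odot>\<^sub>X x) y = c \<odot>\<^sub>Z t x y"
 using linear_on_smult[OF XZ t_linear_l] .

lemma t_zero_l [simp]: "y <: Y ==> t \<zero>\<^sub>X y = \<zero>\<^sub>Z"
 using linear_on_zero[OF XZ t_linear_l] .

lemma t_balanced: "x <: X ==> y <: Y ==> a <: A ==> t (ract X x a) y = t x (lact Y a y)"
 and t_ract: "x <: X ==> y <: Y ==> a <: A ==> t x (ract Y y a) = ract Z (t x y) a"
 and t_lact: "x <: X ==> y <: Y ==> a <: A ==> t (lact X a x) y = lact Z a (t x y)"
 and t_inn: "x <: X ==> y <: Y ==> x' <: X ==> y' <: Y ==>
  inn Z (t x y) (t x' y') = inn Y y (lact Y (inn X x x') y')"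
 using tensor by (auto simp: is_balanced_tensor_def)

abbreviation tensors :: "'z set" where "tensors \<equiv> {t x y | x y. x <: X \<and> y <: Y}"

lemma tensors_subset: "tensors \<subseteq> carrier Z"
 by auto

lemma Z_dense: "norm_closure Z (hnorm A Z) (cspan Z tensors) = carrier Z"
 using tensor by (simp add: is_balanced_tensor_def)

lemma Z_induct [consumes 1, case_names zero tensor add smult lim]:
 assumes "z <: Z" and "P \<zero>\<^sub>Z"
  and "!!x y. x <: X ==> y <: Y ==> P (t x y)"
  and "!!z w. z <: Z ==> w <: Z ==> P z ==> P w ==> P (z \<oplus>\<^sub>Z w)"
  and "!!c z. z <: Z ==> P z ==> P (c \<odot>\<^sub>Z z)"
  and "!!f z. Z.X.vlim f z ==> (!!n. P (f n)) ==> P z"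
 shows "P z"
proof -
 have "z \<in> norm_closure Z (hnorm A Z) (cspan Z tensors)" using assms(1) Z_dense by simp
 thus ?thesis using tensors_subset
  by (rule Z.X.closure_induct) (use assms(2-) in auto)
qed

lemma t_norm: assumes "x <: X" "y <: Y" shows "hnorm A Z (t x y) \<le> hnorm A X x * hnorm A Y y"
proof (rule Z.hnorm_le)
 have "nrm A (inn Z (t x y) (t x y)) = nrm A (inn Y y (lact Y (inn X x x) y))" using assms by (simp add: t_inn)
 also have "\<dots> \<le> hnorm A Y y * hnorm A Y (lact Y (inn X x x) y)" using assms by (intro Y.inn_bound) auto
 also have "\<dots> \<le> hnorm A Y y * (nrm A (inn X x x) * hnorm A Y y)"
  using assms by (intro mult_left_mono Y.lact_bound) auto
 also have "\<dots> = (hnorm A X x * hnorm A Y y)\<^sup>2"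
  using assms by (simp add: X.hnorm_square[symmetric] power_mult_distrib) (simp add: power2_eq_square)
 finally show "nrm A (inn Z (t x y) (t x y)) \<le> (hnorm A X x * hnorm A Y y)\<^sup>2" .
qed (use assms in auto)

subsection \<open>Amplification of operators\<close>

text \<open>T \<otimes> 1 applied to one chosen expression of a vector as a sum of elementary
  tensors. Independence of the expression is only a consequence of
  \<open>tsum_bound\<close>.\<close>

definition tsum :: "('x => 'x) => ('x \<times> 'y) list => 'z" where
 "tsum T ps = foldr (%p w. t (T (fst p)) (snd p) \<oplus>\<^sub>Z w) ps \<zero>\<^sub>Z"

lemma tsum_simps [simp]: "tsum T [] = \<zero>\<^sub>Z" "tsum T (p # ps) = t (T (fst p)) (snd p) \<oplus>\<^sub>Z tsum T ps"
 by (simp_all add: tsum_def)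

context
 fixes ps :: "('x \<times> 'y) list"
 assumes ps: "set ps \<subseteq> carrier X \<times> carrier Y"
begin

lemma tsum_closed: "T \<in> adjointable X ==> tsum T ps <: Z"
 using ps by (induction ps) auto

lemma tsum_inn_tensor:
 assumes "T \<in> adjointable X" "S \<in> adjointable X" "x <: X" "y <: Y"
 shows "inn Z (t (T x) y) (tsum S ps) = inn Z (t x y) (tsum (adjoint X T \<otimes>\<^sub>(LL A X) S) ps)"
 using ps
proof (induction ps)
 case (Cons p ps)
 have TS: "adjoint X T \<otimes>\<^sub>(LL A X) S \<in> adjointable X" using assms by (simp add: X.LL_compose_closed)
 have p: "fst p <: X" "snd p <: Y" "set ps \<subseteq> carrier X \<times> carrier Y" using Cons.prems by auto
 note cl = balanced_tensor.tsum_closed[OF balanced_tensor_axioms p(3)]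
 have "inn X (T x) (S (fst p)) = inn X x ((adjoint X T \<otimes>\<^sub>(LL A X) S) (fst p))"
  using assms p by (simp add: LL_apply X.adjoint_inn del: LL_simps)
 hence "inn Z (t (T x) y) (t (S (fst p)) (snd p)) = inn Z (t x y) (t ((adjoint X T \<otimes>\<^sub>(LL A X) S) (fst p)) (snd p))"
  using assms p X.adjointable_closed[OF TS p(1)] by (simp add: t_inn del: LL_simps)
 thus ?case
  using Cons.IH[OF p(3)] assms p cl[OF assms(2)] cl[OF TS] X.adjointable_closed[OF TS p(1)]
  by (simp add: Z.inn_add del: LL_simps)
qed (use assms in simp)

lemma tsum_inn:
 assumes "set qs \<subseteq> carrier X \<times> carrier Y" "T \<in> adjointable X" "S \<in> adjointable X"
 shows "inn Z (tsum T qs) (tsum S ps) = inn Z (tsum \<one>\<^sub>(LL A X) qs) (tsum (adjoint X T \<otimes>\<^sub>(LL A X) S) ps)"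
 using assms(1)
proof (induction qs)
 case Nil
 have "adjoint X T \<otimes>\<^sub>(LL A X) S \<in> adjointable X" using assms by (simp add: X.LL_compose_closed)
 from tsum_closed[OF this] tsum_closed[OF assms(3)] show ?case by (simp del: LL_simps)
next
 case (Cons q qs)
 have TS: "adjoint X T \<otimes>\<^sub>(LL A X) S \<in> adjointable X" using assms by (simp add: X.LL_compose_closed)
 have one: "\<one>\<^sub>(LL A X) \<in> adjointable X" using X.LL.one_closed by simp
 have q: "fst q <: X" "snd q <: Y" "set qs \<subseteq> carrier X \<times> carrier Y" using Cons.prems by auto
 note cl = balanced_tensor.tsum_closed[OF balanced_tensor_axioms q(3)]
 have "inn Z (tsum T (q # qs)) (tsum S ps) = inn Z (t (T (fst q)) (snd q)) (tsum S ps) \<oplus>\<^sub>A inn Z (tsum T qs) (tsum S ps)"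
  using assms q tsum_closed[OF assms(3)] cl[OF assms(2)] by (simp add: Z.inn_add_left)
 also have "\<dots> = inn Z (t (fst q) (snd q)) (tsum (adjoint X T \<otimes>\<^sub>(LL A X) S) ps)
   \<oplus>\<^sub>A inn Z (tsum \<one>\<^sub>(LL A X) qs) (tsum (adjoint X T \<otimes>\<^sub>(LL A X) S) ps)"
  using Cons.IH[OF q(3)] tsum_inn_tensor[OF assms(2,3) q(1,2)] by (simp del: LL_simps)
 also have "\<dots> = inn Z (tsum \<one>\<^sub>(LL A X) (q # qs)) (tsum (adjoint X T \<otimes>\<^sub>(LL A X) S) ps)"
  using q tsum_closed[OF TS] cl[OF one] by (simp add: Z.inn_add_left LL_apply del: LL_simps)
 finally show ?case .
qed

text \<open>C depends on the expression \<open>ps\<close> but not on T, so its influence disappears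
  when T is replaced by high powers.\<close>

lemma tsum_crude: "\<exists>C\<ge>0. \<forall>T\<in>adjointable X. hnorm A Z (tsum T ps) \<le> C * op_norm A X T"
 using ps
proof (induction ps)
 case Nil
 show ?case by (intro exI[of _ 0]) simp
next
 case (Cons p ps)
 have p: "fst p <: X" "snd p <: Y" "set ps \<subseteq> carrier X \<times> carrier Y" using Cons.prems by auto
 note cl = balanced_tensor.tsum_closed[OF balanced_tensor_axioms p(3)]
 obtain C where C: "C \<ge> 0" "!!T. T \<in> adjointable X ==> hnorm A Z (tsum T ps) \<le> C * op_norm A X T" using Cons.IH[OF p(3)] by blast
 let ?D = "hnorm A X (fst p) * hnorm A Y (snd p)"
 have "hnorm A Z (tsum T (p # ps)) \<le> (?D + C) * op_norm A X T" if T: "T \<in> adjointable X" for T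
 proof -
  have "hnorm A Z (tsum T (p # ps)) \<le> hnorm A Z (t (T (fst p)) (snd p)) + hnorm A Z (tsum T ps)"
   using p T cl[OF T] by (simp add: Z.X.N_add)
  also have "hnorm A Z (t (T (fst p)) (snd p)) \<le> hnorm A X (T (fst p)) * hnorm A Y (snd p)" using p T by (intro t_norm) auto
  also have "\<dots> \<le> (op_norm A X T * hnorm A X (fst p)) * hnorm A Y (snd p)" using p T by (intro mult_right_mono X.op_norm_ge) auto
  finally show ?thesis using C(2)[OF T] by (simp add: algebra_simps)
 qed
 thus ?case using C(1) p by (intro exI[of _ "?D + C"]) auto
qed

text \<open>With \<open>H = T\<^sup>*T\<close>, log-convexity of \<open>k \<mapsto> \<parallel>(H\<^sup>k \<otimes> 1) w\<parallel>\<close> along powers of two.\<close>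

lemma tsum_bound:
 assumes T: "T \<in> adjointable X"
 shows "hnorm A Z (tsum T ps) \<le> op_norm A X T * hnorm A Z (tsum \<one>\<^sub>(LL A X) ps)"
proof -
 have one: "\<one>\<^sub>(LL A X) \<in> adjointable X" using X.LL.one_closed by simp
 let ?s = "op_norm A X T"
 define wn where "wn = hnorm A Z (tsum \<one>\<^sub>(LL A X) ps)"
 \<comment> \<open>\<open>H k\<close> is (T^* T)^(2^k).\<close>
 define H where "H = rec_nat (adjoint X T \<otimes>\<^sub>(LL A X) T) (%_ S. S \<otimes>\<^sub>(LL A X) S)"
 have H0: "H 0 = adjoint X T \<otimes>\<^sub>(LL A X) T" and HSuc: "H (Suc k) = H k \<otimes>\<^sub>(LL A X) H k" for k by (simp_all add: H_def)
 have Hc: "H k \<in> adjointable X \<and> adjoint X (H k) = H k \<and> op_norm A X (H k) \<le> (?s\<^sup>2) ^ (2 ^ k)" for k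
 proof (induction k)
  case 0
  have "adjoint X (adjoint X T \<otimes>\<^sub>(LL A X) T) = adjoint X T \<otimes>\<^sub>(LL A X) T"
   using X.LL.star_mult[of "adjoint X T" T] T by simp
  thus ?case unfolding H0 using T X.op_norm_cstar[OF T] by (simp add: X.LL_compose_closed)
 next
  case (Suc k)
  hence k: "H k \<in> adjointable X" "adjoint X (H k) = H k" "op_norm A X (H k) \<le> (?s\<^sup>2) ^ (2 ^ k)" by auto
  have "op_norm A X (H k \<otimes>\<^sub>(LL A X) H k) \<le> op_norm A X (H k) * op_norm A X (H k)" using k X.op_norm_compose by simp
  also have "\<dots> \<le> (?s\<^sup>2) ^ (2 ^ k) * (?s\<^sup>2) ^ (2 ^ k)" using k by (intro mult_mono) (auto simp: X.op_norm_nonneg)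
  also have "\<dots> = (?s\<^sup>2) ^ (2 ^ Suc k)" by (simp flip: power_add add: mult_2)
  finally show ?case unfolding HSuc using X.LL.star_mult[of "H k" "H k"] k by (simp add: X.LL_compose_closed)
 qed
 define N where "N k = hnorm A Z (tsum (H k) ps)" for k
 have N0: "0 \<le> N k" for k using tsum_closed Hc unfolding N_def by simp
 have w0: "0 \<le> wn" unfolding wn_def using tsum_closed[OF one] by (simp del: LL_simps)
 have step: "(N k)\<^sup>2 \<le> wn * N (Suc k)" for k
 proof -
  have k: "H k \<in> adjointable X" "adjoint X (H k) = H k" "H (Suc k) \<in> adjointable X" using Hc by auto
  have "(N k)\<^sup>2 = nrm A (inn Z (tsum (H k) ps) (tsum (H k) ps))"
   unfolding N_def using tsum_closed[OF k(1)] by (simp add: Z.hnorm_square)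
  also have "inn Z (tsum (H k) ps) (tsum (H k) ps) = inn Z (tsum \<one>\<^sub>(LL A X) ps) (tsum (H (Suc k)) ps)"
   using tsum_inn[OF ps k(1,1)] k(2) by (simp add: HSuc)
  also have "nrm A \<dots> \<le> wn * N (Suc k)" unfolding N_def wn_def by (intro Z.inn_bound tsum_closed one k)
  finally show ?thesis .
 qed
 have first: "(hnorm A Z (tsum T ps))\<^sup>2 \<le> wn * N 0"
 proof -
  have "(hnorm A Z (tsum T ps))\<^sup>2 = nrm A (inn Z (tsum T ps) (tsum T ps))"
   using tsum_closed[OF T] by (simp add: Z.hnorm_square)
  also have "inn Z (tsum T ps) (tsum T ps) = inn Z (tsum \<one>\<^sub>(LL A X) ps) (tsum (H 0) ps)"
   using tsum_inn[OF ps T T] by (simp add: H0)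
  also have "nrm A \<dots> \<le> wn * N 0" unfolding N_def wn_def using Hc by (intro Z.inn_bound tsum_closed one) auto
  finally show ?thesis .
 qed
 obtain C where C: "C \<ge> 0" "!!S. S \<in> adjointable X ==> hnorm A Z (tsum S ps) \<le> C * op_norm A X S" using tsum_crude by blast
 have NC: "N k \<le> C * (?s\<^sup>2) ^ (2 ^ k)" for k
 proof -
  have "N k \<le> C * op_norm A X (H k)" unfolding N_def using Hc by (intro C(2)) auto
  also have "\<dots> \<le> C * (?s\<^sup>2) ^ (2 ^ k)" using Hc C(1) by (intro mult_left_mono) auto
  finally show ?thesis .
 qed
 \<comment> \<open>The iterated inequality \<open>step\<close>, kept in a form without division
   because \<open>wn\<close> may vanish.\<close>
 have iter: "wn * N 0 ^ (2 ^ k) \<le> wn ^ (2 ^ k) * N k" for k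
 proof (induction k)
  case (Suc k)
  have "wn * (wn * N 0 ^ (2 ^ Suc k)) = (wn * N 0 ^ (2 ^ k))\<^sup>2" by (simp add: power_mult_distrib power2_eq_square mult_ac flip: power_add mult_2)
  also have "\<dots> \<le> (wn ^ (2 ^ k) * N k)\<^sup>2" by (intro power_mono Suc.IH mult_nonneg_nonneg w0 zero_le_power N0)
  also have "\<dots> = wn ^ (2 ^ Suc k) * (N k)\<^sup>2" by (simp add: power_mult_distrib mult.commute flip: power_mult)
  also have "\<dots> \<le> wn ^ (2 ^ Suc k) * (wn * N (Suc k))" using step w0 by (intro mult_left_mono) auto
  finally have le: "wn * (wn * N 0 ^ (2 ^ Suc k)) \<le> wn * (wn ^ (2 ^ Suc k) * N (Suc k))" by (simp add: mult_ac)
  show ?case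
  proof (cases "wn = 0")
   case False
   hence "wn > 0" using w0 by simp
   thus ?thesis using le by (rule mult_left_le_imp_le[rotated])
  qed (use N0[of "Suc k"] in simp)
 qed simp
 have s0: "0 \<le> ?s" using T by (rule X.op_norm_nonneg)
 have "N 0 \<le> wn * ?s\<^sup>2"
 proof (cases "wn = 0 \<or> ?s = 0")
  case True
  thus ?thesis
  proof
   assume w: "wn = 0"
   hence "(N 0)\<^sup>2 \<le> 0" using step[of 0] by simp
   thus ?thesis using w by simp
  next
   assume "?s = 0"
   thus ?thesis using NC[of 0] by simp
  qed
 next
  case False
  hence ws: "wn > 0" "?s > 0" using w0 s0 by auto
  define v where "v = wn * ?s\<^sup>2"
  have v: "v > 0" using ws by (simp add: v_def)
  have "N 0 / v \<le> 1"
  proof (rule subexponential_le_1)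
   fix k :: nat
   have "wn * N 0 ^ (2 ^ k) \<le> wn ^ (2 ^ k) * (C * (?s\<^sup>2) ^ (2 ^ k))"
    using iter[of k] NC[of k] w0 by (meson mult_left_mono order_trans zero_le_power)
   hence "wn * N 0 ^ (2 ^ k) \<le> C * v ^ (2 ^ k)" by (simp add: v_def power_mult_distrib mult_ac)
   hence "N 0 ^ (2 ^ k) / v ^ (2 ^ k) \<le> C / wn" using ws v by (simp add: field_simps)
   also have "\<dots> \<le> C / wn * 2 ^ k" using C(1) ws mult_left_mono[of 1 "2 ^ k" "C / wn"] by simp
   finally show "(N 0 / v) ^ 2 ^ k \<le> C / wn * 2 ^ k + 1" by (simp add: power_divide)
  qed
  thus ?thesis using v by (simp add: v_def divide_le_eq)
 qed
 hence "wn * N 0 \<le> wn * (wn * ?s\<^sup>2)" using w0 by (rule mult_left_mono)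
 hence "(hnorm A Z (tsum T ps))\<^sup>2 \<le> (?s * wn)\<^sup>2" using first by (simp add: power_mult_distrib power2_eq_square mult_ac)
 thus ?thesis unfolding wn_def[symmetric] by (rule power2_le_imp_le) (use s0 w0 in simp)
qed

end

text \<open>Each pair in the span of the graph consists of \<open>tsum\<close> for 1 and for T over
  one and the same list, so \<open>tsum_bound\<close> is the estimate that
  \<open>bounded_extension\<close> requires.\<close>

lemma amp_pre:
 assumes T: "T \<in> adjointable X"
 obtains F where "linear_on Z Z F" "!!z. z <: Z ==> hnorm A Z (F z) \<le> op_norm A X T * hnorm A Z z"
  "!!x y. x <: X ==> y <: Y ==> F (t x y) = t (T x) y"
proof -
 let ?G = "{(t x y, t (T x) y) | x y. x <: X \<and> y <: Y}"
 have one: "\<one>\<^sub>(LL A X) \<in> adjointable X" using X.LL.one_closed by simp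
 have G: "?G \<subseteq> carrier Z \<times> carrier Z" using T by auto
 have rep: "\<exists>ps. set ps \<subseteq> carrier X \<times> carrier Y \<and> z = tsum \<one>\<^sub>(LL A X) ps \<and> w = tsum T ps"
  if "(z, w) \<in> pair_span Z Z ?G" for z w
  using that
 proof (induction z w rule: pair_span.induct[split_format (complete)])
  case pair_span_zero
  show ?case by (intro exI[of _ "[]"]) simp
 next
  case (pair_span_gen z w)
  then obtain x y where "x <: X" "y <: Y" "z = t x y" "w = t (T x) y" by auto
  thus ?case using T by (intro exI[of _ "[(x, y)]"]) (simp add: LL_apply)
 next
  case (pair_span_add z w z' w')
  then obtain ps qs where p: "set ps \<subseteq> carrier X \<times> carrier Y" "z = tsum \<one>\<^sub>(LL A X) ps" "w = tsum T ps"
   and q: "set qs \<subseteq> carrier X \<times> carrier Y" "z' = tsum \<one>\<^sub>(LL A X) qs" "w' = tsum T qs" by blast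
  have app: "tsum S (ps @ qs) = tsum S ps \<oplus>\<^sub>Z tsum S qs" if S: "S \<in> adjointable X" for S
   using p(1)
  proof (induction ps)
   case Nil
   show ?case using tsum_closed[OF q(1) S] by simp
  next
   case (Cons p ps)
   have p: "fst p <: X" "snd p <: Y" "set ps \<subseteq> carrier X \<times> carrier Y" using Cons.prems by auto
   show ?case using Cons.IH[OF p(3)] p tsum_closed[OF p(3) S] tsum_closed[OF q(1) S] S by (simp add: Z.X.M.a_assoc)
  qed
  show ?case using p q app[OF one] app[OF T] by (intro exI[of _ "ps @ qs"]) (simp del: LL_simps)
 next
  case (pair_span_smult z w c)
  then obtain ps where p: "set ps \<subseteq> carrier X \<times> carrier Y" "z = tsum \<one>\<^sub>(LL A X) ps" "w = tsum T ps" by blast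
  let ?f = "%p. (c \<odot>\<^sub>X fst p, snd p)"
  have app: "tsum S (map ?f ps) = c \<odot>\<^sub>Z tsum S ps" if S: "S \<in> adjointable X" for S
   using p(1)
  proof (induction ps)
   case (Cons p ps)
   have p: "fst p <: X" "snd p <: Y" "set ps \<subseteq> carrier X \<times> carrier Y" using Cons.prems by auto
   show ?case using Cons.IH[OF p(3)] p tsum_closed[OF p(3) S] S
    by (simp add: X.adjointable_smult t_smult_l Z.X.smult_add_r)
  qed simp
  have "set (map ?f ps) \<subseteq> carrier X \<times> carrier Y" using p(1) by auto
  thus ?case using p app[OF one] app[OF T] by (intro exI[of _ "map ?f ps"]) (simp del: LL_simps set_map)
 qed
 have bound: "hnorm A Z w \<le> op_norm A X T * hnorm A Z z" if "(z, w) \<in> pair_span Z Z ?G" for z w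
  using rep[OF that] tsum_bound[OF _ T] by blast
 have "fst ` ?G = tensors" by force
 hence dense: "carrier Z \<subseteq> norm_closure Z (hnorm A Z) (cspan Z (fst ` ?G))" using Z_dense by simp
 obtain F where F: "linear_on Z Z F" "!!z. z <: Z ==> hnorm A Z (F z) \<le> op_norm A X T * hnorm A Z z"
  "!!a b. (a, b) \<in> pair_span Z Z ?G ==> F a = b"
  using bounded_extension[OF Z.X.normed_vec_axioms Z.X.normed_vec_axioms Z.hcomplete G X.op_norm_nonneg[OF T] bound dense] by blast
 have "F (t x y) = t (T x) y" if "x <: X" "y <: Y" for x y
  using that by (intro F(3) pair_span_gen) auto
 thus ?thesis using that F(1,2) by blast
qed

text \<open>S \<otimes> 1, described in the same words as in \<open>iota\<close>, so that
  \<open>iota_amp\<close> holds by unfolding.\<close>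

definition amp :: "('x => 'x) => ('z => 'z)" where
 "amp S = (THE T. T <: LL A Z \<and> (\<forall>x\<in>carrier X. \<forall>y\<in>carrier Y. T (t x y) = t (S x) y))"

lemmas ZZ = Z.X.cvec_axioms Z.X.cvec_axioms

lemma adjointable_eq_on_tensors:
 assumes U: "U \<in> adjointable Z" and V: "V \<in> adjointable Z"
  and eq: "!!x y. x <: X ==> y <: Y ==> U (t x y) = V (t x y)"
 shows "U = V"
proof (rule Z.adjointable_ext[OF U V])
 fix z assume "z <: Z"
 hence z: "z \<in> norm_closure Z (hnorm A Z) (cspan Z tensors)" by (simp add: Z_dense)
 show "U z = V z"
  by (rule eq_on_dense[OF Z.X.normed_vec_axioms Z.X.normed_vec_axioms Z.adjointable_linear[OF U] Z.op_norm_ge[OF U]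
     Z.adjointable_linear[OF V] Z.op_norm_ge[OF V] tensors_subset z]) (use eq in auto)
qed

text \<open>T and its adjoint are amplified separately; density, used first in one argument and then
  in the other, shows that the two extensions are adjoint.\<close>

lemma amp_props:
 assumes T: "T \<in> adjointable X"
 shows amp_adjointable: "amp T \<in> adjointable Z"
  and amp_tensor: "!!x y. x <: X ==> y <: Y ==> amp T (t x y) = t (T x) y"
  and op_norm_amp: "op_norm A Z (amp T) \<le> op_norm A X T"
proof -
 obtain F where F: "linear_on Z Z F" "!!z. z <: Z ==> hnorm A Z (F z) \<le> op_norm A X T * hnorm A Z z"
  "!!x y. x <: X ==> y <: Y ==> F (t x y) = t (T x) y" using amp_pre[OF T] by blast
 obtain G where G: "linear_on Z Z G" "!!z. z <: Z ==> hnorm A Z (G z) \<le> op_norm A X (adjoint X T) * hnorm A Z z"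
  "!!x y. x <: X ==> y <: Y ==> G (t x y) = t (adjoint X T x) y"
  using amp_pre[OF X.adjoint_adjointable[OF T]] by blast
 note Fc = linear_on_closed[OF ZZ F(1)] and Gc = linear_on_closed[OF ZZ G(1)]
 have vF: "Z.X.vlim (%n. F (f n)) (F l)" if "Z.X.vlim f l" for f l
  by (rule vlim_map[OF Z.X.normed_vec_axioms Z.X.normed_vec_axioms F(1,2) that])
 have vG: "Z.X.vlim (%n. G (f n)) (G l)" if "Z.X.vlim f l" for f l
  by (rule vlim_map[OF Z.X.normed_vec_axioms Z.X.normed_vec_axioms G(1,2) that])
 have tens: "inn Z (t (T x) y) z = inn Z (t x y) (G z)" if xy: "x <: X" "y <: Y" and z: "z <: Z" for x y z
 proof -
  have "z <: Z \<and> inn Z (t (T x) y) z = inn Z (t x y) (G z)" using z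
  proof (induction rule: Z_induct)
   case zero
   show ?case using xy T linear_on_zero[OF ZZ G(1)] by simp
  next
   case (tensor x' y')
   thus ?case using xy T by (simp add: G(3) t_inn X.adjoint_inn)
  next
   case (add z w)
   thus ?case using xy T Gc by (simp add: linear_on_add[OF ZZ G(1)] Z.inn_add)
  next
   case (smult c z)
   thus ?case using xy T Gc by (simp add: linear_on_smult[OF ZZ G(1)] Z.inn_scale)
  next
   case (lim f z)
   have "X.A.vlim (%n. inn Z (t (T x) y) (f n)) (inn Z (t (T x) y) z)" using xy T by (intro Z.vlim_inn lim) auto
   moreover have "X.A.vlim (%n. inn Z (t x y) (G (f n))) (inn Z (t x y) (G z))" using xy by (intro Z.vlim_inn vG lim) auto
   ultimately show ?case using lim Z.X.vlimD(2)[OF lim(1)] by (simp add: X.A.vlim_unique)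
  qed
  thus ?thesis by blast
 qed
 have adj: "inn Z (F w) z = inn Z w (G z)" if w: "w <: Z" and z: "z <: Z" for w z
 proof -
  have "w <: Z \<and> inn Z (F w) z = inn Z w (G z)" using w
  proof (induction rule: Z_induct)
   case zero
   show ?case using z Gc linear_on_zero[OF ZZ F(1)] by simp
  next
   case (tensor x y)
   thus ?case using tens z by (simp add: F(3))
  next
   case (add u w)
   thus ?case using z Fc Gc by (simp add: linear_on_add[OF ZZ F(1)] Z.inn_add_left)
  next
   case (smult c w)
   thus ?case using z Fc Gc by (simp add: linear_on_smult[OF ZZ F(1)] Z.inn_scale_left)
  next
   case (lim f w)
   have "X.A.vlim (%n. inn Z (F (f n)) z) (inn Z (F w) z)" using z by (intro Z.vlim_inn_left vF lim) auto
   moreover have "X.A.vlim (%n. inn Z (f n) (G z)) (inn Z w (G z))" using z Gc by (intro Z.vlim_inn_left lim) auto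
   ultimately show ?case using lim Z.X.vlimD(2)[OF lim(1)] by (simp add: X.A.vlim_unique)
  qed
  thus ?thesis by blast
 qed
 let ?F = "\<lambda>z\<in>carrier Z. F z"
 have Fa: "?F \<in> adjointable Z" by (rule Z.adjointableI[OF Fc Gc adj])
 have Ft: "?F (t x y) = t (T x) y" if "x <: X" "y <: Y" for x y using F(3)[OF that] that by simp
 have "amp T = ?F" unfolding amp_def
 proof (rule the_equality)
  show "?F <: LL A Z \<and> (\<forall>x\<in>carrier X. \<forall>y\<in>carrier Y. ?F (t x y) = t (T x) y)" using Fa Ft by simp
  show "U = ?F" if "U <: LL A Z \<and> (\<forall>x\<in>carrier X. \<forall>y\<in>carrier Y. U (t x y) = t (T x) y)" for U
   by (rule adjointable_eq_on_tensors[OF _ Fa]) (use that Ft in auto)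
 qed
 thus "amp T \<in> adjointable Z" "!!x y. x <: X ==> y <: Y ==> amp T (t x y) = t (T x) y"
  "op_norm A Z (amp T) \<le> op_norm A X T"
  using Fa Ft F(2) X.op_norm_nonneg[OF T] by (auto intro!: Z.op_norm_le)
qed

lemma amp_unique:
 assumes "T \<in> adjointable X" "U \<in> adjointable Z"
  "!!x y. x <: X ==> y <: Y ==> U (t x y) = t (T x) y"
 shows "amp T = U"
 by (rule adjointable_eq_on_tensors[OF amp_adjointable[OF assms(1)] assms(2)]) (simp add: assms amp_tensor)

lemma amp_add: assumes "S \<in> adjointable X" "T \<in> adjointable X"
 shows "amp (S \<oplus>\<^sub>(LL A X) T) = amp S \<oplus>\<^sub>(LL A Z) amp T"
proof (rule amp_unique)
 show "S \<oplus>\<^sub>(LL A X) T \<in> adjointable X" "amp S \<oplus>\<^sub>(LL A Z) amp T \<in> adjointable Z"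
  using assms amp_adjointable X.LL_add_closed Z.LL_add_closed by simp_all
qed (use assms in \<open>simp add: LL_apply amp_tensor t_add_l del: LL_simps\<close>)

lemma amp_mult: assumes "S \<in> adjointable X" "T \<in> adjointable X"
 shows "amp (S \<otimes>\<^sub>(LL A X) T) = amp S \<otimes>\<^sub>(LL A Z) amp T"
proof (rule amp_unique)
 show "S \<otimes>\<^sub>(LL A X) T \<in> adjointable X" "amp S \<otimes>\<^sub>(LL A Z) amp T \<in> adjointable Z"
  using assms amp_adjointable X.LL_compose_closed Z.LL_compose_closed by simp_all
qed (use assms in \<open>simp add: LL_apply amp_tensor del: LL_simps\<close>)

lemma amp_star: assumes "T \<in> adjointable X" shows "amp (adjoint X T) = adjoint Z (amp T)"
proof (rule amp_unique)
 fix x y assume xy: "x <: X" "y <: Y"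
 show "adjoint Z (amp T) (t x y) = t (adjoint X T x) y"
 proof (rule Z.inn_eqI)
  fix z assume "z <: Z"
  hence "z <: Z \<and> inn Z z (adjoint Z (amp T) (t x y)) = inn Z z (t (adjoint X T x) y)"
  proof (induction rule: Z_induct)
   case (tensor x' y')
   thus ?case using xy assms
    by (simp add: Z.adjoint_inn[symmetric] amp_adjointable amp_tensor t_inn X.adjoint_inn)
  next
   case (lim f z)
   have c: "adjoint Z (amp T) (t x y) <: Z" using xy amp_adjointable[OF assms] by blast
   have "X.A.vlim (%n. inn Z (f n) (adjoint Z (amp T) (t x y))) (inn Z z (adjoint Z (amp T) (t x y)))"
    by (intro Z.vlim_inn_left lim c)
   moreover have "X.A.vlim (%n. inn Z (f n) (t (adjoint X T x) y)) (inn Z z (t (adjoint X T x) y))"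
    using xy assms by (intro Z.vlim_inn_left lim) auto
   ultimately show ?case using lim Z.X.vlimD(2)[OF lim(1)] by (simp add: X.A.vlim_unique)
  qed (use xy assms amp_adjointable[OF assms] in \<open>auto simp: Z.inn_add_left Z.inn_scale_left\<close>)
  thus "inn Z z (adjoint Z (amp T) (t x y)) = inn Z z (t (adjoint X T x) y)" by blast
 qed (use xy assms amp_adjointable[OF assms] in auto)
qed (use assms amp_adjointable[OF assms] in auto)

end

context balanced_tensor
begin

subsection \<open>Compression and compactness\<close>

lemma t_vlim_l: assumes "X.X.vlim f x" "y <: Y" shows "Z.X.vlim (%n. t (f n) y) (t x y)"
 by (rule vlim_map[OF X.X.normed_vec_axioms Z.X.normed_vec_axioms t_linear_l[OF assms(2)] _ assms(1), of "hnorm A Y y"])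
  (use t_norm assms(2) in \<open>simp add: mult.commute\<close>)

text \<open>\<open>lann x\<close> is the adjoint of the creation operator \<open>y \<mapsto> x \<otimes> y\<close>.\<close>

definition lann :: "'x => 'z => 'y" where
 "lann x z = (THE v. v <: Y \<and> (\<forall>y\<in>carrier Y. inn Y y v = inn Z (t x y) z))"

text \<open>Every pair (w, v) of the relation satisfies <y, v> = <x \<otimes> y, w>, and the choice
  y = v yields ||v||^2 \<le> ||x|| ||v|| ||w||.\<close>

lemma lann_ex:
 assumes x: "x <: X"
 obtains F where "linear_on Z Y F" "!!z. z <: Z ==> hnorm A Y (F z) \<le> hnorm A X x * hnorm A Z z"
  "!!x' y. x' <: X ==> y <: Y ==> F (t x' y) = lact Y (inn X x x') y"
  "!!y z. y <: Y ==> z <: Z ==> inn Y y (F z) = inn Z (t x y) z"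
proof -
 let ?G = "{(t x' y, lact Y (inn X x x') y) | x' y. x' <: X \<and> y <: Y}"
 have G: "?G \<subseteq> carrier Z \<times> carrier Y" using x by auto
 have rel: "w <: Z \<and> v <: Y \<and> (\<forall>y\<in>carrier Y. inn Y y v = inn Z (t x y) w)"
  if "(w, v) \<in> pair_span Z Y ?G" for w v
  using that
 proof (induction w v rule: pair_span.induct[split_format (complete)])
  case (pair_span_gen w v)
  thus ?case using x by (auto simp: t_inn)
 qed (use x in \<open>auto simp: Y.inn_add Y.inn_scale Z.inn_add Z.inn_scale\<close>)
 have bound: "hnorm A Y v \<le> hnorm A X x * hnorm A Z w" if wv: "(w, v) \<in> pair_span Z Y ?G" for w v
 proof (cases "hnorm A Y v = 0")
  case True
  thus ?thesis using rel[OF wv] x by simp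
 next
  case False
  have c: "w <: Z" "v <: Y" "inn Y v v = inn Z (t x v) w" using rel[OF wv] by auto
  have v: "hnorm A Y v > 0" using False c by (simp add: order_less_le)
  have "hnorm A Y v * hnorm A Y v = nrm A (inn Z (t x v) w)"
   using Y.hnorm_square[OF c(2)] c(3) by (simp add: power2_eq_square)
  also have "\<dots> \<le> hnorm A Z (t x v) * hnorm A Z w" using c x by (intro Z.inn_bound) auto
  also have "\<dots> \<le> (hnorm A X x * hnorm A Y v) * hnorm A Z w" using c x by (intro mult_right_mono t_norm) auto
  finally have "hnorm A Y v * hnorm A Y v \<le> hnorm A Y v * (hnorm A X x * hnorm A Z w)" by (simp add: mult_ac)
  thus ?thesis using v by simp
 qed
 have "fst ` ?G = tensors" by force
 hence dense: "carrier Z \<subseteq> norm_closure Z (hnorm A Z) (cspan Z (fst ` ?G))" using Z_dense by simp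
 obtain F where F: "linear_on Z Y F" "!!z. z <: Z ==> hnorm A Y (F z) \<le> hnorm A X x * hnorm A Z z"
  "!!a b. (a, b) \<in> pair_span Z Y ?G ==> F a = b"
  using bounded_extension[OF Z.X.normed_vec_axioms Y.X.normed_vec_axioms Y.hcomplete G X.hnorm_nonneg[OF x] bound dense] by blast
 have Ft: "F (t x' y) = lact Y (inn X x x') y" if "x' <: X" "y <: Y" for x' y
  using that by (intro F(3) pair_span_gen) auto
 note ZY = Z.X.cvec_axioms Y.X.cvec_axioms
 note Fc = linear_on_closed[OF ZY F(1)]
 have "inn Y y (F z) = inn Z (t x y) z" if y: "y <: Y" and "z <: Z" for y z
 proof -
  have "z <: Z \<and> inn Y y (F z) = inn Z (t x y) z" using \<open>z <: Z\<close>
  proof (induction rule: Z_induct)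
   case zero
   show ?case using x y linear_on_zero[OF ZY F(1)] by simp
  next
   case (tensor x' y')
   thus ?case using x y by (simp add: Ft t_inn)
  next
   case (add z w)
   thus ?case using x y Fc by (simp add: linear_on_add[OF ZY F(1)] Y.inn_add Z.inn_add)
  next
   case (smult c z)
   thus ?case using x y Fc by (simp add: linear_on_smult[OF ZY F(1)] Y.inn_scale Z.inn_scale)
  next
   case (lim f z)
   have "Y.X.vlim (%n. F (f n)) (F z)"
    by (rule vlim_map[OF Z.X.normed_vec_axioms Y.X.normed_vec_axioms F(1,2) lim(1)])
   hence "X.A.vlim (%n. inn Y y (F (f n))) (inn Y y (F z))" by (rule Y.vlim_inn[OF y])
   moreover have "X.A.vlim (%n. inn Z (t x y) (f n)) (inn Z (t x y) z)" using x y by (intro Z.vlim_inn lim) auto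
   ultimately show ?case using lim Z.X.vlimD(2)[OF lim(1)] by (simp add: X.A.vlim_unique)
  qed
  thus ?thesis by blast
 qed
 thus ?thesis using that F(1,2) Ft by blast
qed

lemma lann_props:
 assumes x: "x <: X"
 shows lann_linear: "linear_on Z Y (lann x)"
  and lann_bound: "!!z. z <: Z ==> hnorm A Y (lann x z) \<le> hnorm A X x * hnorm A Z z"
  and lann_tensor: "!!x' y. x' <: X ==> y <: Y ==> lann x (t x' y) = lact Y (inn X x x') y"
  and lann_inn: "!!y z. y <: Y ==> z <: Z ==> inn Y y (lann x z) = inn Z (t x y) z"
proof -
 obtain F where F: "linear_on Z Y F" "!!z. z <: Z ==> hnorm A Y (F z) \<le> hnorm A X x * hnorm A Z z"
  "!!x' y. x' <: X ==> y <: Y ==> F (t x' y) = lact Y (inn X x x') y"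
  "!!y z. y <: Y ==> z <: Z ==> inn Y y (F z) = inn Z (t x y) z" using lann_ex[OF x] by blast
 note ZY = Z.X.cvec_axioms Y.X.cvec_axioms
 have eq: "lann x z = F z" if z: "z <: Z" for z
  unfolding lann_def
 proof (rule the_equality)
  show "F z <: Y \<and> (\<forall>y\<in>carrier Y. inn Y y (F z) = inn Z (t x y) z)"
   using F(4) z linear_on_closed[OF ZY F(1)] by blast
  fix v assume "v <: Y \<and> (\<forall>y\<in>carrier Y. inn Y y v = inn Z (t x y) z)"
  thus "v = F z" using F(4) z linear_on_closed[OF ZY F(1)] by (intro Y.inn_eqI) auto
 qed
 show "linear_on Z Y (lann x)" using F(1) eq unfolding linear_on_def by (auto simp: Pi_def)
 show "hnorm A Y (lann x z) \<le> hnorm A X x * hnorm A Z z" if "z <: Z" for z using F(2) eq that by simp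
 show "lann x (t x' y) = lact Y (inn X x x') y" if "x' <: X" "y <: Y" for x' y
  using F(3) eq that by simp
 show "inn Y y (lann x z) = inn Z (t x y) z" if "y <: Y" "z <: Z" for y z
  using F(4) eq that by simp
qed

lemmas ZY = Z.X.cvec_axioms Y.X.cvec_axioms

lemma lann_closed [simp, intro]: "x <: X ==> z <: Z ==> lann x z <: Y"
 using linear_on_closed[OF ZY lann_linear] .

lemma lann_ract: assumes "x <: X" "z <: Z" "a <: A" shows "lann x (ract Z z a) = ract Y (lann x z) a"
 using assms by (intro Y.inn_eqI) (auto simp: lann_inn Y.inn_ract Z.inn_ract)

text \<open>The matrix coefficient of K between the creation operators of x and x'. It sends
  rank-one operators on Z to rank-one operators on Y and S \<otimes> 1 to the left action of <x, S
  x'>; this links compactness on the tensor product to compactness of \<phi>(a).\<close>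

definition compress :: "'x => 'x => ('z => 'z) => 'y => 'y" where
 "compress x x' K = (\<lambda>y\<in>carrier Y. lann x (K (t x' y)))"

context
 fixes x x' assumes x: "x <: X" "x' <: X"
begin

lemma inn_lann: "u <: X ==> z <: Z ==> y <: Y ==> inn Y (lann u z) y = inn Z z (t u y)"
 using Y.inn_star[of y "lann u z"] Z.inn_star[of "t u y" z] by (simp add: lann_inn)

lemma compress_adjointable: "K \<in> adjointable Z ==> compress x x' K \<in> adjointable Y"
 unfolding compress_def
proof (rule Y.adjointableI[where g = "%y. lann x' (adjoint Z K (t x y))"])
 fix y y' assume K: "K \<in> adjointable Z" and y: "y <: Y" "y' <: Y"
 have "inn Y (lann x (K (t x' y))) y' = inn Z (K (t x' y)) (t x y')" using x y K by (intro inn_lann) auto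
 also have "\<dots> = inn Y y (lann x' (adjoint Z K (t x y')))"
  using x y K by (simp add: Z.adjoint_inn lann_inn)
 finally show "inn Y (lann x (K (t x' y))) y' = inn Y y (lann x' (adjoint Z K (t x y')))" .
qed (use x in auto)

lemma compress_zero: "compress x x' \<zero>\<^sub>(LL A Z) = \<zero>\<^sub>(LL A Y)"
 unfolding compress_def using x linear_on_zero[OF ZY lann_linear] by (auto intro!: restrict_ext)

lemma compress_add: "S \<in> adjointable Z ==> T \<in> adjointable Z ==>
  compress x x' (S \<oplus>\<^sub>(LL A Z) T) = compress x x' S \<oplus>\<^sub>(LL A Y) compress x x' T"
 unfolding compress_def using x linear_on_add[OF ZY lann_linear[OF x(1)]] by (auto intro!: restrict_ext)

lemma compress_smult: "T \<in> adjointable Z ==> compress x x' (c \<odot>\<^sub>(LL A Z) T) = c \<odot>\<^sub>(LL A Y) compress x x' T"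
 unfolding compress_def using x linear_on_smult[OF ZY lann_linear[OF x(1)]] by (auto intro!: restrict_ext)

lemma compress_rank_one: "u <: Z ==> v <: Z ==>
  compress x x' (rank_one Z u v) = rank_one Y (lann x u) (lann x' v)"
 unfolding compress_def rank_one_def using x
 by (auto intro!: restrict_ext simp: lann_ract) 
  (metis Y.inn_star Z.inn_star lann_closed lann_inn t_closed)

lemma compress_bound: assumes "T \<in> adjointable Z"
 shows "op_norm A Y (compress x x' T) \<le> hnorm A X x * hnorm A X x' * op_norm A Z T"
proof (rule Y.op_norm_le)
 show "0 \<le> hnorm A X x * hnorm A X x' * op_norm A Z T" using x assms by (simp add: Z.op_norm_nonneg)
 fix y assume y: "y <: Y"
 have "hnorm A Y (lann x (T (t x' y))) \<le> hnorm A X x * hnorm A Z (T (t x' y))"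
  using x y assms by (intro lann_bound) auto
 also have "\<dots> \<le> hnorm A X x * (op_norm A Z T * hnorm A Z (t x' y))"
  using x y assms by (intro mult_left_mono Z.op_norm_ge) auto
 also have "\<dots> \<le> hnorm A X x * (op_norm A Z T * (hnorm A X x' * hnorm A Y y))"
  using x y assms by (intro mult_left_mono t_norm) (auto simp: Z.op_norm_nonneg)
 finally show "hnorm A Y (compress x x' T y) \<le> hnorm A X x * hnorm A X x' * op_norm A Z T * hnorm A Y y"
  using y by (simp add: compress_def mult_ac)
qed

lemma compress_vlim: assumes "Z.LL.vlim F T" shows "Y.LL.vlim (%n. compress x x' (F n)) (compress x x' T)"
proof (rule Y.LL.vlimI_bound)
 have Fa: "F n \<in> adjointable Z" "T \<in> adjointable Z" for n using Z.LL.vlimD[OF assms] by auto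
 show "compress x x' (F n) <: LL A Y" "compress x x' T <: LL A Y" for n
  using Fa compress_adjointable by auto
 show "nrm (LL A Y) (compress x x' (F n) \<ominus>\<^sub>(LL A Y) compress x x' T)
   \<le> hnorm A X x * hnorm A X x' * nrm (LL A Z) (F n \<ominus>\<^sub>(LL A Z) T)" for n
 proof -
  have m: "F n \<ominus>\<^sub>(LL A Z) T = F n \<oplus>\<^sub>(LL A Z) (-1) \<odot>\<^sub>(LL A Z) T" "(-1) \<odot>\<^sub>(LL A Z) T \<in> adjointable Z"
   using Fa Z.LL.M.minus_eq[of "F n" T] Z.LL.neg_eq_smult[of T] Z.LL_smult_closed by simp_all
  have "compress x x' (F n) \<ominus>\<^sub>(LL A Y) compress x x' T = compress x x' (F n \<ominus>\<^sub>(LL A Z) T)"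
   using Fa m Y.LL.M.minus_eq[of "compress x x' (F n)" "compress x x' T"] Y.LL.neg_eq_smult[of "compress x x' T"] compress_adjointable
   by (simp add: compress_add compress_smult del: LL_simps(2-8))
  moreover have "F n \<ominus>\<^sub>(LL A Z) T \<in> adjointable Z" using Z.LL.minus_in[of "F n" T] Fa by simp
  ultimately show ?thesis using compress_bound by simp
 qed
 show "(%n. hnorm A X x * hnorm A X x' * nrm (LL A Z) (F n \<ominus>\<^sub>(LL A Z) T)) \<longlonglongrightarrow> 0"
  using tendsto_mult_left[OF Z.LL.vlimD(3)[OF assms]] by simp
qed

lemma compress_KK: "K <: KK A Z ==> compress x x' K <: KK A Y"
proof (induction rule: Z.KX_induct')
 case zero
 show ?case using compress_zero Y.KX_zero by metis
next
 case (rank_one u v)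
 thus ?case using x by (simp add: compress_rank_one Y.KX_rank_one)
next
 case (add S T)
 thus ?case using compress_add[of S T] Y.KX_add Z.KX_adjointable by metis
next
 case (smult c T)
 thus ?case using compress_smult[of T c] Y.KX_smult Z.KX_adjointable by metis
next
 case (lim F T)
 show ?case by (rule Y.KX_vlim[OF compress_vlim[OF lim(1)] lim(4)])
qed

lemma compress_amp: assumes "S \<in> adjointable X" shows "compress x x' (amp S) = lact Y (inn X x (S x'))"
 by (rule Y.adjointable_ext[OF compress_adjointable[OF amp_adjointable[OF assms]]])
  (use x assms in \<open>auto simp: compress_def amp_tensor lann_tensor\<close>)

end

text \<open>The coefficients <x, S x'> lie where the left action of Y is isometric
  (\<open>Y.perp_isometric\<close>); on such S amplification loses no information.\<close>

definition perp_range :: "('x => 'x) => bool" where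
 "perp_range S \<longleftrightarrow> S \<in> adjointable X \<and> (\<forall>x\<in>carrier X. \<forall>x'\<in>carrier X. inn X x (S x') \<in> perp A (lact_kernel A Y))"

text \<open>For c = <S x, S x>, ||S x||^2 = ||c|| is at most the norm of the action of c on Y. That
  action is the compression of S \<otimes> 1 between S x and x, of norm at most ||S x|| ||x|| ||S
  \<otimes> 1||.\<close>

lemma amp_isometric: assumes S: "perp_range S" shows "op_norm A X S \<le> op_norm A Z (amp S)"
proof -
 have Sa: "S \<in> adjointable X" using S by (simp add: perp_range_def)
 have U: "amp S \<in> adjointable Z" by (rule amp_adjointable[OF Sa])
 show ?thesis
 proof (rule X.op_norm_le)
  show "0 \<le> op_norm A Z (amp S)" using U by (rule Z.op_norm_nonneg)
  fix x assume x: "x <: X"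
  have Sx: "S x <: X" using Sa x by blast
  let ?c = "inn X (S x) (S x)"
  have "?c \<in> perp A (lact_kernel A Y)" using S x Sx by (simp add: perp_range_def)
  hence "nrm A ?c \<le> op_norm A Y (lact Y ?c)" by (rule Y.perp_isometric)
  also have "lact Y ?c = compress (S x) x (amp S)" using compress_amp[OF Sx x Sa] by simp
  also have "op_norm A Y \<dots> \<le> hnorm A X (S x) * hnorm A X x * op_norm A Z (amp S)"
   by (rule compress_bound[OF Sx x U])
  finally have le: "hnorm A X (S x) * hnorm A X (S x) \<le> hnorm A X (S x) * (op_norm A Z (amp S) * hnorm A X x)"
   using X.hnorm_square[OF Sx] by (simp add: power2_eq_square mult_ac)
  show "hnorm A X (S x) \<le> op_norm A Z (amp S) * hnorm A X x"
  proof (cases "hnorm A X (S x) = 0")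
   case True
   thus ?thesis using x Z.op_norm_nonneg[OF U] by simp
  next
   case False
   hence "hnorm A X (S x) > 0" using Sx by (simp add: order_less_le)
   thus ?thesis using le by simp
  qed
 qed
qed

text \<open>The prefix V makes the claim additive: for z + w choose W for z, then U for w with
  prefix W V. As U \<otimes> 1 is a contraction, the image of z stays small. For an elementary
  tensor the claim is \<open>near_one_small\<close> at the vector V x.\<close>

lemma near_one_amp:
 assumes "w <: Z" shows "\<forall>V\<in>X.near_one. \<forall>e>0. \<exists>W\<in>X.near_one. hnorm A Z (amp (W \<otimes>\<^sub>(LL A X) V) w) \<le> e"
proof -
 have no: "V \<in> adjointable X" "op_norm A X V \<le> 1" if "V \<in> X.near_one" for V using that by (auto simp: X.near_one_def)
 have contr: "hnorm A Z (amp V z) \<le> hnorm A Z z" if V: "V \<in> X.near_one" and z: "z <: Z" for V z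
 proof -
  have "hnorm A Z (amp V z) \<le> op_norm A Z (amp V) * hnorm A Z z" using no[OF V] z by (intro Z.op_norm_ge amp_adjointable)
  also have "\<dots> \<le> 1 * hnorm A Z z"
   using no[OF V] op_norm_amp[OF no(1)[OF V]] z by (intro mult_right_mono) auto
  finally show ?thesis by simp
 qed
 have app: "amp (W \<otimes>\<^sub>(LL A X) V) z = amp W (amp V z)" if "W \<in> X.near_one" "V \<in> X.near_one" "z <: Z" for W V z
  using amp_mult[OF no(1)[OF that(1)] no(1)[OF that(2)]] that(3) by (simp add: LL_apply del: LL_simps)
 have cl: "amp V z <: Z" if "V \<in> X.near_one" "z <: Z" for V z
  using amp_adjointable[OF no(1)[OF that(1)]] that(2) by blast
 have lin: "amp V (z \<oplus>\<^sub>Z z') = amp V z \<oplus>\<^sub>Z amp V z'" "amp V (c \<odot>\<^sub>Z z) = c \<odot>\<^sub>Z amp V z"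
  "amp V (z \<ominus>\<^sub>Z z') = amp V z \<ominus>\<^sub>Z amp V z'"
  if "V \<in> X.near_one" "z <: Z" "z' <: Z" for V z z' c
  using amp_adjointable[OF no(1)[OF that(1)]] that(2,3) by (auto simp: Z.adjointable_add Z.adjointable_smult Z.adjointable_minus)
 have assoc: "(U \<otimes>\<^sub>(LL A X) W) \<otimes>\<^sub>(LL A X) V = U \<otimes>\<^sub>(LL A X) (W \<otimes>\<^sub>(LL A X) V)"
  if "U \<in> X.near_one" "V \<in> X.near_one" "W \<in> X.near_one" for U V W
  using no that X.LL.mult_assoc[of U W V] by simp
 have "w <: Z \<and> (\<forall>V\<in>X.near_one. \<forall>e>0. \<exists>W\<in>X.near_one. hnorm A Z (amp (W \<otimes>\<^sub>(LL A X) V) w) \<le> e)"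
  using assms
 proof (induction rule: Z_induct)
  case zero
  have "hnorm A Z (amp (V \<otimes>\<^sub>(LL A X) V) \<zero>\<^sub>Z) \<le> e" if "V \<in> X.near_one" "e > 0" for V and e :: real
   using that contr[OF X.near_one_compose[OF that(1,1)], of "\<zero>\<^sub>Z"] by simp
  thus ?case by blast
 next
  case (tensor x y)
  have "\<exists>W\<in>X.near_one. hnorm A Z (amp (W \<otimes>\<^sub>(LL A X) V) (t x y)) \<le> e" if V: "V \<in> X.near_one" and e: "e > 0" for V e
  proof -
   have Vx: "V x <: X" using no[OF V] tensor by blast
   have hy: "hnorm A Y y + 1 > 0" using tensor by (simp add: add_nonneg_pos)
   obtain W where W: "W \<in> X.near_one" "hnorm A X (W (V x)) \<le> e / (hnorm A Y y + 1)"
    using X.near_one_small[OF Vx, of "e / (hnorm A Y y + 1)"] e hy by auto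
   have WVx: "W (V x) <: X" using no[OF W(1)] Vx by blast
   have "hnorm A Z (t (W (V x)) y) \<le> hnorm A X (W (V x)) * hnorm A Y y" by (rule t_norm[OF WVx tensor(2)])
   also have "\<dots> \<le> e / (hnorm A Y y + 1) * hnorm A Y y" using W tensor by (intro mult_right_mono) auto
   also have "\<dots> \<le> e" using hy e by (simp add: field_simps)
   finally have "hnorm A Z (amp (W \<otimes>\<^sub>(LL A X) V) (t x y)) \<le> e"
    using app[OF W(1) V t_closed[OF tensor]] amp_tensor[OF no(1)[OF V] tensor] amp_tensor[OF no(1)[OF W(1)] Vx tensor(2)] by simp
   thus ?thesis using W by blast
  qed
  thus ?case using tensor by blast
 next
  case (add z w)
  have "\<exists>W\<in>X.near_one. hnorm A Z (amp (W \<otimes>\<^sub>(LL A X) V) (z \<oplus>\<^sub>Z w)) \<le> e" if V: "V \<in> X.near_one" and e: "e > 0" for V e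
  proof -
   obtain W where W: "W \<in> X.near_one" "hnorm A Z (amp (W \<otimes>\<^sub>(LL A X) V) z) \<le> e / 2"
    using add(3) V e by (meson half_gt_zero)
   note WV = X.near_one_compose[OF W(1) V]
   obtain U where U: "U \<in> X.near_one" "hnorm A Z (amp (U \<otimes>\<^sub>(LL A X) (W \<otimes>\<^sub>(LL A X) V)) w) \<le> e / 2"
    using add(4) WV e by (meson half_gt_zero)
   note UWV = X.near_one_compose[OF U(1) WV]
   have "hnorm A Z (amp (U \<otimes>\<^sub>(LL A X) (W \<otimes>\<^sub>(LL A X) V)) z) \<le> e / 2"
    using contr[OF U(1) cl[OF WV add(1)]] app[OF U(1) WV add(1)] W(2) by simp
   hence "hnorm A Z (amp (U \<otimes>\<^sub>(LL A X) (W \<otimes>\<^sub>(LL A X) V)) (z \<oplus>\<^sub>Z w)) \<le> e"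
    using U(2) Z.X.N_add[OF cl[OF UWV add(1)] cl[OF UWV add(2)]] lin(1)[OF UWV add(1,2)] by simp
   thus ?thesis using X.near_one_compose[OF U(1) W(1)] assoc[OF U(1) V W(1)] by metis
  qed
  thus ?case using add by blast
 next
  case (smult c z)
  have "\<exists>W\<in>X.near_one. hnorm A Z (amp (W \<otimes>\<^sub>(LL A X) V) (c \<odot>\<^sub>Z z)) \<le> e" if V: "V \<in> X.near_one" and e: "e > 0" for V e
  proof -
   have c1: "cmod c + 1 > 0" by (simp add: add_nonneg_pos)
   hence "e / (cmod c + 1) > 0" using e by simp
   then obtain W where W: "W \<in> X.near_one" "hnorm A Z (amp (W \<otimes>\<^sub>(LL A X) V) z) \<le> e / (cmod c + 1)"
    using smult(2) V by blast
   note WV = X.near_one_compose[OF W(1) V]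
   have "hnorm A Z (amp (W \<otimes>\<^sub>(LL A X) V) (c \<odot>\<^sub>Z z)) = cmod c * hnorm A Z (amp (W \<otimes>\<^sub>(LL A X) V) z)"
    using lin(2)[OF WV smult(1,1)] cl[OF WV smult(1)] by (simp add: Z.hnorm_smult)
   also have "\<dots> \<le> cmod c * (e / (cmod c + 1))" using W by (intro mult_left_mono) auto
   also have "\<dots> \<le> e" using c1 e by (simp add: field_simps)
   finally show ?thesis using W by blast
  qed
  thus ?case using smult by blast
 next
  case (lim f z)
  note fz = Z.X.vlimD[OF lim(1)]
  have "\<exists>W\<in>X.near_one. hnorm A Z (amp (W \<otimes>\<^sub>(LL A X) V) z) \<le> e" if V: "V \<in> X.near_one" and e: "e > 0" for V e
  proof -
   obtain n where n: "hnorm A Z (f n \<ominus>\<^sub>Z z) < e / 2"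
    using eventually_happens'[OF sequentially_bot order_tendstoD(2)[OF fz(3), of "e / 2"]] e by auto
   obtain W where W: "W \<in> X.near_one" "hnorm A Z (amp (W \<otimes>\<^sub>(LL A X) V) (f n)) \<le> e / 2"
    using lim(2)[of n] V e by (meson half_gt_zero)
   note WV = X.near_one_compose[OF W(1) V]
   have "hnorm A Z (amp (W \<otimes>\<^sub>(LL A X) V) z) \<le> hnorm A Z (amp (W \<otimes>\<^sub>(LL A X) V) (f n)) + hnorm A Z (amp (W \<otimes>\<^sub>(LL A X) V) z \<ominus>\<^sub>Z amp (W \<otimes>\<^sub>(LL A X) V) (f n))"
    by (rule Z.X.N_diff_le[OF cl[OF WV fz(2)] cl[OF WV fz(1)]])
   also have "amp (W \<otimes>\<^sub>(LL A X) V) z \<ominus>\<^sub>Z amp (W \<otimes>\<^sub>(LL A X) V) (f n) = amp (W \<otimes>\<^sub>(LL A X) V) (z \<ominus>\<^sub>Z f n)"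
    using lin(3)[OF WV fz(2) fz(1)] by simp
   also have "hnorm A Z \<dots> \<le> hnorm A Z (z \<ominus>\<^sub>Z f n)" using fz by (intro contr[OF WV]) auto
   also have "\<dots> = hnorm A Z (f n \<ominus>\<^sub>Z z)" using fz by (intro Z.X.N_minus_commute)
   finally show ?thesis using n W by (intro bexI[of _ W]) auto
  qed
  thus ?case using fz by blast
 qed
 thus ?thesis by blast
qed

text \<open>For a rank-one operator this is \<open>near_one_amp\<close> at its first vector; sums
  are handled by the same use of prefixes.\<close>

lemma near_one_amp_KK:
 assumes "K <: KK A Z"
 shows "\<forall>V\<in>X.near_one. \<forall>e>0. \<exists>W\<in>X.near_one. op_norm A Z (amp (W \<otimes>\<^sub>(LL A X) V) \<otimes>\<^sub>(LL A Z) K) \<le> e"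
proof -
 have no: "V \<in> adjointable X" "op_norm A X V \<le> 1" if "V \<in> X.near_one" for V using that by (auto simp: X.near_one_def)
 have am: "amp V <: LL A Z" "nrm (LL A Z) (amp V) \<le> 1" if V: "V \<in> X.near_one" for V
  using amp_adjointable[OF no(1)[OF V]] op_norm_amp[OF no(1)[OF V]] no(2)[OF V] by auto
 have contr: "nrm (LL A Z) (amp V \<otimes>\<^sub>(LL A Z) T) \<le> nrm (LL A Z) T" if V: "V \<in> X.near_one" and T: "T <: LL A Z" for V T
 proof -
  have "nrm (LL A Z) (amp V \<otimes>\<^sub>(LL A Z) T) \<le> nrm (LL A Z) (amp V) * nrm (LL A Z) T" by (rule Z.LL.nrm_mult[OF am(1)[OF V] T])
  also have "\<dots> \<le> 1 * nrm (LL A Z) T" by (rule mult_right_mono[OF am(2)[OF V] Z.LL.N_nonneg[OF T]])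
  finally show ?thesis by simp
 qed
 have app: "amp (W \<otimes>\<^sub>(LL A X) V) \<otimes>\<^sub>(LL A Z) T = amp W \<otimes>\<^sub>(LL A Z) (amp V \<otimes>\<^sub>(LL A Z) T)"
  if "W \<in> X.near_one" "V \<in> X.near_one" "T <: LL A Z" for W V T
  using amp_mult[OF no(1)[OF that(1)] no(1)[OF that(2)]] Z.LL.mult_assoc[OF am(1)[OF that(1)] am(1)[OF that(2)] that(3)] by simp
 have assoc: "(U \<otimes>\<^sub>(LL A X) W) \<otimes>\<^sub>(LL A X) V = U \<otimes>\<^sub>(LL A X) (W \<otimes>\<^sub>(LL A X) V)"
  if "U \<in> X.near_one" "V \<in> X.near_one" "W \<in> X.near_one" for U V W
  using no that X.LL.mult_assoc[of U W V] by simp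
 have cl: "amp V \<otimes>\<^sub>(LL A Z) T <: LL A Z" if "V \<in> X.near_one" "T <: LL A Z" for V T
  using Z.LL.mult_closed[OF am(1)[OF that(1)] that(2)] .
 have "\<forall>V\<in>X.near_one. \<forall>e>0. \<exists>W\<in>X.near_one. nrm (LL A Z) (amp (W \<otimes>\<^sub>(LL A X) V) \<otimes>\<^sub>(LL A Z) K) \<le> e" using assms
 proof (induction rule: Z.KX_induct')
  case zero
  have "nrm (LL A Z) (amp (V \<otimes>\<^sub>(LL A X) V) \<otimes>\<^sub>(LL A Z) \<zero>\<^sub>(LL A Z)) \<le> e" if V: "V \<in> X.near_one" and "e > 0" for V e
   using that Z.LL.mult_zero_r[OF am(1)[OF X.near_one_compose[OF V V]]] Z.LL.N_zero by (metis less_imp_le)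
  thus ?case by blast
 next
  case (rank_one u v)
  have "\<exists>W\<in>X.near_one. nrm (LL A Z) (amp (W \<otimes>\<^sub>(LL A X) V) \<otimes>\<^sub>(LL A Z) rank_one Z u v) \<le> e" if V: "V \<in> X.near_one" and e: "e > 0" for V e
  proof -
   have hv: "hnorm A Z v + 1 > 0" using rank_one by (simp add: add_nonneg_pos)
   hence e': "e / (hnorm A Z v + 1) > 0" using e by simp
   obtain W where W: "W \<in> X.near_one" "hnorm A Z (amp (W \<otimes>\<^sub>(LL A X) V) u) \<le> e / (hnorm A Z v + 1)"
    using near_one_amp[OF rank_one(1)] V e' by blast
   have a: "amp (W \<otimes>\<^sub>(LL A X) V) \<in> adjointable Z" using am(1)[OF X.near_one_compose[OF W(1) V]] by simp
   have "nrm (LL A Z) (amp (W \<otimes>\<^sub>(LL A X) V) \<otimes>\<^sub>(LL A Z) rank_one Z u v) = op_norm A Z (rank_one Z (amp (W \<otimes>\<^sub>(LL A X) V) u) v)"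
    using Z.compose_rank_one[OF a rank_one] by simp
   also have "\<dots> \<le> hnorm A Z (amp (W \<otimes>\<^sub>(LL A X) V) u) * hnorm A Z v" using a rank_one by (intro Z.op_norm_rank_one) auto
   also have "\<dots> \<le> e / (hnorm A Z v + 1) * hnorm A Z v" using W rank_one by (intro mult_right_mono) auto
   also have "\<dots> \<le> e" using hv e by (simp add: field_simps)
   finally show ?thesis using W by blast
  qed
  thus ?case by blast
 next
  case (add S T)
  have ST: "S <: LL A Z" "T <: LL A Z" using add Z.KX_adjointable by auto
  have "\<exists>W\<in>X.near_one. nrm (LL A Z) (amp (W \<otimes>\<^sub>(LL A X) V) \<otimes>\<^sub>(LL A Z) (S \<oplus>\<^sub>(LL A Z) T)) \<le> e" if V: "V \<in> X.near_one" and e: "e > 0" for V e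
  proof -
   obtain W where W: "W \<in> X.near_one" "nrm (LL A Z) (amp (W \<otimes>\<^sub>(LL A X) V) \<otimes>\<^sub>(LL A Z) S) \<le> e / 2"
    using add(3) V e by (meson half_gt_zero)
   note WV = X.near_one_compose[OF W(1) V]
   obtain U where U: "U \<in> X.near_one" "nrm (LL A Z) (amp (U \<otimes>\<^sub>(LL A X) (W \<otimes>\<^sub>(LL A X) V)) \<otimes>\<^sub>(LL A Z) T) \<le> e / 2"
    using add(4) WV e by (meson half_gt_zero)
   note UWV = X.near_one_compose[OF U(1) WV]
   have "nrm (LL A Z) (amp (U \<otimes>\<^sub>(LL A X) (W \<otimes>\<^sub>(LL A X) V)) \<otimes>\<^sub>(LL A Z) S) \<le> e / 2"
    unfolding app[OF U(1) WV ST(1)] by (rule order_trans[OF contr[OF U(1) cl[OF WV ST(1)]] W(2)])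
   hence "nrm (LL A Z) (amp (U \<otimes>\<^sub>(LL A X) (W \<otimes>\<^sub>(LL A X) V)) \<otimes>\<^sub>(LL A Z) (S \<oplus>\<^sub>(LL A Z) T)) \<le> e"
    unfolding Z.LL.mult_add_right[OF am(1)[OF UWV] ST]
    using U(2) Z.LL.nrm_triangle[OF cl[OF UWV ST(1)] cl[OF UWV ST(2)]] by linarith
   thus ?thesis using X.near_one_compose[OF U(1) W(1)] assoc[OF U(1) V W(1)] by metis
  qed
  thus ?case by blast
 next
  case (smult c T)
  have T: "T <: LL A Z" using smult Z.KX_adjointable by auto
  have "\<exists>W\<in>X.near_one. nrm (LL A Z) (amp (W \<otimes>\<^sub>(LL A X) V) \<otimes>\<^sub>(LL A Z) (c \<odot>\<^sub>(LL A Z) T)) \<le> e" if V: "V \<in> X.near_one" and e: "e > 0" for V e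
  proof -
   have c1: "cmod c + 1 > 0" by (simp add: add_nonneg_pos)
   hence "e / (cmod c + 1) > 0" using e by simp
   then obtain W where W: "W \<in> X.near_one" "nrm (LL A Z) (amp (W \<otimes>\<^sub>(LL A X) V) \<otimes>\<^sub>(LL A Z) T) \<le> e / (cmod c + 1)"
    using smult(2) V by blast
   note WV = X.near_one_compose[OF W(1) V]
   have "nrm (LL A Z) (amp (W \<otimes>\<^sub>(LL A X) V) \<otimes>\<^sub>(LL A Z) (c \<odot>\<^sub>(LL A Z) T)) = cmod c * nrm (LL A Z) (amp (W \<otimes>\<^sub>(LL A X) V) \<otimes>\<^sub>(LL A Z) T)"
    using Z.LL.mult_scale_right[OF am(1)[OF WV] T] Z.LL.nrm_scale[OF cl[OF WV T]] by metis
   also have "\<dots> \<le> cmod c * (e / (cmod c + 1))" using W by (intro mult_left_mono) auto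
   also have "\<dots> \<le> e" using c1 e by (simp add: field_simps)
   finally show ?thesis using W by blast
  qed
  thus ?case by blast
 next
  case (lim F T)
  note fz = Z.LL.vlimD[OF lim(1)]
  have "\<exists>W\<in>X.near_one. nrm (LL A Z) (amp (W \<otimes>\<^sub>(LL A X) V) \<otimes>\<^sub>(LL A Z) T) \<le> e" if V: "V \<in> X.near_one" and e: "e > 0" for V e
  proof -
   obtain n where n: "nrm (LL A Z) (F n \<ominus>\<^sub>(LL A Z) T) < e / 2"
    using eventually_happens'[OF sequentially_bot order_tendstoD(2)[OF fz(3), of "e / 2"]] e by auto
   obtain W where W: "W \<in> X.near_one" "nrm (LL A Z) (amp (W \<otimes>\<^sub>(LL A X) V) \<otimes>\<^sub>(LL A Z) F n) \<le> e / 2"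
    using lim(4)[of n] V e by (meson half_gt_zero)
   note WV = X.near_one_compose[OF W(1) V]
   let ?U = "amp (W \<otimes>\<^sub>(LL A X) V)"
   have "nrm (LL A Z) (?U \<otimes>\<^sub>(LL A Z) T) \<le> nrm (LL A Z) (?U \<otimes>\<^sub>(LL A Z) F n) + nrm (LL A Z) (?U \<otimes>\<^sub>(LL A Z) T \<ominus>\<^sub>(LL A Z) ?U \<otimes>\<^sub>(LL A Z) F n)"
    by (rule Z.LL.N_diff_le[OF cl[OF WV fz(2)] cl[OF WV fz(1)]])
   also have "?U \<otimes>\<^sub>(LL A Z) T \<ominus>\<^sub>(LL A Z) ?U \<otimes>\<^sub>(LL A Z) F n = ?U \<otimes>\<^sub>(LL A Z) (T \<ominus>\<^sub>(LL A Z) F n)"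
    using Z.LL.mult_minus_r[OF am(1)[OF WV] fz(2) fz(1)] by simp
   also have "nrm (LL A Z) \<dots> \<le> nrm (LL A Z) (T \<ominus>\<^sub>(LL A Z) F n)" by (rule contr[OF WV Z.LL.minus_in[OF fz(2) fz(1)]])
   also have "\<dots> = nrm (LL A Z) (F n \<ominus>\<^sub>(LL A Z) T)" by (rule Z.LL.N_minus_commute[OF fz(2) fz(1)])
   finally show ?thesis using n W by (intro bexI[of _ W]) auto
  qed
  thus ?case by blast
 qed
 thus ?thesis by simp
qed

text \<open>For W in \<open>near_one\<close>, S differs from the compact operator (1 - W) S by W S.
  The coefficients of W S lie in the same annihilator, so ||W S|| is at most ||(W \<otimes> 1) (S
  \<otimes> 1)||, which becomes arbitrarily small since S \<otimes> 1 is compact.\<close>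

theorem compact_if_amp_compact:
 assumes S: "perp_range S" and K: "amp S <: KK A Z"
 shows "S <: KK A X"
proof -
 have Sa: "S \<in> adjointable X" "S <: LL A X" using S by (auto simp: perp_range_def)
 have "S \<in> norm_closure (LL A X) (nrm (LL A X)) (carrier (KK A X))"
  unfolding norm_closure_def
 proof (intro CollectI conjI allI impI Sa)
  fix e :: real assume e: "e > 0"
  obtain W where W: "W \<in> X.near_one" "op_norm A Z (amp (W \<otimes>\<^sub>(LL A X) \<one>\<^sub>(LL A X)) \<otimes>\<^sub>(LL A Z) amp S) \<le> e / 2"
   using near_one_amp_KK[OF K] X.near_one_one e by (meson half_gt_zero)
  have Wa: "W <: LL A X" "\<one>\<^sub>(LL A X) \<ominus>\<^sub>(LL A X) W <: KK A X" using W(1) by (auto simp: X.near_one_def)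
  have W1: "W \<otimes>\<^sub>(LL A X) \<one>\<^sub>(LL A X) = W" by (rule X.LL.r_one[OF Wa(1)])
  let ?k = "(\<one>\<^sub>(LL A X) \<ominus>\<^sub>(LL A X) W) \<otimes>\<^sub>(LL A X) S"
  have k: "?k <: KK A X" by (rule X.KX_compose_right[OF Wa(2) Sa(1)])
  have "S \<ominus>\<^sub>(LL A X) ?k = W \<otimes>\<^sub>(LL A X) S"
   using Sa(2) Wa(1) X.LL.one_closed by algebra
  moreover have "perp_range (W \<otimes>\<^sub>(LL A X) S)"
   unfolding perp_range_def
  proof (intro conjI ballI)
   show "W \<otimes>\<^sub>(LL A X) S \<in> adjointable X" using Sa Wa by (simp add: X.LL_compose_closed)
   fix x x' assume x: "x <: X" "x' <: X"
   have "inn X x ((W \<otimes>\<^sub>(LL A X) S) x') = inn X (adjoint X W x) (S x')"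
    using x Sa Wa by (simp add: LL_apply X.adjoint_inn' del: LL_simps(2-8))
   moreover have "adjoint X W x <: X" using Wa x by auto
   ultimately show "inn X x ((W \<otimes>\<^sub>(LL A X) S) x') \<in> perp A (lact_kernel A Y)" using S x by (simp add: perp_range_def del: LL_simps)
  qed
  ultimately have "nrm (LL A X) (S \<ominus>\<^sub>(LL A X) ?k) \<le> op_norm A Z (amp (W \<otimes>\<^sub>(LL A X) S))"
   using amp_isometric[of "W \<otimes>\<^sub>(LL A X) S"] by (simp del: LL_simps(1-7))
  also have "amp (W \<otimes>\<^sub>(LL A X) S) = amp (W \<otimes>\<^sub>(LL A X) \<one>\<^sub>(LL A X)) \<otimes>\<^sub>(LL A Z) amp S"
   unfolding W1 using amp_mult[of W S] Wa Sa by simp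
  also have "op_norm A Z \<dots> \<le> e / 2" by (rule W(2))
  finally show "\<exists>k\<in>carrier (KK A X). nrm (LL A X) (S \<ominus>\<^sub>(LL A X) k) < e" using e by (intro bexI[OF _ k]) linarith
 qed
 thus ?thesis using X.KX_subalgebra by (auto simp: cstar_subalgebra_def)
qed

end

section \<open>Representations of tensor products\<close>

lemma (in hilbert_module) adjointable_vlim: "T \<in> adjointable X ==> X.vlim f l ==> X.vlim (%n. T (f n)) (T l)"
 by (rule vlim_map[OF X.normed_vec_axioms X.normed_vec_axioms adjointable_linear op_norm_ge])

locale tensor_factors = balanced_tensor A X Y Z t + P: bimod_rep A X B \<pi> \<psi>\<^sub>1 + Q: bimod_rep A Y B \<pi> \<psi>\<^sub>2
 for A :: "('a, 'm) cstar_scheme" and X :: "('a, 'x, 'n) bimod_scheme"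
  and Y :: "('a, 'y, 'k) bimod_scheme" and Z :: "('a, 'z, 'l) bimod_scheme" and t
  and B :: "('b, 'o) cstar_scheme" and \<pi> \<psi>\<^sub>1 \<psi>\<^sub>2
begin

text \<open>On the span of the pairs (x \<otimes> y, \<psi>_1(x) \<psi>_2(y)) one has b^* b' =
  \<pi>(<w, w'>), so the estimate for the extension is contractivity of \<pi>.\<close>

theorem tensor_rep_exists:
 obtains \<psi> where "bimod_rep A Z B \<pi> \<psi>" "!!x y. x <: X ==> y <: Y ==> \<psi> (t x y) = \<psi>\<^sub>1 x \<otimes>\<^sub>B \<psi>\<^sub>2 y"
proof -
 let ?G = "{(t x y, \<psi>\<^sub>1 x \<otimes>\<^sub>B \<psi>\<^sub>2 y) | x y. x <: X \<and> y <: Y}"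
 have G: "?G \<subseteq> carrier Z \<times> carrier B" by auto
 have gen2: "star B (\<psi>\<^sub>1 x \<otimes>\<^sub>B \<psi>\<^sub>2 y) \<otimes>\<^sub>B (\<psi>\<^sub>1 x' \<otimes>\<^sub>B \<psi>\<^sub>2 y') = \<pi> (inn Z (t x y) (t x' y'))"
  if "x <: X" "y <: Y" "x' <: X" "y' <: Y" for x y x' y'
 proof -
  have "star B (\<psi>\<^sub>1 x \<otimes>\<^sub>B \<psi>\<^sub>2 y) \<otimes>\<^sub>B (\<psi>\<^sub>1 x' \<otimes>\<^sub>B \<psi>\<^sub>2 y')
   = star B (\<psi>\<^sub>2 y) \<otimes>\<^sub>B ((star B (\<psi>\<^sub>1 x) \<otimes>\<^sub>B \<psi>\<^sub>1 x') \<otimes>\<^sub>B \<psi>\<^sub>2 y')"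
   using that by (simp add: P.B.star_mult P.B.mult_assoc)
  also have "\<dots> = star B (\<psi>\<^sub>2 y) \<otimes>\<^sub>B \<psi>\<^sub>2 (lact Y (inn X x x') y')" using that by (simp add: P.psi_inn Q.psi_lact)
  also have "\<dots> = \<pi> (inn Z (t x y) (t x' y'))" using that by (simp add: Q.psi_inn t_inn)
  finally show ?thesis .
 qed
 note cl = pair_span_closed[OF Z.X.normed_vec_axioms P.B.normed_vec_axioms _ G, of "(w, b)" for w b, simplified]
 have gen1: "star B (\<psi>\<^sub>1 x \<otimes>\<^sub>B \<psi>\<^sub>2 y) \<otimes>\<^sub>B b = \<pi> (inn Z (t x y) w)"
  if xy: "x <: X" "y <: Y" and wb: "(w, b) \<in> pair_span Z B ?G" for x y w b
  using wb
 proof (induction w b rule: pair_span.induct[split_format (complete)])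
  case pair_span_zero
  show ?case using xy by (simp add: P.pi_zero)
 next
  case (pair_span_gen w b)
  thus ?case using xy gen2 by auto
 next
  case (pair_span_add w b w' b')
  thus ?case using xy cl[OF pair_span_add(1)] cl[OF pair_span_add(2)]
   by (simp add: P.B.mult_add_right Z.inn_add P.pi_add)
 next
  case (pair_span_smult w b c)
  thus ?case using xy cl[OF pair_span_smult(1)]
   by (simp add: P.B.mult_scale_right Z.inn_scale hom_smult[OF P.AB P.pi_hom])
 qed
 have rel: "star B b \<otimes>\<^sub>B b' = \<pi> (inn Z w w')"
  if wb: "(w, b) \<in> pair_span Z B ?G" and wb': "(w', b') \<in> pair_span Z B ?G" for w b w' b'
  using wb
 proof (induction w b rule: pair_span.induct[split_format (complete)])
  case pair_span_zero
  show ?case using cl[OF wb'] by (simp add: P.pi_zero)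
 next
  case (pair_span_gen w b)
  thus ?case using gen1[OF _ _ wb'] by auto
 next
  case (pair_span_add w b v d)
  thus ?case using cl[OF wb'] cl[OF pair_span_add(1)] cl[OF pair_span_add(2)]
   by (simp add: P.B.star_add P.B.mult_add_left Z.inn_add_left P.pi_add)
 next
  case (pair_span_smult w b c)
  thus ?case using cl[OF wb'] cl[OF pair_span_smult(1)]
   by (simp add: P.B.star_scale P.B.mult_scale_left Z.inn_scale_left hom_smult[OF P.AB P.pi_hom])
 qed
 have bound: "nrm B b \<le> 1 * hnorm A Z w" if wb: "(w, b) \<in> pair_span Z B ?G" for w b
 proof -
  have "(nrm B b)\<^sup>2 = nrm B (\<pi> (inn Z w w))" using rel[OF wb wb] P.B.nrm_star_mult[of b] cl[OF wb] by simp
  also have "\<dots> \<le> (hnorm A Z w)\<^sup>2" using cl[OF wb] by (simp add: P.pi_contractive Z.hnorm_square)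
  finally show ?thesis using power2_le_imp_le[of "nrm B b" "hnorm A Z w"] cl[OF wb] by simp
 qed
 have "fst ` ?G = tensors" by force
 hence dense: "carrier Z \<subseteq> norm_closure Z (hnorm A Z) (cspan Z (fst ` ?G))" using Z_dense by simp
 obtain \<psi> where \<psi>: "linear_on Z B \<psi>" "!!z. z <: Z ==> nrm B (\<psi> z) \<le> 1 * hnorm A Z z"
  "!!a b. (a, b) \<in> pair_span Z B ?G ==> \<psi> a = b"
  using bounded_extension[OF Z.X.normed_vec_axioms P.B.normed_vec_axioms P.B.complete G zero_le_one bound dense] by blast
 have \<psi>t: "\<psi> (t x y) = \<psi>\<^sub>1 x \<otimes>\<^sub>B \<psi>\<^sub>2 y" if "x <: X" "y <: Y" for x y
  using that by (intro \<psi>(3) pair_span_gen) auto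
 note ZB = Z.X.cvec_axioms P.B.cvec_axioms
 note \<psi>c = linear_on_closed[OF ZB \<psi>(1)]
 have \<psi>v: "P.B.vlim (%n. \<psi> (f n)) (\<psi> l)" if "Z.X.vlim f l" for f l
  by (rule vlim_map[OF Z.X.normed_vec_axioms P.B.normed_vec_axioms \<psi>(1,2) that])
 have inn1: "star B (\<psi> (t x y)) \<otimes>\<^sub>B \<psi> z = \<pi> (inn Z (t x y) z)" if xy: "x <: X" "y <: Y" and "z <: Z" for x y z
 proof -
  have "z <: Z \<and> star B (\<psi> (t x y)) \<otimes>\<^sub>B \<psi> z = \<pi> (inn Z (t x y) z)" using \<open>z <: Z\<close>
  proof (induction rule: Z_induct)
   case zero
   show ?case using xy linear_on_zero[OF ZB \<psi>(1)] \<psi>c by (simp add: P.pi_zero)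
  next
   case (tensor x' y')
   thus ?case using xy gen2 by (simp add: \<psi>t)
  next
   case (add z w)
   thus ?case using xy \<psi>c by (simp add: linear_on_add[OF ZB \<psi>(1)] P.B.mult_add_right Z.inn_add P.pi_add)
  next
   case (smult c z)
   thus ?case using xy \<psi>c
    by (simp add: linear_on_smult[OF ZB \<psi>(1)] P.B.mult_scale_right Z.inn_scale hom_smult[OF P.AB P.pi_hom])
  next
   case (lim f z)
   have "P.B.vlim (%n. star B (\<psi> (t x y)) \<otimes>\<^sub>B \<psi> (f n)) (star B (\<psi> (t x y)) \<otimes>\<^sub>B \<psi> z)"
    using xy \<psi>c by (intro P.B.vlim_mult P.B.vlim_const \<psi>v lim) auto
   moreover have "P.B.vlim (%n. \<pi> (inn Z (t x y) (f n))) (\<pi> (inn Z (t x y) z))"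
    using xy by (intro P.pi_vlim Z.vlim_inn lim) auto
   ultimately show ?case using lim Z.X.vlimD(2)[OF lim(1)] by (simp add: P.B.vlim_unique)
  qed
  thus ?thesis by blast
 qed
 have inn2: "star B (\<psi> w) \<otimes>\<^sub>B \<psi> z = \<pi> (inn Z w z)" if "w <: Z" and z: "z <: Z" for w z
 proof -
  have "w <: Z \<and> star B (\<psi> w) \<otimes>\<^sub>B \<psi> z = \<pi> (inn Z w z)" using \<open>w <: Z\<close>
  proof (induction rule: Z_induct)
   case zero
   show ?case using z linear_on_zero[OF ZB \<psi>(1)] \<psi>c by (simp add: P.pi_zero)
  next
   case (tensor x y)
   thus ?case using z inn1 by simp
  next
   case (add v w)
   thus ?case using z \<psi>c by (simp add: linear_on_add[OF ZB \<psi>(1)] P.B.star_add P.B.mult_add_left Z.inn_add_left P.pi_add)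
  next
   case (smult c w)
   thus ?case using z \<psi>c
    by (simp add: linear_on_smult[OF ZB \<psi>(1)] P.B.star_scale P.B.mult_scale_left Z.inn_scale_left hom_smult[OF P.AB P.pi_hom])
  next
   case (lim f w)
   have "P.B.vlim (%n. star B (\<psi> (f n)) \<otimes>\<^sub>B \<psi> z) (star B (\<psi> w) \<otimes>\<^sub>B \<psi> z)"
    using z \<psi>c by (intro P.B.vlim_mult P.B.vlim_const P.B.vlim_star \<psi>v lim) auto
   moreover have "P.B.vlim (%n. \<pi> (inn Z (f n) z)) (\<pi> (inn Z w z))"
    using z by (intro P.pi_vlim Z.vlim_inn_left lim) auto
   ultimately show ?case using lim Z.X.vlimD(2)[OF lim(1)] by (simp add: P.B.vlim_unique)
  qed
  thus ?thesis by blast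
 qed
 have act: "\<psi> (ract Z (lact Z a z) b) = (\<pi> a \<otimes>\<^sub>B \<psi> z) \<otimes>\<^sub>B \<pi> b"
  if a: "a <: A" and b: "b <: A" and "z <: Z" for a b z
 proof -
  have "z <: Z \<and> \<psi> (ract Z (lact Z a z) b) = (\<pi> a \<otimes>\<^sub>B \<psi> z) \<otimes>\<^sub>B \<pi> b" using \<open>z <: Z\<close>
  proof (induction rule: Z_induct)
   case zero
   show ?case using a b linear_on_zero[OF ZB \<psi>(1)] Z.adjointable_zero[OF Z.lact_adjointable[OF a]] by simp
  next
   case (tensor x y)
   have "ract Z (lact Z a (t x y)) b = t (lact X a x) (ract Y y b)" using tensor a b by (simp add: t_lact t_ract)
   thus ?case using tensor a b by (simp add: \<psi>t P.psi_lact Q.psi_ract P.B.mult_assoc)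
  next
   case (add z w)
   thus ?case using a b \<psi>c
    by (simp add: Z.adjointable_add[OF Z.lact_adjointable] Z.ract_add_left linear_on_add[OF ZB \<psi>(1)] P.B.mult_add_left P.B.mult_add_right)
  next
   case (smult c z)
   thus ?case using a b \<psi>c
    by (simp add: Z.adjointable_smult[OF Z.lact_adjointable] Z.ract_scale_left linear_on_smult[OF ZB \<psi>(1)] P.B.mult_scale_left P.B.mult_scale_right)
  next
   case (lim f z)
   have "P.B.vlim (%n. \<psi> (ract Z (lact Z a (f n)) b)) (\<psi> (ract Z (lact Z a z) b))"
    by (rule \<psi>v[OF Z.vlim_ract[OF Z.adjointable_vlim[OF Z.lact_adjointable[OF a] lim(1)] X.A.vlim_const[OF b]]])
   moreover have "P.B.vlim (%n. (\<pi> a \<otimes>\<^sub>B \<psi> (f n)) \<otimes>\<^sub>B \<pi> b) ((\<pi> a \<otimes>\<^sub>B \<psi> z) \<otimes>\<^sub>B \<pi> b)"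
    by (rule P.B.vlim_mult[OF P.B.vlim_mult[OF P.B.vlim_const[OF P.pi_closed[OF a]] \<psi>v[OF lim(1)]] P.B.vlim_const[OF P.pi_closed[OF b]]])
   ultimately show ?case using lim Z.X.vlimD(2)[OF lim(1)] by (simp add: P.B.vlim_unique)
  qed
  thus ?thesis by blast
 qed
 have "bimod_rep A Z B \<pi> \<psi>"
  by unfold_locales (use \<psi>(1) act inn2 P.pi_hom in \<open>simp add: is_rep_def\<close>)
 thus ?thesis using that \<psi>t by blast
qed

end

section \<open>Compatible representations on two bimodules and their tensor product\<close>

locale tensor_reps = tensor_factors A X Y Z t B \<pi> \<psi>\<^sub>1 \<psi>\<^sub>2 + R: bimod_rep A Z B \<pi> \<psi>
 for A :: "('a, 'm) cstar_scheme" and X :: "('a, 'x, 'n) bimod_scheme"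
  and Y :: "('a, 'y, 'k) bimod_scheme" and Z :: "('a, 'z, 'l) bimod_scheme" and t
  and B :: "('b, 'o) cstar_scheme" and \<pi> \<psi>\<^sub>1 \<psi>\<^sub>2 \<psi> +
 assumes psi_tensor: "x <: X ==> y <: Y ==> \<psi> (t x y) = \<psi>\<^sub>1 x \<otimes>\<^sub>B \<psi>\<^sub>2 y"
begin

text \<open>Creation by x turns into left multiplication by \<psi>_1(x), hence its adjoint into
  multiplication by the star.\<close>

lemma psi_lann: assumes x: "x <: X" and "z <: Z" shows "\<psi>\<^sub>2 (lann x z) = star B (\<psi>\<^sub>1 x) \<otimes>\<^sub>B \<psi> z"
proof -
 note lin = lann_linear[OF x]
 have "z <: Z \<and> \<psi>\<^sub>2 (lann x z) = star B (\<psi>\<^sub>1 x) \<otimes>\<^sub>B \<psi> z" using assms(2)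
 proof (induction rule: Z_induct)
  case zero
  show ?case using x by (simp add: linear_on_zero[OF ZY lin] Q.psi_zero R.psi_zero)
 next
  case (tensor x' y')
  thus ?case using x by (simp add: lann_tensor psi_tensor Q.psi_lact P.psi_inn[symmetric] P.B.mult_assoc)
 next
  case (add z w)
  thus ?case using x by (simp add: linear_on_add[OF ZY lin] Q.psi_add R.psi_add P.B.mult_add_right)
 next
  case (smult c z)
  thus ?case using x by (simp add: linear_on_smult[OF ZY lin] Q.psi_smult R.psi_smult P.B.mult_scale_right)
 next
  case (lim f z)
  have "P.B.vlim (%n. \<psi>\<^sub>2 (lann x (f n))) (\<psi>\<^sub>2 (lann x z))"
   by (rule Q.psi_vlim[OF vlim_map[OF Z.X.normed_vec_axioms Y.X.normed_vec_axioms lin lann_bound[OF x] lim(1)]])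
  moreover have "P.B.vlim (%n. star B (\<psi>\<^sub>1 x) \<otimes>\<^sub>B \<psi> (f n)) (star B (\<psi>\<^sub>1 x) \<otimes>\<^sub>B \<psi> z)"
   using x by (intro P.B.vlim_mult P.B.vlim_const R.psi_vlim lim) auto
  ultimately show ?case using lim Z.X.vlimD(2)[OF lim(1)] by (simp add: P.B.vlim_unique)
 qed
 thus ?thesis by blast
qed

text \<open>On rank-one operators both sides are computed from \<open>psi_lann\<close>; the rest is
  linearity and continuity.\<close>

lemma cpt_compress: assumes x: "x <: X" "x' <: X" and "K <: KK A Z"
 shows "Q.cpt (compress x x' K) = star B (\<psi>\<^sub>1 x) \<otimes>\<^sub>B (R.cpt K \<otimes>\<^sub>B \<psi>\<^sub>1 x')"
 using assms(3)
proof (induction rule: Z.KX_induct')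
 case zero
 show ?case using x compress_zero[OF x] Q.cpt_zero R.cpt_zero by (simp del: LL_simps)
next
 case (rank_one u v)
 thus ?case using x by (simp add: compress_rank_one Q.cpt_rank_one R.cpt_rank_one psi_lann P.B.star_mult P.B.mult_assoc)
next
 case (add S T)
 thus ?case using x compress_add[OF x, of S T] compress_KK[OF x] Z.KX_adjointable
  by (simp add: Q.cpt_add R.cpt_add P.B.mult_add_right P.B.mult_add_left del: LL_simps)
next
 case (smult c T)
 thus ?case using x compress_smult[OF x, of T c] compress_KK[OF x] Z.KX_adjointable
  by (simp add: Q.cpt_smult R.cpt_smult P.B.mult_scale_right P.B.mult_scale_left del: LL_simps)
next
 case (lim F T)
 have "P.B.vlim (%n. Q.cpt (compress x x' (F n))) (Q.cpt (compress x x' T))"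
  by (intro Q.cpt_vlim compress_vlim compress_KK x lim)
 moreover have "P.B.vlim (%n. star B (\<psi>\<^sub>1 x) \<otimes>\<^sub>B (R.cpt (F n) \<otimes>\<^sub>B \<psi>\<^sub>1 x')) (star B (\<psi>\<^sub>1 x) \<otimes>\<^sub>B (R.cpt T \<otimes>\<^sub>B \<psi>\<^sub>1 x'))"
  using x by (intro P.B.vlim_mult P.B.vlim_const R.cpt_vlim lim) auto
 ultimately show ?case using lim by (simp add: P.B.vlim_unique)
qed

lemma cpt_amp: assumes S: "S <: KK A X" and "z <: Z" shows "P.cpt S \<otimes>\<^sub>B \<psi> z = \<psi> (amp S z)"
proof -
 have Sa: "S \<in> adjointable X" by (rule X.KX_adjointable[OF S])
 note U = amp_adjointable[OF Sa]
 have "z <: Z \<and> P.cpt S \<otimes>\<^sub>B \<psi> z = \<psi> (amp S z)" using assms(2)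
 proof (induction rule: Z_induct)
  case zero
  show ?case using S U by (simp add: R.psi_zero)
 next
  case (tensor x y)
  thus ?case using S Sa by (simp add: psi_tensor amp_tensor P.cpt_psi flip: P.B.mult_assoc)
 next
  case (add z w)
  thus ?case using S U by (simp add: R.psi_add P.B.mult_add_right Z.adjointable_add)
 next
  case (smult c z)
  thus ?case using S U by (simp add: R.psi_smult P.B.mult_scale_right Z.adjointable_smult)
 next
  case (lim f z)
  have "P.B.vlim (%n. P.cpt S \<otimes>\<^sub>B \<psi> (f n)) (P.cpt S \<otimes>\<^sub>B \<psi> z)"
   using S by (intro P.B.vlim_mult P.B.vlim_const R.psi_vlim lim) auto
  moreover have "P.B.vlim (%n. \<psi> (amp S (f n))) (\<psi> (amp S z))"
   by (rule R.psi_vlim[OF Z.adjointable_vlim[OF U lim(1)]])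
  ultimately show ?case using lim Z.X.vlimD(2)[OF lim(1)] by (simp add: P.B.vlim_unique)
 qed
 thus ?thesis by blast
qed

text \<open>Both sides agree after compression by vectors of \<open>X\<close>, and both act on \<open>\<psi>(Z)\<close> as \<open>S \<otimes> 1\<close>; hence their
 difference \<open>d\<close> annihilates \<open>\<psi>(Z)\<close>, then \<open>\<psi>\<^sub>1(X)\<close>, then itself.\<close>

theorem cpt_amp_eq:
 assumes cov: "katsura_covariant A Y B \<pi> \<psi>\<^sub>2" and S: "S <: KK A X" "perp_range S"
  and K: "amp S <: KK A Z"
 shows "R.cpt (amp S) = P.cpt S"
proof -
 have Sa: "S \<in> adjointable X" by (rule X.KX_adjointable[OF S(1)])
 define b b' d where "b = P.cpt S" and "b' = R.cpt (amp S)" and "d = b \<ominus>\<^sub>B b'"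
 have c [simp]: "b <: B" "b' <: B" "d <: B" using S K by (auto simp: b_def b'_def d_def)
 have S': "star (LL A X) S <: KK A X" by (rule X.KX_star[OF S(1)])
 have sb: "star B b = P.cpt (star (LL A X) S)" using P.cpt_star[OF S(1)] by (simp add: b_def)
 have K': "star (LL A Z) (amp S) <: KK A Z" by (rule Z.KX_star[OF K])
 have sb': "star B b' = R.cpt (star (LL A Z) (amp S))" using R.cpt_star[OF K] by (simp add: b'_def)
 \<comment> \<open>The place where covariance enters: <x, S x'> lies in the annihilator of the
   kernel, and it acts compactly on Y because its action is a compression of the compact operator S
   \<otimes> 1.\<close>
 have comp: "star B (\<psi>\<^sub>1 x) \<otimes>\<^sub>B (d \<otimes>\<^sub>B \<psi>\<^sub>1 x') = \<zero>\<^sub>B" if x: "x <: X" "x' <: X" for x x'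
 proof -
  have Sx: "S x' <: X" using Sa x by blast
  have e: "lact Y (inn X x (S x')) = compress x x' (amp S)" using compress_amp[OF x Sa] by simp
  have "inn X x (S x') \<in> perp A (lact_kernel A Y)" using S(2) x by (simp add: perp_range_def)
  moreover have "lact Y (inn X x (S x')) <: KK A Y" unfolding e by (rule compress_KK[OF x K])
  ultimately have "Q.cpt (lact Y (inn X x (S x'))) = \<pi> (inn X x (S x'))" using cov by (simp add: katsura_covariant_def)
  hence 1: "star B (\<psi>\<^sub>1 x) \<otimes>\<^sub>B (b' \<otimes>\<^sub>B \<psi>\<^sub>1 x') = \<pi> (inn X x (S x'))"
   unfolding e using cpt_compress[OF x K] by (simp add: b'_def)
  have 2: "star B (\<psi>\<^sub>1 x) \<otimes>\<^sub>B (b \<otimes>\<^sub>B \<psi>\<^sub>1 x') = \<pi> (inn X x (S x'))"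
   using x Sx S by (simp add: b_def P.cpt_psi P.psi_inn)
  have "star B (\<psi>\<^sub>1 x) \<otimes>\<^sub>B (d \<otimes>\<^sub>B \<psi>\<^sub>1 x')
   = star B (\<psi>\<^sub>1 x) \<otimes>\<^sub>B (b \<otimes>\<^sub>B \<psi>\<^sub>1 x') \<ominus>\<^sub>B star B (\<psi>\<^sub>1 x) \<otimes>\<^sub>B (b' \<otimes>\<^sub>B \<psi>\<^sub>1 x')"
   unfolding d_def using x by (simp add: P.B.mult_minus_l P.B.mult_minus_r)
  thus ?thesis unfolding 1 2 using x Sx by simp
 qed
 have dZ: "d \<otimes>\<^sub>B \<psi> z = \<zero>\<^sub>B" if z: "z <: Z" for z
 proof -
  have "b \<otimes>\<^sub>B \<psi> z = b' \<otimes>\<^sub>B \<psi> z" using cpt_amp[OF S(1) z] R.cpt_psi[OF K z] by (simp add: b_def b'_def)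
  thus ?thesis unfolding d_def using z amp_adjointable[OF Sa] by (simp add: P.B.mult_minus_l)
 qed
 have d'Z: "star B d \<otimes>\<^sub>B \<psi> z = \<zero>\<^sub>B" if z: "z <: Z" for z
 proof -
  have "star B b \<otimes>\<^sub>B \<psi> z = star B b' \<otimes>\<^sub>B \<psi> z"
   unfolding sb sb' using cpt_amp[OF S' z] R.cpt_psi[OF K' z] amp_star[OF Sa] by simp
  thus ?thesis unfolding d_def using z by (simp add: P.B.star_minus P.B.mult_minus_l)
 qed
 have db': "star B d \<otimes>\<^sub>B b' = \<zero>\<^sub>B" unfolding b'_def by (rule R.annihilate_cpt[OF _ d'Z K]) auto
 \<comment> \<open>With e = d \<psi>_1(x), the product e^* e equals \<psi>_1(x)^* d^* (b - b')
   \<psi>_1(x). The b' part vanishes by \<open>db'\<close>, and b \<psi>_1(x) = \<psi>_1(S x) leaves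
   the adjoint of an instance of \<open>comp\<close>.\<close>
 have dX: "d \<otimes>\<^sub>B \<psi>\<^sub>1 x = \<zero>\<^sub>B" if x: "x <: X" for x
 proof -
  have Sx: "S x <: X" using Sa x by blast
  let ?e = "d \<otimes>\<^sub>B \<psi>\<^sub>1 x"
  have "star B ?e \<otimes>\<^sub>B ?e = star B (\<psi>\<^sub>1 x) \<otimes>\<^sub>B ((star B d \<otimes>\<^sub>B b) \<otimes>\<^sub>B \<psi>\<^sub>1 x \<ominus>\<^sub>B (star B d \<otimes>\<^sub>B b') \<otimes>\<^sub>B \<psi>\<^sub>1 x)"
  proof -
   have "star B d \<otimes>\<^sub>B d = star B d \<otimes>\<^sub>B b \<ominus>\<^sub>B star B d \<otimes>\<^sub>B b'"
    using P.B.mult_minus_r[of "star B d" b b'] by (simp add: d_def)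
   moreover have "star B ?e \<otimes>\<^sub>B ?e = star B (\<psi>\<^sub>1 x) \<otimes>\<^sub>B ((star B d \<otimes>\<^sub>B d) \<otimes>\<^sub>B \<psi>\<^sub>1 x)"
    using x by (simp add: P.B.star_mult P.B.mult_assoc)
   moreover have "(star B d \<otimes>\<^sub>B b \<ominus>\<^sub>B star B d \<otimes>\<^sub>B b') \<otimes>\<^sub>B \<psi>\<^sub>1 x
    = (star B d \<otimes>\<^sub>B b) \<otimes>\<^sub>B \<psi>\<^sub>1 x \<ominus>\<^sub>B (star B d \<otimes>\<^sub>B b') \<otimes>\<^sub>B \<psi>\<^sub>1 x"
    using x by (intro P.B.mult_minus_l) auto
   ultimately show ?thesis by metis
  qed
  also have "\<dots> = star B (\<psi>\<^sub>1 x) \<otimes>\<^sub>B (star B d \<otimes>\<^sub>B \<psi>\<^sub>1 (S x))"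
   unfolding db' using x Sx P.cpt_psi[OF S(1) x] by (simp add: P.B.mult_assoc flip: b_def)
  also have "\<dots> = star B (star B (\<psi>\<^sub>1 (S x)) \<otimes>\<^sub>B (d \<otimes>\<^sub>B \<psi>\<^sub>1 x))"
   using x Sx by (simp add: P.B.star_mult P.B.mult_assoc)
  also have "\<dots> = \<zero>\<^sub>B" using comp[OF Sx x] by simp
  finally show ?thesis using x by (simp add: P.B.star_mult_eq_0)
 qed
 have "d \<otimes>\<^sub>B star B b = \<zero>\<^sub>B" unfolding sb by (rule P.annihilate_cpt[OF _ dX S']) auto
 moreover have "d \<otimes>\<^sub>B star B b' = \<zero>\<^sub>B" unfolding sb' by (rule R.annihilate_cpt[OF _ dZ K']) auto
 moreover have "d \<otimes>\<^sub>B star B d = d \<otimes>\<^sub>B star B b \<ominus>\<^sub>B d \<otimes>\<^sub>B star B b'"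
  using P.B.mult_minus_r[of d "star B b" "star B b'"] by (simp add: d_def P.B.star_minus)
 ultimately have "d \<otimes>\<^sub>B star B d = \<zero>\<^sub>B" by simp
 hence "star B d = \<zero>\<^sub>B" using P.B.star_mult_eq_0[of "star B d"] by simp
 hence "star B (star B d) = \<zero>\<^sub>B" by simp
 hence "d = \<zero>\<^sub>B" by (subst (asm) P.B.star_star) auto
 hence "b = b'" unfolding d_def using P.B.minus_eq_zero_iff[OF c(1,2)] by blast
 thus ?thesis by (simp add: b_def b'_def)
qed

end

section \<open>Product systems\<close>

sublocale product_system \<subseteq> F: hilbert_bimodule A "fib Y n" for n
 by (rule fib)

context product_system
begin

lemma bt: "m \<noteq> 0 ==> n \<noteq> 0 ==> balanced_tensor A (fib Y m) (fib Y n) (fib Y (m + n)) (prd Y m n)"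
 by (intro balanced_tensor.intro balanced_tensor_axioms.intro fib prd_tensor)

lemma base_closed [simp, intro]: "a <: A ==> base Y a <: fib Y 0"
 and base_surj: "x <: fib Y 0 ==> \<exists>a\<in>carrier A. x = base Y a"
 and base_inn: "a <: A ==> b <: A ==> inn (fib Y 0) (base Y a) (base Y b) = star A a \<otimes>\<^sub>A b"
 and base_ract: "a <: A ==> b <: A ==> ract (fib Y 0) (base Y a) b = base Y (a \<otimes>\<^sub>A b)"
 and base_lact: "a <: A ==> b <: A ==> lact (fib Y 0) a (base Y b) = base Y (a \<otimes>\<^sub>A b)"
 and base_add: "a <: A ==> b <: A ==> base Y (a \<oplus>\<^sub>A b) = base Y a \<oplus>\<^sub>(fib Y 0) base Y b"
 and base_smult: "a <: A ==> base Y (c \<odot>\<^sub>A a) = c \<odot>\<^sub>(fib Y 0) base Y a"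
 and base_inj: "inj_on (base Y) (carrier A)"
 using base unfolding bimod_iso_def linear_on_def bij_betw_def by auto

lemma base_zero: "base Y \<zero>\<^sub>A = \<zero>\<^sub>(fib Y 0)"
 using base_smult[of "\<zero>\<^sub>A" 0] by simp

text \<open>\<open>prd_tensor\<close> excludes degree 0, where multiplication is the action of A;
  hence the case distinction here and below.\<close>

lemma prd_closed [simp, intro]:
 assumes "x <: fib Y m" "y <: fib Y n" shows "prd Y m n x y <: fib Y (m + n)"
proof (cases "m = 0 \<or> n = 0")
 case True
 thus ?thesis
 proof
  assume m: "m = 0"
  then obtain a where "a <: A" "x = base Y a" using base_surj assms by blast
  thus ?thesis using m assms by (simp add: prd_base_left)
 next
  assume n: "n = 0"
  then obtain a where "a <: A" "y = base Y a" using base_surj assms by blast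
  thus ?thesis using n assms by (simp add: prd_base_right)
 qed
next
 case False
 then interpret T: balanced_tensor A "fib Y m" "fib Y n" "fib Y (m + n)" "prd Y m n" by (intro bt) auto
 show ?thesis using assms by (rule T.t_closed)
qed

subsection \<open>The zeroth fibre\<close>

lemma rank_one_base:
 assumes "a <: A" "b <: A"
 shows "rank_one (fib Y 0) (base Y a) (base Y b) = lact (fib Y 0) (a \<otimes>\<^sub>A star A b)"
proof (rule F.adjointable_ext)
 fix x assume "x <: fib Y 0"
 then obtain c where "c <: A" "x = base Y c" using base_surj by blast
 thus "rank_one (fib Y 0) (base Y a) (base Y b) x = lact (fib Y 0) (a \<otimes>\<^sub>A star A b) x"
  using assms by (simp add: base_inn base_ract base_lact mult_assoc)
qed (use assms in auto)

text \<open>The factorization theorem for Y_0, that is for A over itself. It shows every left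
  multiplication on Y_0 to be a single rank-one operator.\<close>

lemma factor_star: assumes "a <: A" obtains b c where "b <: A" "c <: A" "a = b \<otimes>\<^sub>A star A c"
proof -
 obtain z c where z: "z <: fib Y 0" "c <: A" "base Y a = ract (fib Y 0) z c"
  using F.factorization[OF base_closed[OF assms] closed_ideal_carrier] assms by (auto simp: base_inn)
 obtain b where b: "b <: A" "z = base Y b" using base_surj z by blast
 have "base Y a = base Y (b \<otimes>\<^sub>A c)" using z b by (simp add: base_ract)
 hence "a = b \<otimes>\<^sub>A star A (star A c)" using base_inj assms b z by (simp add: inj_on_def)
 thus ?thesis using that[of b "star A c"] b z by simp
qed

lemma lact0_compact: "a <: A ==> lact (fib Y 0) a <: KK A (fib Y 0)"
 by (metis factor_star rank_one_base F.KX_rank_one base_closed)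

lemma lact0_isometric: assumes a: "a <: A" shows "nrm A a \<le> op_norm A (fib Y 0) (lact (fib Y 0) a)"
proof (cases "nrm A a = 0")
 case True
 thus ?thesis using F.op_norm_nonneg a by simp
next
 case False
 hence pos: "nrm A a > 0" using a by (simp add: order_less_le)
 have hb: "hnorm A (fib Y 0) (base Y b) = nrm A b" if "b <: A" for b
  using that by (simp add: hnorm_def base_inn nrm_star_mult)
 have "nrm A (a \<otimes>\<^sub>A star A a) \<le> op_norm A (fib Y 0) (lact (fib Y 0) a) * nrm A a"
  using F.op_norm_ge[OF F.lact_adjointable[OF a] base_closed[of "star A a"]] a by (simp add: base_lact hb)
 thus ?thesis using nrm_star_mult[of "star A a"] a pos by (simp add: power2_eq_square)
qed

lemma lact0_inj: assumes "a <: A" "b <: A" "lact (fib Y 0) a = lact (fib Y 0) b" shows "a = b"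
proof -
 have "lact (fib Y 0) (a \<ominus>\<^sub>A b) = lact (fib Y 0) a \<ominus>\<^sub>(LL A (fib Y 0)) lact (fib Y 0) b"
  by (rule hom_minus[OF cstar_algebra_axioms F.LL.cstar_algebra_axioms F.lact_hom assms(1,2)])
 also have "\<dots> = \<zero>\<^sub>(LL A (fib Y 0))" unfolding assms(3) by (rule F.LL.minus_self) (use assms in simp)
 finally have "nrm A (a \<ominus>\<^sub>A b) \<le> nrm (LL A (fib Y 0)) \<zero>\<^sub>(LL A (fib Y 0))"
  using lact0_isometric[of "a \<ominus>\<^sub>A b"] assms by (simp del: LL_simps(1-7))
 hence "nrm A (a \<ominus>\<^sub>A b) = 0" using assms F.LL.N_zero by (intro order_antisym N_nonneg) auto
 thus ?thesis using assms by (simp add: N_eq_0 minus_eq_zero_iff)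
qed

text \<open>A acts isometrically on Y_0, so the left multiplications form a closed subspace, and it
  contains the rank-one operators by \<open>rank_one_base\<close>.\<close>

lemma compact0: assumes "K <: KK A (fib Y 0)" shows "\<exists>a\<in>carrier A. K = lact (fib Y 0) a"
 using assms
proof (induction rule: F.KX_induct')
 case zero
 have "lact (fib Y 0) \<zero>\<^sub>A = \<zero>\<^sub>(LL A (fib Y 0))"
  by (rule hom_zero[OF cstar_algebra_axioms F.LL.cstar_algebra_axioms F.lact_hom])
 thus ?case by (metis M.zero_closed)
next
 case (rank_one x y)
 then obtain a b where "a <: A" "b <: A" "x = base Y a" "y = base Y b"
  using base_surj[OF rank_one(1)] base_surj[OF rank_one(2)] by blast
 thus ?case using rank_one_base by (intro bexI[of _ "a \<otimes>\<^sub>A star A b"]) auto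
next
 case (add S T)
 then obtain a b where "a <: A" "b <: A" "S = lact (fib Y 0) a" "T = lact (fib Y 0) b" by blast
 thus ?case using hom_add[OF cstar_algebra_axioms F.LL.cstar_algebra_axioms F.lact_hom, of a b 0]
  by (intro bexI[of _ "a \<oplus>\<^sub>A b"]) auto
next
 case (smult c T)
 then obtain a where "a <: A" "T = lact (fib Y 0) a" by blast
 thus ?case using hom_smult[OF cstar_algebra_axioms F.LL.cstar_algebra_axioms F.lact_hom, of a 0 c]
  by (intro bexI[of _ "c \<odot>\<^sub>A a"]) auto
next
 case (lim K T)
 then obtain a where a: "!!n. a n <: A" "!!n. K n = lact (fib Y 0) (a n)" by metis
 let ?L = "LL A (fib Y 0)"
 note Kc = F.LL.vlimD[OF lim(1)]
 have "nrm A (a m \<ominus>\<^sub>A a n) \<le> nrm ?L (K m \<ominus>\<^sub>?L T) + nrm ?L (K n \<ominus>\<^sub>?L T)" for m n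
 proof -
  have "nrm A (a m \<ominus>\<^sub>A a n) \<le> op_norm A (fib Y 0) (lact (fib Y 0) (a m \<ominus>\<^sub>A a n))" using a by (intro lact0_isometric) auto
  also have "lact (fib Y 0) (a m \<ominus>\<^sub>A a n) = K m \<ominus>\<^sub>?L K n"
   using hom_minus[OF cstar_algebra_axioms F.LL.cstar_algebra_axioms F.lact_hom a(1) a(1)] a(2) by simp
  also have "op_norm A (fib Y 0) \<dots> \<le> nrm ?L (K m \<ominus>\<^sub>?L T) + nrm ?L (T \<ominus>\<^sub>?L K n)"
   using F.LL.N_triangle[OF Kc(1) Kc(2) Kc(1)] by simp
  also have "nrm ?L (T \<ominus>\<^sub>?L K n) = nrm ?L (K n \<ominus>\<^sub>?L T)" by (rule F.LL.N_minus_commute[OF Kc(2) Kc(1)])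
  finally show ?thesis .
 qed
 from cauchy_vlim_bound[OF complete a(1) this Kc(3)] obtain l where l: "vlim a l" by blast
 have "F.LL.vlim 0 (%n. lact (fib Y 0) (a n)) (lact (fib Y 0) l)"
  by (rule hom_vlim[OF cstar_algebra_axioms F.LL.cstar_algebra_axioms F.lact_hom l])
 hence "T = lact (fib Y 0) l" using F.LL.vlim_unique[OF lim(1)] unfolding a(2)[abs_def, symmetric] by (simp add: eta_contract_eq)
 thus ?case using vlimD(2)[OF l] by blast
qed

lemma symbol0_lact: "a <: A ==> symbol0 A Y (lact (fib Y 0) a) = a"
 unfolding symbol0_def using lact0_inj by (intro the_equality) auto

subsection \<open>The maps between operators on the fibres\<close>

text \<open>On compact operators, and for \<open>m \<ge> 1\<close> on all adjointable ones, \<open>\<iota>\<close> has its defining property.\<close>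

definition iota_dom :: "nat => ('y => 'y) => bool" where
 "iota_dom m S \<longleftrightarrow> S <: KK A (fib Y m) \<or> m \<noteq> 0 \<and> S \<in> adjointable (fib Y m)"

lemma iota_dom_adjointable: "iota_dom m S ==> S \<in> adjointable (fib Y m)"
 using F.KX_adjointable by (auto simp: iota_dom_def)

lemma iota_dom_0: "iota_dom 0 S ==> \<exists>a\<in>carrier A. S = lact (fib Y 0) a"
 using compact0 by (auto simp: iota_dom_def)

lemma iota_0: "a <: A ==> iota A Y 0 n (lact (fib Y 0) a) = lact (fib Y n) a"
 by (simp add: iota_def symbol0_lact)

lemma iota_less: "n < m ==> iota A Y m n S = \<zero>\<^sub>(LL A (fib Y n))"
 by (simp add: iota_def)

lemma iota_amp:
 "m \<noteq> 0 ==> k \<noteq> 0 ==> iota A Y m (m + k) S = balanced_tensor.amp A (fib Y m) (fib Y k) (fib Y (m + k)) (prd Y m k) S"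
 unfolding balanced_tensor.amp_def[OF bt] iota_def by simp

lemma iota_same: assumes "iota_dom m S" shows "iota A Y m m S = S"
proof (cases "m = 0")
 case True
 then obtain a where "a <: A" "S = lact (fib Y 0) a" using iota_dom_0 assms by blast
 thus ?thesis using True by (simp add: iota_0)
next
 case False
 have Sa: "S \<in> adjointable (fib Y m)" by (rule iota_dom_adjointable[OF assms])
 have S: "S (prd Y m 0 x y) = prd Y m 0 (S x) y" if x: "x <: fib Y m" and y: "y <: fib Y 0" for x y
 proof -
  obtain a where "a <: A" "y = base Y a" using base_surj[OF y] by blast
  thus ?thesis using x Sa by (simp add: prd_base_right F.adjointable_ract)
 qed
 have "(THE T. T <: LL A (fib Y m) \<and> (\<forall>x\<in>carrier (fib Y m). \<forall>y\<in>carrier (fib Y 0). T (prd Y m 0 x y) = prd Y m 0 (S x) y)) = S"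
 proof (rule the_equality)
  fix T assume T: "T <: LL A (fib Y m) \<and> (\<forall>x\<in>carrier (fib Y m). \<forall>y\<in>carrier (fib Y 0). T (prd Y m 0 x y) = prd Y m 0 (S x) y)"
  show "T = S"
  proof (rule F.adjointable_ext[OF _ Sa])
   fix x assume x: "x <: fib Y m"
   obtain z b where z: "z <: fib Y m" "b <: A" "x = ract (fib Y m) z b"
    using F.factorization[OF x closed_ideal_carrier] x by auto
   hence "x = prd Y m 0 z (base Y b)" by (simp add: prd_base_right)
   thus "T x = S x" using T S z by simp
  qed (use T in simp)
 qed (use S Sa in simp)
 thus ?thesis using False by (simp add: iota_def)
qed

lemma iota_adjointable: assumes "iota_dom m S" shows "iota A Y m n S \<in> adjointable (fib Y n)"
proof (cases "n < m")
 case True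
 thus ?thesis using iota_less F.LL_zero_closed by simp
next
 case False
 then consider "m = 0" | "m = n" "m \<noteq> 0" | k where "m \<noteq> 0" "k \<noteq> 0" "n = m + k" 
  by (metis add_cancel_left_right le_add_diff_inverse not_less)
 thus ?thesis
 proof cases
  case 1
  then obtain a where "a <: A" "S = lact (fib Y 0) a" using iota_dom_0 assms by blast
  thus ?thesis using 1 by (simp add: iota_0)
 next
  case 2
  thus ?thesis using iota_same[OF assms] iota_dom_adjointable[OF assms] by simp
 next
  case 3
  then interpret T: balanced_tensor A "fib Y m" "fib Y k" "fib Y (m + k)" "prd Y m k" by (intro bt) auto
  show ?thesis using 3 iota_amp[OF 3(1,2)] T.amp_adjointable[OF iota_dom_adjointable[OF assms]] by simp
 qed
qed

lemma iota_prd: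
 assumes S: "iota_dom m S" and x: "x <: fib Y m" and y: "y <: fib Y k"
 shows "iota A Y m (m + k) S (prd Y m k x y) = prd Y m k (S x) y"
proof -
 consider "m = 0" | "m \<noteq> 0" "k = 0" | "m \<noteq> 0" "k \<noteq> 0" by blast
 thus ?thesis
 proof cases
  case 1
  then obtain a where a: "a <: A" "S = lact (fib Y 0) a" using iota_dom_0 S by blast
  obtain b where b: "b <: A" "x = base Y b" using base_surj x 1 by blast
  show ?thesis using 1 a b y by (simp add: iota_0 prd_base_left base_lact F.lact_mult)
 next
  case 2
  then obtain a where a: "a <: A" "y = base Y a" using base_surj y by blast
  show ?thesis using 2 a x iota_same[OF S] iota_dom_adjointable[OF S] by (simp add: prd_base_right F.adjointable_ract)
 next
  case 3
  then interpret T: balanced_tensor A "fib Y m" "fib Y k" "fib Y (m + k)" "prd Y m k" by (intro bt) auto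
  show ?thesis using iota_amp[OF 3] T.amp_tensor[OF iota_dom_adjointable[OF S] x y] by simp
 qed
qed

text \<open>On products u v y both sides agree by associativity, and the rest is density. For m = 0
  the left action replaces tensoring, and for k = 0 factorization supplies the products.\<close>

lemma iota_Suc:
 assumes S: "iota_dom m S" and mr: "m \<le> r" and r: "r \<noteq> 0"
 shows "iota A Y r (r + 1) (iota A Y m r S) = iota A Y m (r + 1) S"
proof -
 interpret T: balanced_tensor A "fib Y r" "fib Y 1" "fib Y (r + 1)" "prd Y r 1" using r by (intro bt) auto
 note R = iota_adjointable[OF S, of r]
 have "T.amp (iota A Y m r S) = iota A Y m (r + 1) S"
 proof (rule T.amp_unique[OF R iota_adjointable[OF S]])
  fix x y assume x: "x <: fib Y r" and y: "y <: fib Y 1"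
  obtain k where k: "r = m + k" using mr le_Suc_ex by blast
  have gen: "iota A Y m (r + 1) S (prd Y r 1 (prd Y m k u v) y) = prd Y r 1 (iota A Y m r S (prd Y m k u v)) y"
   if uv: "u <: fib Y m" "v <: fib Y k" for u v
  proof -
   have vy: "prd Y k 1 v y <: fib Y (k + 1)" using uv y by blast
   have Su: "S u <: fib Y m" using iota_dom_adjointable[OF S] uv by blast
   have "iota A Y m (m + (k + 1)) S (prd Y m (k + 1) u (prd Y k 1 v y)) = prd Y m (k + 1) (S u) (prd Y k 1 v y)"
    by (rule iota_prd[OF S uv(1) vy])
   also have "\<dots> = prd Y (m + k) 1 (prd Y m k (S u) v) y" by (rule prd_assoc[OF Su uv(2) y, symmetric])
   also have "prd Y m k (S u) v = iota A Y m (m + k) S (prd Y m k u v)" by (rule iota_prd[OF S uv, symmetric])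
   finally show ?thesis using prd_assoc[OF uv y] k by (simp add: add.assoc)
  qed
  have U: "iota A Y m (r + 1) S \<in> adjointable (fib Y (r + 1))" by (rule iota_adjointable[OF S])
  consider "m = 0" | "m \<noteq> 0" "k = 0" | "m \<noteq> 0" "k \<noteq> 0" by blast
  thus "iota A Y m (r + 1) S (prd Y r 1 x y) = prd Y r 1 (iota A Y m r S x) y"
  proof cases
   case 1
   then obtain a where a: "a <: A" "S = lact (fib Y 0) a" using iota_dom_0 S by blast
   show ?thesis using 1 a x y T.t_lact[OF x y a(1)] by (simp add: iota_0)
  next
   case 2
   obtain z b where z: "z <: fib Y m" "b <: A" "x = ract (fib Y m) z b"
    using F.factorization[OF x closed_ideal_carrier] x 2 k by auto
   hence "x = prd Y m k z (base Y b)" using 2 by (simp add: prd_base_right)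
   thus ?thesis using gen[OF z(1), of "base Y b"] 2 z by simp
  next
   case 3
   then interpret W: balanced_tensor A "fib Y m" "fib Y k" "fib Y (m + k)" "prd Y m k" by (intro bt) auto
   have "x <: fib Y (m + k)" using x k by simp
   hence "x <: fib Y (m + k) \<and> iota A Y m (r + 1) S (prd Y r 1 x y) = prd Y r 1 (iota A Y m r S x) y"
   proof (induction rule: W.Z_induct)
    case zero
    show ?case using k y U R T.t_zero_l[OF y, unfolded k] by (simp del: One_nat_def)
   next
    case (tensor u v)
    thus ?case using gen by simp
   next
    case (add z w)
    thus ?case using k y U R by (simp add: T.t_add_l[unfolded k] F.adjointable_add del: One_nat_def)
   next
    case (smult c z)
    thus ?case using k y U R by (simp add: T.t_smult_l[unfolded k] F.adjointable_smult del: One_nat_def)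
   next
    case (lim f z)
    have l: "normed_vec.vlim (fib Y r) (hnorm A (fib Y r)) f z" using lim(1) k by simp
    have 1: "normed_vec.vlim (fib Y (r + 1)) (hnorm A (fib Y (r + 1)))
      (%n. iota A Y m (r + 1) S (prd Y r 1 (f n) y)) (iota A Y m (r + 1) S (prd Y r 1 z y))"
     by (rule F.adjointable_vlim[OF U T.t_vlim_l[OF l y]])
    have 2: "normed_vec.vlim (fib Y (r + 1)) (hnorm A (fib Y (r + 1)))
      (%n. prd Y r 1 (iota A Y m r S (f n)) y) (prd Y r 1 (iota A Y m r S z) y)"
     by (rule T.t_vlim_l[OF F.adjointable_vlim[OF R l] y])
    have "iota A Y m (r + 1) S (prd Y r 1 z y) = prd Y r 1 (iota A Y m r S z) y"
     by (rule F.X.vlim_unique[OF 1]) (use 2 lim(2) in simp)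
    thus ?case using F.X.vlimD(2)[OF lim(1)] by simp
   qed
   thus ?thesis by blast
  qed
 qed
 thus ?thesis using iota_amp[of r 1 "iota A Y m r S"] r by simp
qed

lemma iota_dom_star: "iota_dom m S ==> iota_dom m (adjoint (fib Y m) S)"
 by (auto simp: iota_dom_def F.KX_adjoint)

lemma iota_star: assumes S: "iota_dom m S"
 shows "iota A Y m n (adjoint (fib Y m) S) = adjoint (fib Y n) (iota A Y m n S)"
proof (cases "n < m")
 case True
 thus ?thesis using iota_less F.LL.star_zero by simp
next
 case False
 then consider "m = 0" | "m = n" "m \<noteq> 0" | k where "m \<noteq> 0" "k \<noteq> 0" "n = m + k" 
  by (metis add_cancel_left_right le_add_diff_inverse not_less)
 thus ?thesis
 proof cases
  case 1
  then obtain a where a: "a <: A" "S = lact (fib Y 0) a" using iota_dom_0 S by blast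
  have "adjoint (fib Y 0) S = lact (fib Y 0) (star A a)" using a F.lact_star[of a] by simp
  thus ?thesis using 1 a F.lact_star[of a n] by (simp add: iota_0)
 next
  case 2
  thus ?thesis using iota_same[OF S] iota_same[OF iota_dom_star[OF S]] by simp
 next
  case 3
  then interpret T: balanced_tensor A "fib Y m" "fib Y k" "fib Y (m + k)" "prd Y m k" by (intro bt) auto
  show ?thesis using 3 iota_amp[OF 3(1,2)] T.amp_star[OF iota_dom_adjointable[OF S]] by simp
 qed
qed

text \<open>For r = 1 + k the left action on Y_r is \<phi>_1(a) \<otimes> 1.\<close>

lemma kernel_subset: assumes "r \<noteq> 0" shows "lact_kernel A (fib Y 1) \<subseteq> lact_kernel A (fib Y r)"
proof
 fix a assume a: "a \<in> lact_kernel A (fib Y 1)"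
 hence ac: "a <: A" by (simp add: F.lact_kernel_iff)
 show "a \<in> lact_kernel A (fib Y r)"
 proof (cases "r = 1")
  case True
  thus ?thesis using a by simp
 next
  case False
  then obtain k where k: "k \<noteq> 0" "r = 1 + k" using that[of "r - 1"] assms False by auto
  interpret T: balanced_tensor A "fib Y 1" "fib Y k" "fib Y (1 + k)" "prd Y 1 k" by (rule bt) (use k in auto)
  have "lact (fib Y (1 + k)) a = \<zero>\<^sub>(LL A (fib Y (1 + k)))"
  proof (rule T.adjointable_eq_on_tensors)
   fix x y assume xy: "x <: fib Y 1" "y <: fib Y k"
   hence "lact (fib Y 1) a x = \<zero>\<^sub>(fib Y 1)" using a by (simp add: F.lact_kernel_iff del: One_nat_def)
   thus "lact (fib Y (1 + k)) a (prd Y 1 k x y) = \<zero>\<^sub>(LL A (fib Y (1 + k))) (prd Y 1 k x y)"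
    using T.t_lact[OF xy ac] T.t_closed[OF xy] T.t_zero_l[OF xy(2)] by (simp add: LL_apply del: One_nat_def LL_simps)
  qed (use ac F.LL_zero_closed in auto)
  thus ?thesis using ac k by (simp add: lact_kernel_def)
 qed
qed

lemma kernel_ideal_eq: assumes n: "n \<noteq> 0" shows "kernel_ideal A Y n = lact_kernel A (fib Y 1)"
proof -
 have "(\<Inter>r\<in>{0<..n}. lact_kernel A (fib Y r)) \<subseteq> lact_kernel A (fib Y 1)"
  by (rule INF_lower[of 1 "{0<..n}" "%r. lact_kernel A (fib Y r)"]) (use n in auto)
 moreover have "lact_kernel A (fib Y 1) \<subseteq> (\<Inter>r\<in>{0<..n}. lact_kernel A (fib Y r))"
  by (rule INF_greatest) (rule kernel_subset, simp)
 ultimately show ?thesis using n by (simp add: kernel_ideal_def)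
qed

lemma closed_ideal_kernel_ideal: "closed_ideal A (kernel_ideal A Y n)"
proof (cases "n = 0")
 case True
 thus ?thesis using closed_ideal_carrier by (simp add: kernel_ideal_def)
next
 case False
 thus ?thesis using kernel_ideal_eq F.closed_ideal_lact_kernel by simp
qed

end

section \<open>Representations of product systems\<close>

context product_system
begin

lemma iota_zero: "iota A Y m n \<zero>\<^sub>(LL A (fib Y m)) = \<zero>\<^sub>(LL A (fib Y n))"
proof -
 have d: "iota_dom m \<zero>\<^sub>(LL A (fib Y m))" using F.KX_zero by (simp add: iota_dom_def del: LL_simps)
 consider "n < m" | "m = 0" | "m = n" "m \<noteq> 0" | k where "m \<noteq> 0" "k \<noteq> 0" "n = m + k"
  by (metis add_cancel_left_right le_add_diff_inverse not_less)
 thus ?thesis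
 proof cases
  case 1
  thus ?thesis by (rule iota_less)
 next
  case 2
  have "lact (fib Y k) \<zero>\<^sub>A = \<zero>\<^sub>(LL A (fib Y k))" for k
   by (rule hom_zero[OF cstar_algebra_axioms F.LL.cstar_algebra_axioms F.lact_hom])
  thus ?thesis using 2 iota_0[OF M.zero_closed, of n] by (simp del: LL_simps)
 next
  case 3
  thus ?thesis using iota_same[OF d] by simp
 next
  case 4
  then interpret T: balanced_tensor A "fib Y m" "fib Y k" "fib Y (m + k)" "prd Y m k" by (intro bt) auto
  have "T.amp \<zero>\<^sub>(LL A (fib Y m)) = \<zero>\<^sub>(LL A (fib Y (m + k)))"
   by (rule T.amp_unique) (use F.LL_zero_closed in \<open>auto simp: T.t_zero_l\<close>)
  thus ?thesis using 4 iota_amp[OF 4(1,2)] by (simp del: LL_simps)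
 qed
qed

lemma iota_add: assumes S: "iota_dom m S" and T: "iota_dom m T" and mn: "m \<le> n"
 shows "iota A Y m n (S \<oplus>\<^sub>(LL A (fib Y m)) T) = iota A Y m n S \<oplus>\<^sub>(LL A (fib Y n)) iota A Y m n T"
proof -
 note ad = iota_dom_adjointable[OF S] iota_dom_adjointable[OF T]
 have d: "iota_dom m (S \<oplus>\<^sub>(LL A (fib Y m)) T)"
  using S T F.KX_add[of S m T] F.LL_add_closed[OF ad] F.KX_adjointable by (auto simp: iota_dom_def)
 consider "m = 0" | "m = n" "m \<noteq> 0" | k where "m \<noteq> 0" "k \<noteq> 0" "n = m + k"
  using mn by (metis add_cancel_left_right le_add_diff_inverse)
 thus ?thesis
 proof cases
  case 1
  obtain a where a: "a <: A" "S = lact (fib Y 0) a" using iota_dom_0 S 1 by blast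
  obtain b where b: "b <: A" "T = lact (fib Y 0) b" using iota_dom_0 T 1 by blast
  have "lact (fib Y k) (a \<oplus>\<^sub>A b) = lact (fib Y k) a \<oplus>\<^sub>(LL A (fib Y k)) lact (fib Y k) b" for k
   by (rule hom_add[OF cstar_algebra_axioms F.LL.cstar_algebra_axioms F.lact_hom a(1) b(1)])
  thus ?thesis using 1 a b iota_0[of "a \<oplus>\<^sub>A b" n] by (simp add: iota_0 del: LL_simps)
 next
  case 2
  thus ?thesis using iota_same[OF d] iota_same[OF S] iota_same[OF T] by simp
 next
  case 3
  then interpret T: balanced_tensor A "fib Y m" "fib Y k" "fib Y (m + k)" "prd Y m k" by (intro bt) auto
  show ?thesis using T.amp_add[OF ad] 3 iota_amp[OF 3(1,2)] by (simp del: LL_simps)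
 qed
qed

text \<open>The \<open>iota_dom\<close> part is carried along because the induction step and later
  applications of \<iota> to the sum ask for it.\<close>

lemma iota_finsum:
 assumes "finite G" "!!i. i \<in> G ==> iota_dom m (U i)" and mn: "m \<le> n"
 shows "iota_dom m (finsum (LL A (fib Y m)) U G) \<and>
  iota A Y m n (finsum (LL A (fib Y m)) U G) = finsum (LL A (fib Y n)) (%i. iota A Y m n (U i)) G"
 using assms(1,2)
proof (induction rule: finite_induct)
 case empty
 show ?case using iota_zero F.KX_zero by (simp add: iota_dom_def del: LL_simps)
next
 case (insert i G)
 let ?S = "finsum (LL A (fib Y m)) U G"
 have ih: "iota_dom m ?S" "iota A Y m n ?S = finsum (LL A (fib Y n)) (%i. iota A Y m n (U i)) G" using insert by auto
 have Ui: "iota_dom m (U i)" using insert(4) by blast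
 have c: "U \<in> G \<rightarrow> carrier (LL A (fib Y m))" "U i <: LL A (fib Y m)"
  "(%i. iota A Y m n (U i)) \<in> G \<rightarrow> carrier (LL A (fib Y n))" "iota A Y m n (U i) <: LL A (fib Y n)"
  using insert(4) iota_dom_adjointable iota_adjointable by auto
 have 1: "finsum (LL A (fib Y m)) U (insert i G) = U i \<oplus>\<^sub>(LL A (fib Y m)) ?S"
  by (rule F.LL.M.finsum_insert[OF insert(1,2) c(1,2)])
 have 2: "finsum (LL A (fib Y n)) (%i. iota A Y m n (U i)) (insert i G)
   = iota A Y m n (U i) \<oplus>\<^sub>(LL A (fib Y n)) finsum (LL A (fib Y n)) (%i. iota A Y m n (U i)) G"
  by (rule F.LL.M.finsum_insert[OF insert(1,2) c(3,4)])
 have "iota_dom m (U i \<oplus>\<^sub>(LL A (fib Y m)) ?S)"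
  using Ui ih(1) F.KX_add[of "U i" m ?S] F.LL_add_closed[of "U i" m ?S] F.KX_adjointable
  by (auto simp: iota_dom_def)
 thus ?case unfolding 1 2 using iota_add[OF Ui ih(1) mn] ih(2) by (simp del: LL_simps)
qed

lemma iota_lact: assumes "a <: A" "r \<noteq> 0" shows "iota A Y 1 r (lact (fib Y 1) a) = lact (fib Y r) a"
proof -
 have d: "iota_dom 1 (lact (fib Y 1) a)" using assms by (simp add: iota_dom_def)
 consider "r = 1" | k where "k \<noteq> 0" "r = 1 + k" using assms(2) by (metis add_0_right le_add_diff_inverse less_one not_less)
 thus ?thesis
 proof cases
  case 1
  thus ?thesis using iota_same[OF d] by simp
 next
  case 2
  interpret T: balanced_tensor A "fib Y 1" "fib Y k" "fib Y (1 + k)" "prd Y 1 k" by (rule bt) (use 2 in auto)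
  have "T.amp (lact (fib Y 1) a) = lact (fib Y (1 + k)) a"
   by (rule T.amp_unique) (use assms in \<open>auto simp: T.t_lact simp del: One_nat_def\<close>)
  thus ?thesis using 2 iota_amp[of 1 k "lact (fib Y 1) a"] by simp
 qed
qed

end

section \<open>Representations of a product system and automatic Nica covariance\<close>

locale prod_rep = product_system A Y + B: cstar_algebra B
 for A :: "('a, 'm) cstar_scheme" and Y :: "('a, 'y) prod_system" and B :: "('b, 'k) cstar_scheme" +
 fixes \<Psi> :: "nat => 'y => 'b"
 assumes prod_rep: "is_prod_rep A Y B \<Psi>"
begin

abbreviation \<pi> where "\<pi> \<equiv> %a. \<Psi> 0 (base Y a)"

lemma mult: "x <: fib Y m ==> y <: fib Y n ==> \<Psi> m x \<otimes>\<^sub>B \<Psi> n y = \<Psi> (m + n) (prd Y m n x y)"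
 using prod_rep unfolding is_prod_rep_def by blast

lemma is_rep_fib: "is_rep A (fib Y n) B \<pi> (\<Psi> n)"
proof -
 have 1: "\<pi> a \<otimes>\<^sub>B \<Psi> n x = \<Psi> n (lact (fib Y n) a x)" if "a <: A" "x <: fib Y n" for a x
  using mult[OF base_closed[OF that(1)] that(2)] that by (simp add: prd_base_left)
 have 2: "\<Psi> n x \<otimes>\<^sub>B \<pi> a = \<Psi> n (ract (fib Y n) x a)" if "a <: A" "x <: fib Y n" for a x
  using mult[OF that(2) base_closed[OF that(1)]] that by (simp add: prd_base_right)
 have 3: "\<pi> \<in> cstar_hom A B" "linear_on (fib Y n) B (\<Psi> n)"
  "\<forall>x\<in>carrier (fib Y n). \<forall>y\<in>carrier (fib Y n). star B (\<Psi> n x) \<otimes>\<^sub>B \<Psi> n y = \<pi> (inn (fib Y n) x y)"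
  using prod_rep by (auto simp: is_prod_rep_def)
 show ?thesis unfolding is_rep_def using 3 by (simp add: 1 2)
qed

end

sublocale prod_rep \<subseteq> R: bimod_rep A "fib Y n" B \<pi> "\<Psi> n" for n
 by unfold_locales (rule is_rep_fib)

context prod_rep
begin

abbreviation cpt where "cpt \<equiv> prod_cpt_ext A Y B \<Psi>"

lemma tr: "m \<noteq> 0 ==> n \<noteq> 0 ==>
 tensor_reps A (fib Y m) (fib Y n) (fib Y (m + n)) (prd Y m n) B \<pi> (\<Psi> m) (\<Psi> n) (\<Psi> (m + n))"
 by (intro tensor_reps.intro tensor_factors.intro tensor_reps_axioms.intro bt R.bimod_rep_axioms mult[symmetric])

lemma cpt_0: assumes "a <: A" shows "cpt 0 (lact (fib Y 0) a) = \<pi> a"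
proof -
 obtain b c where bc: "b <: A" "c <: A" "a = b \<otimes>\<^sub>A star A c" using factor_star assms by metis
 have "cpt 0 (rank_one (fib Y 0) (base Y b) (base Y c)) = \<pi> b \<otimes>\<^sub>B star B (\<pi> c)"
  by (rule R.cpt_rank_one) (use bc in auto)
 also have "\<dots> = \<pi> a" using bc R.pi_mult[of b "star A c"] R.pi_star[of c] by simp
 finally show ?thesis using rank_one_base[OF bc(1,2)] bc(3) by simp
qed

text \<open>The source of Nica covariance in a totally ordered semigroup: on a vector of higher
  degree, \<psi>^(m)(S) only sees the first factor in Y_m.\<close>

lemma cpt_iota:
 assumes S: "S <: KK A (fib Y m)" and y: "y <: fib Y n" and mn: "m \<le> n"
 shows "cpt m S \<otimes>\<^sub>B \<Psi> n y = \<Psi> n (iota A Y m n S y)"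
proof -
 have d: "iota_dom m S" using S by (simp add: iota_dom_def)
 consider "m = 0" | "m = n" "m \<noteq> 0" | k where "m \<noteq> 0" "k \<noteq> 0" "n = m + k"
  using mn by (metis add_cancel_left_right le_add_diff_inverse)
 thus ?thesis
 proof cases
  case 1
  then obtain a where a: "a <: A" "S = lact (fib Y 0) a" using iota_dom_0 d by blast
  thus ?thesis using 1 y cpt_0[of a] R.psi_lact[OF y a(1)] by (simp add: iota_0)
 next
  case 2
  thus ?thesis using iota_same[OF d] R.cpt_psi[OF S] y by simp
 next
  case 3
  then interpret T: tensor_reps A "fib Y m" "fib Y k" "fib Y (m + k)" "prd Y m k" B \<pi> "\<Psi> m" "\<Psi> k" "\<Psi> (m + k)"
   by (intro tr) auto
  show ?thesis using T.cpt_amp[OF S] 3 y iota_amp[OF 3(1,2), of S] by simp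
 qed
qed

lemma nica_le:
 assumes S: "S <: KK A (fib Y m)" and T: "T <: KK A (fib Y n)" and mn: "m \<le> n"
 shows "cpt m S \<otimes>\<^sub>B cpt n T = cpt n (iota A Y m n S \<otimes>\<^sub>(LL A (fib Y n)) T)"
proof -
 let ?U = "iota A Y m n S"
 have U: "?U \<in> adjointable (fib Y n)" by (rule iota_adjointable) (use S in \<open>simp add: iota_dom_def\<close>)
 have UL: "?U <: LL A (fib Y n)" using U by simp
 have S': "cpt m S <: B" by (rule R.cpt_closed[OF S])
 note UK = F.KX_compose_left[OF _ U]
 note KL = F.KX_adjointable[unfolded LL_simps(1)[symmetric, where A = A]]
 show ?thesis using T
 proof (induction rule: F.KX_induct')
  case zero
  show ?case using F.LL.mult_zero_r[OF UL] B.mult_zero_r[OF S'] R.cpt_zero by (simp del: LL_simps)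
 next
  case (rank_one x y)
  have "cpt m S \<otimes>\<^sub>B (\<Psi> n x \<otimes>\<^sub>B star B (\<Psi> n y)) = \<Psi> n (?U x) \<otimes>\<^sub>B star B (\<Psi> n y)"
   using rank_one S' by (simp add: B.mult_assoc[symmetric] cpt_iota[OF S _ mn])
  thus ?case unfolding F.compose_rank_one[OF U rank_one] using rank_one U by (simp add: R.cpt_rank_one)
 next
  case (add T T')
  note c = KL[OF add(1)] KL[OF add(2)]
  show ?case unfolding F.LL.mult_add_right[OF UL c] R.cpt_add[OF add(1,2)] R.cpt_add[OF UK[OF add(1)] UK[OF add(2)]]
   using add S' by (simp add: B.mult_add_right)
 next
  case (smult c T)
  note d = KL[OF smult(1)]
  show ?case unfolding F.LL.mult_scale_right[OF UL d] R.cpt_smult[OF smult(1)] R.cpt_smult[OF UK[OF smult(1)]]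
   using smult S' by (simp add: B.mult_scale_right)
 next
  case (lim G T)
  have 1: "B.vlim (%i. cpt m S \<otimes>\<^sub>B cpt n (G i)) (cpt m S \<otimes>\<^sub>B cpt n T)"
   by (rule B.vlim_mult[OF B.vlim_const[OF S'] R.cpt_vlim[OF lim(1,2)]])
  have 2: "B.vlim (%i. cpt n (?U \<otimes>\<^sub>(LL A (fib Y n)) G i)) (cpt n (?U \<otimes>\<^sub>(LL A (fib Y n)) T))"
   by (rule R.cpt_vlim[OF F.LL.vlim_mult[OF F.LL.vlim_const[OF UL] lim(1)] UK[OF lim(2)]])
  show ?case by (rule B.vlim_unique[OF 1]) (use 2 lim(4) in \<open>simp del: LL_simps\<close>)
 qed
qed

theorem nica_covariant: "nica_covariant A Y B \<Psi>"
 unfolding nica_covariant_def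
proof (intro allI ballI)
 fix m n S T assume S: "S <: KK A (fib Y m)" and T: "T <: KK A (fib Y n)"
 have d: "iota_dom m S" "iota_dom n T" using S T by (auto simp: iota_dom_def)
 show "cpt m S \<otimes>\<^sub>B cpt n T = cpt (max m n)
   (iota A Y m (max m n) S \<otimes>\<^sub>(LL A (fib Y (max m n))) iota A Y n (max m n) T)"
 proof (cases "m \<le> n")
  case True
  thus ?thesis using nica_le[OF S T True] iota_same[OF d(2)] by (simp add: max_def del: LL_simps)
 next
  case False
  hence nm: "n \<le> m" by simp
  note S' = F.KX_star[OF S] and T' = F.KX_star[OF T]
  let ?V = "iota A Y n m T"
  have V: "?V <: LL A (fib Y m)" using iota_adjointable[OF d(2)] by simp
  have SL: "S <: LL A (fib Y m)" using F.KX_adjointable[OF S] by simp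
  have SV: "S \<otimes>\<^sub>(LL A (fib Y m)) ?V <: KK A (fib Y m)"
   by (rule F.KX_compose_right[OF S iota_adjointable[OF d(2)]])
  \<comment> \<open>The case n < m is the adjoint of the case already treated.\<close>
  have "star B (cpt m S \<otimes>\<^sub>B cpt n T) = cpt n (star (LL A (fib Y n)) T) \<otimes>\<^sub>B cpt m (star (LL A (fib Y m)) S)"
   using R.cpt_star[OF S] R.cpt_star[OF T] R.cpt_closed[OF S] R.cpt_closed[OF T] B.star_mult by simp
  also have "\<dots> = cpt m (iota A Y n m (star (LL A (fib Y n)) T) \<otimes>\<^sub>(LL A (fib Y m)) star (LL A (fib Y m)) S)"
   by (rule nica_le[OF T' S' nm])
  also have "iota A Y n m (star (LL A (fib Y n)) T) = star (LL A (fib Y m)) ?V" using iota_star[OF d(2)] by simp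
  also have "\<dots> \<otimes>\<^sub>(LL A (fib Y m)) star (LL A (fib Y m)) S = star (LL A (fib Y m)) (S \<otimes>\<^sub>(LL A (fib Y m)) ?V)"
   by (rule F.LL.star_mult[OF SL V, symmetric])
  also have "cpt m \<dots> = star B (cpt m (S \<otimes>\<^sub>(LL A (fib Y m)) ?V))" by (rule R.cpt_star[OF SV])
  finally have "star B (star B (cpt m S \<otimes>\<^sub>B cpt n T)) = star B (star B (cpt m (S \<otimes>\<^sub>(LL A (fib Y m)) ?V)))" by simp
  hence "cpt m S \<otimes>\<^sub>B cpt n T = cpt m (S \<otimes>\<^sub>(LL A (fib Y m)) ?V)"
   using R.cpt_closed[OF S] R.cpt_closed[OF T] R.cpt_closed[OF SV] by (simp del: LL_simps)
  thus ?thesis using nm iota_same[OF d(1)] by (simp add: max_def del: LL_simps)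
 qed
qed

end

section \<open>The augmented direct sums\<close>

lemma adjointable_pairI:
 assumes "T \<in> carrier X \<rightarrow>\<^sub>E carrier X" "S \<in> carrier X \<rightarrow>\<^sub>E carrier X"
  "!!x y. x <: X ==> y <: X ==> inn X (T x) y = inn X x (S y)"
 shows "T \<in> adjointable X"
 using assms unfolding adjointable_def by blast

lemma adjointable_pairE:
 assumes "T \<in> adjointable X"
 obtains S where "S \<in> carrier X \<rightarrow>\<^sub>E carrier X" "!!x y. x <: X ==> y <: X ==> inn X (T x) y = inn X x (S y)"
 using assms unfolding adjointable_def by blast

context product_system
begin

text \<open>The m-th summand Y_m \<sqdot> I_(s-m) of \<open>Xtilde A Y s\<close>; not to be confused
  with the ideal ker \<phi>_1.\<close>

abbreviation J :: "nat => nat => 'y set" where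
 "J s m \<equiv> mod_ideal (fib Y m) (kernel_ideal A Y (s - m))"

lemma J_subset: "x \<in> J s m ==> x <: fib Y m"
 using F.mod_ideal_iff[OF closed_ideal_kernel_ideal] by auto

lemma J_zero: "\<zero>\<^sub>(fib Y m) \<in> J s m"
 using closed_idealD(2)[OF closed_ideal_kernel_ideal]
 by (auto simp: F.mod_ideal_iff[OF closed_ideal_kernel_ideal])

lemma J_add: "x \<in> J s m ==> y \<in> J s m ==> x \<oplus>\<^sub>(fib Y m) y \<in> J s m"
 by (rule F.mod_ideal_add[OF closed_ideal_kernel_ideal])

lemma J_adjointable: assumes "T \<in> adjointable (fib Y m)" "x \<in> J s m" shows "T x \<in> J s m"
proof -
 obtain z a where z: "z <: fib Y m" "a \<in> kernel_ideal A Y (s - m)" "x = ract (fib Y m) z a"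
  using assms(2) unfolding mod_ideal_def by blast
 have "a <: A" using closed_idealD(1)[OF closed_ideal_kernel_ideal] z(2) by blast
 hence "T x = ract (fib Y m) (T z) a" using z assms(1) by (simp add: F.adjointable_ract)
 thus ?thesis using z assms(1) unfolding mod_ideal_def by blast
qed

lemma Xtilde_simps:
 "carrier (Xtilde A Y s) = (\<Pi>\<^sub>E m\<in>{..s}. J s m)"
 "zero (Xtilde A Y s) = (\<lambda>m\<in>{..s}. \<zero>\<^sub>(fib Y m))"
 "add (Xtilde A Y s) = (%x y. \<lambda>m\<in>{..s}. x m \<oplus>\<^sub>(fib Y m) y m)"
 "inn (Xtilde A Y s) = (%x y. \<Oplus>\<^sub>A m\<in>{..s}. inn (fib Y m) (x m) (y m))"
 "lact (Xtilde A Y s) = (%a. \<lambda>x\<in>carrier (Xtilde A Y s). \<lambda>m\<in>{..s}. lact (fib Y m) a (x m))"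
 by (simp_all add: Xtilde_def Let_def)

lemma Xtilde_fib: "x <: Xtilde A Y s ==> m \<le> s ==> x m <: fib Y m"
 using J_subset by (auto simp: Xtilde_simps(1))

lemma Xtilde_ext: "x <: Xtilde A Y s ==> y <: Xtilde A Y s ==> (!!m. m \<le> s ==> x m = y m) ==> x = y"
 unfolding Xtilde_simps by (rule PiE_ext) auto

lemma abelian_monoid_Xtilde: "abelian_monoid (Xtilde A Y s)"
proof (rule abelian_monoidI)
 show add: "x \<oplus>\<^sub>(Xtilde A Y s) y <: Xtilde A Y s"
  if "x <: Xtilde A Y s" "y <: Xtilde A Y s" for x y
  using that J_add by (auto simp: Xtilde_simps PiE_iff)
 show zero: "\<zero>\<^sub>(Xtilde A Y s) <: Xtilde A Y s" using J_zero by (auto simp: Xtilde_simps)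
 fix x y z assume x: "x <: Xtilde A Y s" and y: "y <: Xtilde A Y s"
 show "\<zero>\<^sub>(Xtilde A Y s) \<oplus>\<^sub>(Xtilde A Y s) x = x"
  by (rule Xtilde_ext[OF add[OF zero x] x]) (use Xtilde_fib[OF x] in \<open>simp add: Xtilde_simps(2,3)\<close>)
 show "x \<oplus>\<^sub>(Xtilde A Y s) y = y \<oplus>\<^sub>(Xtilde A Y s) x"
  by (rule Xtilde_ext[OF add[OF x y] add[OF y x]])
   (use Xtilde_fib[OF x] Xtilde_fib[OF y] in \<open>simp add: Xtilde_simps(3) F.X.M.a_comm\<close>)
 assume z: "z <: Xtilde A Y s"
 show "x \<oplus>\<^sub>(Xtilde A Y s) y \<oplus>\<^sub>(Xtilde A Y s) z = x \<oplus>\<^sub>(Xtilde A Y s) (y \<oplus>\<^sub>(Xtilde A Y s) z)"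
  by (rule Xtilde_ext[OF add[OF add[OF x y] z] add[OF x add[OF y z]]])
   (use Xtilde_fib[OF x] Xtilde_fib[OF y] Xtilde_fib[OF z] in \<open>simp add: Xtilde_simps(3) F.X.M.a_assoc\<close>)
qed

lemma Xtilde_inn_add:
 assumes "x <: Xtilde A Y s" "y <: Xtilde A Y s" "z <: Xtilde A Y s"
 shows "inn (Xtilde A Y s) (x \<oplus>\<^sub>(Xtilde A Y s) y) z = inn (Xtilde A Y s) x z \<oplus>\<^sub>A inn (Xtilde A Y s) y z"
  and "inn (Xtilde A Y s) z (x \<oplus>\<^sub>(Xtilde A Y s) y) = inn (Xtilde A Y s) z x \<oplus>\<^sub>A inn (Xtilde A Y s) z y"
proof -
 note c = Xtilde_fib[OF assms(1)] Xtilde_fib[OF assms(2)] Xtilde_fib[OF assms(3)]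
 have "(\<Oplus>\<^sub>A m\<in>{..s}. inn (fib Y m) ((x \<oplus>\<^sub>(Xtilde A Y s) y) m) (z m))
  = (\<Oplus>\<^sub>A m\<in>{..s}. inn (fib Y m) (x m) (z m) \<oplus>\<^sub>A inn (fib Y m) (y m) (z m))"
  by (rule M.finsum_cong') (use c in \<open>auto simp: Xtilde_simps(3) F.inn_add_left\<close>)
 also have "\<dots> = (\<Oplus>\<^sub>A m\<in>{..s}. inn (fib Y m) (x m) (z m)) \<oplus>\<^sub>A (\<Oplus>\<^sub>A m\<in>{..s}. inn (fib Y m) (y m) (z m))"
  by (rule M.finsum_addf) (use c in auto)
 finally show "inn (Xtilde A Y s) (x \<oplus>\<^sub>(Xtilde A Y s) y) z = inn (Xtilde A Y s) x z \<oplus>\<^sub>A inn (Xtilde A Y s) y z"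
  by (simp add: Xtilde_simps(4))
 have "(\<Oplus>\<^sub>A m\<in>{..s}. inn (fib Y m) (z m) ((x \<oplus>\<^sub>(Xtilde A Y s) y) m))
  = (\<Oplus>\<^sub>A m\<in>{..s}. inn (fib Y m) (z m) (x m) \<oplus>\<^sub>A inn (fib Y m) (z m) (y m))"
  by (rule M.finsum_cong') (use c in \<open>auto simp: Xtilde_simps(3) F.inn_add\<close>)
 also have "\<dots> = (\<Oplus>\<^sub>A m\<in>{..s}. inn (fib Y m) (z m) (x m)) \<oplus>\<^sub>A (\<Oplus>\<^sub>A m\<in>{..s}. inn (fib Y m) (z m) (y m))"
  by (rule M.finsum_addf) (use c in auto)
 finally show "inn (Xtilde A Y s) z (x \<oplus>\<^sub>(Xtilde A Y s) y) = inn (Xtilde A Y s) z x \<oplus>\<^sub>A inn (Xtilde A Y s) z y"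
  by (simp add: Xtilde_simps(4))
qed

text \<open>Operators that act summand by summand. They preserve each Y_m \<sqdot> I_(s-m) because
  adjointable operators are right A-linear.\<close>

definition diag :: "nat => (nat => 'y => 'y) => (nat => 'y) => nat => 'y" where
 "diag s U = (\<lambda>x\<in>carrier (Xtilde A Y s). \<lambda>r\<in>{..s}. U r (x r))"

lemma diag_PiE: assumes "!!r. r \<le> s ==> U r \<in> adjointable (fib Y r)"
 shows "diag s U \<in> carrier (Xtilde A Y s) \<rightarrow>\<^sub>E carrier (Xtilde A Y s)"
 using J_adjointable[OF assms] by (auto simp: diag_def Xtilde_simps(1) PiE_iff)

lemma diag_adjointable:
 assumes U: "!!r. r \<le> s ==> U r \<in> adjointable (fib Y r)" shows "diag s U \<in> adjointable (Xtilde A Y s)"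
proof -
 let ?V = "%r. adjoint (fib Y r) (U r)"
 have "inn (Xtilde A Y s) (diag s U x) y = inn (Xtilde A Y s) x (diag s ?V y)"
  if x: "x <: Xtilde A Y s" and y: "y <: Xtilde A Y s" for x y
  unfolding Xtilde_simps(4)
  by (rule M.finsum_cong') (use x y U Xtilde_fib[OF x] Xtilde_fib[OF y] in \<open>auto simp: diag_def F.adjoint_inn\<close>)
 thus ?thesis
  by (intro adjointable_pairI[of "diag s U" _ "diag s ?V"] diag_PiE) (use U in auto)
qed

text \<open>The sum in (CP) is a \<open>finsum\<close> over these operators, whose rules are those
  of an abelian monoid.\<close>

lemma abelian_monoid_LL_Xtilde: "abelian_monoid (LL A (Xtilde A Y s))"
proof -
 let ?W = "Xtilde A Y s"
 interpret W: abelian_monoid ?W by (rule abelian_monoid_Xtilde)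
 have C: "T x <: ?W" if "T \<in> adjointable ?W" "x <: ?W" for T x using that by (auto simp: adjointable_def)
 have ext: "S = T" if "S \<in> adjointable ?W" "T \<in> adjointable ?W" "!!x. x <: ?W ==> S x = T x" for S T
  using that unfolding adjointable_def by (auto intro!: PiE_ext[of S "carrier ?W" "%_. carrier ?W" T])
 have zero: "(\<lambda>x\<in>carrier ?W. \<zero>\<^sub>?W) \<in> adjointable ?W"
 proof -
  have "(\<lambda>x\<in>carrier ?W. \<zero>\<^sub>?W) = diag s (%r. \<zero>\<^sub>(LL A (fib Y r)))"
   by (auto simp: diag_def Xtilde_simps(2) restrict_def fun_eq_iff dest!: Xtilde_fib)
  thus ?thesis using diag_adjointable[of s "%r. \<zero>\<^sub>(LL A (fib Y r))"] F.LL_zero_closed by simp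
 qed
 have add: "(\<lambda>x\<in>carrier ?W. S x \<oplus>\<^sub>?W T x) \<in> adjointable ?W" if "S \<in> adjointable ?W" "T \<in> adjointable ?W" for S T
 proof -
  note ST = that
  obtain S' where S': "S' \<in> carrier ?W \<rightarrow>\<^sub>E carrier ?W" "!!x y. x <: ?W ==> y <: ?W ==> inn ?W (S x) y = inn ?W x (S' y)"
   by (rule adjointable_pairE[OF ST(1)]) blast
  obtain T' where T': "T' \<in> carrier ?W \<rightarrow>\<^sub>E carrier ?W" "!!x y. x <: ?W ==> y <: ?W ==> inn ?W (T x) y = inn ?W x (T' y)"
   by (rule adjointable_pairE[OF ST(2)]) blast
  have c: "S' x <: ?W" "T' x <: ?W" if "x <: ?W" for x using S'(1) T'(1) that by auto
  have "inn ?W (S x \<oplus>\<^sub>?W T x) y = inn ?W x (S' y \<oplus>\<^sub>?W T' y)" if x: "x <: ?W" and y: "y <: ?W" for x y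
   using Xtilde_inn_add(1)[OF C[OF ST(1) x] C[OF ST(2) x] y] Xtilde_inn_add(2)[OF c[OF y] x] S'(2)[OF x y] T'(2)[OF x y]
   by simp
  thus ?thesis
   by (intro adjointable_pairI[of _ _ "\<lambda>x\<in>carrier ?W. S' x \<oplus>\<^sub>?W T' x"])
    (use C[OF ST(1)] C[OF ST(2)] c in \<open>simp_all add: PiE_iff extensional_restrict\<close>)
 qed
 show ?thesis
 proof (rule abelian_monoidI)
  fix R S T assume R: "R <: LL A ?W" and S: "S <: LL A ?W"
  hence RS: "R \<in> adjointable ?W" "S \<in> adjointable ?W" by (auto simp: LL_def)
  show "R \<oplus>\<^sub>(LL A ?W) S <: LL A ?W" using add[OF RS] by (simp add: LL_def)
  show "\<zero>\<^sub>(LL A ?W) \<oplus>\<^sub>(LL A ?W) R = R" unfolding LL_def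
   using ext[OF add[OF zero RS(1)] RS(1)] C[OF RS(1)] by simp
  show "R \<oplus>\<^sub>(LL A ?W) S = S \<oplus>\<^sub>(LL A ?W) R" unfolding LL_def
   using C[OF RS(1)] C[OF RS(2)] by (auto simp: W.a_comm)
  assume T: "T <: LL A ?W"
  hence Ta: "T \<in> adjointable ?W" by (simp add: LL_def)
  show "R \<oplus>\<^sub>(LL A ?W) S \<oplus>\<^sub>(LL A ?W) T = R \<oplus>\<^sub>(LL A ?W) (S \<oplus>\<^sub>(LL A ?W) T)" unfolding LL_def
   using C[OF RS(1)] C[OF RS(2)] C[OF Ta] by (auto simp: W.a_assoc)
 qed (use zero in \<open>simp add: LL_def\<close>)
qed

lemma diag_zero: "diag s (%r. \<zero>\<^sub>(LL A (fib Y r))) = \<zero>\<^sub>(LL A (Xtilde A Y s))"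
 by (auto simp: LL_def diag_def Xtilde_simps(2) restrict_def fun_eq_iff dest!: Xtilde_fib)

lemma diag_add:
 assumes "!!r. r \<le> s ==> U r \<in> adjointable (fib Y r)" "!!r. r \<le> s ==> V r \<in> adjointable (fib Y r)"
 shows "diag s (%r. U r \<oplus>\<^sub>(LL A (fib Y r)) V r) = diag s U \<oplus>\<^sub>(LL A (Xtilde A Y s)) diag s V"
 by (auto simp: LL_def diag_def Xtilde_simps(3) restrict_def fun_eq_iff dest!: Xtilde_fib)

lemma diag_finsum:
 assumes "finite G" "!!i r. i \<in> G ==> U i r \<in> adjointable (fib Y r)"
 shows "(\<Oplus>\<^sub>(LL A (Xtilde A Y s))i\<in>G. diag s (U i)) = diag s (%r. \<Oplus>\<^sub>(LL A (fib Y r))j\<in>G. U j r)"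
 using assms
proof (induction rule: finite_induct)
 interpret W: abelian_monoid "LL A (Xtilde A Y s)" by (rule abelian_monoid_LL_Xtilde)
 {
  case empty
  show ?case unfolding W.finsum_empty F.LL.M.finsum_empty by (rule diag_zero[symmetric])
 next
  case (insert i G)
  have d: "diag s (U j) <: LL A (Xtilde A Y s)" if "j \<in> insert i G" for j
   using diag_adjointable[of s "U j"] insert(4) that by (simp add: LL_def)
  have fs: "(\<Oplus>\<^sub>(LL A (fib Y r))j\<in>G. U j r) \<in> adjointable (fib Y r)" for r
   using F.LL.M.finsum_closed[of "%j. U j r" G r] insert(4) by auto
  have "(\<Oplus>\<^sub>(LL A (Xtilde A Y s))i\<in>insert i G. diag s (U i))
   = diag s (U i) \<oplus>\<^sub>(LL A (Xtilde A Y s)) diag s (%r. \<Oplus>\<^sub>(LL A (fib Y r))j\<in>G. U j r)"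
   using W.finsum_insert[OF insert(1,2), of "%i. diag s (U i)"] d insert by simp
  also have "\<dots> = diag s (%r. U i r \<oplus>\<^sub>(LL A (fib Y r)) (\<Oplus>\<^sub>(LL A (fib Y r))j\<in>G. U j r))"
   by (rule diag_add[symmetric]) (use insert(4) fs in auto)
  also have "(%r. U i r \<oplus>\<^sub>(LL A (fib Y r)) (\<Oplus>\<^sub>(LL A (fib Y r))j\<in>G. U j r)) = (%r. \<Oplus>\<^sub>(LL A (fib Y r))i\<in>insert i G. U i r)"
  proof
   fix r
   show "U i r \<oplus>\<^sub>(LL A (fib Y r)) (\<Oplus>\<^sub>(LL A (fib Y r))j\<in>G. U j r) = (\<Oplus>\<^sub>(LL A (fib Y r))i\<in>insert i G. U i r)"
    by (rule F.LL.M.finsum_insert[OF insert(1,2), symmetric]) (use insert(4) in auto)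
  qed
  finally show ?case .
 }
qed

text \<open>Unites the cases m = 0 and m > 0 of \<open>iota_tilde\<close>: for m = 0 the left action
  on the direct sum is \<iota> from degree 0 in each summand.\<close>

lemma iota_tilde_diag: "iota_tilde A Y m s S = diag s (%r. iota A Y m r S)"
 by (simp add: iota_tilde_def diag_def iota_def Xtilde_simps(5) cong: restrict_cong)

lemma diag_eq_zero_iff:
 assumes U: "!!r. r \<le> s ==> U r \<in> adjointable (fib Y r)"
 shows "diag s U = \<zero>\<^sub>(LL A (Xtilde A Y s)) \<longleftrightarrow> (\<forall>r\<le>s. \<forall>x\<in>J s r. U r x = \<zero>\<^sub>(fib Y r))"
proof
 assume D: "diag s U = \<zero>\<^sub>(LL A (Xtilde A Y s))"
 show "\<forall>r\<le>s. \<forall>x\<in>J s r. U r x = \<zero>\<^sub>(fib Y r)"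
 proof (intro allI impI ballI)
  fix r x assume r: "r \<le> s" and x: "x \<in> J s r"
  \<comment> \<open>Test vector concentrated in the r-th summand.\<close>
  define w where "w = (\<lambda>m\<in>{..s}. if m = r then x else \<zero>\<^sub>(fib Y m))"
  have w: "w <: Xtilde A Y s" using x J_zero by (auto simp: w_def Xtilde_simps(1))
  have "diag s U w r = \<zero>\<^sub>(fib Y r)" unfolding D using w r by (simp add: LL_def Xtilde_simps(2))
  thus "U r x = \<zero>\<^sub>(fib Y r)" using w r by (simp add: diag_def) (simp add: w_def)
 qed
next
 assume "\<forall>r\<le>s. \<forall>x\<in>J s r. U r x = \<zero>\<^sub>(fib Y r)"
 thus "diag s U = \<zero>\<^sub>(LL A (Xtilde A Y s))"
  by (auto simp: LL_def diag_def Xtilde_simps(1,2) fun_eq_iff restrict_def PiE_iff)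
qed

text \<open>The hypothesis of (CP) at the index \<open>s\<close>, read fibrewise.\<close>

lemma iota_tilde_sum_zero_iff:
 assumes "finite G" and T: "!!m. m \<in> G ==> T m <: KK A (fib Y m)"
 shows "(\<Oplus>\<^sub>(LL A (Xtilde A Y s))m\<in>G. iota_tilde A Y m s (T m)) = \<zero>\<^sub>(LL A (Xtilde A Y s)) \<longleftrightarrow>
  (\<forall>r\<le>s. \<forall>x\<in>J s r. (\<Oplus>\<^sub>(LL A (fib Y r))m\<in>G. iota A Y m r (T m)) x = \<zero>\<^sub>(fib Y r))"
proof -
 have U: "iota A Y m r (T m) \<in> adjointable (fib Y r)" if "m \<in> G" for m r
  by (rule iota_adjointable) (use T[OF that] in \<open>simp add: iota_dom_def\<close>)
 have "(\<Oplus>\<^sub>(LL A (Xtilde A Y s))m\<in>G. diag s (%r. iota A Y m r (T m)))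
   = diag s (%r. \<Oplus>\<^sub>(LL A (fib Y r))m\<in>G. iota A Y m r (T m))"
  by (rule diag_finsum[OF assms(1) U])
 thus ?thesis unfolding iota_tilde_diag
 proof (simp only:, intro diag_eq_zero_iff)
  fix r
  show "(\<Oplus>\<^sub>(LL A (fib Y r))m\<in>G. iota A Y m r (T m)) \<in> adjointable (fib Y r)"
   using F.LL.M.finsum_closed[of "%m. iota A Y m r (T m)" G r] U by auto
 qed
qed

end

section \<open>Katsura covariance and (CP)\<close>

lemma (in cvec) add_minus_cancel: "x <: V ==> y <: V ==> (x \<oplus> y) \<ominus> x = y"
 by algebra

context prod_rep
begin

text \<open>On the fibres r \<ge> 1 the two terms cancel by \<open>iota_lact\<close>. On the fibre 0
  the T_1 term is absent, but for s \<ge> 1 the summand there is A \<sqdot> ker \<phi>_1, which a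
  annihilates.\<close>

theorem CP_imp_katsura:
 assumes CP: "satisfies_CP A Y B \<Psi>" shows "katsura_covariant A (fib Y 1) B \<pi> (\<Psi> 1)"
 unfolding katsura_covariant_def
proof (intro ballI impI)
 fix a assume a: "a \<in> perp A (lact_kernel A (fib Y 1))" and K: "lact (fib Y 1) a <: KK A (fib Y 1)"
 have ac: "a <: A" using a by (simp add: perp_def)
 define c where "c = (-1) \<odot>\<^sub>A a"
 have cc: "c <: A" using ac by (simp add: c_def)
 have ac0: "a \<oplus>\<^sub>A c = \<zero>\<^sub>A" using ac smult_l_distr[of 1 "-1" a] by (simp add: c_def)
 have lc: "lact (fib Y 1) c = (-1) \<odot>\<^sub>(LL A (fib Y 1)) lact (fib Y 1) a"
  unfolding c_def by (rule hom_smult[OF cstar_algebra_axioms F.LL.cstar_algebra_axioms F.lact_hom ac])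
 have Kc: "lact (fib Y 1) c <: KK A (fib Y 1)" unfolding lc by (rule F.KX_smult[OF K])
 define T where "T = (\<lambda>m::nat. if m = 0 then lact (fib Y 0) a else lact (fib Y 1) c)"
 have T: "T m <: KK A (fib Y m)" if "m \<in> {0, 1}" for m
  using that Kc lact0_compact[OF ac] by (auto simp: T_def simp del: KK_simps)
 have sum: "(\<Oplus>\<^sub>(LL A (fib Y r))m\<in>{0, 1}. iota A Y m r (T m)) x = lact (fib Y r) a x \<oplus>\<^sub>(fib Y r) iota A Y 1 r (lact (fib Y 1) c) x"
  if x: "x <: fib Y r" for r x
 proof -
  have i: "iota A Y m r (T m) <: LL A (fib Y r)" if "m \<in> {0, 1}" for m
   using iota_adjointable[of m "T m" r] T[OF that] by (simp add: iota_dom_def)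
  have "(\<Oplus>\<^sub>(LL A (fib Y r))m\<in>{1}. iota A Y m r (T m)) = iota A Y 1 r (T 1) \<oplus>\<^sub>(LL A (fib Y r)) \<zero>\<^sub>(LL A (fib Y r))"
   by (subst F.LL.M.finsum_insert) (use i[of 1] in \<open>auto simp del: LL_simps One_nat_def\<close>)
  moreover have "(\<Oplus>\<^sub>(LL A (fib Y r))m\<in>{0, 1}. iota A Y m r (T m))
   = iota A Y 0 r (T 0) \<oplus>\<^sub>(LL A (fib Y r)) (\<Oplus>\<^sub>(LL A (fib Y r))m\<in>{1}. iota A Y m r (T m))"
   by (rule F.LL.M.finsum_insert) (use i in auto)
  ultimately show ?thesis using x i[of 1] ac by (simp add: LL_apply T_def iota_0 del: LL_simps(2-8) One_nat_def)
 qed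
 have "(\<Oplus>\<^sub>(LL A (Xtilde A Y s))m\<in>{0, 1}. iota_tilde A Y m s (T m)) = \<zero>\<^sub>(LL A (Xtilde A Y s))" if s: "s \<ge> 1" for s
 proof (subst iota_tilde_sum_zero_iff[OF _ T], simp, simp, intro allI impI ballI)
  fix r x assume r: "r \<le> s" and x: "x \<in> J s r"
  have xc: "x <: fib Y r" by (rule J_subset[OF x])
  show "(\<Oplus>\<^sub>(LL A (fib Y r))m\<in>{0, 1}. iota A Y m r (T m)) x = \<zero>\<^sub>(fib Y r)"
  proof (cases "r = 0")
   case False
   have "lact (fib Y r) a x \<oplus>\<^sub>(fib Y r) lact (fib Y r) c x = lact (fib Y r) (a \<oplus>\<^sub>A c) x"
    using xc ac cc by (simp add: F.lact_add)
   thus ?thesis unfolding sum[OF xc] iota_lact[OF cc False] using xc by (simp add: ac0)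
  next
   case True
   obtain z k where z: "z <: fib Y 0" "k \<in> kernel_ideal A Y s" "x = ract (fib Y 0) z k"
    using x True unfolding mod_ideal_def by auto
   have k: "k \<in> lact_kernel A (fib Y 1)" using z(2) s kernel_ideal_eq[of s] by auto
   note id = closed_idealD[OF F.closed_ideal_lact_kernel[of 1]]
   have kc: "k <: A" using k id(1) by blast
   obtain b where b: "b <: A" "z = base Y b" using base_surj[OF z(1)] by blast
   have "lact (fib Y 0) a x = base Y (a \<otimes>\<^sub>A (b \<otimes>\<^sub>A k))" using b z kc ac by (simp add: base_ract base_lact)
   also have "a \<otimes>\<^sub>A (b \<otimes>\<^sub>A k) = \<zero>\<^sub>A" using a id(5)[OF b(1) k] unfolding perp_def by blast
   finally show ?thesis unfolding sum[OF xc] using True xc iota_less[of 0 1]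
    by (simp add: base_zero LL_apply del: LL_simps One_nat_def)
  qed
 qed
 hence "\<forall>q. \<exists>r\<ge>q. \<forall>s\<ge>r. (\<Oplus>\<^sub>(LL A (Xtilde A Y s))m\<in>{0, 1}. iota_tilde A Y m s (T m)) = \<zero>\<^sub>(LL A (Xtilde A Y s))"
  by (intro allI, rule_tac x = "max q 1" in exI) simp
 hence s1: "(\<Oplus>\<^sub>B m\<in>{0, 1}. cpt m (T m)) = \<zero>\<^sub>B"
  using CP[unfolded satisfies_CP_def, rule_format, of "{0, 1}" T] T by blast
 have s2: "(\<Oplus>\<^sub>B m\<in>{0, 1}. cpt m (T m)) = cpt 0 (T 0) \<oplus>\<^sub>B (\<Oplus>\<^sub>B m\<in>{1}. cpt m (T m))"
  by (rule B.M.finsum_insert) (use T R.cpt_closed in auto)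
 have s3: "(\<Oplus>\<^sub>B m\<in>{1}. cpt m (T m)) = cpt 1 (T 1) \<oplus>\<^sub>B \<zero>\<^sub>B"
  by (subst B.M.finsum_insert) (use R.cpt_closed[OF T[of 1]] in auto)
 have s4: "cpt 1 (T 1) = (-1) \<odot>\<^sub>B cpt 1 (lact (fib Y 1) a)"
  using R.cpt_smult[OF K] lc by (simp add: T_def del: One_nat_def)
 have s5: "cpt 0 (T 0) = \<pi> a" using cpt_0[OF ac] by (simp add: T_def)
 let ?k = "cpt 1 (lact (fib Y 1) a)"
 have kB: "?k <: B" by (rule R.cpt_closed[OF K])
 have e: "\<pi> a \<oplus>\<^sub>B (-1) \<odot>\<^sub>B ?k = \<zero>\<^sub>B"
  using s1 unfolding s2 s3 s4 s5 B.M.r_zero[OF B.smult_in[OF kB]] .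
 have "\<pi> a \<ominus>\<^sub>B ?k = \<zero>\<^sub>B" using e kB by (simp add: B.M.minus_eq B.neg_eq_smult)
 thus "?k = \<pi> a" using B.minus_eq_zero_iff[of "\<pi> a" ?k] kB R.pi_closed[OF ac] by simp
qed

text \<open>If \<open>Q \<in> L(Y\<^sub>r)\<close> kills \<open>Y\<^sub>r \<sqdot> ker \<phi>\<^sub>1\<close>, then its matrix coefficients lie in \<open>(ker \<phi>\<^sub>1)\<^sup>\<bottom>\<close>.\<close>

lemma descend:
 assumes cov: "katsura_covariant A (fib Y 1) B \<pi> (\<Psi> 1)" and Q: "iota_dom r Q"
  and kill: "!!y b. y <: fib Y r ==> b \<in> lact_kernel A (fib Y 1) ==> Q (ract (fib Y r) y b) = \<zero>\<^sub>(fib Y r)"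
  and K: "iota A Y r (r + 1) Q <: KK A (fib Y (r + 1))"
 shows "Q <: KK A (fib Y r) \<and> cpt (r + 1) (iota A Y r (r + 1) Q) = cpt r Q"
proof (cases "r = 0")
 case True
 then obtain a where a: "a <: A" "Q = lact (fib Y 0) a" using iota_dom_0 Q by blast
 note id = closed_idealD[OF F.closed_ideal_lact_kernel[of 1]]
 have "a \<otimes>\<^sub>A b = \<zero>\<^sub>A" if b: "b \<in> lact_kernel A (fib Y 1)" for b
 proof -
  have bc: "b <: A" using b id(1) by blast
  have b': "star A b \<otimes>\<^sub>A star A a \<in> lact_kernel A (fib Y 1)"
  proof -
   have "star A b \<in> lact_kernel A (fib Y 1)"
    using b bc F.lact_star[of b 1] F.LL.star_zero[of 1] by (simp add: lact_kernel_def del: LL_simps(4) One_nat_def)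
   thus ?thesis using id(6) a(1) by blast
  qed
  hence b'c: "star A b \<otimes>\<^sub>A star A a <: A" using id(1) by blast
  \<comment> \<open>\<open>kill\<close> at the vector b and the kernel element b^* a^*, which yields
    (a b) (a b)^* = 0.\<close>
  have "base Y ((a \<otimes>\<^sub>A b) \<otimes>\<^sub>A (star A b \<otimes>\<^sub>A star A a)) = Q (ract (fib Y 0) (base Y b) (star A b \<otimes>\<^sub>A star A a))"
   using a bc by (simp add: base_ract base_lact mult_assoc)
  also have "\<dots> = base Y \<zero>\<^sub>A" using kill[of "base Y b", OF _ b'] True bc by (simp add: base_zero)
  finally have "(a \<otimes>\<^sub>A b) \<otimes>\<^sub>A (star A b \<otimes>\<^sub>A star A a) = \<zero>\<^sub>A"
   using base_inj a bc by (auto simp: inj_on_def)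
  hence "star A (a \<otimes>\<^sub>A b) = \<zero>\<^sub>A"
   using star_mult_eq_0[of "star A (a \<otimes>\<^sub>A b)"] a bc by (simp add: star_mult)
  hence "star A (star A (a \<otimes>\<^sub>A b)) = \<zero>\<^sub>A" by simp
  thus ?thesis using a bc by (subst (asm) star_star) auto
 qed
 hence ap: "a \<in> perp A (lact_kernel A (fib Y 1))" using a by (simp add: perp_def)
 have i: "iota A Y r (r + 1) Q = lact (fib Y 1) a" using True a iota_0[of a 1] by simp
 have "cpt 1 (lact (fib Y 1) a) = \<pi> a"
  using cov ap K True unfolding i katsura_covariant_def by (simp del: KK_simps)
 thus ?thesis unfolding i using True a lact0_compact cpt_0 by simp
next
 case False
 interpret T: tensor_reps A "fib Y r" "fib Y 1" "fib Y (r + 1)" "prd Y r 1" B \<pi> "\<Psi> r" "\<Psi> 1" "\<Psi> (r + 1)"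
  by (rule tr) (use False in auto)
 have Qa: "Q \<in> adjointable (fib Y r)" by (rule iota_dom_adjointable[OF Q])
 have i: "iota A Y r (r + 1) Q = T.amp Q" by (rule iota_amp) (use False in auto)
 have pr: "T.perp_range Q"
  unfolding T.perp_range_def
 proof (intro conjI ballI Qa)
  fix x y assume xy: "x <: fib Y r" "y <: fib Y r"
  have "inn (fib Y r) x (Q y) \<otimes>\<^sub>A b = \<zero>\<^sub>A" if b: "b \<in> lact_kernel A (fib Y 1)" for b
  proof -
   have bc: "b <: A" using b by (simp add: lact_kernel_def)
   have Qy: "Q y <: fib Y r" using Qa xy by blast
   have "inn (fib Y r) x (Q y) \<otimes>\<^sub>A b = inn (fib Y r) x (ract (fib Y r) (Q y) b)" using F.inn_ract[OF xy(1) Qy bc] by simp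
   also have "ract (fib Y r) (Q y) b = \<zero>\<^sub>(fib Y r)" using F.adjointable_ract[OF Qa xy(2) bc] kill[OF xy(2) b] by simp
   finally show ?thesis using xy by simp
  qed
  thus "inn (fib Y r) x (Q y) \<in> perp A (lact_kernel A (fib Y 1))" using xy Qa by (auto simp: perp_def)
 qed
 have Qc: "Q <: KK A (fib Y r)" by (rule T.compact_if_amp_compact[OF pr K[unfolded i]])
 show ?thesis unfolding i using Qc T.cpt_amp_eq[OF cov Qc pr K[unfolded i]] by blast
qed

text \<open>Two inductions in opposite directions: \<open>QK\<close> descends from Q_N = 0 to make
  every Q_r compact, and \<open>up\<close> ascends to identify \<psi>^(r)(Q_r) with the partial sum.
  Both use \<open>descend\<close>, once for compactness and once for the value.\<close>

theorem katsura_imp_CP: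
 assumes cov: "katsura_covariant A (fib Y 1) B \<pi> (\<Psi> 1)" shows "satisfies_CP A Y B \<Psi>"
 unfolding satisfies_CP_def
proof (intro allI impI, elim conjE)
 fix G T assume G: "finite G" and "\<forall>m\<in>G. T m <: KK A (fib Y m)"
  and hyp: "\<forall>q. \<exists>r\<ge>q. \<forall>s\<ge>r. (\<Oplus>\<^sub>(LL A (Xtilde A Y s))m\<in>G. iota_tilde A Y m s (T m)) = \<zero>\<^sub>(LL A (Xtilde A Y s))"
 hence T: "T m <: KK A (fib Y m)" if "m \<in> G" for m using that by blast
 have d: "iota_dom m (T m)" if "m \<in> G" for m using T[OF that] by (simp add: iota_dom_def)
 have ia: "iota A Y m r (T m) \<in> adjointable (fib Y r)" if "m \<in> G" for m r by (rule iota_adjointable[OF d[OF that]])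
 \<comment> \<open>Terms of degree above r contribute zero to the full sum; the truncated form is
   the one that obeys the recursion \<open>step\<close>.\<close>
 define Q where "Q = (%r. \<Oplus>\<^sub>(LL A (fib Y r))m\<in>G \<inter> {..r}. iota A Y m r (T m))"
 have Qa: "Q r \<in> adjointable (fib Y r)" for r
  unfolding Q_def using F.LL.M.finsum_closed[of "%m. iota A Y m r (T m)" "G \<inter> {..r}" r] ia by auto
 have Q_eq: "(\<Oplus>\<^sub>(LL A (fib Y r))m\<in>G. iota A Y m r (T m)) = Q r" for r
  unfolding Q_def
  by (rule F.LL.M.add.finprod_mono_neutral_cong_left[symmetric])
   (use G ia iota_less in \<open>auto simp del: LL_simps(2-8)\<close>)
 obtain N0 where N0: "\<forall>s\<ge>N0. (\<Oplus>\<^sub>(LL A (Xtilde A Y s))m\<in>G. iota_tilde A Y m s (T m)) = \<zero>\<^sub>(LL A (Xtilde A Y s))"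
  using hyp by blast
 have Q0: "Q r x = \<zero>\<^sub>(fib Y r)" if "s \<ge> N0" "r \<le> s" "x \<in> J s r" for s r x
  using N0 that iota_tilde_sum_zero_iff[OF G T, of s] Q_eq by simp
 \<comment> \<open>Any s above r makes I_(s-r) equal to ker \<phi>_1.\<close>
 have kill: "Q r (ract (fib Y r) y b) = \<zero>\<^sub>(fib Y r)"
  if y: "y <: fib Y r" and b: "b \<in> lact_kernel A (fib Y 1)" for r y b
 proof (rule Q0)
  show "N0 \<le> max N0 (Suc r)" "r \<le> max N0 (Suc r)" by auto
  show "ract (fib Y r) y b \<in> J (max N0 (Suc r)) r"
   using y b kernel_ideal_eq[of "max N0 (Suc r) - r"] unfolding mod_ideal_def by auto
 qed
 define N where "N = max N0 (Max (insert 0 G))"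
 have GN: "G \<inter> {..N} = G" using G by (auto simp: N_def intro: max.coboundedI2)
 \<comment> \<open>At r = s = N the ideal is I_0 = A, and Y_N \<sqdot> A is all of Y_N by
   factorization.\<close>
 have QN: "Q N = \<zero>\<^sub>(LL A (fib Y N))"
 proof (rule F.adjointable_ext[OF Qa])
  show "\<zero>\<^sub>(LL A (fib Y N)) \<in> adjointable (fib Y N)" using F.LL_zero_closed by simp
  fix x assume x: "x <: fib Y N"
  obtain z b where "z <: fib Y N" "b <: A" "x = ract (fib Y N) z b"
   using F.factorization[OF x closed_ideal_carrier] x by auto
  hence "x \<in> J N N" unfolding mod_ideal_def kernel_ideal_def by auto
  hence "Q N x = \<zero>\<^sub>(fib Y N)" using Q0[of N N x] by (simp add: N_def)
  thus "Q N x = \<zero>\<^sub>(LL A (fib Y N)) x" using x by simp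
 qed
 have split: "G \<inter> {..r + 1} = (if r + 1 \<in> G then insert (r + 1) (G \<inter> {..r}) else G \<inter> {..r})" for r
  by (auto simp: le_Suc_eq)
 \<comment> \<open>For r = 0 membership in \<open>iota_dom\<close> means compactness; it holds
   because the only term that can occur is T_0.\<close>
 have amp: "iota_dom r (Q r) \<and>
   iota A Y r (r + 1) (Q r) = (\<Oplus>\<^sub>(LL A (fib Y (r + 1)))m\<in>G \<inter> {..r}. iota A Y m (r + 1) (T m))" for r
 proof -
  have dr: "iota_dom r (iota A Y m r (T m))" if m: "m \<in> G \<inter> {..r}" for m
  proof (cases "r = 0")
   case True
   hence "m = 0" "m \<in> G" using m by auto
   thus ?thesis using True d[of m] iota_same[OF d[of m]] by simp
  next
   case False
   thus ?thesis using ia m by (simp add: iota_dom_def)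
  qed
  have st: "iota A Y r (r + 1) (iota A Y m r (T m)) = iota A Y m (r + 1) (T m)" if m: "m \<in> G \<inter> {..r}" for m
  proof (cases "r = 0")
   case True
   hence "m = 0" "m \<in> G" using m by auto
   thus ?thesis using True iota_same[OF d[of m]] by simp
  next
   case False
   thus ?thesis using m iota_Suc[OF d[of m], of r] by simp
  qed
  have fin: "finite (G \<inter> {..r})" using G by simp
  have "(\<Oplus>\<^sub>(LL A (fib Y (r + 1)))m\<in>G \<inter> {..r}. iota A Y r (r + 1) (iota A Y m r (T m)))
   = (\<Oplus>\<^sub>(LL A (fib Y (r + 1)))m\<in>G \<inter> {..r}. iota A Y m (r + 1) (T m))"
   by (rule F.LL.M.finsum_cong') (use st ia in auto)
  thus ?thesis
   using iota_finsum[where U = "%m. iota A Y m r (T m)" and m = r and n = "r + 1", OF fin dr] unfolding Q_def by simp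
 qed
 have step: "Q (r + 1) = (if r + 1 \<in> G then T (r + 1) \<oplus>\<^sub>(LL A (fib Y (r + 1))) iota A Y r (r + 1) (Q r) else iota A Y r (r + 1) (Q r))" for r
 proof (cases "r + 1 \<in> G")
  case True
  have "Q (r + 1) = iota A Y (r + 1) (r + 1) (T (r + 1)) \<oplus>\<^sub>(LL A (fib Y (r + 1))) (\<Oplus>\<^sub>(LL A (fib Y (r + 1)))m\<in>G \<inter> {..r}. iota A Y m (r + 1) (T m))"
   unfolding Q_def split using True by (simp only: if_True) (rule F.LL.M.finsum_insert, use G ia in auto)
  thus ?thesis using True amp[of r] iota_same[OF d[OF True]] by (simp del: LL_simps)
 next
  case False
  thus ?thesis using amp[of r] split[of r] by (simp add: Q_def)
 qed
 have down: "iota A Y r (r + 1) (Q r) <: KK A (fib Y (r + 1))" if K: "Q (r + 1) <: KK A (fib Y (r + 1))" for r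
 proof (cases "r + 1 \<in> G")
  case True
  let ?U = "iota A Y r (r + 1) (Q r)"
  have c: "?U <: LL A (fib Y (r + 1))" "T (r + 1) <: LL A (fib Y (r + 1))"
   using iota_adjointable[OF conjunct1[OF amp[of r]], of "r + 1"] F.KX_adjointable[OF T[OF True]] by auto
  have "Q (r + 1) \<ominus>\<^sub>(LL A (fib Y (r + 1))) T (r + 1) = ?U"
   unfolding step using True c F.LL.add_minus_cancel[OF c(2,1)] by (simp del: LL_simps)
  thus ?thesis using F.KX_minus[OF K T[OF True]] by simp
 next
  case False
  thus ?thesis using K step[of r] by simp
 qed
 have QK: "Q r <: KK A (fib Y r)" if "r \<le> N" for r
  using that
 proof (induction rule: inc_induct)
  case base
  show ?case unfolding QN by (rule F.KX_zero)
 next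
  case (step n)
  hence "Q (n + 1) <: KK A (fib Y (n + 1))" by simp
  from descend[OF cov _ _ down[OF this]] show ?case using amp[of n] kill by blast
 qed
 have up: "cpt r (Q r) = (\<Oplus>\<^sub>B m\<in>G \<inter> {..r}. cpt m (T m))" if "r \<le> N" for r
  using that
 proof (induction r)
  case 0
  have e: "G \<inter> {..0} = (if 0 \<in> G then {0} else {})" by auto
  show ?case
  proof (cases "0 \<in> G")
   case True
   have c: "cpt 0 (T 0) <: B" by (rule R.cpt_closed[OF T[OF True]])
   have "Q 0 = T 0"
    unfolding Q_def e using True iota_same[OF d[OF True]] ia[OF True, of 0]
    by (simp only: if_True) (subst F.LL.M.finsum_insert, auto simp del: LL_simps(2-8))
   thus ?thesis unfolding e using True c by (simp only: if_True) (subst B.M.finsum_insert, auto)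
  next
   case False
   thus ?thesis unfolding Q_def e using R.cpt_zero by (simp del: LL_simps)
  qed
 next
  case (Suc r)
  hence K: "Q (r + 1) <: KK A (fib Y (r + 1))" using QK[of "r + 1"] by simp
  have D: "cpt (r + 1) (iota A Y r (r + 1) (Q r)) = cpt r (Q r)"
   using descend[OF cov _ _ down[OF K]] amp[of r] kill by blast
  have ih: "cpt r (Q r) = (\<Oplus>\<^sub>B m\<in>G \<inter> {..r}. cpt m (T m))" using Suc by simp
  have "cpt (r + 1) (Q (r + 1)) = (\<Oplus>\<^sub>B m\<in>G \<inter> {..r + 1}. cpt m (T m))"
  proof (cases "r + 1 \<in> G")
   case True
   have "(\<Oplus>\<^sub>B m\<in>insert (r + 1) (G \<inter> {..r}). cpt m (T m)) = cpt (r + 1) (T (r + 1)) \<oplus>\<^sub>B (\<Oplus>\<^sub>B m\<in>G \<inter> {..r}. cpt m (T m))"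
    by (rule B.M.finsum_insert) (use G R.cpt_closed[OF T] True in auto)
   moreover have "cpt (r + 1) (Q (r + 1)) = cpt (r + 1) (T (r + 1)) \<oplus>\<^sub>B cpt (r + 1) (iota A Y r (r + 1) (Q r))"
    unfolding step using True R.cpt_add[OF T[OF True] down[OF K]] by simp
   ultimately show ?thesis unfolding split D ih using True by simp
  next
   case False
   thus ?thesis unfolding split step using D ih by simp
  qed
  thus ?case by simp
 qed
 show "(\<Oplus>\<^sub>B m\<in>G. cpt m (T m)) = \<zero>\<^sub>B" using up[of N] QN R.cpt_zero GN by simp
qed

end

section \<open>Transport along an isomorphism of bimodules\<close>

text \<open>X and the fibre Y_1 have different types, so covariance has to be carried across
  \<kappa>. With u and v given as a mutually inverse pair the locale is symmetric, and each fact
  needs proof in one direction only.\<close>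

locale rep_iso = P: bimod_rep A X B \<pi> \<psi> + Q: bimod_rep A Z B \<pi> \<xi>
 for A :: "('a, 'm) cstar_scheme" and X :: "('a, 'x, 'n) bimod_scheme" and Z :: "('a, 'z, 'l) bimod_scheme"
  and B :: "('b, 'k) cstar_scheme" and \<pi> \<psi> \<xi> +
 fixes u :: "'x => 'z" and v :: "'z => 'x"
 assumes u: "u \<in> bimod_iso A X Z" and v: "v \<in> bimod_iso A Z X"
  and vu: "x <: X ==> v (u x) = x" and uv: "z <: Z ==> u (v z) = z"
  and chi: "x <: X ==> \<xi> (u x) = \<psi> x"
begin

lemma u_closed: "x <: X ==> u x <: Z"
 and u_inn: "x <: X ==> y <: X ==> inn Z (u x) (u y) = inn X x y"
 and u_lact: "x <: X ==> a <: A ==> u (lact X a x) = lact Z a (u x)"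
 using u by (auto simp: bimod_iso_def linear_on_def)

lemma v_linear: "linear_on Z X v"
 and v_inn: "x <: Z ==> y <: Z ==> inn X (v x) (v y) = inn Z x y"
 and v_ract: "x <: Z ==> a <: A ==> v (ract Z x a) = ract X (v x) a"
 and v_lact: "x <: Z ==> a <: A ==> v (lact Z a x) = lact X a (v x)"
 using v by (auto simp: bimod_iso_def)

lemmas ZX = Q.X.cvec_axioms P.X.cvec_axioms

lemma v_closed: "z <: Z ==> v z <: X"
 by (rule linear_on_closed[OF ZX v_linear])

definition pull :: "('z => 'z) => 'x => 'x" where "pull T = (\<lambda>x\<in>carrier X. v (T (u x)))"

lemma pull_adjointable: assumes T: "T \<in> adjointable Z" shows "pull T \<in> adjointable X"
 unfolding pull_def
proof (rule P.adjointableI)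
 show "v (T (u x)) <: X" if "x <: X" for x by (rule v_closed[OF Q.adjointable_closed[OF T u_closed[OF that]]])
 show "v (adjoint Z T (u x)) <: X" if "x <: X" for x
  by (rule v_closed[OF Q.adjointable_closed[OF Q.adjoint_adjointable[OF T] u_closed[OF that]]])
 show "inn X (v (T (u x))) y = inn X x (v (adjoint Z T (u y)))" if xy: "x <: X" "y <: X" for x y
 proof -
  have c: "T (u x) <: Z" "adjoint Z T (u y) <: Z" "u x <: Z" "u y <: Z"
   using Q.adjointable_closed T Q.adjoint_adjointable[OF T] u_closed xy by auto
  have "inn X (v (T (u x))) (v (u y)) = inn X (v (u x)) (v (adjoint Z T (u y)))"
   using c T by (simp add: v_inn Q.adjoint_inn)
  thus ?thesis using xy by (simp add: vu)
 qed
qed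

lemma pull_lact: "a <: A ==> pull (lact Z a) = lact X a"
 by (rule P.adjointable_ext[OF pull_adjointable]) (auto simp: pull_def u_closed v_lact vu)

lemma pull_bound: assumes T: "T \<in> adjointable Z" shows "op_norm A X (pull T) \<le> op_norm A Z T"
proof (rule P.op_norm_le)
 show "0 \<le> op_norm A Z T" by (rule Q.op_norm_nonneg[OF T])
 fix x assume x: "x <: X"
 have c: "u x <: Z" "T (u x) <: Z" using T x u_closed by auto
 have "hnorm A X (pull T x) = hnorm A Z (T (u x))" using x c by (simp add: pull_def hnorm_def v_inn)
 also have "\<dots> \<le> op_norm A Z T * hnorm A Z (u x)" by (rule Q.op_norm_ge[OF T c(1)])
 also have "hnorm A Z (u x) = hnorm A X x" using x by (simp add: hnorm_def u_inn)
 finally show "hnorm A X (pull T x) \<le> op_norm A Z T * hnorm A X x" .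
qed

lemma pull_linear: "linear_on (LL A Z) (LL A X) pull"
 unfolding linear_on_def
proof (intro conjI ballI allI Pi_I)
 show "pull T <: LL A X" if "T <: LL A Z" for T using pull_adjointable that by simp
 show "pull (S \<oplus>\<^sub>(LL A Z) T) = pull S \<oplus>\<^sub>(LL A X) pull T"
  if "S <: LL A Z" "T <: LL A Z" for S T
  using that u_closed by (auto simp: pull_def linear_on_add[OF ZX v_linear] intro!: restrict_ext)
 show "pull (c \<odot>\<^sub>(LL A Z) T) = c \<odot>\<^sub>(LL A X) pull T" if "T <: LL A Z" for c T
  using that u_closed by (auto simp: pull_def linear_on_smult[OF ZX v_linear] intro!: restrict_ext)
qed

text \<open>Compactness and value are proved together, since sums and limits of values are only
  controlled on compact operators.\<close>

lemma pull_compact: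
 assumes "T <: KK A Z" shows "pull T <: KK A X \<and> P.cpt (pull T) = Q.cpt T"
 using assms
proof (induction rule: Q.KX_induct')
 note L = Q.LL.cvec_axioms P.LL.cvec_axioms
 note KL = Q.KX_adjointable[unfolded LL_simps(1)[symmetric, where A = A]]
 {
  case zero
  show ?case using linear_on_zero[OF L pull_linear] P.KX_zero P.cpt_zero Q.cpt_zero by (simp del: LL_simps)
 next
  case (rank_one x y)
  have "pull (rank_one Z x y) = rank_one X (v x) (v y)"
  proof (rule P.adjointable_ext[OF pull_adjointable])
   fix w assume w: "w <: X"
   have "inn Z y (u w) = inn X (v y) w" using v_inn[OF rank_one(2) u_closed[OF w]] w by (simp add: vu)
   thus "pull (rank_one Z x y) w = rank_one X (v x) (v y) w"
    using w rank_one u_closed[OF w] v_closed by (simp add: pull_def v_ract)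
  qed (use rank_one v_closed in auto)
  moreover have "\<xi> z = \<psi> (v z)" if "z <: Z" for z using chi[OF v_closed[OF that]] that by (simp add: uv)
  ultimately show ?case using rank_one v_closed P.KX_rank_one by (simp add: P.cpt_rank_one Q.cpt_rank_one)
 next
  case (add S T)
  thus ?case using linear_on_add[OF L pull_linear KL[OF add(1)] KL[OF add(2)]] P.KX_add[of "pull S" "pull T"]
   by (simp add: P.cpt_add Q.cpt_add del: LL_simps)
 next
  case (smult c T)
  thus ?case using linear_on_smult[OF L pull_linear KL[OF smult(1)], of c] P.KX_smult[of "pull T" c]
   by (simp add: P.cpt_smult Q.cpt_smult del: LL_simps)
 next
  case (lim F T)
  have FK: "pull (F n) <: KK A X" for n using lim by blast
  have V: "P.LL.vlim (%n. pull (F n)) (pull T)"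
   by (rule vlim_map[OF Q.LL.normed_vec_axioms P.LL.normed_vec_axioms pull_linear _ lim(1), of 1])
    (simp add: pull_bound)
  have 1: "P.B.vlim (%n. P.cpt (pull (F n))) (P.cpt (pull T))" by (rule P.cpt_vlim[OF V FK])
  have 2: "P.B.vlim (%n. Q.cpt (F n)) (Q.cpt T)" by (rule Q.cpt_vlim[OF lim(1,2)])
  have e: "(%n. P.cpt (pull (F n))) = (%n. Q.cpt (F n))" using lim(4) by auto
  show ?case using P.KX_vlim[OF V FK] P.B.vlim_unique[OF 1 2[folded e]] by blast
 }
qed

lemma kernel_eq: "lact_kernel A Z \<subseteq> lact_kernel A X"
proof
 fix a assume a: "a \<in> lact_kernel A Z"
 hence ac: "a <: A" by (simp add: Q.lact_kernel_iff)
 have "lact X a x = \<zero>\<^sub>X" if x: "x <: X" for x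
 proof -
  have "lact X a x = v (lact Z a (u x))" using x ac u_lact[OF x ac, symmetric] by (simp add: vu)
  thus ?thesis using a u_closed[OF x] linear_on_zero[OF ZX v_linear] by (simp add: Q.lact_kernel_iff)
 qed
 thus "a \<in> lact_kernel A X" using ac by (simp add: P.lact_kernel_iff)
qed

end

lemma rep_iso_sym: assumes "rep_iso A X Z B \<pi> \<psi> \<xi> u v" shows "rep_iso A Z X B \<pi> \<xi> \<psi> v u"
proof -
 interpret rep_iso A X Z B \<pi> \<psi> \<xi> u v by fact
 have "\<psi> (v z) = \<xi> z" if "z <: Z" for z using chi[OF v_closed[OF that]] uv[OF that] by simp
 thus ?thesis
  by (intro rep_iso.intro rep_iso_axioms.intro P.bimod_rep_axioms Q.bimod_rep_axioms u v uv vu)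
qed

context rep_iso
begin

lemma katsura_transport:
 assumes cov: "katsura_covariant A X B \<pi> \<psi>" shows "katsura_covariant A Z B \<pi> \<xi>"
 unfolding katsura_covariant_def
proof (intro ballI impI)
 interpret S: rep_iso A Z X B \<pi> \<xi> \<psi> v u by (rule rep_iso_sym[OF rep_iso_axioms])
 fix a assume a: "a \<in> perp A (lact_kernel A Z)" and K: "lact Z a <: KK A Z"
 have ac: "a <: A" using a by (simp add: perp_def)
 have "a \<in> perp A (lact_kernel A X)" using a S.kernel_eq by (auto simp: perp_def)
 moreover note pull_compact[OF K, unfolded pull_lact[OF ac]]
 ultimately show "Q.cpt (lact Z a) = \<pi> a" using cov unfolding katsura_covariant_def by auto
qed

end

theorem katsura_covariant_iso:
 assumes "rep_iso A X Z B \<pi> \<psi> \<xi> u v"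
 shows "katsura_covariant A X B \<pi> \<psi> \<longleftrightarrow> katsura_covariant A Z B \<pi> \<xi>"
 using rep_iso.katsura_transport[OF assms] rep_iso.katsura_transport[OF rep_iso_sym[OF assms]] by blast

lemma bimod_iso_inv:
 assumes X: "hilbert_bimodule A X" and u: "u \<in> bimod_iso A X Z"
 shows "inv_into (carrier X) u \<in> bimod_iso A Z X"
proof -
 interpret X: hilbert_bimodule A X by fact
 let ?v = "inv_into (carrier X) u"
 have lin: "!!x y. x <: X ==> y <: X ==> u (x \<oplus>\<^sub>X y) = u x \<oplus>\<^sub>Z u y"
  "!!c x. x <: X ==> u (c \<odot>\<^sub>X x) = c \<odot>\<^sub>Z u x" and bij: "bij_betw u (carrier X) (carrier Z)"
  and inn: "!!x y. x <: X ==> y <: X ==> inn Z (u x) (u y) = inn X x y"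
  and act: "!!x a. x <: X ==> a <: A ==> ract Z (u x) a = u (ract X x a)"
   "!!x a. x <: X ==> a <: A ==> lact Z a (u x) = u (lact X a x)"
  using u by (auto simp: bimod_iso_def linear_on_def)
 have vu [simp]: "?v (u x) = x" if "x <: X" for x using that bij by (simp add: bij_betw_inv_into_left)
 have ex: "\<exists>x\<in>carrier X. z = u x" if "z <: Z" for z using that bij by (auto simp: bij_betw_def)
 have v: "?v z <: X" if "z <: Z" for z using ex[OF that] by auto
 have add: "?v (z \<oplus>\<^sub>Z w) = ?v z \<oplus>\<^sub>X ?v w" if "z <: Z" "w <: Z" for z w
  using ex[OF that(1)] ex[OF that(2)] by (auto simp flip: lin)
 have sm: "?v (c \<odot>\<^sub>Z z) = c \<odot>\<^sub>X ?v z" if "z <: Z" for c z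
  using ex[OF that] by (auto simp flip: lin)
 have i: "inn X (?v z) (?v w) = inn Z z w" if "z <: Z" "w <: Z" for z w
  using ex[OF that(1)] ex[OF that(2)] by (auto simp: inn)
 have r: "?v (ract Z z a) = ract X (?v z) a" "?v (lact Z a z) = lact X a (?v z)" if "z <: Z" "a <: A" for z a
  using ex[OF that(1)] that(2) by (auto simp: act)
 show ?thesis unfolding bimod_iso_def linear_on_def
  using v add sm i r bij_betw_inv_into[OF bij] by auto
qed

section \<open>The representation of the tensor powers\<close>

lemma is_rep_cong:
 assumes "hilbert_bimodule A X" and "!!a. a <: A ==> \<pi> a = \<pi>' a" and "!!x. x <: X ==> \<psi> x = \<psi>' x"
 shows "is_rep A X B \<pi> \<psi> \<longleftrightarrow> is_rep A X B \<pi>' \<psi>'"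
proof -
 interpret X: hilbert_bimodule A X by fact
 show ?thesis using assms(2,3)
  by (simp add: is_rep_def cstar_hom_def linear_on_def Pi_iff)
qed

lemma is_rep_pullback:
 assumes X: "hilbert_bimodule A X" and Z: "hilbert_bimodule A Z" and u: "u \<in> bimod_iso A X Z" and rep: "is_rep A Z B \<pi> \<psi>"
 shows "is_rep A X B \<pi> (%x. \<psi> (u x))"
proof -
 interpret X: hilbert_bimodule A X by fact
 interpret Z: hilbert_bimodule A Z by fact
 have u': "!!x. x <: X ==> u x <: Z"
  "!!x y. x <: X ==> y <: X ==> u (x \<oplus>\<^sub>X y) = u x \<oplus>\<^sub>Z u y"
  "!!c x. x <: X ==> u (c \<odot>\<^sub>X x) = c \<odot>\<^sub>Z u x"
  "!!x y. x <: X ==> y <: X ==> inn Z (u x) (u y) = inn X x y"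
  "!!x a. x <: X ==> a <: A ==> u (ract X x a) = ract Z (u x) a"
  "!!x a. x <: X ==> a <: A ==> u (lact X a x) = lact Z a (u x)"
  using u by (auto simp: bimod_iso_def linear_on_def)
 show ?thesis using rep by (simp add: is_rep_def linear_on_def Pi_iff u')
qed

context tensor_powers
begin

text \<open>Induction on m that splits off one factor from Y_1: for u v in Y_(1+m) associativity
  reduces the claim to the assumption on Y_1 and the induction hypothesis, and density does the
  rest.\<close>

lemma prd_rep_mult:
 assumes B: "cstar_algebra B" and rep: "!!n. is_rep A (fib Y n) B \<pi> (\<Psi> n)"
  and base: "!!a. a <: A ==> \<Psi> 0 (base Y a) = \<pi> a"
  and one: "!!n x y. n \<noteq> 0 ==> x <: fib Y 1 ==> y <: fib Y n ==>
   \<Psi> (1 + n) (prd Y 1 n x y) = \<Psi> 1 x \<otimes>\<^sub>B \<Psi> n y"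
  and xy: "x <: fib Y m" "y <: fib Y n"
 shows "\<Psi> m x \<otimes>\<^sub>B \<Psi> n y = \<Psi> (m + n) (prd Y m n x y)"
proof -
 interpret B: cstar_algebra B by fact
 interpret R: bimod_rep A "fib Y k" B \<pi> "\<Psi> k" for k by unfold_locales (rule rep)
 have left: "\<Psi> 0 x \<otimes>\<^sub>B \<Psi> n y = \<Psi> (0 + n) (prd Y 0 n x y)"
  if x: "x <: fib Y 0" and y: "y <: fib Y n" for x y n
 proof -
  obtain a where "a <: A" "x = base Y a" using base_surj[OF x] by blast
  thus ?thesis using y R.psi_lact[OF y] by (simp add: prd_base_left base)
 qed
 show ?thesis
 proof (cases "n = 0")
  case True
  have "y <: fib Y 0" using xy(2) True by simp
  from base_surj[OF this] obtain a where "a <: A" "y = base Y a" by blast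
  thus ?thesis using xy(1) R.psi_ract[OF xy(1)] True by (simp add: prd_base_right base)
 next
  case n: False
  show ?thesis using xy(1)
  proof (induction m arbitrary: x)
   case 0
   thus ?case using left[OF 0 xy(2)] by simp
  next
   case (Suc m)
   show ?case
   proof (cases "m = 0")
    case True
    thus ?thesis using one[OF n _ xy(2)] Suc(2) by simp
   next
    case m: False
    interpret W: balanced_tensor A "fib Y 1" "fib Y m" "fib Y (1 + m)" "prd Y 1 m" by (rule bt) (use m in auto)
    interpret T: balanced_tensor A "fib Y (1 + m)" "fib Y n" "fib Y (1 + m + n)" "prd Y (1 + m) n"
     by (rule bt) (use n in auto)
    note c = R.psi_closed[OF xy(2)]
    have "x <: fib Y (1 + m)" using Suc(2) by simp
    hence "x <: fib Y (1 + m) \<and> \<Psi> (1 + m) x \<otimes>\<^sub>B \<Psi> n y = \<Psi> (1 + m + n) (prd Y (1 + m) n x y)"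
    proof (induction rule: W.Z_induct)
     case zero
     show ?case using c T.t_zero_l[OF xy(2)] R.psi_zero[of "1 + m"] R.psi_zero[of "1 + m + n"]
      by (simp del: plus_1_eq_Suc add_Suc One_nat_def)
    next
     case (tensor u v)
     have vy: "prd Y m n v y <: fib Y (m + n)" using tensor xy by blast
     have "\<Psi> (1 + m) (prd Y 1 m u v) \<otimes>\<^sub>B \<Psi> n y = \<Psi> 1 u \<otimes>\<^sub>B (\<Psi> m v \<otimes>\<^sub>B \<Psi> n y)"
      unfolding one[OF m tensor] by (rule B.mult_assoc) (use tensor xy in auto)
     also have "\<dots> = \<Psi> 1 u \<otimes>\<^sub>B \<Psi> (m + n) (prd Y m n v y)" using Suc(1)[OF tensor(2)] by simp
     also have "\<dots> = \<Psi> (1 + (m + n)) (prd Y 1 (m + n) u (prd Y m n v y))"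
      by (rule one[symmetric]) (use n tensor vy in auto)
     also have "prd Y 1 (m + n) u (prd Y m n v y) = prd Y (1 + m) n (prd Y 1 m u v) y"
      by (rule prd_assoc[OF tensor xy(2), symmetric])
     finally show ?case using W.t_closed[OF tensor] by (simp only: add.assoc simp_thms)
    next
     case (add z w)
     thus ?case using c xy(2) T.t_closed
      by (simp add: T.t_add_l R.psi_add B.mult_add_left del: plus_1_eq_Suc add_Suc One_nat_def)
    next
     case (smult t z)
     thus ?case using c xy(2) T.t_closed
      by (simp add: T.t_smult_l R.psi_smult B.mult_scale_left del: plus_1_eq_Suc add_Suc One_nat_def)
    next
     case (lim f z)
     have 1: "B.vlim (%i. \<Psi> (1 + m) (f i) \<otimes>\<^sub>B \<Psi> n y) (\<Psi> (1 + m) z \<otimes>\<^sub>B \<Psi> n y)"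
      by (rule B.vlim_mult[OF R.psi_vlim[OF lim(1)] B.vlim_const[OF c]])
     have 2: "B.vlim (%i. \<Psi> (1 + m + n) (prd Y (1 + m) n (f i) y)) (\<Psi> (1 + m + n) (prd Y (1 + m) n z y))"
      by (rule R.psi_vlim[OF T.t_vlim_l[OF lim(1) xy(2)]])
     have e: "(%i. \<Psi> (1 + m) (f i) \<otimes>\<^sub>B \<Psi> n y) = (%i. \<Psi> (1 + m + n) (prd Y (1 + m) n (f i) y))"
      using lim(2) by blast
     show ?case using F.X.vlimD(2)[OF lim(1)] B.vlim_unique[OF 1 2[folded e]] by blast
    qed
    thus ?thesis by simp
   qed
  qed
 qed
qed

lemma tensor_word_closed: "xs \<noteq> [] ==> set xs \<subseteq> carrier X ==> tensor_word Y \<kappa> xs <: fib Y (length xs)"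
proof (induction xs rule: induct_list012)
 case (2 x)
 thus ?case using kappa by (auto simp: bimod_iso_def linear_on_def)
next
 case (3 x x' xs)
 hence "\<kappa> x <: fib Y 1" using kappa by (auto simp: bimod_iso_def linear_on_def)
 thus ?case using prd_closed[of "\<kappa> x" 1 "tensor_word Y \<kappa> (x' # xs)" "length (x' # xs)"] 3 by simp
qed simp

text \<open>The representation of Y_(n+2) is obtained from that of Y_(n+1) by tensoring with the one
  on Y_1 from the left. Dependent choice collects these extensions into one family.\<close>

lemma tensor_rep_ex:
 assumes B: "cstar_algebra B" and rep: "is_rep A X B \<pi> \<psi>"
 shows "\<exists>\<Psi>. is_prod_rep A Y B \<Psi> \<and> (\<forall>a\<in>carrier A. \<Psi> 0 (base Y a) = \<pi> a) \<and>
  (\<forall>xs. xs \<noteq> [] \<and> set xs \<subseteq> carrier X \<longrightarrow> \<Psi> (length xs) (tensor_word Y \<kappa> xs) = mult_word B \<psi> xs)"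
proof -
 interpret B: cstar_algebra B by fact
 let ?k = "inv_into (carrier X) \<kappa>" and ?b = "inv_into (carrier A) (base Y)"
 have k: "?k \<in> bimod_iso A (fib Y 1) X" by (rule bimod_iso_inv[OF X.hilbert_bimodule_axioms kappa])
 have kin: "inj_on \<kappa> (carrier X)" using kappa by (simp add: bimod_iso_def bij_betw_def)
 have rep1: "is_rep A (fib Y 1) B \<pi> (%y. \<psi> (?k y))" by (rule is_rep_pullback[OF fib X.hilbert_bimodule_axioms k rep])
 \<comment> \<open>Index n stands for the fibre n + 1. The clause for n = 0 pins the starting point,
   which the choice would otherwise leave free.\<close>
 define P where "P = (%n f. is_rep A (fib Y (Suc n)) B \<pi> f \<and> (n = 0 \<longrightarrow> f = (%y. \<psi> (?k y))))"
 define S where "S = (%n f g. \<forall>x\<in>carrier (fib Y 1). \<forall>y\<in>carrier (fib Y (Suc n)). g (prd Y 1 (Suc n) x y) = \<psi> (?k x) \<otimes>\<^sub>B f y)"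
 have "\<exists>f. \<forall>n. P n (f n) \<and> S n (f n) (f (Suc n))"
 proof (rule dependent_nat_choice)
  show "\<exists>f. P 0 f" using rep1 by (auto simp: P_def)
  fix f n assume "P n f"
  hence r: "is_rep A (fib Y (Suc n)) B \<pi> f" by (simp add: P_def)
  interpret T: tensor_factors A "fib Y 1" "fib Y (Suc n)" "fib Y (1 + Suc n)" "prd Y 1 (Suc n)" B \<pi> "%y. \<psi> (?k y)" f
   by (intro tensor_factors.intro bt bimod_rep.intro bimod_rep_axioms.intro fib B rep1 r) auto
  obtain g where g: "bimod_rep A (fib Y (1 + Suc n)) B \<pi> g"
   "!!x y. x <: fib Y 1 ==> y <: fib Y (Suc n) ==> g (prd Y 1 (Suc n) x y) = \<psi> (?k x) \<otimes>\<^sub>B f y"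
   using T.tensor_rep_exists by blast
  thus "\<exists>g. P (Suc n) g \<and> S n f g" using bimod_rep.rep[OF g(1)] by (auto simp: P_def S_def)
 qed
 then obtain f where f: "!!n. P n (f n)" "!!n. S n (f n) (f (Suc n))" by blast
 define \<Psi> where "\<Psi> = (%n. case n of 0 => (%y. \<pi> (?b y)) | Suc n => f n)"
 have base0: "\<Psi> 0 (base Y a) = \<pi> a" if "a <: A" for a using that base_inj by (simp add: \<Psi>_def)
 have one: "\<Psi> 1 (\<kappa> x) = \<psi> x" if "x <: X" for x
  using f(1)[of 0] that kin by (simp add: \<Psi>_def P_def)
 have Psi1: "\<Psi> 1 = (%y. \<psi> (?k y))" using f(1)[of 0] by (simp add: \<Psi>_def P_def)
 have reps: "is_rep A (fib Y n) B \<pi> (\<Psi> n)" for n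
 proof (cases n)
  case 0
  have ph: "\<pi> \<in> cstar_hom A B" using rep by (simp add: is_rep_def)
  note ph' = hom_closed[OF X.A.cstar_algebra_axioms B ph] hom_mult[OF X.A.cstar_algebra_axioms B ph]
   hom_add[OF X.A.cstar_algebra_axioms B ph] hom_smult[OF X.A.cstar_algebra_axioms B ph] hom_star[OF X.A.cstar_algebra_axioms B ph]
  have b [simp]: "?b (base Y a) = a" if "a <: A" for a using that base_inj by simp
  have "?b x <: A \<and> base Y (?b x) = x" if "x <: fib Y 0" for x using base_surj[OF that] by auto
  hence bx: "?b x <: A" "base Y (?b x) = x" if "x <: fib Y 0" for x using that by auto
  have ops: "?b (x \<oplus>\<^sub>(fib Y 0) y) = ?b x \<oplus>\<^sub>A ?b y" "?b (c \<odot>\<^sub>(fib Y 0) x) = c \<odot>\<^sub>A ?b x"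
   "inn (fib Y 0) x y = star A (?b x) \<otimes>\<^sub>A ?b y"
   if "x <: fib Y 0" "y <: fib Y 0" for x y c
   using base_surj[OF that(1)] base_surj[OF that(2)] by (auto simp: base_inn simp flip: base_add base_smult)
  have act: "?b (ract (fib Y 0) (lact (fib Y 0) a x) c) = (a \<otimes>\<^sub>A ?b x) \<otimes>\<^sub>A c"
   if "x <: fib Y 0" "a <: A" "c <: A" for x a c
   using base_surj[OF that(1)] that(2,3) by (auto simp: base_lact base_ract)
  have "is_rep A (fib Y 0) B \<pi> (%y. \<pi> (?b y))"
   unfolding is_rep_def linear_on_def using ph by (auto simp: ops act bx ph')
  thus ?thesis using 0 by (simp add: \<Psi>_def)
 next
  case (Suc k)
  thus ?thesis using f(1)[of k] by (simp add: \<Psi>_def P_def)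
 qed
 have step: "\<Psi> (1 + n) (prd Y 1 n x y) = \<Psi> 1 x \<otimes>\<^sub>B \<Psi> n y"
  if n: "n \<noteq> 0" and xy: "x <: fib Y 1" "y <: fib Y n" for n x y
 proof -
  obtain k where k: "n = Suc k" using n not0_implies_Suc by blast
  show ?thesis using f(2)[of k] xy unfolding Psi1 S_def k by (simp add: \<Psi>_def)
 qed
 have mult: "\<Psi> m x \<otimes>\<^sub>B \<Psi> n y = \<Psi> (m + n) (prd Y m n x y)"
  if "x <: fib Y m" "y <: fib Y n" for m n x y
  by (rule prd_rep_mult[OF B reps base0 step that])
 have "(%a. \<Psi> 0 (base Y a)) \<in> cstar_hom A B"
  using rep by (simp add: is_rep_def cstar_hom_def linear_on_def base0 Pi_iff)
 moreover have "\<Psi> 0 (base Y (inn (fib Y n) x y)) = star B (\<Psi> n x) \<otimes>\<^sub>B \<Psi> n y"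
  if "x <: fib Y n" "y <: fib Y n" for n x y
  using reps[of n] that by (simp add: is_rep_def base0)
 ultimately have "is_prod_rep A Y B \<Psi>"
  unfolding is_prod_rep_def using reps mult by (simp add: is_rep_def)
 moreover have "\<Psi> (length xs) (tensor_word Y \<kappa> xs) = mult_word B \<psi> xs" if "xs \<noteq> []" "set xs \<subseteq> carrier X" for xs
  using that
 proof (induction xs rule: induct_list012)
  case (2 x)
  thus ?case using one by simp
 next
  case (3 x x' xs)
  let ?w = "tensor_word Y \<kappa> (x' # xs)" and ?n = "length (x' # xs)"
  have w: "?w <: fib Y ?n" using tensor_word_closed[of "x' # xs"] 3 by simp
  have kx: "\<kappa> x <: fib Y 1" using kappa 3 by (auto simp: bimod_iso_def linear_on_def)
  have "\<Psi> (1 + ?n) (prd Y 1 ?n (\<kappa> x) ?w) = \<Psi> 1 (\<kappa> x) \<otimes>\<^sub>B \<Psi> ?n ?w" by (rule step[OF _ kx w]) simp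
  thus ?case using 3 one[of x] by simp
 qed simp
 ultimately show ?thesis using base0 by blast
qed

lemma tensor_rep_props:
 assumes B: "cstar_algebra B" and rep: "is_rep A X B \<pi> \<psi>"
 shows "prod_rep A Y B (tensor_rep A X Y \<kappa> B \<pi> \<psi>)"
  and "a <: A ==> tensor_rep A X Y \<kappa> B \<pi> \<psi> 0 (base Y a) = \<pi> a"
  and "x <: X ==> tensor_rep A X Y \<kappa> B \<pi> \<psi> 1 (\<kappa> x) = \<psi> x"
proof -
 let ?R = "tensor_rep A X Y \<kappa> B \<pi> \<psi>"
 have p: "is_prod_rep A Y B ?R" "\<forall>a\<in>carrier A. ?R 0 (base Y a) = \<pi> a"
  "\<forall>xs. xs \<noteq> [] \<and> set xs \<subseteq> carrier X \<longrightarrow> ?R (length xs) (tensor_word Y \<kappa> xs) = mult_word B \<psi> xs"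
  using someI_ex[OF tensor_rep_ex[OF assms], folded tensor_rep_def] by blast+
 show "prod_rep A Y B ?R" by (intro prod_rep.intro prod_rep_axioms.intro product_system_axioms B p)
 show "a <: A ==> ?R 0 (base Y a) = \<pi> a" using p(2) by blast
 show "x <: X ==> ?R 1 (\<kappa> x) = \<psi> x" using p(3)[rule_format, of "[x]"] by simp
qed

text \<open>Stated for any representation of the product system that restricts to \<pi> and \<psi>,
  because it serves both for \<open>tensor_rep\<close> and for the universal
  \<open>j\<close>.\<close>

lemma prod_rep_katsura_iff:
 assumes "prod_rep A Y B \<Psi>" and rep: "is_rep A X B \<pi> \<psi>"
  and pi: "!!a. a <: A ==> \<Psi> 0 (base Y a) = \<pi> a" and psi: "!!x. x <: X ==> \<Psi> 1 (\<kappa> x) = \<psi> x"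
 shows "katsura_covariant A X B \<pi> \<psi> \<longleftrightarrow> satisfies_CP A Y B \<Psi>"
proof -
 interpret prod_rep A Y B \<Psi> by fact
 let ?k = "inv_into (carrier X) \<kappa>" and ?\<pi> = "%a. \<Psi> 0 (base Y a)"
 have rep': "is_rep A X B ?\<pi> \<psi>" using is_rep_cong[OF X.hilbert_bimodule_axioms, of ?\<pi> \<pi> \<psi> \<psi> B] pi rep by simp
 have bij: "bij_betw \<kappa> (carrier X) (carrier (fib Y 1))" using kappa by (simp add: bimod_iso_def)
 have "rep_iso A X (fib Y 1) B ?\<pi> \<psi> (\<Psi> 1) \<kappa> ?k"
 proof (intro rep_iso.intro rep_iso_axioms.intro bimod_rep.intro bimod_rep_axioms.intro rep' R.rep
   B.cstar_algebra_axioms X.hilbert_bimodule_axioms fib kappa psi)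
  show "?k \<in> bimod_iso A (fib Y 1) X" by (rule bimod_iso_inv[OF X.hilbert_bimodule_axioms kappa])
 qed (use bij in \<open>auto simp: bij_betw_inv_into_left bij_betw_inv_into_right\<close>)
 hence "katsura_covariant A X B ?\<pi> \<psi> \<longleftrightarrow> katsura_covariant A (fib Y 1) B ?\<pi> (\<Psi> 1)"
  by (rule katsura_covariant_iso)
 moreover have "katsura_covariant A X B ?\<pi> \<psi> \<longleftrightarrow> katsura_covariant A X B \<pi> \<psi>"
  using pi by (auto simp: katsura_covariant_def perp_def)
 ultimately show ?thesis using CP_imp_katsura katsura_imp_CP by blast
qed

end

section \<open>The isomorphism\<close>

text \<open>Homomorphisms are continuous, so fixed points form a closed set; this passes from
  generators to the generated algebra.\<close>

lemma hom_equalizer: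
 assumes A: "cstar_algebra A" and h: "h \<in> cstar_hom A A"
 shows "cstar_subalgebra {a \<in> carrier A. h a = a} A"
proof -
 interpret A: cstar_algebra A by fact
 note hh = hom_mult[OF A A h] hom_add[OF A A h] hom_smult[OF A A h] hom_star[OF A A h] hom_zero[OF A A h]
 have "submodule {a \<in> carrier A. h a = a} complex_ring A"
  by (rule A.submoduleI) (auto simp: hh A.neg_eq_smult)
 moreover have "norm_closure A (nrm A) {a \<in> carrier A. h a = a} \<subseteq> {a \<in> carrier A. h a = a}"
 proof
  fix l assume l: "l \<in> norm_closure A (nrm A) {a \<in> carrier A. h a = a}"
  have sub: "{a \<in> carrier A. h a = a} \<subseteq> carrier A" by blast
  from A.norm_closure_vlim[OF l sub] obtain f where f: "A.vlim f l" "!!n. f n \<in> {a \<in> carrier A. h a = a}" by metis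
  have e: "(%n. h (f n)) = f" using f(2) by auto
  have "h l = l" by (rule A.vlim_unique[OF hom_vlim[OF A A h f(1), unfolded e] f(1)])
  thus "l \<in> {a \<in> carrier A. h a = a}" using A.vlimD(2)[OF f(1)] by blast
 qed
 ultimately show ?thesis unfolding cstar_subalgebra_def by (auto simp: hh)
qed

lemma hom_comp:
 assumes A: "cstar_algebra A" and B: "cstar_algebra B" and C: "cstar_algebra C"
  and g: "g \<in> cstar_hom A B" and h: "h \<in> cstar_hom B C"
 shows "(%a. h (g a)) \<in> cstar_hom A C"
 unfolding cstar_hom_def linear_on_def
 using hom_closed[OF A B g] hom_closed[OF B C h]
 by (simp add: Pi_iff hom_mult[OF A B g] hom_add[OF A B g] hom_smult[OF A B g] hom_star[OF A B g]
  hom_mult[OF B C h] hom_add[OF B C h] hom_smult[OF B C h] hom_star[OF B C h])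

lemma hom_id_if_generated:
 assumes A: "cstar_algebra A" and h: "h \<in> cstar_hom A A" and gen: "cstar_generated A S = carrier A"
  and S: "!!a. a \<in> S ==> a <: A \<and> h a = a" and a: "a <: A"
 shows "h a = a"
proof -
 have "cstar_generated A S \<subseteq> {a \<in> carrier A. h a = a}"
  unfolding cstar_generated_def by (rule Inter_lower) (use hom_equalizer[OF A h] S in auto)
 thus ?thesis using gen a by blast
qed

text \<open>Y_(n+1) is the closed span of products of Y_1 with Y_n, so everything is generated in
  degrees 0 and 1.\<close>

lemma (in prod_rep) subalgebra_contains_fibres:
 assumes D: "cstar_subalgebra D B" and 0: "!!a. a <: A ==> \<pi> a \<in> D"
  and 1: "!!y. y <: fib Y 1 ==> \<Psi> 1 y \<in> D" and y: "y <: fib Y n"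
 shows "\<Psi> n y \<in> D"
 using y
proof (induction n arbitrary: y)
 case 0
 thus ?case using base_surj[OF 0] assms(2) by auto
next
 case (Suc n)
 note ops = subalgebra_ops[OF B.cstar_algebra_axioms D]
 show ?case
 proof (cases "n = 0")
  case True
  thus ?thesis using 1[of y] Suc(2) by simp
 next
  case False
  interpret W: balanced_tensor A "fib Y 1" "fib Y n" "fib Y (1 + n)" "prd Y 1 n" by (rule bt) (use False in auto)
  have "y <: fib Y (1 + n)" using Suc(2) by simp
  hence "y <: fib Y (1 + n) \<and> \<Psi> (1 + n) y \<in> D"
  proof (induction rule: W.Z_induct)
   case zero
   show ?case using R.psi_zero[of "1 + n"] ops by (simp del: plus_1_eq_Suc One_nat_def)
  next
   case (tensor u v)
   have "\<Psi> 1 u \<otimes>\<^sub>B \<Psi> n v \<in> D" using 1[OF tensor(1)] Suc(1)[OF tensor(2)] ops by blast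
   thus ?case using tensor unfolding mult[OF tensor] by blast
  next
   case (add z w)
   thus ?case using ops by (simp add: R.psi_add del: plus_1_eq_Suc One_nat_def)
  next
   case (smult t z)
   thus ?case using ops by (simp add: R.psi_smult del: plus_1_eq_Suc One_nat_def)
  next
   case (lim f z)
   have "\<Psi> (1 + n) z \<in> D"
    by (rule vlim_subalgebra(1)[OF B.cstar_algebra_axioms D R.psi_vlim[OF lim(1)]]) (use lim(2) in blast)
   thus ?case using F.X.vlimD(2)[OF lim(1)] by blast
  qed
  thus ?thesis by simp
 qed
qed

theorem proposition5p3:
  fixes A :: "'a cstar" and X :: "('a, 'x) bimod"
    and Y :: "('a, 'y) prod_system" and \<kappa> :: "'x \<Rightarrow> 'y"
    and OX NO :: "'u cstar"
    and i\<^sub>A :: "'a \<Rightarrow> 'u" and i\<^sub>X :: "'x \<Rightarrow> 'u" and j :: "nat \<Rightarrow> 'y \<Rightarrow> 'u"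
  assumes "cstar_algebra A"
    and "hilbert_bimodule A X"
    and "tensor_powers A X Y \<kappa>"
    and "is_katsura_algebra A X OX i\<^sub>A i\<^sub>X"
    and "is_NO_algebra A Y NO j"
  shows "(\<exists>\<theta>\<in>cstar_iso OX NO.
            (\<forall>a\<in>carrier A. \<theta> (i\<^sub>A a) = j 0 (base Y a)) \<and>
            (\<forall>x\<in>carrier X. \<theta> (i\<^sub>X x) = j 1 (\<kappa> x))) \<and>
         (\<forall>(B :: 'b cstar) \<pi> \<psi>.
            cstar_algebra B \<and> is_rep A X B \<pi> \<psi> \<longrightarrow>
            (katsura_covariant A X B \<pi> \<psi> \<longleftrightarrow>
             satisfies_CP A Y B (tensor_rep A X Y \<kappa> B \<pi> \<psi>)))"
proof -
 interpret tensor_powers A X Y \<kappa> by fact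
 have cov: "katsura_covariant A X B \<pi> \<psi> \<longleftrightarrow> satisfies_CP A Y B (tensor_rep A X Y \<kappa> B \<pi> \<psi>)"
  if B: "cstar_algebra B" and rep: "is_rep A X B \<pi> \<psi>" for B :: "'c cstar" and \<pi> \<psi>
  by (rule prod_rep_katsura_iff[OF tensor_rep_props(1)[OF B rep] rep tensor_rep_props(2,3)[OF B rep]])
 have OX: "cstar_algebra OX" "is_rep A X OX i\<^sub>A i\<^sub>X" "katsura_covariant A X OX i\<^sub>A i\<^sub>X"
  and OX_gen: "cstar_generated OX (i\<^sub>A ` carrier A \<union> i\<^sub>X ` carrier X) = carrier OX"
  and OX_univ: "!!(B :: 'u cstar) \<pi> \<psi>. cstar_algebra B ==> is_rep A X B \<pi> \<psi> ==> katsura_covariant A X B \<pi> \<psi> ==>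
    \<exists>\<rho>\<in>cstar_hom OX B. (\<forall>a\<in>carrier A. \<rho> (i\<^sub>A a) = \<pi> a) \<and> (\<forall>x\<in>carrier X. \<rho> (i\<^sub>X x) = \<psi> x)"
  using assms(4) unfolding is_katsura_algebra_def by blast+
 have NO: "cstar_algebra NO" "is_prod_rep A Y NO j" "CNP_covariant A Y NO j"
  and NO_gen: "cstar_generated NO (\<Union>n. j n ` carrier (fib Y n)) = carrier NO"
  and NO_univ: "!!(B :: 'u cstar) \<psi>. cstar_algebra B ==> is_prod_rep A Y B \<psi> ==> CNP_covariant A Y B \<psi> ==>
    \<exists>\<rho>\<in>cstar_hom NO B. \<forall>n. \<forall>y\<in>carrier (fib Y n). \<rho> (j n y) = \<psi> n y"
  using assms(5) unfolding is_NO_algebra_def by blast+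
 interpret J: prod_rep A Y NO j
  by (intro prod_rep.intro prod_rep_axioms.intro product_system_axioms NO)
 let ?\<psi> = "%x. j 1 (\<kappa> x)" and ?\<Phi> = "tensor_rep A X Y \<kappa> OX i\<^sub>A i\<^sub>X"
 have jrep: "is_rep A X NO J.\<pi> ?\<psi>"
  by (rule is_rep_pullback[OF X.hilbert_bimodule_axioms fib kappa J.is_rep_fib])
 have "katsura_covariant A X NO J.\<pi> ?\<psi>"
  using prod_rep_katsura_iff[OF J.prod_rep_axioms jrep] NO(3) by (simp add: CNP_covariant_def)
 then obtain \<rho> where \<rho>: "\<rho> \<in> cstar_hom OX NO" "!!a. a <: A ==> \<rho> (i\<^sub>A a) = j 0 (base Y a)"
  "!!x. x <: X ==> \<rho> (i\<^sub>X x) = j 1 (\<kappa> x)"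
  using OX_univ[OF NO(1) jrep] by blast
 note \<Phi> = tensor_rep_props[OF OX(1,2)]
 interpret P: prod_rep A Y OX ?\<Phi> by (rule \<Phi>(1))
 have "CNP_covariant A Y OX ?\<Phi>"
  using P.nica_covariant prod_rep_katsura_iff[OF \<Phi>(1) OX(2) \<Phi>(2,3)] OX(3) by (simp add: CNP_covariant_def)
 then obtain \<sigma> where \<sigma>: "\<sigma> \<in> cstar_hom NO OX" "!!n y. y <: fib Y n ==> \<sigma> (j n y) = ?\<Phi> n y"
  using NO_univ[OF OX(1) P.prod_rep] by blast
 have kc: "\<kappa> x <: fib Y 1" if "x <: X" for x
  using kappa that by (auto simp: bimod_iso_def linear_on_def)
 have ks: "\<exists>x\<in>carrier X. y = \<kappa> x" if "y <: fib Y 1" for y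
  using kappa that by (auto simp: bimod_iso_def bij_betw_def)
 interpret I: bimod_rep A X OX i\<^sub>A i\<^sub>X
  by (intro bimod_rep.intro bimod_rep_axioms.intro X.hilbert_bimodule_axioms OX)
 have \<sigma>\<rho>: "\<sigma> (\<rho> b) = b" if b: "b <: OX" for b
 proof (rule hom_id_if_generated[OF OX(1) hom_comp[OF OX(1) NO(1) OX(1) \<rho>(1) \<sigma>(1)] OX_gen _ b])
  fix c assume "c \<in> i\<^sub>A ` carrier A \<union> i\<^sub>X ` carrier X"
  thus "c <: OX \<and> \<sigma> (\<rho> c) = c"
   using kc by (auto simp: \<rho> \<sigma> \<Phi>(2) \<Phi>(3) simp del: One_nat_def)
 qed
 have \<rho>\<sigma>: "\<rho> (\<sigma> b) = b" if b: "b <: NO" for b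
 proof (rule hom_id_if_generated[OF NO(1) hom_comp[OF NO(1) OX(1) NO(1) \<sigma>(1) \<rho>(1)] NO_gen _ b])
  fix c assume "c \<in> (\<Union>n. j n ` carrier (fib Y n))"
  then obtain n y where ny: "y <: fib Y n" "c = j n y" by blast
  \<comment> \<open>The generators of \<open>NO\<close> come from all fibres, whereas \<rho> is
    prescribed only in degrees 0 and 1.\<close>
  have "j n y \<in> {b \<in> carrier NO. \<rho> (\<sigma> b) = b}"
  proof (rule J.subalgebra_contains_fibres[OF _ _ _ ny(1)])
   show "cstar_subalgebra {b \<in> carrier NO. \<rho> (\<sigma> b) = b} NO"
    by (rule hom_equalizer[OF NO(1) hom_comp[OF NO(1) OX(1) NO(1) \<sigma>(1) \<rho>(1)]])
   show "j 0 (base Y a) \<in> {b \<in> carrier NO. \<rho> (\<sigma> b) = b}" if "a <: A" for a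
    using that J.R.pi_closed[OF that] by (simp add: \<sigma>(2) \<Phi>(2) \<rho>(2) base_closed)
   show "j 1 y \<in> {b \<in> carrier NO. \<rho> (\<sigma> b) = b}" if y: "y <: fib Y 1" for y
   proof -
    obtain x where x: "x <: X" "y = \<kappa> x" using ks[OF y] by blast
    have "\<rho> (\<sigma> (j 1 y)) = j 1 y" unfolding \<sigma>(2)[OF y] unfolding x(2) \<Phi>(3)[OF x(1)] by (rule \<rho>(3)[OF x(1)])
    thus ?thesis using J.R.psi_closed[OF y] by simp
   qed
  qed
  thus "c <: NO \<and> \<rho> (\<sigma> c) = c" using ny by blast
 qed
 have "bij_betw \<rho> (carrier OX) (carrier NO)"
  by (rule bij_betwI[where g = \<sigma>])
   (use hom_closed[OF OX(1) NO(1) \<rho>(1)] hom_closed[OF NO(1) OX(1) \<sigma>(1)] \<sigma>\<rho> \<rho>\<sigma> in auto)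
 hence "\<rho> \<in> cstar_iso OX NO" using \<rho>(1) by (simp add: cstar_iso_def)
 thus ?thesis using \<rho>(2,3) cov by blast
qed

end
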